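(* Let $\mathcal{M}$ be a von Neumann algebra with a faithful normal semifinite weight $\nu$, and let $\psi$ be an Orlicz function. The topology of convergence in measure on $L^\psi(\mathcal{M})$ (respectively $L_\psi(\mathcal{M})$) is normable whenever the upper Boyd index of $L^\psi(\mathbb{R})$ (respectively $L_\psi(\mathbb{R})$) is strictly less than $1$.
   Context: Orlicz functions: convex $\psi:[0,\infty)\to[0,\infty]$ with $\psi(0)=0$, $\lim_{u\to\infty}\psi(u)=\infty$, neither identically zero nor infinite valued on all of $(0,\infty)$, left continuous at $b_\psi=\sup\{u>0:\psi(u)<\infty\}$. $\psi^*(u)=\sup_{v>0}(uv-\psi(v))$, $\psi^{-1}(t)=\sup\{s:\psi(s)\le t\}$. Fundamental functions of $L^\psi(\mathbb{R})$ (Luxemburg norm) and $L_\psi(\mathbb{R})$ (Orlicz norm): $\varphi_\psi(t)=1/\psi^{-1}(1/t)$ and $\widetilde{\varphi}_\psi(t)=t/\varphi_{\psi^*}(t)$, $t>0$. Boyd index (Bennett–Sharpley): for a rearrangement invariant space $X$ over $\mathbb{R}$ let $\overline{X}$ be its Luxemburg representation over $(0,\infty)$ (for an Orlicz space, the Orlicz space over $(0,\infty)$ with the same function and type of norm), let $(E_sf)(t)=f(st)$ and let $h_X(s)$ be the operator norm of $E_{1/s}$ on $\overline{X}$. The upper Boyd index is $\inf_{1<s<\infty}\frac{\log h_X(s)}{\log s}$. $\mathcal{A}=\mathcal{M}\rtimes_{\sigma^\nu}\mathbb{R}$ is the crossed product by the modular group of $\nu$, $\mathcal{M}$ being identified with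 its canonical image in $\mathcal{A}$; $(\theta_s)_{s\in\mathbb{R}}$ is the dual action; $\tau_{\mathcal{A}}$ is the canonical trace, with $\tau_{\mathcal{A}}\circ\theta_s=e^{-s}\tau_{\mathcal{A}}$; $\widetilde{\mathcal{A}}$ is the $*$-algebra of $\tau_{\mathcal{A}}$-measurable operators with the topology of convergence in measure, to which $\theta_s$ extends; $h=d\widetilde{\nu}/d\tau_{\mathcal{A}}$ is the density of the dual weight, with $\theta_s(h)=e^{-s}h$. $L^1(\mathcal{M})=\{x\in\widetilde{\mathcal{A}}:\theta_s(x)=e^{-s}x\ \forall s\in\mathbb{R}\}$. $\mathfrak{n}_\nu=\{a\in\mathcal{M}:\nu(a^*a)<\infty\}$. $[\cdot]$ denotes closure of a closable operator and products of $\tau_{\mathcal{A}}$-measurable operators are strong products. For a projection $e\in\mathfrak{n}_\nu$, $[e\widetilde{\varphi}_{\psi^*}(h)^{1/2}]$, $[\widetilde{\varphi}_{\psi^*}(h)^{1/2}e]$ and the analogous operators with $\varphi_{\psi^*}$ belong to $\widetilde{\mathcal{A}}$. Define $$L^\psi(\mathcal{M})=\{a\in\widetilde{\mathcal{A}}:[e\widetilde{\varphi}_{\psi^*}(h)^{1/2}]a[\widetilde{\varphi}_{\psi^*}(h)^{1/2}f]\in L^1(\mathcal{M})\text{ for all projections }e,f\in\mathfrak{n}_\nu\},$$ $$L_\psi(\mathcal{M})=\{a\in\widetilde{\mathcal{A}}:[e\varphi_{\psi^*}(h)^{1/2}]a[\varphi_{\psi^*}(h)^{1/2}f]\in L^1(\mathcal{M})\text{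 for all projections }e,f\in\mathfrak{n}_\nu\},$$ both carrying the topology of convergence in measure inherited from $\widetilde{\mathcal{A}}$. Normable means that the topology is induced by some norm. *)

theory Defs
  imports "HOL-Analysis.Analysis"
begin

section \<open>Complex Hilbert spaces and the space L2(R, H)\<close>

class complex_hilbert = real_inner + complete_space +
  fixes scaleC :: "complex \<Rightarrow> 'a \<Rightarrow> 'a"  (infixr "*\<^sub>C" 75)
  assumes scaleC_add_right: "a *\<^sub>C (x + y) = a *\<^sub>C x + a *\<^sub>C y"
    and scaleC_add_left: "(a + b) *\<^sub>C x = a *\<^sub>C x + b *\<^sub>C x"
    and scaleC_scaleC: "a *\<^sub>C b *\<^sub>C x = (a * b) *\<^sub>C x"
    and scaleC_of_real: "complex_of_real r *\<^sub>C x = r *\<^sub>R x"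
    and inner_scaleC_i: "inner (\<i> *\<^sub>C x) (\<i> *\<^sub>C y) = inner x y"

text \<open>The complex inner product is antilinear in the first variable.\<close>

definition cinner :: "'a::complex_hilbert \<Rightarrow> 'a \<Rightarrow> complex"
  where "cinner x y = Complex (inner x y) (inner (\<i> *\<^sub>C x) y)"

lemma scaleC_conv: "(c::complex) *\<^sub>C (x::'a::complex_hilbert) = Re c *\<^sub>R x + Im c *\<^sub>R (\<i> *\<^sub>C x)"
proof -
  have "c *\<^sub>C x = (complex_of_real (Re c) + complex_of_real (Im c) * \<i>) *\<^sub>C x"
    by (subst complex_eq[of c]) (simp add: mult.commute)
  also have "\<dots> = Re c *\<^sub>R x + Im c *\<^sub>R (\<i> *\<^sub>C x)"
    by (simp only: scaleC_add_left scaleC_of_real scaleC_scaleC[symmetric])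
  finally show ?thesis .
qed

lemma norm_scaleC: "norm (c *\<^sub>C (x::'a::complex_hilbert)) = cmod c * norm x"
proof -
  have i2: "\<i> *\<^sub>C \<i> *\<^sub>C x = - x"
    using scaleC_of_real[of "-1" x] by (simp add: scaleC_scaleC)
  have "inner (\<i> *\<^sub>C x) x = inner (\<i> *\<^sub>C \<i> *\<^sub>C x) (\<i> *\<^sub>C x)"
    by (simp add: inner_scaleC_i)
  then have o: "inner (\<i> *\<^sub>C x) x = 0" by (simp add: i2 inner_commute)
  have "(norm (c *\<^sub>C x))\<^sup>2 = (cmod c)\<^sup>2 * (norm x)\<^sup>2"
    unfolding scaleC_conv[of c x] cmod_power2
    unfolding power2_norm_eq_inner
    by (simp add: inner_add_left inner_add_right o inner_commute[of x "\<i> *\<^sub>C x"] inner_scaleC_i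
        algebra_simps power2_eq_square)
  then show ?thesis
    by (metis norm_ge_zero power2_eq_iff_nonneg mult_nonneg_nonneg power_mult_distrib)
qed

lemma continuous_scaleC: "continuous_on UNIV (\<lambda>x::'a::complex_hilbert. c *\<^sub>C x)"
proof (rule lipschitz_on_continuous_on, rule lipschitz_onI)
  fix x y :: 'a
  have "c *\<^sub>C x - c *\<^sub>C y = c *\<^sub>C (x - y)"
    using scaleC_add_right[of c "x - y" y] by simp
  then show "dist (c *\<^sub>C x) (c *\<^sub>C y) \<le> cmod c * dist x y"
    by (simp add: dist_norm norm_scaleC)
qed simp

text \<open>Bochner (strong) measurability: the space of values need not be separable, so Borel
  measurability alone would not be stable under sums.\<close>

definition strongly_measurable :: "(real \<Rightarrow> 'a::metric_space) \<Rightarrow> bool"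
  where "strongly_measurable f \<longleftrightarrow>
    f \<in> borel_measurable lborel \<and> (\<exists>C. countable C \<and> range f \<subseteq> closure C)"

lemma strongly_measurable_approx:
  fixes f :: "real \<Rightarrow> 'a::metric_space"
  assumes "strongly_measurable f"
  obtains i :: "nat \<Rightarrow> real \<Rightarrow> nat" and d :: "nat \<Rightarrow> 'a"
  where "\<And>n. i n \<in> measurable lborel (count_space UNIV)"
    "\<And>t. (\<lambda>n. d (i n t)) \<longlonglongrightarrow> f t"
proof -
  from assms obtain C where f[measurable]: "f \<in> borel_measurable lborel"
    and C: "countable C" "range f \<subseteq> closure C"
    by (auto simp: strongly_measurable_def)
  have "C \<noteq> {}" using C(2) by auto
  define d where "d = from_nat_into C"
  define i where "i n t = (LEAST k. dist (f t) (d k) < 1 / real (Suc n))" for n t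
  have ex: "\<exists>k. dist (f t) (d k) < 1 / real (Suc n)" for n t
  proof -
    have "f t \<in> closure C" using C(2) by auto
    then obtain y where "y \<in> C" "dist y (f t) < 1 / real (Suc n)"
      unfolding closure_approachable by (meson zero_less_divide_1_iff of_nat_0_less_iff zero_less_Suc)
    then show ?thesis
      by (metis d_def C(1) dist_commute from_nat_into_surj)
  qed
  have less: "dist (f t) (d (i n t)) < 1 / real (Suc n)" for n t
    unfolding i_def by (rule LeastI_ex[OF ex])
  have dm: "(\<lambda>t. dist (f t) c) \<in> borel_measurable lborel" for c
    by (rule borel_measurable_continuous_on[OF _ f]) (intro continuous_intros)
  have "i n \<in> measurable lborel (count_space UNIV)" for n
    unfolding i_def using dm by measurable
  moreover have "(\<lambda>n. d (i n t)) \<longlonglongrightarrow> f t" for t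
  proof (rule metric_LIMSEQ_I)
    fix r :: real assume "0 < r"
    then obtain N where N: "1 / real (Suc N) < r" by (metis nat_approx_posE)
    show "\<exists>no. \<forall>n\<ge>no. dist (d (i n t)) (f t) < r"
    proof (intro exI allI impI)
      fix n assume "N \<le> n"
      have "dist (d (i n t)) (f t) < 1 / real (Suc n)" using less[of t n] by (simp add: dist_commute)
      also have "\<dots> \<le> 1 / real (Suc N)" using \<open>N \<le> n\<close> by (simp add: frac_le)
      finally show "dist (d (i n t)) (f t) < r" using N by simp
    qed
  qed
  ultimately show thesis by (rule that)
qed

lemma strongly_measurable_cont2:
  fixes f :: "real \<Rightarrow> 'a::metric_space" and f' :: "real \<Rightarrow> 'b::metric_space"
    and g :: "'a \<Rightarrow> 'b \<Rightarrow> 'c::metric_space"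
  assumes "strongly_measurable f" "strongly_measurable f'"
    and g: "continuous_on UNIV (\<lambda>p. g (fst p) (snd p))"
  shows "strongly_measurable (\<lambda>t. g (f t) (f' t))"
proof -
  obtain i d where i[measurable]: "\<And>n. i n \<in> measurable lborel (count_space (UNIV::nat set))"
    and d: "\<And>t. (\<lambda>n. d (i n t)) \<longlonglongrightarrow> f t"
    using strongly_measurable_approx[OF assms(1)] by blast
  obtain i' d' where i'[measurable]: "\<And>n. i' n \<in> measurable lborel (count_space (UNIV::nat set))"
    and d': "\<And>t. (\<lambda>n. d' (i' n t)) \<longlonglongrightarrow> f' t"
    using strongly_measurable_approx[OF assms(2)] by blast
  have lim: "(\<lambda>n. g (d (i n t)) (d' (i' n t))) \<longlonglongrightarrow> g (f t) (f' t)" for t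
  proof -
    have "(\<lambda>n. (d (i n t), d' (i' n t))) \<longlonglongrightarrow> (f t, f' t)"
      by (intro tendsto_Pair d d')
    from continuous_on_tendsto_compose[OF g this] show ?thesis by simp
  qed
  have meas: "(\<lambda>t. g (d (i n t)) (d' (i' n t))) \<in> borel_measurable lborel" for n
  proof -
    have 1: "(\<lambda>t. g (d (i n t)) (d' k)) \<in> borel_measurable lborel" for k
      by (rule measurable_compose[OF i]) simp
    show ?thesis
      by (rule measurable_compose_countable[where f="\<lambda>k t. g (d (i n t)) (d' k)", OF 1 i'])
  qed
  define C where "C = (\<lambda>(m, n). g (d m) (d' n)) ` UNIV"
  have "countable C" unfolding C_def by (rule countable_image) simp
  moreover have "g (f t) (f' t) \<in> closure C" for t
    unfolding closure_sequential
    by (rule exI[of _ "\<lambda>n. g (d (i n t)) (d' (i' n t))"]) (auto simp: C_def lim)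
  ultimately show ?thesis
    unfolding strongly_measurable_def
    using borel_measurable_LIMSEQ_metric[OF meas lim] by blast
qed

lemma strongly_measurable_lim:
  fixes f :: "nat \<Rightarrow> real \<Rightarrow> 'a::metric_space"
  assumes f: "\<And>n. strongly_measurable (f n)" and lim: "\<And>t. (\<lambda>n. f n t) \<longlonglongrightarrow> g t"
  shows "strongly_measurable g"
proof -
  have m: "\<And>n. f n \<in> borel_measurable lborel" using f by (auto simp: strongly_measurable_def)
  have "\<forall>n. \<exists>C. countable C \<and> range (f n) \<subseteq> closure C" using f by (auto simp: strongly_measurable_def)
  then obtain C where C: "\<And>n. countable (C n)" "\<And>n. range (f n) \<subseteq> closure (C n)" by metis
  have "g t \<in> closure (\<Union>n. C n)" for t
  proof -
    have "f n t \<in> closure (\<Union>n. C n)" for n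
      using C(2)[of n] closure_mono[of "C n" "\<Union>n. C n"] by blast
    then have "g t \<in> closure (closure (\<Union>n. C n))"
      using closure_sequential[THEN iffD2, OF exI, of "\<lambda>n. f n t", OF conjI, OF _ lim[of t]] by metis
    then show ?thesis by simp
  qed
  then have "range g \<subseteq> closure (\<Union>n. C n)" by blast
  moreover have "countable (\<Union>n. C n)" using C(1) by simp
  moreover have "g \<in> borel_measurable lborel" by (rule borel_measurable_LIMSEQ_metric[OF m lim])
  ultimately show ?thesis unfolding strongly_measurable_def by metis
qed

lemma strongly_measurable_borel [measurable_dest]:
  "strongly_measurable f \<Longrightarrow> f \<in> borel_measurable lborel"
  by (simp add: strongly_measurable_def)

lemma strongly_measurable_const: "strongly_measurable (\<lambda>_. c)"
  unfolding strongly_measurable_def by (auto intro!: exI[of _ "{c}"])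

lemma strongly_measurable_real:
  fixes f :: "real \<Rightarrow> 'a::{metric_space,second_countable_topology}"
  assumes "f \<in> borel_measurable lborel" shows "strongly_measurable f"
proof -
  obtain D :: "'a set" where "countable D" "\<And>X. open X \<Longrightarrow> X \<noteq> {} \<Longrightarrow> \<exists>d\<in>D. d \<in> X"
    using countable_dense_exists by metis
  moreover from this have "closure D = UNIV"
    unfolding closure_def islimpt_def by (auto; metis)
  ultimately show ?thesis
    using assms unfolding strongly_measurable_def by auto
qed

lemma strongly_measurable_comp1:
  fixes f :: "real \<Rightarrow> 'a::metric_space" and g :: "'a \<Rightarrow> 'c::metric_space"
  assumes "strongly_measurable f" and "continuous_on UNIV g"
  shows "strongly_measurable (\<lambda>t. g (f t))"
proof (rule strongly_measurable_cont2[OF assms(1) assms(1), where g="\<lambda>x y. g x"])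
  show "continuous_on UNIV (\<lambda>p::'a \<times> 'a. g (fst p))"
    using continuous_on_compose2[OF assms(2) continuous_on_fst[OF continuous_on_id]] by auto
qed

lemma strongly_measurable_add:
  fixes f g :: "real \<Rightarrow> 'a::real_normed_vector"
  assumes "strongly_measurable f" "strongly_measurable g"
  shows "strongly_measurable (\<lambda>t. f t + g t)"
  by (rule strongly_measurable_cont2[OF assms]) (intro continuous_intros)

lemma strongly_measurable_scaleR:
  fixes f :: "real \<Rightarrow> 'a::real_normed_vector"
  assumes "strongly_measurable f"
  shows "strongly_measurable (\<lambda>t. c *\<^sub>R f t)"
  by (rule strongly_measurable_comp1[OF assms]) (intro continuous_intros)

lemma measurable_inner_strongly:
  fixes f g :: "real \<Rightarrow> 'a::real_inner"
  assumes "strongly_measurable f" "strongly_measurable g"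
  shows "(\<lambda>t. inner (f t) (g t)) \<in> borel_measurable lborel"
  by (rule strongly_measurable_borel, rule strongly_measurable_cont2[OF assms]) (intro continuous_intros)

definition square_integrable :: "(real \<Rightarrow> 'a::real_normed_vector) \<Rightarrow> bool"
  where "square_integrable f \<longleftrightarrow>
    strongly_measurable f \<and> (\<integral>\<^sup>+ t. ennreal ((norm (f t))\<^sup>2) \<partial>lborel) < \<infinity>"

lemma square_integrable_alt:
  "square_integrable f \<longleftrightarrow> strongly_measurable f \<and> integrable lborel (\<lambda>t. (norm (f t))\<^sup>2)"
proof -
  have "(\<lambda>t. (norm (f t))\<^sup>2) \<in> borel_measurable lborel" if "strongly_measurable f"
    using strongly_measurable_borel[OF that] by measurable
  then show ?thesis
    unfolding square_integrable_def integrable_iff_bounded by auto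
qed

lemma square_integrable_add:
  fixes f g :: "real \<Rightarrow> 'a::real_normed_vector"
  assumes "square_integrable f" "square_integrable g"
  shows "square_integrable (\<lambda>t. f t + g t)"
  unfolding square_integrable_alt
proof (rule conjI)
  have fm: "strongly_measurable f" "strongly_measurable g" using assms by (auto simp: square_integrable_def)
  show sm: "strongly_measurable (\<lambda>t. f t + g t)" using fm by (rule strongly_measurable_add)
  show "integrable lborel (\<lambda>t. (norm (f t + g t))\<^sup>2)"
  proof (rule Bochner_Integration.integrable_bound)
    show "integrable lborel (\<lambda>t. 2 * (norm (f t))\<^sup>2 + 2 * (norm (g t))\<^sup>2)"
      using assms by (auto simp: square_integrable_alt)
    show "(\<lambda>t. (norm (f t + g t))\<^sup>2) \<in> borel_measurable lborel"
      using strongly_measurable_borel[OF sm] by measurable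
    have "(norm (f t + g t))\<^sup>2 \<le> 2 * (norm (f t))\<^sup>2 + 2 * (norm (g t))\<^sup>2" for t
    proof -
      have "(norm (f t + g t))\<^sup>2 \<le> (norm (f t) + norm (g t))\<^sup>2"
        by (intro power_mono norm_triangle_ineq norm_ge_zero)
      moreover have "0 \<le> (norm (f t) - norm (g t))\<^sup>2" by simp
      ultimately show ?thesis unfolding power2_sum power2_diff by linarith
    qed
    then show "AE t in lborel. norm ((norm (f t + g t))\<^sup>2) \<le> norm (2 * (norm (f t))\<^sup>2 + 2 * (norm (g t))\<^sup>2)"
      by (simp add: abs_of_nonneg)
  qed
qed

lemma square_integrable_scaleR:
  fixes f :: "real \<Rightarrow> 'a::real_normed_vector"
  assumes "square_integrable f" shows "square_integrable (\<lambda>t. c *\<^sub>R f t)"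
  using assms unfolding square_integrable_alt
  by (auto intro: strongly_measurable_scaleR simp: power_mult_distrib)

lemma square_integrable_diff:
  fixes f g :: "real \<Rightarrow> 'a::real_normed_vector"
  assumes "square_integrable f" "square_integrable g"
  shows "square_integrable (\<lambda>t. f t - g t)"
  using square_integrable_add[OF assms(1) square_integrable_scaleR[OF assms(2), of "-1"]] by simp

lemma square_integrable_scaleC:
  fixes f :: "real \<Rightarrow> 'a::complex_hilbert"
  assumes "square_integrable f" shows "square_integrable (\<lambda>t. c *\<^sub>C f t)"
  using assms unfolding square_integrable_alt
  by (auto intro: strongly_measurable_comp1[OF _ continuous_scaleC] simp: norm_scaleC power_mult_distrib)

lemma square_integrable_zero: "square_integrable (\<lambda>t. 0)"
  by (simp add: square_integrable_alt strongly_measurable_const)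

lemma integrable_inner:
  fixes f g :: "real \<Rightarrow> 'a::real_inner"
  assumes "square_integrable f" "square_integrable g"
  shows "integrable lborel (\<lambda>t. inner (f t) (g t))"
proof (rule Bochner_Integration.integrable_bound)
  show "integrable lborel (\<lambda>t. (norm (f t))\<^sup>2 + (norm (g t))\<^sup>2)"
    using assms by (auto simp: square_integrable_alt)
  show "(\<lambda>t. inner (f t) (g t)) \<in> borel_measurable lborel"
    using assms unfolding square_integrable_def by (blast intro: measurable_inner_strongly)
  have "\<bar>inner (f t) (g t)\<bar> \<le> (norm (f t))\<^sup>2 + (norm (g t))\<^sup>2" for t
  proof -
    have "\<bar>inner (f t) (g t)\<bar> \<le> norm (f t) * norm (g t)" by (rule Cauchy_Schwarz_ineq2)
    moreover have "0 \<le> (norm (f t) - norm (g t))\<^sup>2" by simp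
    moreover have "0 \<le> norm (f t) * norm (g t)" by simp
    ultimately show ?thesis unfolding power2_diff by linarith
  qed
  then show "AE t in lborel. norm (inner (f t) (g t)) \<le> norm ((norm (f t))\<^sup>2 + (norm (g t))\<^sup>2)"
    by simp
qed

quotient_type (overloaded) 'a L2 = "real \<Rightarrow> 'a::complex_hilbert" / partial:
  "\<lambda>f g. square_integrable f \<and> square_integrable g \<and> (AE t in lborel. f t = g t)"
proof (rule part_equivpI)
  show "\<exists>f::real \<Rightarrow> 'a. square_integrable f \<and> square_integrable f \<and> (AE t in lborel. f t = f t)"
    using square_integrable_zero by auto
  show "symp (\<lambda>f g::real \<Rightarrow> 'a. square_integrable f \<and> square_integrable g \<and> (AE t in lborel. f t = g t))"
    by (rule sympI) (auto elim: eventually_mono)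
  show "transp (\<lambda>f g::real \<Rightarrow> 'a. square_integrable f \<and> square_integrable g \<and> (AE t in lborel. f t = g t))"
    by (rule transpI) (auto elim: eventually_elim2)
qed

instantiation L2 :: (complex_hilbert) real_vector
begin

lift_definition zero_L2 :: "'a L2" is "\<lambda>t. 0" by (simp add: square_integrable_zero)
lift_definition plus_L2 :: "'a L2 \<Rightarrow> 'a L2 \<Rightarrow> 'a L2" is "\<lambda>f g t. f t + g t"
  by (auto intro: square_integrable_add elim: eventually_elim2)
lift_definition scaleR_L2 :: "real \<Rightarrow> 'a L2 \<Rightarrow> 'a L2" is "\<lambda>c f t. c *\<^sub>R f t"
  by (auto intro: square_integrable_scaleR elim: eventually_mono)
lift_definition minus_L2 :: "'a L2 \<Rightarrow> 'a L2 \<Rightarrow> 'a L2" is "\<lambda>f g t. f t - g t"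
  by (auto intro: square_integrable_diff elim: eventually_elim2)
lift_definition uminus_L2 :: "'a L2 \<Rightarrow> 'a L2" is "\<lambda>f t. - f t"
  using square_integrable_scaleR[where c="-1"] by (auto elim: eventually_mono)
instance
proof
  fix x y z :: "'a L2" and a b :: real
  show "x + y + z = x + (y + z)"
    by transfer (auto intro!: square_integrable_add simp: algebra_simps)
  show "x + y = y + x" by transfer (auto intro!: square_integrable_add simp: algebra_simps)
  show "0 + x = x" by transfer auto
  show "- x + x = 0"
    by transfer (use square_integrable_zero in auto)
  show "x - y = x + - y" by transfer (auto intro!: square_integrable_diff)
  show "a *\<^sub>R (x + y) = a *\<^sub>R x + a *\<^sub>R y"
    by transfer (auto intro!: square_integrable_add square_integrable_scaleR simp: algebra_simps)
  show "(a + b) *\<^sub>R x = a *\<^sub>R x + b *\<^sub>R x"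
    by transfer (auto intro!: square_integrable_add square_integrable_scaleR simp: algebra_simps)
  show "a *\<^sub>R b *\<^sub>R x = (a * b) *\<^sub>R x"
    by transfer (auto intro!: square_integrable_scaleR)
  show "1 *\<^sub>R x = x" by transfer auto
qed

end

instantiation L2 :: (complex_hilbert) real_inner
begin

lift_definition inner_L2 :: "'a L2 \<Rightarrow> 'a L2 \<Rightarrow> real" is
  "\<lambda>f g. \<integral>t. inner (f t) (g t) \<partial>lborel"
proof (rule integral_cong_AE, goal_cases)
  case 1 then show ?case unfolding square_integrable_def by (blast intro: measurable_inner_strongly)
next
  case 2 then show ?case unfolding square_integrable_def by (blast intro: measurable_inner_strongly)
next
  case 3 then show ?case by (auto elim: eventually_elim2)
qed

definition norm_L2 :: "'a L2 \<Rightarrow> real" where "norm_L2 x = sqrt (inner x x)"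
definition dist_L2 :: "'a L2 \<Rightarrow> 'a L2 \<Rightarrow> real" where "dist_L2 x y = norm (x - y)"
definition sgn_L2 :: "'a L2 \<Rightarrow> 'a L2" where "sgn_L2 x = inverse (norm x) *\<^sub>R x"
definition uniformity_L2 :: "('a L2 \<times> 'a L2) filter"
  where "uniformity_L2 = (INF e\<in>{0 <..}. principal {(x, y). dist x y < e})"
definition open_L2 :: "'a L2 set \<Rightarrow> bool"
  where "open_L2 U \<longleftrightarrow> (\<forall>x\<in>U. eventually (\<lambda>(x', y). x' = x \<longrightarrow> y \<in> U) uniformity)"

instance
proof
  fix x y z :: "'a L2" and a :: real and U :: "'a L2 set"
  show "dist x y = norm (x - y)" by (simp add: dist_L2_def)
  show "sgn x = x /\<^sub>R norm x" by (simp add: sgn_L2_def)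
  show "uniformity = (INF e\<in>{0<..}. principal {(x, y). dist x (y::'a L2) < e})"
    by (rule uniformity_L2_def)
  show "open U \<longleftrightarrow> (\<forall>x\<in>U. eventually (\<lambda>(x', y). x' = x \<longrightarrow> y \<in> U) uniformity)"
    by (rule open_L2_def)
  show "norm x = sqrt (inner x x)" by (rule norm_L2_def)
  show "inner x y = inner y x" by transfer (simp add: inner_commute)
  show "inner (x + y) z = inner x z + inner y z"
    by transfer (auto simp: inner_add_left intro!: Bochner_Integration.integral_add integrable_inner)
  show "inner (a *\<^sub>R x) y = a * inner x y" by transfer simp
  show "0 \<le> inner x x" by transfer simp
  show "(inner x x = 0) = (x = 0)"
  proof (transfer, goal_cases)
    case (1 f)
    then have "integrable lborel (\<lambda>t. inner (f t) (f t))" by (auto intro: integrable_inner)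
    from integral_nonneg_eq_0_iff_AE[OF this] 1 show ?case
      by (auto simp: square_integrable_zero)
  qed
qed

end

lemma square_integrable_rep: "square_integrable (rep_L2 x)"
  using Quotient3_rep_reflp[OF Quotient3_L2, of x] by auto

lemma abs_rep_L2: "abs_L2 (rep_L2 x) = x"
  by (rule Quotient3_abs_rep[OF Quotient3_L2])

lemma abs_L2_diff:
  fixes f g :: "real \<Rightarrow> 'a::complex_hilbert"
  assumes "square_integrable f" "square_integrable g"
  shows "abs_L2 f - abs_L2 g = abs_L2 (\<lambda>t. f t - g t)"
  using assms by (simp add: minus_L2.abs_eq)

lemma norm_abs_L2:
  fixes f :: "real \<Rightarrow> 'a::complex_hilbert"
  assumes "square_integrable f"
  shows "(norm (abs_L2 f))\<^sup>2 = (\<integral>t. (norm (f t))\<^sup>2 \<partial>lborel)"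
  using assms by (simp add: power2_norm_eq_inner inner_L2.abs_eq)

lemma nn_norm_abs_L2:
  fixes f :: "real \<Rightarrow> 'a::complex_hilbert"
  assumes "square_integrable f"
  shows "(\<integral>\<^sup>+t. ennreal ((norm (f t))\<^sup>2) \<partial>lborel) = ennreal ((norm (abs_L2 f))\<^sup>2)"
  unfolding norm_abs_L2[OF assms] using assms
  by (intro nn_integral_eq_integral) (auto simp: square_integrable_alt)

lemma summable_from_weighted:
  fixes a :: "nat \<Rightarrow> real"
  assumes "(\<Sum>n. ennreal (2 ^ n * (a n)\<^sup>2)) \<noteq> \<infinity>" and "\<And>n. 0 \<le> a n"
  shows "summable a"
proof -
  have s: "summable (\<lambda>n. 2 ^ n * (a n)\<^sup>2)"
    using assms(1) by (intro summable_suminf_not_top) auto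
  have "summable (\<lambda>n. (1/2::real) ^ n + 2 ^ n * (a n)\<^sup>2)"
    by (intro summable_add s summable_geometric) simp
  moreover have "norm (a n) \<le> (1/2::real) ^ n + 2 ^ n * (a n)\<^sup>2" for n
  proof -
    define p :: real where "p = 2 ^ n"
    have p: "p > 0" by (simp add: p_def)
    have "0 \<le> (1 - p * a n)\<^sup>2" by simp
    then have "2 * (p * a n) \<le> 1 + p * p * (a n)\<^sup>2"
      unfolding power2_diff by (simp add: power2_eq_square algebra_simps)
    moreover have "0 \<le> p * a n" using p assms(2) by simp
    ultimately have "p * a n \<le> p * (1 / p + p * (a n)\<^sup>2)"
      using p by (simp add: algebra_simps)
    then have "a n \<le> 1 / p + p * (a n)\<^sup>2" using p by simp
    then show ?thesis using assms(2) by (simp add: p_def power_one_over)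
  qed
  ultimately show ?thesis by (rule summable_comparison_test'[where N=0])
qed

instance L2 :: (complex_hilbert) complete_space
proof
  fix X :: "nat \<Rightarrow> 'a L2" assume cX: "Cauchy X"
  have "\<forall>n. \<exists>N. \<forall>m\<ge>N. \<forall>k\<ge>N. dist (X m) (X k) < (1/2) ^ n"
    using cX unfolding Cauchy_def by (metis zero_less_divide_1_iff zero_less_numeral zero_less_power)
  then obtain N where N: "\<And>n m k. m \<ge> N n \<Longrightarrow> k \<ge> N n \<Longrightarrow> dist (X m) (X k) < (1/2) ^ n"
    by metis
  define r where "r n = (\<Sum>k\<le>n. N k) + n" for n
  have r1: "N n \<le> r n" for n
    unfolding r_def by (rule trans_le_add1, rule member_le_sum) auto
  have r2: "strict_mono r" unfolding strict_mono_Suc_iff by (simp add: r_def)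
  have r3: "N m \<le> r n" if "m \<le> n" for m n
    unfolding r_def using that by (intro trans_le_add1 member_le_sum) auto
  define f where "f n = rep_L2 (X (r n))" for n
  have sf: "square_integrable (f n)" for n by (simp add: f_def square_integrable_rep)
  have af: "abs_L2 (f n) = X (r n)" for n by (simp add: f_def abs_rep_L2)
  have fd: "(\<integral>\<^sup>+t. ennreal ((norm (f n t - f m t))\<^sup>2) \<partial>lborel) = ennreal ((dist (X (r n)) (X (r m)))\<^sup>2)" for n m
    using nn_norm_abs_L2[OF square_integrable_diff[OF sf[of n] sf[of m]]]
    unfolding abs_L2_diff[OF sf[of n] sf[of m], symmetric] af dist_norm by simp
  have smf: "strongly_measurable (f n)" for n using sf by (simp add: square_integrable_def)
  have smd: "strongly_measurable (\<lambda>t. f n t - f m t)" for n m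
    using square_integrable_diff[OF sf sf] by (auto simp: square_integrable_def)
  have nm[measurable]: "(\<lambda>t. norm (f n t - f m t)) \<in> borel_measurable lborel" for n m
    using strongly_measurable_borel[OF smd] by measurable
  define a where "a n t = norm (f (Suc n) t - f n t)" for n t
  have am[measurable]: "a n \<in> borel_measurable lborel" for n
    unfolding a_def by measurable
  define S where "S t = (\<Sum>n. ennreal (2 ^ n * (a n t)\<^sup>2))" for t
  have Sm[measurable]: "S \<in> borel_measurable lborel" unfolding S_def by measurable
  have "(\<integral>\<^sup>+t. S t \<partial>lborel) = (\<Sum>n. \<integral>\<^sup>+t. ennreal (2 ^ n * (a n t)\<^sup>2) \<partial>lborel)"
    unfolding S_def by (rule nn_integral_suminf) measurable
  also have "\<dots> \<le> (\<Sum>n. ennreal ((1/2) ^ n))"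
  proof (intro suminf_le summableI)
    fix n
    have "(\<integral>\<^sup>+t. ennreal (2 ^ n * (a n t)\<^sup>2) \<partial>lborel) = ennreal (2 ^ n) * (\<integral>\<^sup>+t. ennreal ((a n t)\<^sup>2) \<partial>lborel)"
      by (subst nn_integral_cmult[symmetric]) (auto simp: ennreal_mult)
    also have "\<dots> = ennreal (2 ^ n * (dist (X (r (Suc n))) (X (r n)))\<^sup>2)"
      unfolding a_def fd by (simp add: ennreal_mult)
    also have "\<dots> \<le> ennreal ((1/2) ^ n)"
    proof (rule ennreal_leI)
      have "dist (X (r (Suc n))) (X (r n)) \<le> (1/2) ^ n"
        by (intro less_imp_le N r1 r3) simp
      then have "(dist (X (r (Suc n))) (X (r n)))\<^sup>2 \<le> ((1/2) ^ n)\<^sup>2"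
        by (intro power_mono) auto
      then have "2 ^ n * (dist (X (r (Suc n))) (X (r n)))\<^sup>2 \<le> 2 ^ n * ((1/2) ^ n)\<^sup>2"
        by simp
      also have "2 ^ n * ((1/2::real) ^ n)\<^sup>2 = (1/2) ^ n"
        by (simp add: power2_eq_square power_one_over)
      finally show "2 ^ n * (dist (X (r (Suc n))) (X (r n)))\<^sup>2 \<le> (1/2) ^ n" .
    qed
    finally show "(\<integral>\<^sup>+t. ennreal (2 ^ n * (a n t)\<^sup>2) \<partial>lborel) \<le> ennreal ((1/2) ^ n)" .
  qed
  also have "\<dots> = ennreal (\<Sum>n. (1/2) ^ n)"
    by (rule suminf_ennreal2) (auto intro: summable_geometric)
  also have "\<dots> < \<infinity>" by simp
  finally have "(\<integral>\<^sup>+t. S t \<partial>lborel) < \<infinity>" .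
  then have AES: "AE t in lborel. S t \<noteq> \<infinity>"
    by (intro nn_integral_PInf_AE) auto
  define B where "B = {t. S t \<noteq> \<infinity>}"
  have Bm[measurable]: "B \<in> sets lborel"
    unfolding B_def using Sm by measurable
  have conv: "convergent (\<lambda>n. f n t)" if "t \<in> B" for t
  proof -
    have "summable (\<lambda>n. a n t)"
      by (rule summable_from_weighted) (use that in \<open>auto simp: B_def S_def a_def\<close>)
    then have Csum: "Cauchy (\<lambda>n. \<Sum>k<n. a k t)"
      by (intro convergent_Cauchy) (simp add: summable_iff_convergent)
    have bd: "dist (f m t) (f n t) \<le> \<bar>(\<Sum>k<m. a k t) - (\<Sum>k<n. a k t)\<bar>" for m n
    proof -
      have *: "dist (f n t) (f m t) \<le> (\<Sum>k<n. a k t) - (\<Sum>k<m. a k t)" if "m \<le> n" for m n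
        using that
      proof (induction n rule: dec_induct)
        case (step n)
        have "dist (f (Suc n) t) (f m t) \<le> dist (f (Suc n) t) (f n t) + dist (f n t) (f m t)"
          by (rule dist_triangle)
        with step show ?case by (simp add: a_def dist_norm)
      qed simp
      show ?thesis
        using *[of m n] *[of n m] by (cases "m \<le> n") (auto simp: dist_commute)
    qed
    have "Cauchy (\<lambda>n. f n t)"
    proof (rule metric_CauchyI)
      fix e :: real assume "0 < e"
      then obtain M where "\<forall>m\<ge>M. \<forall>n\<ge>M. dist (\<Sum>k<m. a k t) (\<Sum>k<n. a k t) < e"
        using Csum unfolding Cauchy_def by blast
      then show "\<exists>M. \<forall>m\<ge>M. \<forall>n\<ge>M. dist (f m t) (f n t) < e"
        using bd by (simp add: dist_real_def) (meson le_less_trans)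
    qed
    then show ?thesis by (rule Cauchy_convergent)
  qed
  define F where "F t = (if t \<in> B then lim (\<lambda>n. f n t) else 0)" for t
  have limF: "(\<lambda>n. indicator B t *\<^sub>R f n t) \<longlonglongrightarrow> F t" for t
    using conv[of t] by (auto simp: F_def convergent_LIMSEQ_iff)
  have "strongly_measurable (\<lambda>t. indicator B t *\<^sub>R f n t)" for n
  proof (rule strongly_measurable_cont2[where g="\<lambda>x y. x *\<^sub>R y"])
    show "strongly_measurable (indicator B :: real \<Rightarrow> real)"
      by (rule strongly_measurable_real) measurable
    show "strongly_measurable (f n)" by (rule smf)
  qed (intro continuous_intros)
  then have smF: "strongly_measurable F"
    using limF by (rule strongly_measurable_lim)
  have smFd: "strongly_measurable (\<lambda>t. F t - f m t)" for m
    using strongly_measurable_add[OF smF strongly_measurable_scaleR[OF smf[of m], of "-1"]] by simp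
  have key: "(\<integral>\<^sup>+t. ennreal ((norm (F t - f m t))\<^sup>2) \<partial>lborel) \<le> ennreal (((1/2) ^ m)\<^sup>2)" for m
  proof -
    have "(\<integral>\<^sup>+t. ennreal ((norm (F t - f m t))\<^sup>2) \<partial>lborel)
        = (\<integral>\<^sup>+t. liminf (\<lambda>n. ennreal ((norm (f n t - f m t))\<^sup>2)) \<partial>lborel)"
    proof (rule nn_integral_cong_AE, use AES in eventually_elim)
      fix t assume "S t \<noteq> \<infinity>"
      then have "t \<in> B" by (simp add: B_def)
      then have "(\<lambda>n. f n t) \<longlonglongrightarrow> F t" using limF[of t] by simp
      then have "(\<lambda>n. ennreal ((norm (f n t - f m t))\<^sup>2)) \<longlonglongrightarrow> ennreal ((norm (F t - f m t))\<^sup>2)"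
        by (intro tendsto_intros) auto
      from lim_imp_Liminf[OF _ this] show
        "ennreal ((norm (F t - f m t))\<^sup>2) = liminf (\<lambda>n. ennreal ((norm (f n t - f m t))\<^sup>2))"
        by simp
    qed
    also have "\<dots> \<le> liminf (\<lambda>n. \<integral>\<^sup>+t. ennreal ((norm (f n t - f m t))\<^sup>2) \<partial>lborel)"
      by (rule nn_integral_liminf) measurable
    also have "\<dots> = liminf (\<lambda>n. ennreal ((dist (X (r n)) (X (r m)))\<^sup>2))" by (simp add: fd)
    also have "\<dots> \<le> liminf (\<lambda>n. ennreal (((1/2) ^ m)\<^sup>2))"
    proof (rule Liminf_mono)
      show "\<forall>\<^sub>F n in sequentially. ennreal ((dist (X (r n)) (X (r m)))\<^sup>2) \<le> ennreal (((1/2) ^ m)\<^sup>2)"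
        unfolding eventually_sequentially
      proof (intro exI[of _ m] allI impI ennreal_leI power_mono)
        fix n assume "m \<le> n"
        show "dist (X (r n)) (X (r m)) \<le> (1/2) ^ m"
          by (intro less_imp_le N r1 r3 \<open>m \<le> n\<close>)
      qed simp
    qed
    also have "\<dots> = ennreal (((1/2) ^ m)\<^sup>2)" by (simp add: Liminf_const)
    finally show ?thesis .
  qed
  have sFd: "square_integrable (\<lambda>t. F t - f m t)" for m
    unfolding square_integrable_def
    by (intro conjI smFd le_less_trans[OF key[of m]]) simp
  have sF: "square_integrable F"
    using square_integrable_add[OF sFd[of 0] sf[of 0]] by simp
  have "dist (X (r m)) (abs_L2 F) \<le> (1/2) ^ m" for m
  proof -
    have "ennreal ((dist (abs_L2 F) (X (r m)))\<^sup>2) \<le> ennreal (((1/2) ^ m)\<^sup>2)"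
      using key[of m]
      unfolding nn_norm_abs_L2[OF sFd] abs_L2_diff[OF sF sf[of m], symmetric] af dist_norm .
    then have "(dist (abs_L2 F) (X (r m)))\<^sup>2 \<le> ((1/2) ^ m)\<^sup>2"
      by (subst (asm) ennreal_le_iff) (rule zero_le_power2)
    then have "dist (abs_L2 F) (X (r m)) \<le> (1/2) ^ m"
      by (rule power2_le_imp_le) simp
    then show ?thesis by (subst dist_commute)
  qed
  then have le: "\<forall>\<^sub>F m in sequentially. dist (X (r m)) (abs_L2 F) \<le> (1/2) ^ m"
    by (rule always_eventually[OF allI])
  have lim0: "(\<lambda>m. (1/2::real) ^ m) \<longlonglongrightarrow> 0" by (rule LIMSEQ_realpow_zero) auto
  have "(\<lambda>m. dist (X (r m)) (abs_L2 F)) \<longlonglongrightarrow> 0"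
    by (rule real_tendsto_sandwich[OF always_eventually[OF allI] le tendsto_const lim0])
      (rule zero_le_dist)
  then have "(X \<circ> r) \<longlonglongrightarrow> abs_L2 F" unfolding comp_def by (subst tendsto_dist_iff)
  with cX r2 have "X \<longlonglongrightarrow> abs_L2 F"
    by (rule Cauchy_converges_subseq)
  then show "convergent X" by (rule convergentI)
qed

instantiation L2 :: (complex_hilbert) complex_hilbert
begin

lift_definition scaleC_L2 :: "complex \<Rightarrow> 'a L2 \<Rightarrow> 'a L2" is "\<lambda>c f t. c *\<^sub>C f t"
  by (auto intro: square_integrable_scaleC elim: eventually_mono)

instance
proof
  fix x y :: "'a L2" and a b :: complex and r :: real
  show "a *\<^sub>C (x + y) = a *\<^sub>C x + a *\<^sub>C y"
    by transfer (auto intro!: square_integrable_add square_integrable_scaleC simp: scaleC_add_right)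
  show "(a + b) *\<^sub>C x = a *\<^sub>C x + b *\<^sub>C x"
    by transfer (auto intro!: square_integrable_add square_integrable_scaleC simp: scaleC_add_left)
  show "a *\<^sub>C b *\<^sub>C x = (a * b) *\<^sub>C x"
    by transfer (auto intro!: square_integrable_scaleC simp: scaleC_scaleC)
  show "complex_of_real r *\<^sub>C x = r *\<^sub>R x"
    by transfer (auto intro!: square_integrable_scaleR simp: scaleC_of_real)
  show "inner (\<i> *\<^sub>C x) (\<i> *\<^sub>C y) = inner x y"
    by transfer (simp add: inner_scaleC_i)
qed

end

type_synonym 'h operator = "'h \<Rightarrow> 'h"

text \<open>Unbounded operators are represented by their graphs.\<close>

type_synonym 'h graph = "('h \<times> 'h) set"


section \<open>Bounded operators and von Neumann algebras\<close>

definition bounded_operator :: "'h::complex_hilbert operator \<Rightarrow> bool"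
  where "bounded_operator x \<longleftrightarrow> bounded_linear x \<and> (\<forall>c v. x (c *\<^sub>C v) = c *\<^sub>C x v)"

definition adj :: "'h::complex_hilbert operator \<Rightarrow> 'h operator"
  where "adj x = (THE y. bounded_operator y \<and> (\<forall>u v. cinner (x u) v = cinner u (y v)))"

definition is_projection :: "'h::complex_hilbert operator \<Rightarrow> bool"
  where "is_projection e \<longleftrightarrow> bounded_operator e \<and> e \<circ> e = e \<and> adj e = e"

definition positive_operator :: "'h::complex_hilbert operator \<Rightarrow> bool"
  where "positive_operator x \<longleftrightarrow> bounded_operator x \<and>
    (\<forall>v. Im (cinner v (x v)) = 0 \<and> 0 \<le> Re (cinner v (x v)))"

definition commutant :: "'h::complex_hilbert operator set \<Rightarrow> 'h operator set"
  where "commutant S = {y. bounded_operator y \<and> (\<forall>x\<in>S. x \<circ> y = y \<circ> x)}"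

definition von_neumann_algebra :: "'h::complex_hilbert operator set \<Rightarrow> bool"
  where "von_neumann_algebra M \<longleftrightarrow>
    M \<subseteq> Collect bounded_operator \<and> (\<forall>x\<in>M. adj x \<in> M) \<and> commutant (commutant M) = M"

definition pos_part :: "'h::complex_hilbert operator set \<Rightarrow> 'h operator set"
  where "pos_part M = {x \<in> M. positive_operator x}"

definition op_le :: "'h::complex_hilbert operator \<Rightarrow> 'h operator \<Rightarrow> bool"
  where "op_le x y \<longleftrightarrow> positive_operator (\<lambda>v. y v - x v)"


section \<open>Weights\<close>

text \<open>Weights are functions on all operators; only their values on the positive part matter.\<close>

definition weight :: "'h::complex_hilbert operator set \<Rightarrow> ('h operator \<Rightarrow> ennreal) \<Rightarrow> bool"
  where "weight M \<nu> \<longleftrightarrow>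
    (\<forall>x\<in>pos_part M. \<forall>y\<in>pos_part M. \<nu> (\<lambda>v. x v + y v) = \<nu> x + \<nu> y) \<and>
    (\<forall>x\<in>pos_part M. \<forall>c\<ge>0. \<nu> (\<lambda>v. c *\<^sub>R x v) = ennreal c * \<nu> x)"

definition n_ideal :: "'h::complex_hilbert operator set \<Rightarrow> ('h operator \<Rightarrow> ennreal) \<Rightarrow> 'h operator set"
  where "n_ideal M \<nu> = {a \<in> M. \<nu> (adj a \<circ> a) < \<infinity>}"

definition faithful_weight :: "'h::complex_hilbert operator set \<Rightarrow> ('h operator \<Rightarrow> ennreal) \<Rightarrow> bool"
  where "faithful_weight M \<nu> \<longleftrightarrow> (\<forall>x\<in>pos_part M. \<nu> x = 0 \<longrightarrow> x = (\<lambda>v. 0))"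

definition normal_weight :: "'h::complex_hilbert operator set \<Rightarrow> ('h operator \<Rightarrow> ennreal) \<Rightarrow> bool"
  where "normal_weight M \<nu> \<longleftrightarrow>
    (\<forall>D x. D \<noteq> {} \<and> D \<subseteq> pos_part M \<and> x \<in> pos_part M \<and>
      (\<forall>a\<in>D. \<forall>b\<in>D. \<exists>c\<in>D. op_le a c \<and> op_le b c) \<and>
      (\<forall>a\<in>D. op_le a x) \<and> (\<forall>y\<in>pos_part M. (\<forall>a\<in>D. op_le a y) \<longrightarrow> op_le x y)
      \<longrightarrow> \<nu> x = (SUP a\<in>D. \<nu> a))"

text \<open>Semifiniteness: the left ideal of square-\<open>\<nu>\<close>-integrable elements is dense in the strong
  operator topology (for a left ideal this is the same as \<open>\<sigma>\<close>-weak density).\<close>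

definition semifinite_weight :: "'h::complex_hilbert operator set \<Rightarrow> ('h operator \<Rightarrow> ennreal) \<Rightarrow> bool"
  where "semifinite_weight M \<nu> \<longleftrightarrow>
    (\<forall>x\<in>M. \<forall>F. finite F \<longrightarrow> (\<forall>e>0. \<exists>y\<in>n_ideal M \<nu>. \<forall>v\<in>F. norm (x v - y v) < e))"

definition fns_weight :: "'h::complex_hilbert operator set \<Rightarrow> ('h operator \<Rightarrow> ennreal) \<Rightarrow> bool"
  where "fns_weight M \<nu> \<longleftrightarrow>
    weight M \<nu> \<and> faithful_weight M \<nu> \<and> normal_weight M \<nu> \<and> semifinite_weight M \<nu>"

text \<open>The linear extension of \<open>\<nu>\<close> to the span of the positive elements of finite weight.\<close>

definition weight_ext ::
    "'h::complex_hilbert operator set \<Rightarrow> ('h operator \<Rightarrow> ennreal) \<Rightarrow> 'h operator \<Rightarrow> complex"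
  where "weight_ext M \<nu> x = (THE c. \<exists>p q r s.
    {p, q, r, s} \<subseteq> {y \<in> pos_part M. \<nu> y < \<infinity>} \<and>
    x = (\<lambda>v. (p v - q v) + \<i> *\<^sub>C (r v - s v)) \<and>
    c = Complex (enn2real (\<nu> p) - enn2real (\<nu> q)) (enn2real (\<nu> r) - enn2real (\<nu> s)))"


section \<open>The modular automorphism group\<close>

definition star_automorphism :: "'h::complex_hilbert operator set \<Rightarrow> ('h operator \<Rightarrow> 'h operator) \<Rightarrow> bool"
  where "star_automorphism M \<alpha> \<longleftrightarrow> bij_betw \<alpha> M M \<and>
    (\<forall>x\<in>M. \<forall>y\<in>M. \<alpha> (\<lambda>v. x v + y v) = (\<lambda>v. \<alpha> x v + \<alpha> y v) \<and> \<alpha> (x \<circ> y) = \<alpha> x \<circ> \<alpha> y) \<and>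
    (\<forall>x\<in>M. \<forall>c. \<alpha> (\<lambda>v. c *\<^sub>C x v) = (\<lambda>v. c *\<^sub>C \<alpha> x v)) \<and>
    (\<forall>x\<in>M. \<alpha> (adj x) = adj (\<alpha> x))"

definition one_parameter_automorphism_group ::
    "'h::complex_hilbert operator set \<Rightarrow> (real \<Rightarrow> 'h operator \<Rightarrow> 'h operator) \<Rightarrow> bool"
  where "one_parameter_automorphism_group M \<sigma> \<longleftrightarrow>
    (\<forall>t. star_automorphism M (\<sigma> t)) \<and>
    (\<forall>s t. \<forall>x\<in>M. \<sigma> (s + t) x = \<sigma> s (\<sigma> t x)) \<and>
    (\<forall>x\<in>M. \<forall>v. continuous_on UNIV (\<lambda>t. \<sigma> t x v))"

text \<open>The modular group of \<open>\<nu>\<close> is the unique one-parameter automorphism group for which \<open>\<nu>\<close> is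
  invariant and satisfies the modular (KMS) condition, with the sign convention
  \<open>F t = \<nu> (\<sigma> t x \<circ> y)\<close>, \<open>F (t + \<i>) = \<nu> (y \<circ> \<sigma> t x)\<close>.\<close>

definition modular_group ::
    "'h::complex_hilbert operator set \<Rightarrow> ('h operator \<Rightarrow> ennreal) \<Rightarrow>
     (real \<Rightarrow> 'h operator \<Rightarrow> 'h operator) \<Rightarrow> bool"
  where "modular_group M \<nu> \<sigma> \<longleftrightarrow>
    one_parameter_automorphism_group M \<sigma> \<and>
    (\<forall>t. \<forall>x\<in>pos_part M. \<nu> (\<sigma> t x) = \<nu> x) \<and>
    (\<forall>x y. {x, adj x, y, adj y} \<subseteq> n_ideal M \<nu> \<longrightarrow>
      (\<exists>F. continuous_on {z. 0 \<le> Im z \<and> Im z \<le> 1} F \<and>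
        bounded (F ` {z. 0 \<le> Im z \<and> Im z \<le> 1}) \<and>
        F holomorphic_on {z. 0 < Im z \<and> Im z < 1} \<and>
        (\<forall>t::real. F (of_real t) = weight_ext M \<nu> (\<sigma> t x \<circ> y) \<and>
                   F (of_real t + \<i>) = weight_ext M \<nu> (y \<circ> \<sigma> t x))))"


section \<open>Unbounded operators and functional calculus\<close>

definition op_graph :: "'h operator \<Rightarrow> 'h graph"
  where "op_graph x = {(v, x v) | v. True}"

definition graph_op :: "'h graph \<Rightarrow> 'h operator"
  where "graph_op T v = (THE w. (v, w) \<in> T)"

definition closed_densely_defined :: "'h::complex_hilbert graph \<Rightarrow> bool"
  where "closed_densely_defined T \<longleftrightarrow>
    (0, 0) \<in> T \<and>
    (\<forall>(u, v)\<in>T. \<forall>(x, y)\<in>T. (u + x, v + y) \<in> T) \<and>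
    (\<forall>c. \<forall>(u, v)\<in>T. (c *\<^sub>C u, c *\<^sub>C v) \<in> T) \<and>
    single_valued T \<and> closed T \<and> closure (Domain T) = UNIV"

definition affiliated :: "'h::complex_hilbert operator set \<Rightarrow> 'h graph \<Rightarrow> bool"
  where "affiliated A T \<longleftrightarrow> (\<forall>b\<in>commutant A. \<forall>(u, v)\<in>T. (b u, b v) \<in> T)"

definition adj_graph :: "'h::complex_hilbert graph \<Rightarrow> 'h graph"
  where "adj_graph T = {(u, v). \<forall>(x, y)\<in>T. cinner y u = cinner x v}"

definition positive_selfadjoint :: "'h::complex_hilbert graph \<Rightarrow> bool"
  where "positive_selfadjoint T \<longleftrightarrow>
    closed_densely_defined T \<and> adj_graph T = T \<and> (\<forall>(x, y)\<in>T. 0 \<le> Re (cinner x y))"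

text \<open>The closures of the algebraic sum, scalar multiple and product.\<close>

definition strong_sum :: "'h::complex_hilbert graph \<Rightarrow> 'h graph \<Rightarrow> 'h graph"
  where "strong_sum S T = closure {(x, y + z) | x y z. (x, y) \<in> S \<and> (x, z) \<in> T}"

definition strong_scale :: "complex \<Rightarrow> 'h::complex_hilbert graph \<Rightarrow> 'h graph"
  where "strong_scale c T = closure {(x, c *\<^sub>C y) | x y. (x, y) \<in> T}"

definition strong_diff :: "'h::complex_hilbert graph \<Rightarrow> 'h graph \<Rightarrow> 'h graph"
  where "strong_diff S T = strong_sum S (strong_scale (-1) T)"

definition strong_prod :: "'h::complex_hilbert graph \<Rightarrow> 'h graph \<Rightarrow> 'h graph"
  where "strong_prod S T = closure {(x, z) | x y z. (x, y) \<in> T \<and> (y, z) \<in> S}"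

definition spectral_measure :: "(real set \<Rightarrow> 'h::complex_hilbert operator) \<Rightarrow> bool"
  where "spectral_measure E \<longleftrightarrow>
    (\<forall>B\<in>sets borel. is_projection (E B)) \<and> E UNIV = (\<lambda>v. v) \<and>
    (\<forall>B. range B \<subseteq> sets borel \<and> disjoint_family B \<longrightarrow>
      (\<forall>v. (\<lambda>n::nat. E (B n) v) sums E (\<Union>n. B n) v))"

definition scalar_measure :: "(real set \<Rightarrow> 'h::complex_hilbert operator) \<Rightarrow> 'h \<Rightarrow> real measure"
  where "scalar_measure E v = measure_of UNIV (sets borel) (\<lambda>B. ennreal ((norm (E B v))\<^sup>2))"

definition spectral_domain ::
    "(real set \<Rightarrow> 'h::complex_hilbert operator) \<Rightarrow> (real \<Rightarrow> complex) \<Rightarrow> 'h set"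
  where "spectral_domain E f =
    {v. (\<integral>\<^sup>+ u. ennreal ((cmod (f u))\<^sup>2) \<partial>scalar_measure E v) < \<infinity>}"

text \<open>The operator \<open>\<integral> f dE\<close>: \<open>\<langle>z, y\<rangle> = \<integral> f d\<langle>z, E x\<rangle>\<close>, the complex measure \<open>\<langle>z, E x\<rangle>\<close> being
  expressed by polarization.\<close>

definition spectral_integral ::
    "(real set \<Rightarrow> 'h::complex_hilbert operator) \<Rightarrow> (real \<Rightarrow> complex) \<Rightarrow> 'h graph"
  where "spectral_integral E f = {(x, y). x \<in> spectral_domain E f \<and>
    (\<forall>z\<in>spectral_domain E f. cinner z y =
      (1 / 4) * (\<Sum>k<4. \<i> ^ k * (\<integral>u. f u \<partial>scalar_measure E (x + (\<i> ^ k) *\<^sub>C z))))}"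

text \<open>\<open>f(h)\<close> for selfadjoint \<open>h\<close>; the spectral measure of \<open>h\<close> is unique on Borel sets.\<close>

definition borel_calculus :: "(real \<Rightarrow> complex) \<Rightarrow> 'h::complex_hilbert graph \<Rightarrow> 'h graph"
  where "borel_calculus f h =
    {p. \<exists>E. spectral_measure E \<and> h = spectral_integral E complex_of_real \<and> p \<in> spectral_integral E f}"


section \<open>Measurable operators and the topology of convergence in measure\<close>

definition measurable_operators ::
    "'h::complex_hilbert operator set \<Rightarrow> ('h operator \<Rightarrow> ennreal) \<Rightarrow> 'h graph set"
  where "measurable_operators A \<tau> = {a. closed_densely_defined a \<and> affiliated A a \<and>
    (\<forall>\<delta>>0. \<exists>e\<in>A. is_projection e \<and> range e \<subseteq> Domain a \<and> \<tau> (\<lambda>v. v - e v) \<le> ennreal \<delta>)}"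

definition measure_nbhd ::
    "'h::complex_hilbert operator set \<Rightarrow> ('h operator \<Rightarrow> ennreal) \<Rightarrow> real \<Rightarrow> real \<Rightarrow> 'h graph set"
  where "measure_nbhd A \<tau> \<epsilon> \<delta> = {a \<in> measurable_operators A \<tau>. \<exists>e\<in>A. is_projection e \<and>
    range e \<subseteq> Domain a \<and> (\<forall>v w. (e v, w) \<in> a \<longrightarrow> norm w \<le> \<epsilon> * norm v) \<and>
    \<tau> (\<lambda>v. v - e v) \<le> ennreal \<delta>}"

definition measure_topology ::
    "'h::complex_hilbert operator set \<Rightarrow> ('h operator \<Rightarrow> ennreal) \<Rightarrow> 'h graph topology"
  where "measure_topology A \<tau> = topology (\<lambda>U. U \<subseteq> measurable_operators A \<tau> \<and>
    (\<forall>a\<in>U. \<exists>\<epsilon>>0. \<exists>\<delta>>0. \<forall>b\<in>measurable_operators A \<tau>.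
      strong_diff b a \<in> measure_nbhd A \<tau> \<epsilon> \<delta> \<longrightarrow> b \<in> U))"

lemma measure_nbhd_mono:
  assumes "\<epsilon> \<le> \<epsilon>'" "\<delta> \<le> \<delta>'"
  shows "measure_nbhd A \<tau> \<epsilon> \<delta> \<subseteq> measure_nbhd A \<tau> \<epsilon>' \<delta>'"
proof
  fix a assume "a \<in> measure_nbhd A \<tau> \<epsilon> \<delta>"
  then obtain e where e: "a \<in> measurable_operators A \<tau>" "e \<in> A" "is_projection e"
    "range e \<subseteq> Domain a" "\<And>v w. (e v, w) \<in> a \<Longrightarrow> norm w \<le> \<epsilon> * norm v"
    "\<tau> (\<lambda>v. v - e v) \<le> ennreal \<delta>"
    unfolding measure_nbhd_def by blast
  moreover have "norm w \<le> \<epsilon>' * norm v" if "(e v, w) \<in> a" for v w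
    using e(5)[OF that] mult_right_mono[OF assms(1), of "norm v"] by simp
  moreover have "\<tau> (\<lambda>v. v - e v) \<le> ennreal \<delta>'"
    using e(6) ennreal_leI[OF assms(2)] by (rule order_trans)
  ultimately show "a \<in> measure_nbhd A \<tau> \<epsilon>' \<delta>'"
    unfolding measure_nbhd_def by blast
qed

lemma openin_measure_topology:
  "openin (measure_topology A \<tau>) U \<longleftrightarrow> U \<subseteq> measurable_operators A \<tau> \<and>
    (\<forall>a\<in>U. \<exists>\<epsilon>>0. \<exists>\<delta>>0. \<forall>b\<in>measurable_operators A \<tau>.
      strong_diff b a \<in> measure_nbhd A \<tau> \<epsilon> \<delta> \<longrightarrow> b \<in> U)"
proof -
  let ?R = "measurable_operators A \<tau>"
  let ?N = "measure_nbhd A \<tau>"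
  let ?Q = "\<lambda>U a. \<exists>\<epsilon>>0. \<exists>\<delta>>0. \<forall>b\<in>?R. strong_diff b a \<in> ?N \<epsilon> \<delta> \<longrightarrow> b \<in> U"
  have inter: "?Q (S \<inter> T) a" if Q: "?Q S a" "?Q T a" for S T a
  proof -
    obtain p q where p: "p > 0" "q > 0" "\<forall>b\<in>?R. strong_diff b a \<in> ?N p q \<longrightarrow> b \<in> S"
      using Q(1) by blast
    obtain p' q' where p': "p' > 0" "q' > 0" "\<forall>b\<in>?R. strong_diff b a \<in> ?N p' q' \<longrightarrow> b \<in> T"
      using Q(2) by blast
    have sub: "?N (min p p') (min q q') \<subseteq> ?N p q" "?N (min p p') (min q q') \<subseteq> ?N p' q'"
      by (rule measure_nbhd_mono[OF min.cobounded1 min.cobounded1],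
          rule measure_nbhd_mono[OF min.cobounded2 min.cobounded2])
    have "\<forall>b\<in>?R. strong_diff b a \<in> ?N (min p p') (min q q') \<longrightarrow> b \<in> S \<inter> T"
    proof (intro ballI impI IntI)
      fix b assume b: "b \<in> ?R" "strong_diff b a \<in> ?N (min p p') (min q q')"
      show "b \<in> S" by (rule p(3)[rule_format, OF b(1) subsetD[OF sub(1) b(2)]])
      show "b \<in> T" by (rule p'(3)[rule_format, OF b(1) subsetD[OF sub(2) b(2)]])
    qed
    moreover have "0 < min p p'" "0 < min q q'"
      using p(1,2) p'(1,2) by (simp_all only: min_less_iff_conj)
    ultimately show ?thesis by (intro exI[of _ "min p p'"] exI[of _ "min q q'"] conjI)
  qed
  have mono: "?Q T a" if Q: "?Q S a" and "S \<subseteq> T" for S T a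
  proof -
    obtain p q where "p > 0" "q > 0" "\<forall>b\<in>?R. strong_diff b a \<in> ?N p q \<longrightarrow> b \<in> S"
      using Q by (elim exE conjE)
    then show ?thesis
      using \<open>S \<subseteq> T\<close> by (intro exI[of _ p] exI[of _ q] conjI ballI impI) (auto dest: subsetD)
  qed
  have "istopology (\<lambda>U. U \<subseteq> ?R \<and> (\<forall>a\<in>U. ?Q U a))"
    unfolding istopology_def
  proof (rule conjI)
    show "\<forall>S T. S \<subseteq> ?R \<and> (\<forall>a\<in>S. ?Q S a) \<longrightarrow> T \<subseteq> ?R \<and> (\<forall>a\<in>T. ?Q T a) \<longrightarrow>
        S \<inter> T \<subseteq> ?R \<and> (\<forall>a\<in>S \<inter> T. ?Q (S \<inter> T) a)"
    proof (intro allI impI conjI ballI)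
      fix S T assume S: "S \<subseteq> ?R \<and> (\<forall>a\<in>S. ?Q S a)" and T: "T \<subseteq> ?R \<and> (\<forall>a\<in>T. ?Q T a)"
      show "S \<inter> T \<subseteq> ?R" using S by (intro le_infI1) (rule conjunct1)
      fix a assume "a \<in> S \<inter> T"
      then have "a \<in> S" "a \<in> T" by simp_all
      show "?Q (S \<inter> T) a"
        by (rule inter[OF bspec[OF conjunct2[OF S] \<open>a \<in> S\<close>] bspec[OF conjunct2[OF T] \<open>a \<in> T\<close>]])
    qed
    show "\<forall>K. (\<forall>S\<in>K. S \<subseteq> ?R \<and> (\<forall>a\<in>S. ?Q S a)) \<longrightarrow>
        \<Union>K \<subseteq> ?R \<and> (\<forall>a\<in>\<Union>K. ?Q (\<Union>K) a)"
    proof (intro allI impI conjI ballI)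
      fix K assume K: "\<forall>S\<in>K. S \<subseteq> ?R \<and> (\<forall>a\<in>S. ?Q S a)"
      show "\<Union>K \<subseteq> ?R" by (rule Sup_least) (rule conjunct1[OF bspec[OF K]])
      fix a assume "a \<in> \<Union>K"
      then obtain S where "S \<in> K" "a \<in> S" by (rule UnionE)
      show "?Q (\<Union>K) a"
        by (rule mono[OF bspec[OF conjunct2[OF bspec[OF K \<open>S \<in> K\<close>]] \<open>a \<in> S\<close>] Union_upper[OF \<open>S \<in> K\<close>]])
    qed
  qed
  then show ?thesis
    unfolding measure_topology_def by (subst topology_inverse') (assumption, rule refl)
qed

text \<open>\<open>T\<close> is a topology on a complex vector space \<open>L\<close> of operators, with strong sums and scalar
  multiples; a norm on \<open>L\<close> induces it.\<close>

definition normable :: "'h::complex_hilbert graph set \<Rightarrow> 'h graph topology \<Rightarrow> bool"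
  where "normable L T \<longleftrightarrow>
    op_graph (\<lambda>v. 0) \<in> L \<and> (\<forall>a\<in>L. \<forall>b\<in>L. strong_sum a b \<in> L) \<and>
    (\<forall>c. \<forall>a\<in>L. strong_scale c a \<in> L) \<and>
    (\<exists>N :: 'h graph \<Rightarrow> real.
      (\<forall>a\<in>L. 0 \<le> N a \<and> (N a = 0 \<longleftrightarrow> a = op_graph (\<lambda>v. 0))) \<and>
      (\<forall>c. \<forall>a\<in>L. N (strong_scale c a) = cmod c * N a) \<and>
      (\<forall>a\<in>L. \<forall>b\<in>L. N (strong_sum a b) \<le> N a + N b) \<and>
      (\<forall>U. openin T U \<longleftrightarrow>
        U \<subseteq> L \<and> (\<forall>a\<in>U. \<exists>r>0. \<forall>b\<in>L. N (strong_diff b a) < r \<longrightarrow> b \<in> U)))"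


section \<open>The crossed product, its dual action and canonical trace\<close>

text \<open>\<open>crossed_embed \<sigma> x\<close> is \<open>\<pi>(x)\<close>, \<open>(\<pi>(x)\<xi>)(t) = \<sigma>\<^sub>-\<^sub>t(x)\<xi>(t)\<close>, and \<open>shift_op s\<close> is \<open>\<lambda>(s)\<close>.
  The dual action is spatial, implemented by \<open>phase_op\<close>, and therefore makes sense for
  unbounded operators as well (\<open>dual_action_graph\<close>).\<close>

definition crossed_embed ::
    "(real \<Rightarrow> 'h::complex_hilbert operator \<Rightarrow> 'h operator) \<Rightarrow> 'h operator \<Rightarrow> 'h L2 operator"
  where "crossed_embed \<sigma> x \<xi> = abs_L2 (\<lambda>t. \<sigma> (- t) x (rep_L2 \<xi> t))"

definition shift_op :: "real \<Rightarrow> 'h::complex_hilbert L2 operator"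
  where "shift_op s \<xi> = abs_L2 (\<lambda>t. rep_L2 \<xi> (t - s))"

definition phase_op :: "real \<Rightarrow> 'h::complex_hilbert L2 operator"
  where "phase_op s \<xi> = abs_L2 (\<lambda>t. cis (- (s * t)) *\<^sub>C rep_L2 \<xi> t)"

definition crossed_product ::
    "'h::complex_hilbert operator set \<Rightarrow> (real \<Rightarrow> 'h operator \<Rightarrow> 'h operator) \<Rightarrow> 'h L2 operator set"
  where "crossed_product M \<sigma> = commutant (commutant (crossed_embed \<sigma> ` M \<union> range shift_op))"

definition dual_action :: "real \<Rightarrow> 'h::complex_hilbert L2 operator \<Rightarrow> 'h L2 operator"
  where "dual_action s a = phase_op s \<circ> a \<circ> phase_op (- s)"

definition dual_action_graph :: "real \<Rightarrow> 'h::complex_hilbert L2 graph \<Rightarrow> 'h L2 graph"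
  where "dual_action_graph s a = (\<lambda>(u, v). (phase_op s u, phase_op s v)) ` a"

text \<open>Haagerup's dual weight \<open>\<nu> \<circ> \<pi>\<^sup>-\<^sup>1 \<circ> T\<close>, \<open>T(a) = \<integral> \<theta>\<^sub>s(a) ds\<close>. The value of \<open>\<nu>\<close> at an element
  \<open>m\<close> of the extended positive part is the supremum of \<open>m(\<omega>)\<close> over the positive normal functionals
  \<open>\<omega> \<le> \<nu>\<close>. Every such functional on \<open>\<pi>(M)\<close> is of the form \<open>a \<mapsto> \<Sum>\<^sub>n \<langle>\<xi>\<^sub>n, a \<xi>\<^sub>n\<rangle>\<close> with
  \<open>\<Sum>\<^sub>n \<parallel>\<xi>\<^sub>n\<parallel>\<^sup>2 < \<infinity>\<close>, and \<open>T(a)(\<omega>) = \<integral> \<Sum>\<^sub>n \<langle>\<xi>\<^sub>n, \<theta>\<^sub>s(a) \<xi>\<^sub>n\<rangle> ds\<close>.\<close>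

definition vector_functional :: "(nat \<Rightarrow> 'h::complex_hilbert) \<Rightarrow> 'h operator \<Rightarrow> ennreal"
  where "vector_functional \<xi> a = (\<Sum>n. ennreal (Re (cinner (\<xi> n) (a (\<xi> n)))))"

definition dual_weight ::
    "'h::complex_hilbert operator set \<Rightarrow> ('h operator \<Rightarrow> ennreal) \<Rightarrow>
     (real \<Rightarrow> 'h operator \<Rightarrow> 'h operator) \<Rightarrow> 'h L2 operator \<Rightarrow> ennreal"
  where "dual_weight M \<nu> \<sigma> a =
    (SUP \<xi>\<in>{\<xi>. summable (\<lambda>n. (norm (\<xi> n))\<^sup>2) \<and>
               (\<forall>x\<in>pos_part M. vector_functional \<xi> (crossed_embed \<sigma> x) \<le> \<nu> x)}.
      \<integral>\<^sup>+ s. vector_functional \<xi> (dual_action s a) \<partial>lborel)"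

text \<open>\<open>h = d\<rho>/d\<tau>\<close> in the sense of Pedersen and Takesaki:
  \<open>\<rho>(a) = lim\<^sub>\<epsilon>\<^sub>\<rightarrow>\<^sub>0 \<tau>(h\<^sub>\<epsilon>\<^sup>1\<^sup>/\<^sup>2 a h\<^sub>\<epsilon>\<^sup>1\<^sup>/\<^sup>2)\<close> with \<open>h\<^sub>\<epsilon> = h (1 + \<epsilon>h)\<^sup>-\<^sup>1\<close>, an increasing limit.\<close>

definition is_density ::
    "'h::complex_hilbert operator set \<Rightarrow> ('h operator \<Rightarrow> ennreal) \<Rightarrow> ('h operator \<Rightarrow> ennreal) \<Rightarrow>
     'h graph \<Rightarrow> bool"
  where "is_density A \<tau> \<rho> h \<longleftrightarrow> positive_selfadjoint h \<and> affiliated A h \<and>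
    (\<forall>a\<in>pos_part A. \<rho> a = (SUP \<epsilon>\<in>{0<..}.
      let k = graph_op (borel_calculus (\<lambda>u. of_real (sqrt (u / (1 + \<epsilon> * u)))) h)
      in \<tau> (k \<circ> a \<circ> k)))"

text \<open>The canonical trace \<open>\<tau>\<close> of the crossed product together with the density \<open>h\<close> of the dual
  weight. Scaling under the dual action determines \<open>\<tau>\<close> only up to a dual-invariant central density;
  the normalization \<open>h\<^sup>i\<^sup>t = \<lambda>(t)\<close> singles out the canonical trace.\<close>

definition canonical_trace ::
    "'h::complex_hilbert operator set \<Rightarrow> ('h operator \<Rightarrow> ennreal) \<Rightarrow>
     (real \<Rightarrow> 'h operator \<Rightarrow> 'h operator) \<Rightarrow> ('h L2 operator \<Rightarrow> ennreal) \<Rightarrow> 'h L2 graph \<Rightarrow> bool"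
  where "canonical_trace M \<nu> \<sigma> \<tau> h \<longleftrightarrow>
    fns_weight (crossed_product M \<sigma>) \<tau> \<and>
    (\<forall>a\<in>crossed_product M \<sigma>. \<tau> (adj a \<circ> a) = \<tau> (a \<circ> adj a)) \<and>
    (\<forall>s. \<forall>a\<in>pos_part (crossed_product M \<sigma>). \<tau> (dual_action s a) = ennreal (exp (- s)) * \<tau> a) \<and>
    is_density (crossed_product M \<sigma>) \<tau> (dual_weight M \<nu> \<sigma>) h \<and>
    (\<forall>t. borel_calculus (\<lambda>u. if 0 < u then cis (t * ln u) else 0) h = op_graph (shift_op t))"


section \<open>Orlicz functions and upper Boyd indices\<close>

text \<open>Only the values on \<open>[0, \<infinity>)\<close> are relevant.\<close>

definition orlicz_function :: "(real \<Rightarrow> ereal) \<Rightarrow> bool"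
  where "orlicz_function \<psi> \<longleftrightarrow>
    (\<forall>u\<ge>0. 0 \<le> \<psi> u) \<and>
    (\<forall>u\<ge>0. \<forall>v\<ge>0. \<forall>t\<in>{0..1}. \<psi> ((1 - t) * u + t * v) \<le> ereal (1 - t) * \<psi> u + ereal t * \<psi> v) \<and>
    \<psi> 0 = 0 \<and> (\<psi> \<longlongrightarrow> \<infinity>) at_top \<and>
    (\<exists>u>0. \<psi> u \<noteq> 0) \<and> (\<exists>u>0. \<psi> u \<noteq> \<infinity>) \<and>
    (\<forall>b. ereal b = (SUP u\<in>{u. 0 < u \<and> \<psi> u < \<infinity>}. ereal u) \<longrightarrow> (\<psi> \<longlongrightarrow> \<psi> b) (at_left b))"

definition orlicz_conj :: "(real \<Rightarrow> ereal) \<Rightarrow> real \<Rightarrow> ereal"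
  where "orlicz_conj \<psi> u = (SUP v\<in>{0<..}. ereal (u * v) - \<psi> v)"

definition orlicz_inv :: "(real \<Rightarrow> ereal) \<Rightarrow> real \<Rightarrow> real"
  where "orlicz_inv \<psi> t = Sup {s. 0 \<le> s \<and> \<psi> s \<le> ereal t}"

definition fund_luxemburg :: "(real \<Rightarrow> ereal) \<Rightarrow> real \<Rightarrow> real"
  where "fund_luxemburg \<psi> t = 1 / orlicz_inv \<psi> (1 / t)"

definition fund_orlicz :: "(real \<Rightarrow> ereal) \<Rightarrow> real \<Rightarrow> real"
  where "fund_orlicz \<psi> t = t / fund_luxemburg (orlicz_conj \<psi>) t"

definition half_line :: "real measure"
  where "half_line = restrict_space lborel {0<..}"

definition luxemburg_norm :: "(real \<Rightarrow> ereal) \<Rightarrow> (real \<Rightarrow> complex) \<Rightarrow> ennreal"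
  where "luxemburg_norm \<psi> f =
    Inf {ennreal l | l. 0 < l \<and> (\<integral>\<^sup>+ t. e2ennreal (\<psi> (cmod (f t) / l)) \<partial>half_line) \<le> 1}"

definition orlicz_norm :: "(real \<Rightarrow> ereal) \<Rightarrow> (real \<Rightarrow> complex) \<Rightarrow> ennreal"
  where "orlicz_norm \<psi> f =
    (SUP g\<in>{g \<in> borel_measurable half_line. luxemburg_norm (orlicz_conj \<psi>) g \<le> 1}.
      \<integral>\<^sup>+ t. ennreal (cmod (f t * g t)) \<partial>half_line)"

definition dilation :: "real \<Rightarrow> (real \<Rightarrow> complex) \<Rightarrow> real \<Rightarrow> complex"
  where "dilation s f t = f (s * t)"

text \<open>\<open>N\<close> is an extended norm on measurable functions on \<open>(0, \<infinity>)\<close>, the space being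
  \<open>{f. N f < \<infinity>}\<close>.\<close>

definition dilation_norm :: "((real \<Rightarrow> complex) \<Rightarrow> ennreal) \<Rightarrow> real \<Rightarrow> ennreal"
  where "dilation_norm N s = (SUP f\<in>{f \<in> borel_measurable half_line. N f \<le> 1}. N (dilation (1 / s) f))"

definition upper_boyd_index :: "((real \<Rightarrow> complex) \<Rightarrow> ennreal) \<Rightarrow> real"
  where "upper_boyd_index N = (INF s\<in>{1<..}. ln (enn2real (dilation_norm N s)) / ln s)"


section \<open>Orlicz spaces of a von Neumann algebra\<close>

definition haagerup_L1 ::
    "'h::complex_hilbert operator set \<Rightarrow> (real \<Rightarrow> 'h operator \<Rightarrow> 'h operator) \<Rightarrow>
     ('h L2 operator \<Rightarrow> ennreal) \<Rightarrow> 'h L2 graph set"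
  where "haagerup_L1 M \<sigma> \<tau> = {x \<in> measurable_operators (crossed_product M \<sigma>) \<tau>.
    \<forall>s. dual_action_graph s x = strong_scale (of_real (exp (- s))) x}"

definition sqrt_calculus :: "(real \<Rightarrow> real) \<Rightarrow> 'h::complex_hilbert graph \<Rightarrow> 'h graph"
  where "sqrt_calculus \<phi> h = borel_calculus (\<lambda>u. if 0 < u then of_real (sqrt (\<phi> u)) else 0) h"

text \<open>The space \<open>{a. [e \<phi>(h)\<^sup>1\<^sup>/\<^sup>2] a [\<phi>(h)\<^sup>1\<^sup>/\<^sup>2 f] \<in> L\<^sup>1(M) for all projections e, f}\<close>, for a function
  \<open>\<phi>\<close> on \<open>(0, \<infinity>)\<close>; \<open>h\<close> has trivial kernel, so the value at \<open>0\<close> is immaterial.\<close>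

definition crossed_space ::
    "(real \<Rightarrow> real) \<Rightarrow> 'h::complex_hilbert operator set \<Rightarrow> ('h operator \<Rightarrow> ennreal) \<Rightarrow>
     (real \<Rightarrow> 'h operator \<Rightarrow> 'h operator) \<Rightarrow> ('h L2 operator \<Rightarrow> ennreal) \<Rightarrow> 'h L2 graph \<Rightarrow> 'h L2 graph set"
  where "crossed_space \<phi> M \<nu> \<sigma> \<tau> h = {a \<in> measurable_operators (crossed_product M \<sigma>) \<tau>.
    \<forall>e f. is_projection e \<and> e \<in> n_ideal M \<nu> \<and> is_projection f \<and> f \<in> n_ideal M \<nu> \<longrightarrow>
      strong_prod
        (strong_prod (strong_prod (op_graph (crossed_embed \<sigma> e)) (sqrt_calculus \<phi> h)) a)
        (strong_prod (sqrt_calculus \<phi> h) (op_graph (crossed_embed \<sigma> f)))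
      \<in> haagerup_L1 M \<sigma> \<tau>}"

definition luxemburg_space ::
    "(real \<Rightarrow> ereal) \<Rightarrow> 'h::complex_hilbert operator set \<Rightarrow> ('h operator \<Rightarrow> ennreal) \<Rightarrow>
     (real \<Rightarrow> 'h operator \<Rightarrow> 'h operator) \<Rightarrow> ('h L2 operator \<Rightarrow> ennreal) \<Rightarrow> 'h L2 graph \<Rightarrow> 'h L2 graph set"
  where "luxemburg_space \<psi> = crossed_space (fund_orlicz (orlicz_conj \<psi>))"

definition orlicz_space ::
    "(real \<Rightarrow> ereal) \<Rightarrow> 'h::complex_hilbert operator set \<Rightarrow> ('h operator \<Rightarrow> ennreal) \<Rightarrow>
     (real \<Rightarrow> 'h operator \<Rightarrow> 'h operator) \<Rightarrow> ('h L2 operator \<Rightarrow> ennreal) \<Rightarrow> 'h L2 graph \<Rightarrow> 'h L2 graph set"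
  where "orlicz_space \<psi> = crossed_space (fund_luxemburg (orlicz_conj \<psi>))"

end

theory Submission
  imports Defs "HOL-Probability.Levy"
begin

text \<open>Let \<open>w\<close> be the fundamental function whose square root at \<open>h\<close> enters the definition of the space \<open>L\<close>, and
  let \<open>V(r, d)\<close> be the basic neighbourhoods of zero in measure. For \<open>a\<close> in \<open>L\<close> the operator
  \<open>w(h)\<^sup>1\<^sup>/\<^sup>2 a w(h)\<^sup>1\<^sup>/\<^sup>2\<close> scales like \<open>h\<close>, so \<open>\<theta>\<^sub>s(a) = D a D\<close> with \<open>D\<^sup>2 = w(h) / (e\<^sup>s w(e\<^sup>-\<^sup>s h))\<close>. A Boyd index
  below 1 gives \<open>q\<close> and \<open>\<kappa> > 1\<close> with \<open>w(q t) \<ge> \<kappa> w(t)\<close>, whence \<open>L \<inter> V(r, d) \<subseteq> V(Q r, d / q)\<close> for some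
  \<open>1 < Q < q\<close>. So each \<open>a\<close> in \<open>L \<inter> V(1, 1)\<close> is bounded by \<open>Q\<^sup>m\<^sup>i\<^sup>n\<^sup>(\<^sup>k\<^sup>,\<^sup>l\<^sup>)\<close> between the \<open>k\<close>-th and \<open>l\<close>-th layers of
  two chains of projections with cotraces \<open>q\<^sup>-\<^sup>l\<close>. Weighting the layers by \<open>Q\<^sup>l\<close> gives positive operators of
  bounded trace, as \<open>Q < q\<close>. For a convex combination one averages these operators and
  cuts at a spectral subspace, on which a Schur test bounds the combination. Thus the convex hull of
  \<open>L \<inter> V(1, 1)\<close> is bounded, and its Minkowski functional is a norm inducing the topology.\<close>

text \<open>In measure, the summands of a combination are bounded on unrelated projections, and the
  codimension of the intersection of these grows with their number. Traces of positive operators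
  average well, which is why the chains become operators before anything is cut. Two strict
  inequalities are spent: \<open>Q < q\<close> makes the traces of the weighted layers summable,
  \<open>Q > 1\<close> makes the Schur kernel summable off the diagonal; the latter is free, as a
  bound may be weakened.

  The index enters through characteristic functions of intervals. Up to a factor \<open>t\<close>,
  \<open>w\<close> is the reciprocal of the fundamental function of the space, so a dilation norm
  \<open>H < s\<close> at \<open>s\<close> gives \<open>w(s t) >= (s / H) w(t)\<close>.

  The longest preliminary is that \<open>w(h)\<^sup>1\<^sup>/\<^sup>2 \<pi>(f)\<close> is measurable
  for \<open>f\<close> of finite weight. It rests on \<open>h\<close> being the density of the dual
  weight: bounded truncations \<open>k\<close> of \<open>h\<^sup>1\<^sup>/\<^sup>2\<close> satisfy
  \<open>\<tau>(k a k) <=\<close> dual weight of \<open>a\<close>, and the dual weight of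
  \<open>\<pi>(f) a \<pi>(f)\<close> is controlled by \<open>\<nu>(f)\<close> once the orbit of
  \<open>a\<close> under the dual action has a bounded integral.\<close>

notation scaleC (infixr "*c" 75) and scaleR (infixr "*r" 75) and orthogonal_comp ("_\<bottom>" [1000] 1000)

abbreviation (input) seq_limit (infixr "---->" 60) where "X ----> L == X \<longlonglongrightarrow> L"

abbreviation (input) iff_ascii (infixr "<->" 25) where "A <-> B == A \<longleftrightarrow> B"

abbreviation (input) "nni == nn_integral"

abbreviation (input) "adjg == adj_graph"

abbreviation (input) "dag == dual_action_graph"

abbreviation (input) "smeas == scalar_measure"

abbreviation (input) "gop == graph_op"

abbreviation (input) "sft == shift_op"

abbreviation (input) "ind == indicator"

abbreviation (input) "BM == borel_measurable borel"

abbreviation (input) "bop == bounded_operator"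

abbreviation (input) "posop == positive_operator"

abbreviation (input) "sdom == spectral_domain"

abbreviation (input) "si == spectral_integral"

abbreviation (input) "ph == phase_op"

lemmas inner_sums = inner_add_left inner_add_right inner_diff_left inner_diff_right

lemmas norm_sq = power2_norm_eq_inner

section \<open>Orthogonal projections\<close>

lemma perp_iff: "x : K\<bottom> <-> (ALL y : K. inner x y = 0)" by (auto simp: orthogonal_comp_def orthogonal_def inner_commute)

lemma closed_perp: "closed (K\<bottom> :: 'a::real_inner set)"
proof -
 have "K\<bottom> = (INT y : K. {x. inner x y = 0})" by (auto simp: perp_iff)
 thus ?thesis by (auto intro!: closed_INT closed_Collect_eq continuous_intros)
qed

lemma closure_subspace:
 fixes S :: "'a::real_normed_vector set" assumes "subspace S" shows "subspace (closure S)" unfolding subspace_def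
proof (intro conjI ballI allI)
 show "0 : closure S" using subspace_0[OF assms] closure_subset by blast
 fix x y c assume x: "x : closure S"
 obtain X where X: "!!n. X n : S" "X ----> x" using x unfolding closure_sequential by auto
 show "c *r x : closure S" unfolding closure_sequential
  using X subspace_scale[OF assms] by (intro exI[of _ "%n. c *r X n"]) (auto intro: tendsto_intros)
 assume y: "y : closure S"
 obtain Y where Y: "!!n. Y n : S" "Y ----> y" using y unfolding closure_sequential by auto
 show "x + y : closure S" unfolding closure_sequential
  using X Y subspace_add[OF assms] by (intro exI[of _ "%n. X n + Y n"]) (auto intro: tendsto_intros)
qed

text \<open>The parallelogram law makes a minimizing sequence for the distance Cauchy; at the
  minimizer the difference is orthogonal to \<open>K\<close>, since otherwise a move along some
  \<open>z\<close> in \<open>K\<close> would shorten it.\<close>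

lemma orthogonal_projection_exists:
 fixes K :: "'a::{real_inner,complete_space} set" assumes "closed K" "subspace K"
 shows "EX y : K. x - y : K\<bottom>"
proof -
 define d where "d = Inf ((%y. (norm (x - y))^2) ` K)"
 have bdd: "bdd_below ((%y. (norm (x - y))^2) ` K)" by (rule bdd_belowI[of _ 0]) auto
 have ne: "(%y. (norm (x - y))^2) ` K ~= {}" using subspace_0[OF assms(2)] by auto
 have dle: "d <= (norm (x - y))^2" if "y : K" for y unfolding d_def using that bdd by (intro cInf_lower) auto
 have "EX y : K. (norm (x - y))^2 < d + 1 / real (Suc n)" for n
  using cInf_lessD[OF ne, of "d + 1 / real (Suc n)"] by (auto simp: d_def)
 then obtain Y where Y: "!!n. Y n : K" "!!n. (norm (x - Y n))^2 < d + 1 / real (Suc n)" by metis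
 have par: "(norm (Y m - Y n))^2 <= 2 / real (Suc m) + 2 / real (Suc n)" for m n
 proof -
  have "(1/2) *r (Y m + Y n) : K" using assms(2) Y(1) by (simp add: subspace_add subspace_scale)
  hence "d <= (norm (x - (1/2) *r (Y m + Y n)))^2" by (rule dle)
  moreover have "(norm (Y m - Y n))^2 + 4 * (norm (x - (1/2) *r (Y m + Y n)))^2
    = 2 * (norm (x - Y m))^2 + 2 * (norm (x - Y n))^2" by (simp add: norm_sq inner_sums inner_commute algebra_simps)
  ultimately show ?thesis using Y(2)[of m] Y(2)[of n] by simp
 qed
 have "Cauchy Y"
 proof (rule metric_CauchyI)
  fix e :: real assume "0 < e"
  then obtain N where N: "1 / real (Suc N) < e^2 / 4"
   by (metis nat_approx_posE zero_less_divide_iff zero_less_numeral zero_less_power)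
  show "EX M. ALL m>=M. ALL n>=M. dist (Y m) (Y n) < e"
  proof (intro exI[of _ N] allI impI)
   fix m n assume "m >= N" "n >= N"
   hence "1 / real (Suc m) <= 1 / real (Suc N)" "1 / real (Suc n) <= 1 / real (Suc N)" by (auto simp: frac_le)
   hence "(norm (Y m - Y n))^2 < e^2" using par[of m n] N by simp
   thus "dist (Y m) (Y n) < e" using `0 < e` by (simp add: dist_norm power2_less_imp_less)
  qed
 qed
 then obtain y where lim: "Y ----> y" by (auto simp: Cauchy_convergent_iff convergent_def)
 have yK: "y : K" using assms(1) Y(1) lim by (rule closed_sequentially)
 have "(%n. (norm (x - Y n))^2) ----> (norm (x - y))^2" by (intro tendsto_intros lim)
 moreover have "(%n. d + 1 / real (Suc n)) ----> d + 0" by (intro tendsto_intros LIMSEQ_Suc lim_1_over_n)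
 ultimately have yd: "(norm (x - y))^2 <= d"
  using Y(2) by (intro LIMSEQ_le[of "%n. (norm (x - Y n))^2" _ "%n. d + 1 / real (Suc n)"]) (auto intro: less_imp_le)
 have "inner (x - y) z = 0" if z: "z : K" for z
 proof (rule ccontr)
  assume nz: "inner (x - y) z ~= 0"
  \<comment> \<open>The minimizer of the quadratic polynomial
    \<open>c -> (norm (x - y - c z))^2\<close>.\<close>
  define c where "c = inner (x - y) z / inner z z"
  have zz: "inner z z > 0" using nz by (metis inner_gt_zero_iff inner_zero_right)
  have "y + c *r z : K" using assms(2) yK z by (simp add: subspace_add subspace_scale)
  hence "d <= (norm (x - (y + c *r z)))^2" by (rule dle)
  also have "... = (norm ((x - y) - c *r z))^2" by (simp add: algebra_simps)
  also have "... = (norm (x - y))^2 - 2 * c * inner (x - y) z + c * c * inner z z" unfolding norm_sq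
   by (simp add: inner_sums inner_commute algebra_simps)
  also have "... = (norm (x - y))^2 - (inner (x - y) z)^2 / inner z z" using zz by (simp add: c_def field_simps power2_eq_square)
  also have "... < (norm (x - y))^2" using nz zz by simp
  finally show False using yd by simp
 qed
 thus ?thesis using yK by (auto simp: perp_iff)
qed

text \<open>Projections are addressed by their ranges throughout, because intersections, preimages
  and increasing chains are easier to form for subspaces than for projections.\<close>

definition oproj :: "'a::real_inner set => 'a => 'a" where "oproj K x = (THE y. y : K & x - y : K\<bottom>)"

lemma oproj_eqI:
 fixes K :: "'a::real_inner set" assumes "subspace K" "y : K" "x - y : K\<bottom>"
 shows "oproj K x = y" unfolding oproj_def
proof (rule the_equality)
 fix z assume z: "z : K & x - z : K\<bottom>"
 have "z - y : K" using assms z by (simp add: subspace_diff)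
 moreover have "(x - y) - (x - z) : K\<bottom>" by (rule subspace_diff[OF subspace_orthogonal_comp]) (use assms z in auto)
 ultimately have "inner (z - y) (z - y) = 0" by (simp add: perp_iff)
 thus "z = y" by simp
qed (use assms in auto)

context
 fixes K :: "'a::{real_inner,complete_space} set" assumes K: "closed K" "subspace K"
begin

lemma oproj_mem: "oproj K x : K" and oproj_diff: "x - oproj K x : K\<bottom>"
 using orthogonal_projection_exists[OF K, of x] oproj_eqI[OF K(2)] by metis+

lemma oproj_id: "x : K ==> oproj K x = x" by (rule oproj_eqI[OF K(2)]) (auto simp: perp_iff)

lemma oproj_zero: "x : K\<bottom> ==> oproj K x = 0" by (rule oproj_eqI[OF K(2)]) (auto simp: subspace_0[OF K(2)])

lemma oproj_eq_iff: "oproj K x = x <-> x : K" using oproj_id oproj_mem by metis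

lemma range_oproj: "range (oproj K) = K" using oproj_mem oproj_id by (metis subsetI image_subset_iff rangeI subset_antisym)

lemma inner_oproj: "inner (oproj K x) y = inner (oproj K x) (oproj K y)"
proof -
 have "inner (y - oproj K y) (oproj K x) = 0" using oproj_diff[of y] oproj_mem[of x] by (simp add: perp_iff)
 thus ?thesis by (simp add: inner_diff_right inner_commute[of _ "oproj K x"])
qed

lemma oproj_sym: "inner (oproj K x) y = inner x (oproj K y)"
 using inner_oproj[of x y] inner_oproj[of y x] by (simp add: inner_commute)

lemma inner_oproj_self: "inner (oproj K x) x = (norm (oproj K x))^2" using inner_oproj[of x x] by (simp add: norm_sq)

lemma norm_oproj_pyth: "(norm x)^2 = (norm (oproj K x))^2 + (norm (x - oproj K x))^2" using inner_oproj_self[of x]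
 by (simp add: norm_sq inner_sums inner_commute)

lemma norm_oproj_le: "norm (oproj K x) <= norm x" by (rule power2_le_imp_le) (use norm_oproj_pyth[of x] in auto)

lemma bounded_linear_oproj: "bounded_linear (oproj K)"
proof
 fix x y and r :: real
 show "oproj K (x + y) = oproj K x + oproj K y"
 proof (rule oproj_eqI[OF K(2)])
  show "oproj K x + oproj K y : K" by (intro subspace_add K oproj_mem)
  have "(x - oproj K x) + (y - oproj K y) : K\<bottom>" by (intro subspace_add oproj_diff subspace_orthogonal_comp)
  thus "x + y - (oproj K x + oproj K y) : K\<bottom>" by (simp add: algebra_simps)
 qed
 show "oproj K (r *r x) = r *r oproj K x"
 proof (rule oproj_eqI[OF K(2)])
  show "r *r oproj K x : K" by (intro subspace_scale K oproj_mem)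
  have "r *r (x - oproj K x) : K\<bottom>" by (intro subspace_scale oproj_diff subspace_orthogonal_comp)
  thus "r *r x - r *r oproj K x : K\<bottom>" by (simp add: algebra_simps)
 qed
 show "EX B. ALL x. norm (oproj K x) <= norm x * B" by (rule exI[of _ 1]) (simp add: norm_oproj_le)
qed

lemma perp_comp: "K\<bottom>\<bottom> = K"
proof (intro equalityI subsetI)
 fix x assume x: "x : K\<bottom>\<bottom>"
 have "x - oproj K x : K\<bottom>\<bottom>" by (rule subspace_diff[OF subspace_orthogonal_comp x])
   (use oproj_mem[of x] orthogonal_comp_subset[of K] in auto)
 hence "inner (x - oproj K x) (x - oproj K x) = 0" using oproj_diff[of x] by (simp add: perp_iff)
 thus "x : K" using oproj_mem[of x] by simp
qed (use orthogonal_comp_subset in auto)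

lemma oproj_comp: "oproj (K\<bottom>) x = x - oproj K x" by (rule oproj_eqI[OF subspace_orthogonal_comp oproj_diff])
  (use oproj_mem perp_comp in auto)


text \<open>\<open>y\<close> stands for the adjoint of \<open>x\<close>. Taking it as a parameter
  and asking only for real linearity covers multiplication by \<open>\<i>\<close> and pairs of
  operators on the product space, where no complex structure is available.\<close>

lemma oproj_commute: assumes x: "linear x" "!!u v. inner (x u) v = inner u (y v)" "x ` K <= K" "y ` K <= K"
 shows "oproj K (x u) = x (oproj K u)"
proof (rule oproj_eqI[OF K(2)])
 show "x (oproj K u) : K" using x(3) oproj_mem by auto
 have "inner (x (u - oproj K u)) z = 0" if "z : K" for z
  using x(2)[of "u - oproj K u" z] x(4) that oproj_diff[of u] by (auto simp: perp_iff)
 thus "x u - x (oproj K u) : K\<bottom>" by (auto simp: perp_iff linear_diff[OF x(1)])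
qed

end

lemma perp_closure: "(closure S)\<bottom> = (S\<bottom> :: 'a::real_inner set)"
proof (intro equalityI subsetI)
 fix x assume x: "x : S\<bottom>"
 have "S <= {y. inner x y = 0}" using x by (auto simp: perp_iff)
 moreover have "closed {y. inner x y = 0}" by (intro closed_Collect_eq continuous_intros)
 ultimately have "closure S <= {y. inner x y = 0}" by (rule closure_minimal)
 thus "x : (closure S)\<bottom>" by (auto simp: perp_iff)
next
 fix x assume "x : (closure S)\<bottom>"
 thus "x : S\<bottom>" using orthogonal_comp_anti_mono[OF closure_subset[of S]] by blast
qed

lemma perp_comp_closure:
 fixes S :: "'a::{real_inner,complete_space} set" assumes "subspace S" shows "S\<bottom>\<bottom> = closure S"
 using perp_comp[OF closed_closure closure_subspace[OF assms]] by (simp add: perp_closure)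

lemma dense_if_perp:
 fixes S :: "'a::{real_inner,complete_space} set" assumes "subspace S" "!!x. x : S\<bottom> ==> x = 0"
 shows "closure S = UNIV" using perp_comp_closure[OF assms(1)] assms(2) subspace_0[OF subspace_orthogonal_comp[of S]]
  orthogonal_comp_null by (metis singletonI subsetI subset_antisym empty_subsetI insert_subset singletonD)

section \<open>Riesz representation, adjoints and the closed graph theorem\<close>

lemma riesz_representation:
 fixes f :: "'a::{real_inner,complete_space} => real" assumes "bounded_linear f"
 shows "EX y. ALL x. f x = inner x y"
proof (cases "ALL x. f x = 0")
 case True thus ?thesis by (intro exI[of _ 0]) auto
next
 case False
 interpret f: bounded_linear f by fact
 define K where "K = {x. f x = 0}"
 have K: "closed K" "subspace K" unfolding K_def subspace_def
  by (auto intro!: closed_Collect_eq continuous_intros f.continuous_on simp: f.add f.scaleR f.zero)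
 obtain x0 where x0: "f x0 ~= 0" using False by auto
 define z where "z = x0 - oproj K x0"
 have fz: "f z ~= 0" using x0 oproj_mem[OF K, of x0] by (simp add: z_def f.diff K_def)
 hence zz: "inner z z ~= 0" by (auto simp: f.zero)
 have "f x = inner x ((f z / inner z z) *r z)" for x
 proof -
  have "x - (f x / f z) *r z : K" using fz by (simp add: K_def f.diff f.scaleR)
  hence "inner z (x - (f x / f z) *r z) = 0" using oproj_diff[OF K, of x0] by (simp add: perp_iff z_def)
  thus ?thesis using fz zz by (simp add: inner_diff_right inner_commute field_simps)
 qed
 thus ?thesis by blast
qed

lemma real_adjoint_exists:
 fixes T :: "'a::{real_inner,complete_space} => 'b::real_inner" assumes "bounded_linear T"
 shows "EX S. bounded_linear S & (ALL u v. inner (T u) v = inner u (S v))"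
proof -
 interpret T: bounded_linear T by fact
 have "EX y. ALL x. inner (T x) v = inner x y" for v by (rule riesz_representation)
   (rule bounded_linear_compose[OF bounded_linear_inner_left T.bounded_linear_axioms])
 then obtain S where S: "!!u v. inner (T u) v = inner u (S v)" by metis
 obtain B where B: "B > 0" "!!x. norm (T x) <= norm x * B" using T.pos_bounded by auto
 have "bounded_linear S"
 proof
  show "S (x + y) = S x + S y" for x y by (rule vector_eq_ldot[THEN iffD1]) (auto simp: inner_add_right S[symmetric])
  show "S (r *r x) = r *r S x" for r x by (rule vector_eq_ldot[THEN iffD1]) (auto simp: S[symmetric])
  have "norm (S v) <= norm v * B" for v
  proof (cases "S v = 0")
   case False
   have "norm (S v) * norm (S v) = inner (T (S v)) v" by (simp add: S norm_sq[symmetric] power2_eq_square)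
   also have "... <= norm (T (S v)) * norm v" by (rule norm_cauchy_schwarz)
   also have "... <= norm (S v) * B * norm v" by (intro mult_right_mono B) auto
   finally show ?thesis using False by (simp add: mult.commute mult.left_commute)
  qed (use B in auto)
  thus "EX K. ALL x. norm (S x) <= norm x * K" by blast
 qed
 thus ?thesis using S by blast
qed

text \<open>Closedness of the graph makes the domain \<open>D\<close> of the adjoint dense. Hence
  the sets \<open>F n\<close>, closed because only vectors of \<open>D\<close> are tested, bound the
  norm of \<open>S x\<close>, and by Baire's theorem one of them contains a ball.\<close>

lemma closed_graph_bounded_linear:
 fixes S :: "'a::{real_inner,complete_space} => 'b::{real_inner,complete_space}"
 assumes lin: "linear S" and cl: "closed {(x, S x) | x. True}"
 shows "bounded_linear S"
proof -
 define G where "G = {(x, S x) | x. True}"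
 have G: "closed G" "subspace G" using cl unfolding G_def subspace_def
  by (auto simp: linear_add[OF lin] linear_scale[OF lin] linear_0[OF lin] zero_prod_def)
 define D where "D = {v. EX z. ALL u. inner (S u) v = inner u z}"
 have D: "subspace D" unfolding D_def subspace_def
  by (auto simp: inner_add_right inner_scaleR_right) (metis inner_zero_right inner_add_right inner_scaleR_right)+
 have dense: "closure D = UNIV"
 proof (rule dense_if_perp[OF D])
  fix y assume y: "y : D\<bottom>"
  \<comment> \<open>Projecting \<open>(0, y)\<close> to the graph gives \<open>y - S u\<close> in
    \<open>D\<close>. As \<open>y\<close> is orthogonal to \<open>D\<close>, the squares of the
    norms of \<open>y - S u\<close> and \<open>u\<close> add up to 0.\<close>
  obtain u where u: "oproj G (0, y) = (u, S u)" using oproj_mem[OF G, of "(0,y)"] by (auto simp: G_def)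
  have o: "inner (S x) (y - S u) = inner x u" for x using oproj_diff[OF G, of "(0,y)"] unfolding u perp_iff
   by (auto simp: G_def inner_commute)
  hence "y - S u : D" by (auto simp: D_def)
  hence "inner y (y - S u) = 0" using y by (auto simp: perp_iff)
  with o[of u] have "inner (y - S u) (y - S u) + inner u u = 0" by (simp add: inner_diff_left)
  hence "inner (y - S u) (y - S u) = 0" "inner u u = 0" by (metis add_nonneg_eq_0_iff inner_ge_zero)+
  thus "y = 0" by (simp add: linear_0[OF lin])
 qed
 define F where "F n = {x. ALL v : D. inner (S x) v <= real n * norm v}" for n
 have Fc: "closed (F n)" for n
 proof -
  have "closed {x. inner (S x) v <= real n * norm v}" if v: "v : D" for v
  proof -
   obtain z where z: "!!u. inner (S u) v = inner u z" using v unfolding D_def by auto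
   show ?thesis unfolding z by (intro closed_Collect_le continuous_intros)
  qed
  moreover have "F n = (INT v : D. {x. inner (S x) v <= real n * norm v})" by (auto simp: F_def)
  ultimately show ?thesis by auto
 qed
 have Fn: "norm (S x) <= real n" if "x : F n" for x n
 proof -
  have "closed {v. inner (S x) v <= real n * norm v}" by (intro closed_Collect_le continuous_intros)
  moreover have "D <= {v. inner (S x) v <= real n * norm v}" using that by (auto simp: F_def)
  ultimately have "UNIV <= {v. inner (S x) v <= real n * norm v}" using closure_minimal dense by metis
  hence "inner (S x) (S x) <= real n * norm (S x)" by auto
  thus ?thesis by (cases "S x = 0") (auto simp: norm_sq[symmetric] power2_eq_square)
 qed
 have UF: "(UN n. F n) = UNIV"
 proof (intro equalityI subsetI UN_I)
  fix x
  have "inner (S x) v <= real (nat \<lceil>norm (S x)\<rceil>) * norm v" for v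
   by (rule order_trans[OF norm_cauchy_schwarz]) (intro mult_right_mono real_nat_ceiling_ge norm_ge_zero)
  thus "x : F (nat \<lceil>norm (S x)\<rceil>)" by (auto simp: F_def)
 qed auto
 have "EX n. interior (F n) ~= {}"
 proof (rule ccontr)
  assume "~ ?thesis"
  hence "Met_TC.mtopology interior_of Union (range F) = {}"
   by (intro Met_TC.metric_Baire_category_alt) (auto simp: Fc complete_UNIV)
  thus False using UF by simp
 qed
 then obtain n x0 r where r: "r > 0" "ball x0 r <= F n" by (metis equals0I mem_interior)
 have nS: "norm (S x) <= 2 * real n" if "norm x < r" for x
 proof -
  have "norm (S (x0 + x)) <= real n" "norm (S x0) <= real n" using r that by (auto intro!: Fn simp: subset_iff dist_norm)
  moreover have "S x = S (x0 + x) - S x0" by (simp add: linear_add[OF lin])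
  ultimately show ?thesis using norm_triangle_ineq4[of "S (x0 + x)" "S x0"] by simp
 qed
 show ?thesis
 proof (rule bounded_linear_intro)
  show "S (x + y) = S x + S y" for x y by (rule linear_add[OF lin])
  show "S (c *r x) = c *r S x" for c x by (rule linear_scale[OF lin])
  show "norm (S x) <= norm x * (4 * real n / r)" for x
  proof (cases "x = 0")
   case False
   define c where "c = r / (2 * norm x)"
   have c: "c > 0" using False r by (simp add: c_def)
   have "norm (S (c *r x)) <= 2 * real n" using False r by (intro nS) (simp add: c_def)
   hence "c * norm (S x) <= 2 * real n" using c by (simp add: linear_scale[OF lin])
   thus ?thesis using False r by (simp add: c_def field_simps)
  qed (simp add: linear_0[OF lin])
 qed
qed

section \<open>Bounded operators on complex Hilbert spaces\<close>

lemma scaleC_one [simp]: "1 *c (x::'a::complex_hilbert) = x" using scaleC_of_real[of 1 x] by simp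

lemma scaleC_zero_right [simp]: "c *c (0::'a::complex_hilbert) = 0" using scaleC_add_right[of c 0 "0::'a"] by simp

lemma scaleC_zero_left [simp]: "0 *c (x::'a::complex_hilbert) = 0" using scaleC_of_real[of 0 x] by simp

lemma scaleC_minus1 [simp]: "(-1) *c (x::'a::complex_hilbert) = - x" using scaleC_of_real[of "-1" x] by simp

lemma scaleC_minus_right [simp]: "c *c (- x::'a::complex_hilbert) = - (c *c x)"
 using scaleC_add_right[of c x "-x"] by (simp add: eq_neg_iff_add_eq_0 add.commute)

lemma scaleC_diff_right: "c *c (x - y::'a::complex_hilbert) = c *c x - c *c y" using scaleC_add_right[of c x "-y"] by simp

lemma scaleC_i_i [simp]: "\<i> *c \<i> *c (x::'a::complex_hilbert) = - x" by (simp add: scaleC_scaleC)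

lemma scaleC_scaleR: "c *c r *r (x::'a::complex_hilbert) = r *r c *c x"
 by (simp add: scaleC_of_real[symmetric] scaleC_scaleC mult.commute)

lemma inner_i_left: "inner (\<i> *c x) (y::'a::complex_hilbert) = - inner x (\<i> *c y)"
 using inner_scaleC_i[of x "\<i> *c y"] by simp

lemma inner_scaleC_left: "inner (c *c x) (y::'a::complex_hilbert) = inner x (cnj c *c y)"
 unfolding scaleC_conv[of c] scaleC_conv[of "cnj c"] by (simp add: inner_sums inner_i_left inner_diff_right)

lemma bounded_linear_scaleC: "bounded_linear (%x::'a::complex_hilbert. c *c x)"
 by (rule bounded_linear_intro[where K="cmod c"]) (auto simp: scaleC_add_right scaleC_scaleR norm_scaleC)

lemmas tendsto_scaleC [tendsto_intros] = bounded_linear.tendsto[OF bounded_linear_scaleC]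
lemmas continuous_on_scaleC [continuous_intros] = bounded_linear.continuous_on[OF bounded_linear_scaleC]

lemma Re_cinner [simp]: "Re (cinner x y) = inner x y" and Im_cinner: "Im (cinner x y) = inner (\<i> *c x) y"
 by (auto simp: cinner_def)

lemma cinner_eqI: assumes "inner x y = inner x' y'" "inner (\<i> *c x) y = inner (\<i> *c x') y'"
 shows "cinner x y = cinner x' y'" using assms by (simp add: cinner_def)

lemma cinner_add_left: "cinner (x + y) z = cinner x z + cinner y z"
 and cinner_add_right: "cinner x (y + z) = cinner x y + cinner x z"
 and cinner_diff_left: "cinner (x - y) z = cinner x z - cinner y z"
 and cinner_diff_right: "cinner x (y - z) = cinner x y - cinner x z" by (auto simp: complex_eq_iff Im_cinner inner_sums
   scaleC_add_right scaleC_diff_right)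

lemma cinner_scaleC_right: "cinner x (c *c y) = c * cinner x y" unfolding scaleC_conv[of c]
 by (auto simp: complex_eq_iff Im_cinner inner_add_right inner_i_left)

lemma cinner_scaleC_left: "cinner (c *c x) y = cnj c * cinner x y" unfolding scaleC_conv[of c]
 by (auto simp: complex_eq_iff Im_cinner inner_add_left inner_i_left scaleC_add_right scaleC_scaleR
   inner_diff_left algebra_simps)

lemma cinner_commute: "cinner x y = cnj (cinner y x)"
 using inner_i_left[of y x] by (auto simp: complex_eq_iff Im_cinner inner_commute)

lemma cinner_self: "cinner x x = of_real ((norm x)^2)"
proof -
 have "inner (\<i> *c x) x = 0" using inner_i_left[of x x] by (simp add: inner_commute)
 thus ?thesis by (simp add: complex_eq_iff Im_cinner norm_sq)
qed

lemma cinner_zero_right [simp]: "cinner x 0 = 0" and cinner_zero_left [simp]: "cinner 0 x = 0"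
 by (auto simp: cinner_def zero_complex.code)

lemma norm_cinner_le: "cmod (cinner x y) <= norm x * norm y"
proof (cases "cinner x y = 0")
 case False
 define c where "c = sgn (cinner x y)"
 have c1: "cmod c = 1" using False by (simp add: c_def norm_sgn)
 have "cinner (c *c x) y = of_real (cmod (cinner x y))" using False unfolding cinner_scaleC_left c_def
  by (simp add: sgn_eq mult.commute complex_norm_square[symmetric] power2_eq_square)
 hence "cmod (cinner x y) = inner (c *c x) y" by (metis Re_cinner Re_complex_of_real)
 also have "... <= norm (c *c x) * norm y" by (rule norm_cauchy_schwarz)
 finally show ?thesis by (simp add: norm_scaleC c1)
qed simp

lemma boI: assumes "bounded_linear x" "!!v. x (\<i> *c v) = \<i> *c x v"
 shows "bop x" unfolding bounded_operator_def
proof (intro conjI allI)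
 interpret bounded_linear x by fact
 show "x (c *c v) = c *c x v" for c v unfolding scaleC_conv[of c] by (simp add: add scaleR assms(2))
qed fact

section \<open>Operators and their adjoints\<close>

context
 fixes x :: "'h::complex_hilbert operator" assumes x: "bop x"
begin

lemma bo_linear: "bounded_linear x" using x by (simp add: bounded_operator_def)
lemma bo_scaleC: "x (c *c v) = c *c x v" using x by (simp add: bounded_operator_def)

interpretation bounded_linear x by (rule bo_linear)

lemmas bo_add = add and bo_diff = diff and bo_zero = zero and bo_scaleR = scaleR and bo_minus = neg
 and bo_tendsto = tendsto and bo_continuous = continuous_on

end

lemmas bo_simps = bo_add bo_diff bo_zero bo_scaleR bo_scaleC

lemma bo_bound: assumes "bop x" obtains B where "B > 0" "!!v. norm (x v) <= B * norm v"
 using bounded_linear.pos_bounded[OF bo_linear[OF assms]] by (auto simp: mult.commute)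

lemma bo_id: "bop (%v. v)" by (intro boI bounded_linear_ident) simp

lemma bo_0: "bop (%v. 0)" by (intro boI bounded_linear_zero) simp

lemma bo_comp:
 "bop x ==> bop y ==> bop (x o y)" unfolding o_def by (rule boI, rule bounded_linear_compose) (auto simp: bo_linear bo_scaleC)

lemma bo_plus:
 "bop x ==> bop y ==> bop (%v. x v + y v)" by (intro boI bounded_linear_add) (auto simp: bo_linear bo_scaleC scaleC_add_right)

lemma bo_mult:
 "bop x ==> bop (%v. c *c x v)" by (intro boI bounded_linear_compose[OF bounded_linear_scaleC])
  (auto simp: bo_linear bo_scaleC scaleC_scaleC mult.commute)

lemma bo_minus':
 "bop x ==> bop y ==> bop (%v. x v - y v)" using bo_plus[OF _ bo_mult[of y "-1"]] by simp

text \<open>The imaginary part of \<open>cinner\<close> is a real inner product with the first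
  argument multiplied by \<open>\<i>\<close>. Complex adjointness therefore reduces to the real
  inner product, in which most later computations are done.\<close>

lemma adjoint_iff: assumes "bop x"
 shows "(ALL u v. cinner (x u) v = cinner u (y v)) <-> (ALL u v. inner (x u) v = inner u (y v))"
 using assms by (metis Re_cinner bo_scaleC cinner_eqI)

lemma assumes "bop x"
 shows bo_adj: "bop (adj x)" and adj_inner: "inner (x u) v = inner u (adj x v)"
proof -
 obtain S where S: "bounded_linear S" "!!u v. inner (x u) v = inner u (S v)"
  using real_adjoint_exists[OF bo_linear[OF assms]] by auto
 have "S (\<i> *c v) = \<i> *c S v" for v
 proof (rule vector_eq_ldot[THEN iffD1], rule allI)
  show "inner u (S (\<i> *c v)) = inner u (\<i> *c S v)" for u
   using inner_i_left[of "x u" v] inner_i_left[of u "S v"] bo_scaleC[OF assms, of "\<i>" u] by (metis S(2) minus_equation_iff)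
 qed
 hence bS: "bop S" using S(1) by (intro boI)
 have "adj x = S" unfolding adj_def adjoint_iff[OF assms]
 proof (rule the_equality)
  show "bop S & (ALL u v. inner (x u) v = inner u (S v))" using bS S by auto
  fix y assume "bop y & (ALL u v. inner (x u) v = inner u (y v))"
  hence "ALL u. inner u (y v) = inner u (S v)" for v using S by metis
  thus "y = S" by (metis ext vector_eq_ldot)
 qed
 thus "bop (adj x)" "inner (x u) v = inner u (adj x v)" using bS S by auto
qed

lemma adj_inner': "bop x ==> inner (adj x u) v = inner u (x v)" using adj_inner[of x v u] by (simp add: inner_commute)

lemma adj_eqI: assumes "bop x" "!!u v. inner (x u) v = inner u (y v)"
 shows "adj x = y"
proof
 fix v
 have "ALL u. inner u (adj x v) = inner u (y v)" using adj_inner[OF assms(1)] assms(2) by metis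
 thus "adj x v = y v" by (rule vector_eq_ldot[THEN iffD1])
qed

lemma adj_adj: "bop x ==> adj (adj x) = x" by (intro adj_eqI bo_adj) (auto simp: adj_inner')

lemma adj_comp: "bop x ==> bop y ==> adj (x o y) = adj y o adj x" by (intro adj_eqI bo_comp) (auto simp: adj_inner)

lemma selfadjoint_iff: "bop x ==> adj x = x <-> (ALL u v. inner (x u) v = inner u (x v))" by (metis adj_eqI adj_inner)

lemma isp_iff:
 "is_projection e <-> bop e & (ALL v. e (e v) = e v) & (ALL u v. inner (e u) v = inner u (e v))"
 unfolding is_projection_def using selfadjoint_iff by (auto simp: fun_eq_iff)

text \<open>On a complex space an operator with real quadratic form is symmetric: the vanishing
  imaginary part is polarized, and replacing \<open>v\<close> by \<open>\<i> *c v\<close> gives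
  symmetry of \<open>x\<close>.\<close>

lemma posop_iff:
 "posop x <-> bop x & (ALL u v. inner (x u) v = inner u (x v)) & (ALL v. 0 <= inner v (x v))"
proof (cases "bop x")
 case True
 note [simp] = bo_simps[OF True]
 have "(ALL v. inner (\<i> *c v) (x v) = 0) <-> (ALL u v. inner (x u) v = inner u (x v))" (is "?L <-> ?R")
 proof (intro iffI allI)
  fix u v assume L: ?L
  have "inner (\<i> *c (u + v)) (x (u + v)) = 0" for u v using L by blast
  hence *: "inner (\<i> *c u) (x v) + inner (\<i> *c v) (x u) = 0" for u v using L by (simp add: scaleC_add_right inner_sums)
  have "inner (\<i> *c u) (x (\<i> *c v)) + inner (\<i> *c \<i> *c v) (x u) = 0" by (rule *)
  thus "inner (x u) v = inner u (x v)" by (simp add: inner_scaleC_i inner_commute)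
 next
  fix v assume R: ?R
  have "inner (\<i> *c v) (x v) = inner v (x (\<i> *c v))" using R by (metis inner_commute)
  thus "inner (\<i> *c v) (x v) = 0" using inner_i_left[of v "x v"] by simp
 qed
 thus ?thesis using True by (auto simp: positive_operator_def Im_cinner)
qed (simp add: positive_operator_def)

section \<open>Closed complex subspaces and projections\<close>

definition csubspace :: "'h::complex_hilbert set => bool" where "csubspace K <-> subspace K & (ALL v : K. \<i> *c v : K)"

lemma csubspaceD: assumes "csubspace K"
 shows csubspace_subspace: "subspace K" and csubspace_0: "0 : K" and csubspace_add: "u : K ==> v : K ==> u + v : K"
  and csubspace_diff: "u : K ==> v : K ==> u - v : K" and csubspace_scaleC: "u : K ==> c *c u : K"
 using assms unfolding csubspace_def scaleC_conv[of c] by (auto intro: subspace_add subspace_diff subspace_scale subspace_0)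

lemma csubspaceI: assumes "0 : K" "!!u v. u : K ==> v : K ==> u + v : K" "!!c u. u : K ==> c *c u : K"
 shows "csubspace K" unfolding csubspace_def subspace_def using assms by (metis scaleC_of_real)

lemma csubspace_perp: "csubspace K ==> csubspace (K\<bottom>)"
 by (auto simp: csubspace_def subspace_orthogonal_comp perp_iff inner_i_left)

lemma csubspace_Int: "csubspace K ==> csubspace L ==> csubspace (K Int L)" by (auto simp: csubspace_def subspace_inter)

lemma csubspace_range: assumes "bop x" shows "csubspace (range x)"
proof (rule csubspaceI)
 show "0 : range x" using bo_zero[OF assms] by (metis rangeI)
 show "u + v : range x" if "u : range x" "v : range x" for u v using that by (auto simp: bo_add[OF assms, symmetric])
 show "c *c u : range x" if "u : range x" for c u using that by (auto simp: bo_scaleC[OF assms, symmetric])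
qed

lemma csubspace_kernel: "bop x ==> csubspace {v. x v = 0}" by (rule csubspaceI) (auto simp: bo_zero bo_add bo_scaleC)

lemma closed_kernel: "bop x ==> closed {v. x v = 0}"
 by (rule closed_Collect_eq[OF bo_continuous[OF _ continuous_on_id] continuous_on_const])

lemma bo_oproj: assumes "closed K" "csubspace K" shows "bop (oproj K)"
proof (rule boI)
 have K: "closed K" "subspace K" using assms by (auto simp: csubspace_def)
 show "bounded_linear (oproj K)" by (rule bounded_linear_oproj[OF K])
 show "oproj K (\<i> *c v) = \<i> *c oproj K v" for v by (rule oproj_commute[OF K, of _ "%v. - (\<i> *c v)"])
   (use assms csubspaceD[OF assms(2)] in
    "auto simp: inner_i_left intro: bounded_linear.linear bounded_linear_scaleC subspace_neg K")
qed

lemma isp_oproj: assumes "closed K" "csubspace K" shows "is_projection (oproj K)"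
proof -
 have K: "closed K" "subspace K" using assms by (auto simp: csubspace_def)
 show ?thesis by (simp add: isp_iff bo_oproj[OF assms] oproj_sym[OF K] oproj_id[OF K] oproj_mem[OF K])
qed

lemma isp_eq_oproj: assumes "is_projection e"
 shows "closed (range e)" "csubspace (range e)" "e = oproj (range e)"
proof -
 have e: "bop e" "!!v. e (e v) = e v" "!!u v. inner (e u) v = inner u (e v)" using assms by (auto simp: isp_iff)
 have r: "range e = {v. v - e v = 0}" using e(2) by (auto intro: range_eqI[of _ e])
 show cl: "closed (range e)" unfolding r using closed_kernel[OF bo_minus'[OF bo_id e(1)]] by simp
 show cs: "csubspace (range e)" by (rule csubspace_range[OF e(1)])
 show "e = oproj (range e)" by (rule ext, rule sym, rule oproj_eqI)
   (use cs in "auto simp: csubspace_def perp_iff inner_diff_left e")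
qed

section \<open>Graphs\<close>

text \<open>The product space is only a real inner product space, so a complex graph is a real
  subspace stable under multiplying both coordinates by \<open>\<i>\<close>. Orthogonal projections
  onto graphs are then available.\<close>

definition linear_graph :: "'h::complex_hilbert graph => bool"
 where "linear_graph T <-> subspace T & (ALL (u, v) : T. (\<i> *c u, \<i> *c v) : T)"

lemma linear_graphD: assumes "linear_graph T"
 shows lg_subspace: "subspace T" and lg_0: "(0, 0) : T" and lg_add: "(u, v) : T ==> (u', v') : T ==> (u + u', v + v') : T"
  and lg_diff: "(u, v) : T ==> (u', v') : T ==> (u - u', v - v') : T" and lg_scaleC: "(u, v) : T ==> (c *c u, c *c v) : T"
proof -
 have T: "subspace T" "!!u v. (u, v) : T ==> (\<i> *c u, \<i> *c v) : T" using assms by (auto simp: linear_graph_def)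
 show "subspace T" "(0, 0) : T" using T subspace_0[OF T(1)] by (auto simp: zero_prod_def)
 show a: "(u, v) : T ==> (u', v') : T ==> (u + u', v + v') : T" for u v u' v'
  using subspace_add[OF T(1), of "(u,v)" "(u',v')"] by simp
 show "(u, v) : T ==> (u', v') : T ==> (u - u', v - v') : T" using subspace_diff[OF T(1), of "(u,v)" "(u',v')"] by simp
 have s: "(u, v) : T ==> (r *r u, r *r v) : T" for u v r using subspace_scale[OF T(1), of "(u,v)" r] by simp
 show "(u, v) : T ==> (c *c u, c *c v) : T" unfolding scaleC_conv[of c] by (intro a s T(2))
qed

lemma lgI: assumes "(0, 0) : T" "!!u v u' v'. (u, v) : T ==> (u', v') : T ==> (u + u', v + v') : T"
  "!!c u v. (u, v) : T ==> (c *c u, c *c v) : T"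
 shows "linear_graph T"
 unfolding linear_graph_def subspace_def using assms(1) assms(2) assms(3)[where c="\<i>"] assms(3)[where c="of_real _"]
 by (auto simp: zero_prod_def scaleC_of_real)

lemma closed_densely_defined_iff:
 "closed_densely_defined T <-> linear_graph T & single_valued T & closed T & closure (Domain T) = UNIV"
proof -
 have "linear_graph T <-> (0, 0) : T & (ALL (u, v) : T. ALL (x, y) : T. (u + x, v + y) : T) &
   (ALL c. ALL (u, v) : T. (c *c u, c *c v) : T)" (is "_ <-> ?R")
 proof
  assume "linear_graph T" thus ?R using linear_graphD[of T] by auto
 next
  assume ?R thus "linear_graph T" by (intro lgI) auto
 qed
 thus ?thesis unfolding closed_densely_defined_def by blast
qed

lemma lg_closure: assumes "linear_graph T" shows "linear_graph (closure T)" unfolding linear_graph_def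
proof (intro conjI ballI)
 show "subspace (closure T)" using lg_subspace[OF assms] by (rule closure_subspace)
 fix p assume "p : closure T"
 then obtain X where X: "!!n. X n : T" "X ----> p" unfolding closure_sequential by auto
 have "(%n. (\<i> *c fst (X n), \<i> *c snd (X n))) ----> (\<i> *c fst p, \<i> *c snd p)" by (intro tendsto_intros X)
 moreover have "(\<i> *c fst (X n), \<i> *c snd (X n)) : T" for n using X(1)[of n] lg_scaleC[OF assms] by (cases "X n") auto
 ultimately show "case p of (u, v) => (\<i> *c u, \<i> *c v) : closure T" unfolding closure_sequential by (cases p) fastforce
qed

lemma csubspace_Domain: "linear_graph T ==> csubspace (Domain T)"
 by (rule csubspaceI) (auto dest: lg_0 lg_add lg_scaleC intro: DomainI)

lemma adj_graph_iff: assumes "linear_graph T"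
 shows "(u, v) : adjg T <-> (ALL x y. (x, y) : T --> inner y u = inner x v)"
proof -
 have "cinner y u = cinner x v" if "ALL x y. (x, y) : T --> inner y u = inner x v" "(x, y) : T" for x y
  using that lg_scaleC[OF assms that(2), of "\<i>"] by (intro cinner_eqI) auto
 moreover have "inner y u = inner x v" if "cinner y u = cinner x v" for x y using arg_cong[OF that, of Re] by simp
 ultimately show ?thesis unfolding adj_graph_def by blast
qed

lemma adj_graph_inner: assumes "(u, v) : adjg T" "(x, y) : T" shows "inner y u = inner x v"
proof -
 have "cinner y u = cinner x v" using assms unfolding adj_graph_def by auto
 thus ?thesis using Re_cinner by metis
qed

lemma lg_adj: assumes "linear_graph T" shows "linear_graph (adjg T)" unfolding adj_graph_def
 by (rule lgI) (auto simp: cinner_add_right cinner_scaleC_right split: prod.splits; metis)+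

text \<open>Turns closedness of adjoints, and the identity of the double adjoint with the closure,
  into facts about orthogonal complements in the product space.\<close>

lemma adj_graph_orthogonal:
 "linear_graph T ==> (u, v) : adjg T <-> (v, - u) : T\<bottom>" by (auto simp: adj_graph_iff perp_iff inner_commute)

lemma adj_adj_graph: assumes "linear_graph T" shows "adjg (adjg T) = closure T"
proof -
 have "(a, b) : adjg (adjg T) <-> (a, b) : T\<bottom>\<bottom>" for a b
  unfolding adj_graph_iff[OF lg_adj[OF assms]] adj_graph_orthogonal[OF assms] unfolding perp_iff[of "(a,b)"]
 proof (intro iffI ballI allI impI)
  fix p assume H: "ALL x y. (y, - x) : T\<bottom> --> inner y a = inner x b" and p: "p : T\<bottom>"
  have "inner (fst p) a = inner (- snd p) b" by (rule H[rule_format]) (use p in simp)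
  thus "inner (a, b) p = 0" by (cases p) (simp add: inner_commute)
 next
  fix x y assume H: "ALL p : T\<bottom>. inner (a, b) p = 0" and p: "(y, - x) : T\<bottom>"
  show "inner y a = inner x b" using bspec[OF H p] by (simp add: inner_commute)
 qed
 thus ?thesis using perp_comp_closure[OF lg_subspace[OF assms]] by auto
qed

lemma closed_adj_graph: assumes "linear_graph T" shows "closed (adjg T)"
proof -
 have "adjg T = (%p. (snd p, - fst p)) -` (T\<bottom>)" using adj_graph_orthogonal[OF assms] by auto
 thus ?thesis by (simp add: closed_perp closed_vimage continuous_on_Pair continuous_on_minus continuous_on_fst continuous_on_snd)
qed

lemma single_valued_adj_graph: assumes "closure (Domain T) = UNIV" shows "single_valued (adjg T)"
proof (rule single_valuedI)
 fix u v w assume "(u, v) : adjg T" "(u, w) : adjg T"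
 hence "inner x (v - w) = 0" if "x : Domain T" for x
  using that adj_graph_inner[OF `(u, v) : adjg T`] adj_graph_inner[OF `(u, w) : adjg T`] by (auto simp: inner_diff_right)
 hence "v - w : (Domain T)\<bottom>" by (auto simp: perp_iff inner_commute)
 hence "v - w : (UNIV)\<bottom>" using perp_closure assms by metis
 thus "v = w" by simp
qed

lemma graph_op_eq: "single_valued T ==> (v, w) : T ==> gop T v = w"
 unfolding graph_op_def by (auto dest: single_valuedD intro!: the_equality)

lemma graph_op_mem: "single_valued T ==> v : Domain T ==> (v, gop T v) : T" by (auto simp: graph_op_eq)

lemma op_graph_iff [simp]: "(u, v) : op_graph x <-> v = x u" by (auto simp: op_graph_def)

lemma graph_op_op_graph [simp]: "gop (op_graph x) = x" by (auto simp: graph_op_def)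

lemma Domain_op_graph [simp]: "Domain (op_graph x) = UNIV" by (auto simp: Domain.simps)

lemma lg_op_graph: "bop x ==> linear_graph (op_graph x)" by (rule lgI) (auto simp: bo_zero bo_add bo_scaleC)

lemma closed_op_graph: "bop x ==> closed (op_graph x)"
proof -
 assume x: "bop x"
 have "op_graph x = {p. snd p = x (fst p)}" by (auto simp: op_graph_def)
 thus ?thesis by (auto intro!: closed_Collect_eq continuous_intros bo_continuous[OF x])
qed

section \<open>Positive operators\<close>

lemma bo_real_mult:
 "bop x ==> bop (%v. c *r x v)" using bo_mult[of x "of_real c"] by (simp add: scaleC_of_real)

lemma positive_operatorD: assumes "posop x"
 shows posop_bounded: "bop x" and posop_sym: "inner (x u) v = inner u (x v)" and posop_nonneg: "0 <= inner v (x v)"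
 using assms by (auto simp: posop_iff)

lemma op_le_iff: assumes "posop x" "posop y"
 shows "op_le x y <-> (ALL v. inner v (x v) <= inner v (y v))" using assms unfolding op_le_def posop_iff
 by (auto simp: inner_sums bo_minus')

lemma posop_square: assumes "bop x" "!!u v. inner (x u) v = inner u (x v)"
 shows "posop (x o x)" unfolding posop_iff
proof (intro conjI allI)
 show "0 <= inner v ((x o x) v)" for v using assms(2)[of v "x v"] by (metis comp_apply inner_ge_zero)
qed (auto simp: bo_comp assms)

lemma posop_adj_comp: assumes "bop x" shows "posop (adj x o x)" unfolding posop_iff using assms
 by (auto simp: bo_comp bo_adj adj_inner' adj_inner[symmetric])

lemma posop_comp_adj: assumes "bop x" shows "posop (x o adj x)"
 using posop_adj_comp[OF bo_adj[OF assms]] adj_adj[OF assms] by simp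

lemma posop_plus:
 "posop x ==> posop y ==> posop (%v. x v + y v)" by (auto simp: posop_iff bo_plus inner_sums)

lemma posop_mult:
 "posop x ==> 0 <= c ==> posop (%v. c *r x v)" by (auto simp: posop_iff bo_real_mult)

lemma posop_conj: assumes "posop x" "bop y" shows "posop (adj y o x o y)" using assms unfolding posop_iff
 by (auto simp: bo_comp bo_adj adj_inner' adj_inner[symmetric])

text \<open>For \<open>0 <= x <= k\<close> this is the operator inequality
  \<open>x^2 <= k x\<close>, obtained by expanding the form of \<open>x\<close> at
  \<open>v - x v / k\<close>. It turns convergence of quadratic forms into strong
  convergence.\<close>

lemma norm_positive_le: assumes x: "posop x" and k: "k > 0" "!!v. inner v (x v) <= k * (norm v)^2"
 shows "(norm (x v))^2 <= k * inner v (x v)"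
proof -
 note b = posop_bounded[OF x]
 have "0 <= inner (v - (1/k) *r x v) (x (v - (1/k) *r x v))" by (rule posop_nonneg[OF x])
 also have "... = inner v (x v) - (2/k) * (norm (x v))^2 + ((1/k) * (1/k)) * inner (x v) (x (x v))"
  by (simp add: bo_simps[OF b] inner_sums norm_sq
    posop_sym[OF x, of v "x v", symmetric] field_simps diff_divide_distrib)
 also have "((1/k) * (1/k)) * inner (x v) (x (x v)) <= ((1/k) * (1/k)) * (k * (norm (x v))^2)" by (intro mult_left_mono k) auto
 also have "((1/k) * (1/k)) * (k * (norm (x v))^2) = (1/k) * (norm (x v))^2" using k by simp
 finally show ?thesis using k by (simp add: field_simps)
qed

lemma norm_le_positive: assumes x: "posop x" and k: "k > 0" "!!v. inner v (x v) <= k * (norm v)^2"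
 shows "norm (x v) <= k * norm v"
proof (rule power2_le_imp_le)
 have "(norm (x v))^2 <= k * (k * (norm v)^2)"
  by (rule order_trans[OF norm_positive_le[OF x k] mult_left_mono[OF k(2)]]) (use k(1) in simp)
 thus "(norm (x v))^2 <= (k * norm v)^2" by (simp add: power2_eq_square mult_ac)
qed (use k in auto)

lemma bo_limit: assumes x: "!!n. bop (x n)" "!!n v. norm (x n v) <= C * norm v" and lim: "!!v. (%n. x n v) ----> y v"
 shows "bop y"
proof (rule boI)
 show "bounded_linear y"
 proof (rule bounded_linear_intro)
  fix u v and r :: real
  have "(%n. x n u + x n v) ----> y u + y v" by (intro tendsto_intros lim)
  thus "y (u + v) = y u + y v" using lim[of "u + v"] LIMSEQ_unique by (simp add: bo_add[OF x(1)])
  have "(%n. r *r x n v) ----> r *r y v" by (intro tendsto_intros lim)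
  thus "y (r *r v) = r *r y v" using lim[of "r *r v"] LIMSEQ_unique by (simp add: bo_scaleR[OF x(1)])
  show "norm (y v) <= norm v * C"
   by (rule LIMSEQ_le_const2[OF tendsto_norm[OF lim[of v]]]) (use x(2) in "auto simp: mult.commute")
 qed
 fix v
 have "(%n. \<i> *c x n v) ----> \<i> *c y v" by (intro tendsto_intros lim)
 thus "y (\<i> *c v) = \<i> *c y v" using lim[of "\<i> *c v"] LIMSEQ_unique by (simp add: bo_scaleC[OF x(1)])
qed

lemma posop_limit: assumes x: "!!n. posop (x n)" and b: "bop y" and lim: "!!v. (%n. x n v) ----> y v"
 shows "posop y" unfolding posop_iff
proof (intro conjI allI b)
 fix u v
 have "(%n. inner (x n u) v) ----> inner (y u) v" "(%n. inner u (x n v)) ----> inner u (y v)" by (intro tendsto_intros lim)+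
 thus "inner (y u) v = inner u (y v)" using LIMSEQ_unique by (simp add: posop_sym[OF x])
 have "(%n. inner v (x n v)) ----> inner v (y v)" by (intro tendsto_intros lim)
 thus "0 <= inner v (y v)" by (rule LIMSEQ_le_const) (use posop_nonneg[OF x] in auto)
qed

text \<open>The forms converge, being increasing and bounded; \<open>norm_positive_le\<close>
  applied to differences makes the vectors \<open>x n v\<close> a Cauchy sequence.\<close>

lemma incseq_positive_operators_converge:
 fixes x :: "nat => 'h::complex_hilbert operator" assumes x: "!!n. posop (x n)"
  and inc: "!!n v. inner v (x n v) <= inner v (x (Suc n) v)" and k: "k > 0" "!!n v. inner v (x n v) <= k * (norm v)^2"
 shows "EX y. posop y & (ALL v. (%n. x n v) ----> y v)"
proof -
 have mono: "inner v (x m v) <= inner v (x n v)" if "m <= n" for m n v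
  using that by (induction n rule: dec_induct) (auto intro: order_trans inc)
 have "convergent (%n. x n v)" for v
 proof -
  have "bdd_above (range (%n. inner v (x n v)))" using k(2) by (auto intro!: bdd_aboveI)
  hence "convergent (%n. inner v (x n v))" by (rule convergentI[OF LIMSEQ_incseq_SUP]) (auto simp: incseq_def mono)
  hence C: "Cauchy (%n. inner v (x n v))" by (rule convergent_Cauchy)
  have bd: "(norm (x n v - x m v))^2 <= k * \<bar>inner v (x n v) - inner v (x m v)\<bar>" for m n
  proof -
   have *: "(norm (x n v - x m v))^2 <= k * \<bar>inner v (x n v) - inner v (x m v)\<bar>" if mn: "m <= n" for m n
   proof -
    have p: "posop (%v. x n v - x m v)" using op_le_iff[OF x x] mono[OF mn] by (auto simp: op_le_def)
    have "inner v (x n v - x m v) <= k * (norm v)^2" for v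
     using posop_nonneg[OF x[of m], of v] k(2)[of v n] by (simp add: inner_diff_right)
    from norm_positive_le[OF p k(1) this] show ?thesis using mono[OF mn, of v] by (simp add: inner_diff_right)
   qed
   show ?thesis using *[of m n] *[of n m] by (cases "m <= n") (auto simp: norm_minus_commute abs_minus_commute)
  qed
  have "Cauchy (%n. x n v)"
  proof (rule metric_CauchyI)
   fix e :: real assume "e > 0"
   hence "e^2 / k > 0" using k by simp
   then obtain M where M: "!!m n. m >= M ==> n >= M ==> \<bar>inner v (x m v) - inner v (x n v)\<bar> < e^2 / k"
    using C unfolding Cauchy_def dist_real_def by metis
   have "dist (x m v) (x n v) < e" if "m >= M" "n >= M" for m n
   proof (rule power2_less_imp_less)
    have "k * \<bar>inner v (x m v) - inner v (x n v)\<bar> < e^2" using M[OF that] k by (simp add: field_simps)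
    thus "(dist (x m v) (x n v))^2 < e^2" using bd[of m n] by (simp add: dist_norm)
   qed (use `e > 0` in auto)
   thus "EX M. ALL m>=M. ALL n>=M. dist (x m v) (x n v) < e" by blast
  qed
  thus ?thesis by (rule Cauchy_convergent)
 qed
 then obtain y where y: "!!v. (%n. x n v) ----> y v" unfolding convergent_def by metis
 have "bop y" by (rule bo_limit[OF posop_bounded[OF x] norm_le_positive[OF x k] y])
 thus ?thesis using posop_limit[OF x _ y] y by blast
qed

text \<open>Polynomials in \<open>s\<close> with nonnegative coefficients. The closure rules suffice
  to prove commutation, symmetry and positivity by induction, so no coefficients are recorded; the
  iterates of the square root algorithm and their differences are of this kind.\<close>

inductive pos_polynomial :: "'h::complex_hilbert operator => 'h operator => bool" for s where
 pos_polynomial_id: "pos_polynomial s (%v. v)" | pos_polynomial_mult: "pos_polynomial s x ==> pos_polynomial s (%v. s (x v))"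
| pos_polynomial_add: "pos_polynomial s x ==> pos_polynomial s y ==> pos_polynomial s (%v. x v + y v)"
| pos_polynomial_scale: "pos_polynomial s x ==> 0 <= c ==> pos_polynomial s (%v. c *r x v)"

context
 fixes s :: "'h::complex_hilbert operator" assumes s: "posop s"
begin

lemma pos_polynomial_bounded: "pos_polynomial s x ==> bop x" by (induction rule: pos_polynomial.induct)
  (auto intro: bo_id bo_plus bo_real_mult
   bo_comp[OF posop_bounded[OF s], unfolded o_def])

lemma pos_polynomial_comp: "pos_polynomial s x ==> pos_polynomial s y ==> pos_polynomial s (%v. x (y v))"
 by (induction rule: pos_polynomial.induct) (auto intro: pos_polynomial.intros)

lemma pos_polynomial_commute: assumes "pos_polynomial s x" "bop b" "!!v. b (s v) = s (b v)"
 shows "b (x v) = x (b v)" using assms(1) by (induction arbitrary: v rule: pos_polynomial.induct)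
  (auto simp: assms(3) bo_simps[OF assms(2)])

lemma pos_polynomial_sym: "pos_polynomial s x ==> inner (x u) v = inner u (x v)"
proof (induction arbitrary: u v rule: pos_polynomial.induct)
 case (pos_polynomial_mult x)
 have "s (x v) = x (s v)" by (rule pos_polynomial_commute[OF pos_polynomial_mult.hyps posop_bounded[OF s]]) simp
 thus ?case using pos_polynomial_mult posop_sym[OF s] by metis
qed (auto simp: inner_sums)

lemma pos_polynomial_power_nonneg: "0 <= inner ((s ^^ k) v) v"
proof -
 have sym: "inner ((s ^^ j) u) v = inner u ((s ^^ j) v)" for j u v
  by (induction j arbitrary: u v) (auto simp: posop_sym[OF s] funpow_swap1)
 show ?thesis
 proof (cases "even k")
  case True
  then obtain j where "k = j + j" by (metis evenE mult_2)
  hence "inner ((s ^^ k) v) v = inner ((s ^^ j) v) ((s ^^ j) v)" by (simp add: funpow_add sym)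
  thus ?thesis by simp
 next
  case False
  then obtain j where "k = j + Suc j" by (metis oddE add_Suc_right mult_2 Suc_eq_plus1)
  hence "inner ((s ^^ k) v) v = inner ((s ^^ j) v) (s ((s ^^ j) v))" by (simp add: funpow_add sym posop_sym[OF s] funpow_swap1)
  thus ?thesis by (simp add: posop_nonneg[OF s])
 qed
qed

lemma pos_polynomial_positive: assumes "pos_polynomial s x" shows "posop x"
proof -
 \<comment> \<open>The power of \<open>s\<close> on the left is what lets the induction pass a
   multiplication by \<open>s\<close>.\<close>
 have "0 <= inner ((s ^^ k) v) (x v)" for k v using assms
 proof (induction arbitrary: k rule: pos_polynomial.induct)
  case (pos_polynomial_mult x)
  thus ?case using pos_polynomial_mult.IH[of "Suc k"] by (simp add: posop_sym[OF s])
 qed (auto simp: pos_polynomial_power_nonneg inner_add_right)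
 from this[of 0] show ?thesis using pos_polynomial_bounded[OF assms] pos_polynomial_sym[OF assms] by (auto simp: posop_iff)
qed

end

section \<open>Square roots, spectral subspaces and supports\<close>

lemma posop_bound: assumes "posop x"
 obtains k where "k > 0" "!!v. inner v (x v) <= k * (norm v)^2"
proof -
 obtain B where B: "B > 0" "!!v. norm (x v) <= B * norm v" using bo_bound[OF posop_bounded[OF assms]] by blast
 have "inner v (x v) <= B * (norm v)^2" for v
  using order_trans[OF norm_cauchy_schwarz[of v "x v"] mult_left_mono[OF B(2)[of v], of "norm v"]]
  by (simp add: power2_eq_square mult.left_commute)
 thus thesis using B(1) that by blast
qed

text \<open>The square root of \<open>1 - s\<close> is \<open>1 - z\<close>, \<open>z\<close> being the limit of the increasing iteration
  \<open>z \<mapsto> (z\<^sup>2 + s) / 2\<close>.\<close>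

lemma positive_sqrt_exists: assumes X: "posop X"
 shows "EX r. posop r & r o r = X & (ALL b. bop b --> (ALL v. b (X v) = X (b v)) --> (ALL v. b (r v) = r (b v)))"
proof -
 obtain k where k: "k > 0" "!!v. inner v (X v) <= k * (norm v)^2" using posop_bound[OF X] by blast
 note bX = posop_bounded[OF X]
 \<comment> \<open>Then \<open>1 - s = X / k\<close> lies between 0 and 1.\<close>
 define s where "s v = v - (1/k) *r X v" for v
 have bs: "bop s" unfolding s_def by (intro bo_minus' bo_id bo_real_mult bX)
 have s: "posop s" unfolding posop_iff using bs k posop_sym[OF X] by (auto simp: s_def inner_sums field_simps norm_sq)
 have s1: "inner v (s v) <= 1 * (norm v)^2" for v
  using k(1) posop_nonneg[OF X, of v] by (simp add: s_def inner_diff_right norm_sq)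
 define z where "z = rec_nat (%v. 0 *r v) (%n zn v. (1/2) *r (zn (zn v) + s v))"
 have z0: "z 0 = (%v. 0 *r v)" and zS: "z (Suc n) = (%v. (1/2) *r (z n (z n v) + s v))" for n by (auto simp: z_def)
 have sp: "pos_polynomial s s" using pos_polynomial_mult[OF pos_polynomial_id, of s] by simp
 have zp: "pos_polynomial s (z n)" for n
 proof (induction n)
  case 0 show ?case unfolding z0 by (intro pos_polynomial_scale pos_polynomial_id) simp
 next
  case (Suc n) show ?case unfolding zS
   by (rule pos_polynomial_scale[OF pos_polynomial_add[OF pos_polynomial_comp[OF s Suc Suc] sp]]) simp
 qed
 note zb = pos_polynomial_bounded[OF s zp]
 have z1: "norm (z n v) <= norm v" for n v
 proof (induction n arbitrary: v)
  case (Suc n)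
  have "norm (z n (z n v)) <= norm v" using Suc[of "z n v"] Suc[of v] by simp
  moreover have "norm (s v) <= norm v" using norm_le_positive[OF s zero_less_one s1, of v] by simp
  ultimately show ?case unfolding zS using norm_triangle_ineq[of "z n (z n v)" "s v"] by simp
 qed (simp add: z0)
 have zcomm: "z m (z n v) = z n (z m v)" for m n v by (rule pos_polynomial_commute[OF s zp zb])
   (rule pos_polynomial_commute[OF s zp bs, symmetric], simp)
 \<comment> \<open>Since \<open>z (n+2) - z (n+1)\<close> is half the product of
   \<open>z (n+1) - z n\<close> and \<open>z (n+1) + z n\<close>, increments stay polynomials with
   nonnegative coefficients, and the iteration increases.\<close>
 have dp: "pos_polynomial s (%v. z (Suc n) v - z n v)" for n
 proof (induction n)
  case 0
  have "pos_polynomial s (%v. (1/2) *r s v)" by (intro pos_polynomial_scale sp) simp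
  thus ?case by (simp add: zS z0 bo_zero)
 next
  case (Suc n)
  have "pos_polynomial s (%v. (1/2) *r ((%v. z (Suc n) v - z n v) (z (Suc n) v + z n v)))"
   by (intro pos_polynomial_scale pos_polynomial_comp[OF s Suc] pos_polynomial_add zp) simp
  moreover have "(1/2) *r ((%v. z (Suc n) v - z n v) (z (Suc n) v + z n v)) = z (Suc (Suc n)) v - z (Suc n) v" for v
  proof -
   have "z (Suc (Suc n)) v - z (Suc n) v = (1/2) *r (z (Suc n) (z (Suc n) v) - z n (z n v))"
    by (subst zS[of "Suc n"], subst (3) zS[of n]) (simp add: algebra_simps)
   thus ?thesis by (simp only: bo_add[OF zb]) (simp add: zcomm[of "Suc n" n])
  qed
  ultimately show ?case by simp
 qed
 have "EX y. posop y & (ALL v. (%n. z n v) ----> y v)"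
 proof (rule incseq_positive_operators_converge[where k=1])
  show "posop (z n)" for n by (rule pos_polynomial_positive[OF s zp])
  show "inner v (z n v) <= inner v (z (Suc n) v)" for n v
   using posop_nonneg[OF pos_polynomial_positive[OF s dp[of n]], of v] by (simp add: inner_diff_right)
  show "inner v (z n v) <= 1 * (norm v)^2" for n v
   using order_trans[OF norm_cauchy_schwarz[of v "z n v"] mult_left_mono[OF z1[of n v], of "norm v"]]
   by (simp add: power2_eq_square)
 qed simp
 then obtain y where y: "posop y" "!!v. (%n. z n v) ----> y v" by blast
 note yb = posop_bounded[OF y(1)]
 have ny: "norm (y v) <= norm v" for v by (rule LIMSEQ_le_const2[OF tendsto_norm[OF y(2)[of v]]]) (use z1 in auto)
 have yy: "2 *r y v = y (y v) + s v" for v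
 proof -
  have "(%n. z n (z n v)) ----> y (y v)"
  proof (rule Lim_transform)
   show "(%n. z n (y v)) ----> y (y v)" by (rule y(2))
   have "(%n. norm (z n v - y v)) ----> 0" using y(2)[of v] by (simp add: tendsto_norm_zero_iff LIM_zero_iff)
   thus "(%n. z n (z n v) - z n (y v)) ----> 0" by (rule Lim_null_comparison[rotated]) (auto simp: bo_diff[OF zb, symmetric] z1)
  qed
  hence "(%n. (1/2) *r (z n (z n v) + s v)) ----> (1/2) *r (y (y v) + s v)" by (intro tendsto_intros)
  moreover have "(%n. z (Suc n) v) ----> y v" using y(2)[of v] by (rule LIMSEQ_Suc)
  ultimately have "y v = (1/2) *r (y (y v) + s v)" unfolding zS by (metis LIMSEQ_unique)
  thus ?thesis by (metis scaleR_half_double scaleR_scaleR scaleR_one scaleR_2 scaleR_right_distrib)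
 qed
 \<comment> \<open>The fixed point equation says \<open>(1 - y)^2 = 1 - s = X / k\<close>.\<close>
 define r where "r v = sqrt k *r (v - y v)" for v
 have "bop r" unfolding r_def by (intro bo_real_mult bo_minus' bo_id yb)
 moreover have "inner v (y v) <= inner v v" for v
  using order_trans[OF norm_cauchy_schwarz[of v "y v"] mult_left_mono[OF ny[of v], of "norm v"]]
  by (simp add: power2_eq_square norm_sq[symmetric])
 ultimately have "posop r" unfolding posop_iff using k posop_sym[OF y(1)] by (auto simp: r_def inner_sums)
 moreover have "r o r = X"
 proof
  fix v
  have "(r o r) v = k *r (v - 2 *r y v + y (y v))" using k(1) by (simp add: r_def bo_simps[OF yb]
     scaleR_2 algebra_simps)
  also have "... = X v" using k(1) by (simp add: yy s_def)
  finally show "(r o r) v = X v" .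
 qed
 moreover have "b (r v) = r (b v)" if b: "bop b" "ALL v. b (X v) = X (b v)" for b v
 proof -
  have "b (s v) = s (b v)" for v using b by (simp add: s_def bo_simps[OF b(1)])
  hence "b (z n v) = z n (b v)" for n by (rule pos_polynomial_commute[OF s zp b(1)])
  moreover have "(%n. b (z n v)) ----> b (y v)" by (rule bo_tendsto[OF b(1) y(2)])
  ultimately have "b (y v) = y (b v)" using y(2)[of "b v"] LIMSEQ_unique by simp
  thus ?thesis by (simp add: r_def bo_simps[OF b(1)])
 qed
 ultimately show ?thesis by blast
qed

text \<open>With \<open>Y = X - k\<close> and \<open>N = (Y\<^sup>2)\<^sup>1\<^sup>/\<^sup>2\<close>, the kernel of \<open>N + Y\<close> is the spectral subspace \<open>X \<le> k\<close>.\<close>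

lemma spectral_cut: assumes X: "bop X" "!!u v. inner (X u) v = inner u (X v)"
 shows "EX L. closed L & csubspace L & (ALL b. bop b --> (ALL v. b (X v) = X (b v)) --> b ` L <= L) &
  (ALL v : L. inner v (X v) <= k * (norm v)^2) & (ALL v : L\<bottom>. k * (norm v)^2 <= inner v (X v))"
proof -
 define Y where "Y v = X v - k *r v" for v
 have bY: "bop Y" unfolding Y_def by (intro bo_minus' X bo_real_mult bo_id)
 have symY: "inner (Y u) v = inner u (Y v)" for u v using X(2) by (simp add: Y_def inner_sums)
 obtain N where N: "posop N" "N o N = Y o Y" and Nc: "!!b v. bop b ==> (ALL v. b (Y (Y v)) = Y (Y (b v))) ==> b (N v) = N (b v)"
  using positive_sqrt_exists[OF posop_square[OF bY symY]] by (auto simp: o_def)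
 note bN = posop_bounded[OF N(1)]
 have NN: "N (N v) = Y (Y v)" for v using N(2) by (metis comp_apply)
 have YN: "Y (N v) = N (Y v)" for v by (rule Nc[OF bY]) simp
 define L where "L = {v. N v + Y v = 0}"
 have bNY: "bop (%v. N v + Y v)" by (intro bo_plus bN bY)
 have clL: "closed L" "csubspace L" unfolding L_def by (rule closed_kernel[OF bNY], rule csubspace_kernel[OF bNY])
 have "b ` L <= L" if b: "bop b" "ALL v. b (X v) = X (b v)" for b
 proof -
  have bY: "b (Y v) = Y (b v)" for v using b(2) by (simp add: Y_def bo_simps[OF b(1)])
  have "b (N v) = N (b v)" for v by (rule Nc[OF b(1)]) (simp add: bY)
  thus ?thesis using bY bo_simps[OF b(1)] unfolding L_def by (auto; metis)
 qed
 moreover have "inner v (X v) <= k * (norm v)^2" if "v : L" for v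
 proof -
  have "Y v = - N v" using that by (simp add: L_def eq_neg_iff_add_eq_0 add.commute)
  hence "inner v (Y v) <= 0" using posop_nonneg[OF N(1), of v] by simp
  thus ?thesis by (simp add: Y_def inner_diff_right norm_sq)
 qed
 moreover have "k * (norm v)^2 <= inner v (X v)" if v: "v : L\<bottom>" for v
 proof -
  \<comment> \<open>\<open>(N + Y) (N - Y) = N^2 - Y^2 = 0\<close>, so \<open>N - Y\<close> maps
    into \<open>L\<close>. For \<open>v\<close> orthogonal to \<open>L\<close> its symmetry gives
    \<open>N v = Y v\<close>.\<close>
  have "N v - Y v : L" by (simp add: L_def bo_diff[OF bN] bo_diff[OF bY] NN YN)
  moreover have "inner (N v - Y v) w = inner v (N w - Y w)" for w by (simp add: inner_sums symY posop_sym[OF N(1)])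
  moreover have "N (N v - Y v) - Y (N v - Y v) : L" by (simp add: L_def bo_diff[OF bN] bo_diff[OF bY] NN YN)
  ultimately have "inner (N v - Y v) (N v - Y v) = 0" using v by (simp add: perp_iff)
  hence "Y v = N v" by simp
  hence "inner v (Y v) >= 0" using posop_nonneg[OF N(1), of v] by simp
  thus ?thesis by (simp add: Y_def inner_diff_right norm_sq)
 qed
 ultimately show ?thesis using clL by blast
qed

lemma perp_range: assumes "bop x" shows "(range x)\<bottom> = {v. adj x v = 0}"
proof -
 have "v : (range x)\<bottom> <-> (ALL u. inner u (adj x v) = inner u 0)" for v
  by (auto simp: perp_iff adj_inner[OF assms, symmetric] inner_commute)
 moreover have "(ALL u. inner u w = inner u 0) <-> w = 0" for w :: 'a by (rule vector_eq_ldot)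
 ultimately show ?thesis by blast
qed

lemma closure_range_adj: assumes "bop x" shows "closure (range (adj x)) = {v. x v = 0}\<bottom>"
 using perp_comp_closure[of "range (adj x)"] perp_range[of "adj x"]
  csubspace_range[OF bo_adj[OF assms]] assms by (simp add: bo_adj adj_adj csubspace_def)

text \<open>For a positive contraction \<open>s / k\<close>, the operators \<open>s g\<^sub>n = 1 - (1 - s / k)\<^sup>n\<close> increase to the
  support projection of \<open>s\<close>.\<close>

primrec gsum :: "real => 'h::complex_hilbert operator => nat => 'h operator" where
 "gsum k s 0 = (%v. 0 *r v)" | "gsum k s (Suc n) = (%v. gsum k s n v - (1/k) *r s (gsum k s n v) + (1/k) *r v)"

text \<open>The approximants are \<open>s\<close> times polynomials in \<open>s\<close>, so an
  operator intertwining \<open>s\<close> and \<open>t\<close> carries those of \<open>s\<close> to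
  those of \<open>t\<close>. This is how the supports of \<open>adj x o x\<close> and
  \<open>x o adj x\<close> are compared later.\<close>

lemma support_series: assumes s: "posop s" and k: "k > 0" "!!v. inner v (s v) <= k * (norm v)^2"
 shows posop_gsum: "posop (gsum k s n)"
  and gsum_commute: "bop b ==> (!!v. b (s v) = s (b v)) ==> b (gsum k s n v) = gsum k s n (b v)"
  and posop_support: "posop (%v. s (gsum k s n v))"
  and support_mono: "inner v (s (gsum k s n v)) <= inner v (s (gsum k s (Suc n) v))"
  and support_lim: "(%n. s (gsum k s n v)) ----> oproj ({v. s v = 0}\<bottom>) v"
proof -
 note bs = posop_bounded[OF s]
 define t where "t v = v - (1/k) *r s v" for v
 have bt: "bop t" unfolding t_def by (intro bo_minus' bo_id bo_real_mult bs)
 have t: "posop t" unfolding posop_iff using bt k posop_sym[OF s] by (auto simp: t_def inner_sums field_simps norm_sq)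
 have gS: "gsum k s (Suc n) v = t (gsum k s n v) + (1/k) *r v" for n v by (simp add: t_def)
 have gp: "pos_polynomial t (gsum k s n)" for n
 proof (induction n)
  case (Suc n)
  hence "pos_polynomial t (%v. t (gsum k s n v) + (1/k) *r v)" by (intro pos_polynomial.intros) (use k in auto)
  moreover have "(%v. t (gsum k s n v) + (1/k) *r v) = gsum k s (Suc n)" by (auto simp: t_def)
  ultimately show ?case by simp
 qed (use pos_polynomial_scale[OF pos_polynomial_id, of 0] in simp)
 thus g: "posop (gsum k s n)" for n by (rule pos_polynomial_positive[OF t])
 show comm: "b (gsum k s n v) = gsum k s n (b v)" if "bop b" "!!v. b (s v) = s (b v)" for b n v
  by (rule pos_polynomial_commute[OF t gp that(1)]) (simp add: t_def bo_diff bo_scaleR that)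
 obtain r where r: "posop r" "r o r = s" "!!b. bop b ==> ALL v. b (s v) = s (b v) ==> ALL v. b (r v) = r (b v)"
  using positive_sqrt_exists[OF s] by blast
 have rr: "s v = r (r v)" for v using r(2) by auto
 have sx: "inner v (s (x v)) = inner (r v) (x (r v))" if "posop x" "!!v. x (s v) = s (x v)" for x v
  using r(3)[OF posop_bounded[OF that(1)]] that(2) by (simp add: rr posop_sym[OF r(1)])
 have sg: "s (gsum k s n v) = gsum k s n (s v)" for n v by (rule comm[OF bs]) simp
 show p: "posop (%v. s (gsum k s n v))" for n unfolding posop_iff using bo_comp[OF bs posop_bounded[OF g[of n]]]
  using sx[OF g sg[symmetric]] by (auto simp: o_def posop_nonneg[OF g] posop_sym[OF s] posop_sym[OF g] sg)
 have tn: "pos_polynomial t (t ^^ n)" for n by (induction n) (auto simp: o_def id_def intro: pos_polynomial.intros)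
 have st: "s (t v) = t (s v)" for v by (simp add: t_def bo_simps[OF bs])
 \<comment> \<open>A geometric sum: with \<open>t = 1 - s / k\<close> the approximant is
   \<open>1 - t^n\<close>.\<close>
 have e: "s (gsum k s n v) = v - (t ^^ n) v" for n v
 proof (induction n)
  case (Suc n)
  have "s (gsum k s (Suc n) v) = t (s (gsum k s n v)) + (1/k) *r s v" by (simp only: gS bo_simps[OF bs] st)
  also have "... = v - t ((t ^^ n) v)" by (simp add: Suc bo_diff[OF bt]) (simp add: t_def)
  finally show ?case by simp
 qed (simp add: bo_zero[OF bs])
 show inc: "inner v (s (gsum k s n v)) <= inner v (s (gsum k s (Suc n) v))" for n v
 proof -
  have "s ((t ^^ n) v) = (t ^^ n) (s v)" for v by (rule pos_polynomial_commute[OF t tn bs]) (rule st)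
  note q = sx[OF pos_polynomial_positive[OF t tn] this[symmetric]]
  have "t ((t ^^ n) v) = (t ^^ n) v - (1/k) *r s ((t ^^ n) v)" by (simp add: t_def)
  thus ?thesis using k(1) q[of v] posop_nonneg[OF pos_polynomial_positive[OF t tn], of "r v" n]
   unfolding e by (simp add: inner_diff_right)
 qed
 obtain y where y: "!!v. (%n. s (gsum k s n v)) ----> y v"
  using incseq_positive_operators_converge[where x="%n v. s (gsum k s n v)", OF p inc zero_less_one]
   posop_nonneg[OF pos_polynomial_positive[OF t tn]] by (auto simp: e inner_diff_right norm_sq)
 have "oproj ({v. s v = 0}\<bottom>) v = y v"
 proof (rule oproj_eqI[OF subspace_orthogonal_comp])
  have "inner (y v) w = 0" if w: "s w = 0" for w
  proof (rule LIMSEQ_unique)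
   show "(%n. inner (s (gsum k s n v)) w) ----> inner (y v) w" by (intro tendsto_intros y)
   show "(%n. inner (s (gsum k s n v)) w) ----> 0"
    using w by (simp add: posop_sym[OF p]) (simp add: sg bo_zero posop_bounded[OF g])
  qed
  thus "y v : {v. s v = 0}\<bottom>" by (auto simp: perp_iff)
  have l: "(%n. (t ^^ n) v) ----> v - y v" using tendsto_diff[OF tendsto_const[of v] y[of v]] by (simp add: e)
  \<comment> \<open>The limit of \<open>t^n v\<close> is fixed by \<open>t\<close>, hence
    annihilated by \<open>s\<close>.\<close>
  have "t (v - y v) = v - y v" using LIMSEQ_unique[OF bo_tendsto[OF bt l]] LIMSEQ_Suc[OF l] by simp
  hence "s (v - y v) = 0" using k(1) by (simp add: t_def)
  thus "v - y v : {v. s v = 0}\<bottom>\<bottom>" by (auto simp: perp_iff inner_commute)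
 qed
 thus "(%n. s (gsum k s n v)) ----> oproj ({v. s v = 0}\<bottom>) v" using y by simp
qed

section \<open>Subspaces affiliated with a von Neumann algebra\<close>

lemma adj_commutant: assumes S: "!!x. x : S ==> bop x" "!!x. x : S ==> adj x : S" and b: "b : commutant S"
 shows "adj b : commutant S" unfolding commutant_def
proof (intro CollectI conjI ballI)
 have bb: "bop b" using b by (simp add: commutant_def)
 thus "bop (adj b)" by (rule bo_adj)
 fix x assume x: "x : S"
 have "adj x o b = b o adj x" using b S(2)[OF x] by (auto simp: commutant_def)
 hence "adj (adj x o b) = adj (b o adj x)" by simp
 thus "x o adj b = adj b o x" using bb S(1)[OF x] by (simp add: adj_comp bo_adj adj_adj)
qed

locale von_neumann =
 fixes A :: "'h::complex_hilbert operator set" assumes von_neumann: "von_neumann_algebra A"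
begin

lemma bounded: "x : A ==> bop x" using von_neumann by (auto simp: von_neumann_algebra_def)

lemma adj_mem: "x : A ==> adj x : A" using von_neumann by (auto simp: von_neumann_algebra_def)

lemma commutant_bo: "b : commutant A ==> bop b" by (auto simp: commutant_def)

lemma commutantD: "b : commutant A ==> x : A ==> b (x v) = x (b v)" unfolding commutant_def by (auto simp: fun_eq_iff)

lemma memI: assumes "bop x" "!!b v. b : commutant A ==> b (x v) = x (b v)"
 shows "x : A"
proof -
 have "x : commutant (commutant A)" using assms by (auto simp: commutant_def fun_eq_iff)
 thus ?thesis using von_neumann by (simp add: von_neumann_algebra_def)
qed

lemma commutant_adj: "b : commutant A ==> adj b : commutant A" by (rule adj_commutant[OF bounded adj_mem])

lemma id_mem: "(%v. v) : A" by (intro memI bo_id) simp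

lemma zero_mem: "(%v. 0) : A" by (intro memI bo_0) (simp add: commutant_bo bo_zero)

lemma comp_mem: assumes "x : A" "y : A" shows "x o y : A"
proof (rule memI)
 show "b ((x o y) v) = (x o y) (b v)" if b: "b : commutant A" for b v
  using commutantD[OF b assms(1)] commutantD[OF b assms(2)] by simp
qed (intro bo_comp bounded assms)

lemma plus_mem: assumes "x : A" "y : A" shows "(%v. x v + y v) : A"
proof (rule memI)
 show "b (x v + y v) = x (b v) + y (b v)" if b: "b : commutant A" for b v
  using commutantD[OF b assms(1)] commutantD[OF b assms(2)] by (simp add: bo_add[OF commutant_bo[OF b]])
qed (intro bo_plus bounded assms)

lemma scaleC_mem: assumes "x : A" shows "(%v. c *c x v) : A"
proof (rule memI)
 show "b (c *c x v) = c *c x (b v)" if b: "b : commutant A" for b v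
  using commutantD[OF b assms] by (simp add: bo_scaleC[OF commutant_bo[OF b]])
qed (intro bo_mult bounded assms)

lemma minus_mem: "x : A ==> y : A ==> (%v. x v - y v) : A" using plus_mem[OF _ scaleC_mem[of y "-1"]] by simp

lemma scaleR_mem: "x : A ==> (%v. c *r x v) : A" using scaleC_mem[of x "of_real c"] by (simp add: scaleC_of_real)

text \<open>These are the ranges of the projections of \<open>A\<close>, described by invariance
  under the commutant.\<close>

definition reducing :: "'h set => bool" where "reducing K <-> closed K & csubspace K & (ALL b : commutant A. b ` K <= K)"

lemma redD: assumes "reducing K"
 shows "closed K" "csubspace K" "subspace K" "b : commutant A ==> v : K ==> b v : K"
 using assms by (auto simp: reducing_def csubspace_def)

lemma oproj_mem_algebra: assumes K: "reducing K" shows "oproj K : A"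
proof (rule memI)
 show "bop (oproj K)" using redD[OF K] by (intro bo_oproj)
 fix b v assume b: "b : commutant A"
 have "oproj K (b v) = b (oproj K v)" by (rule oproj_commute[OF redD(1)[OF K] redD(3)[OF K], of b "adj b"])
   (use b commutant_adj[OF b] commutant_bo[OF b] redD(4)[OF K] in
    "auto simp: adj_inner bo_linear bounded_linear.linear")
 thus "b (oproj K v) = oproj K (b v)" by simp
qed

lemma red_range: assumes "is_projection e" "e : A" shows "reducing (range e)"
 using isp_eq_oproj[OF assms(1)] commutantD[OF _ assms(2)] by (auto simp: reducing_def)

lemma red_UNIV: "reducing UNIV" and red_zero: "reducing {0}"
 by (auto simp: reducing_def csubspace_def subspace_def commutant_bo bo_zero)

lemma red_Int: "reducing K ==> reducing L ==> reducing (K Int L)" unfolding reducing_def by (auto simp: csubspace_Int) (blast+)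

lemma red_INT: "(!!n. reducing (K n)) ==> reducing (INT n. K n)" unfolding reducing_def csubspace_def
 by (auto intro!: subspace_Inter) blast

lemma red_perp: assumes "reducing K" shows "reducing (K\<bottom>)" unfolding reducing_def
proof (intro conjI ballI closed_perp csubspace_perp redD[OF assms])
 fix b assume b: "b : commutant A"
 have "inner (b x) y = 0" if "x : K\<bottom>" "y : K" for x y
  using adj_inner[OF commutant_bo[OF b], of x y] redD(4)[OF assms commutant_adj[OF b] that(2)] that(1) by (simp add: perp_iff)
 thus "b ` (K\<bottom>) <= K\<bottom>" by (auto simp: perp_iff)
qed

lemma red_kernel: assumes "x : A" shows "reducing {v. x v = 0}"
proof -
 have "x (b v) = 0" if "b : commutant A" "x v = 0" for b v
  using commutantD[OF that(1) assms, of v] that bo_zero[OF commutant_bo[OF that(1)]] by simp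
 thus ?thesis unfolding reducing_def by (auto simp: closed_kernel csubspace_kernel bounded assms)
qed

lemma red_closure_range: assumes "x : A" shows "reducing (closure (range x))"
proof -
 have "closure (range x) = {v. adj x v = 0}\<bottom>"
  using closure_range_adj[OF bo_adj[OF bounded[OF assms]]] adj_adj[OF bounded[OF assms]] by simp
 thus ?thesis by (simp add: red_perp red_kernel adj_mem assms)
qed

lemma red_vimage: assumes K: "reducing K" and x: "x : A" shows "reducing (x -` K)"
proof -
 have "x -` K = {v. (oproj (K\<bottom>) o x) v = 0}"
  using redD[OF K] by (auto simp: oproj_comp oproj_id dest: oproj_mem[of K] simp flip: oproj_eq_iff[of K])
 thus ?thesis by (simp add: red_kernel comp_mem oproj_mem_algebra red_perp K x del: comp_apply)
qed

lemma commuting_invariant_reducing: assumes "X : A" "closed L" "csubspace L"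
  and "!!b. bop b ==> (ALL v. b (X v) = X (b v)) ==> b ` L <= L"
 shows "reducing L" unfolding reducing_def using assms commutantD commutant_bo by metis

lemma sqrt_mem: assumes "X : A" "posop X"
 obtains r where "r : A" "posop r" "r o r = X"
  "!!b v. bop b ==> (ALL v. b (X v) = X (b v)) ==> b (r v) = r (b v)"
proof -
 obtain r where r: "posop r" "r o r = X"
  "!!b v. bop b ==> (ALL v. b (X v) = X (b v)) ==> b (r v) = r (b v)" using positive_sqrt_exists[OF assms(2)] by blast
 moreover have "r : A" by (rule memI[OF posop_bounded[OF r(1)] r(3)[OF commutant_bo]]) (auto intro: commutantD[OF _ assms(1)])
 ultimately show thesis using that by blast
qed


text \<open>These are entries of the characteristic matrix of a closed operator, the projection onto
  its graph. Being bounded elements of \<open>A\<close>, they bring unbounded affiliated graphs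
  within reach of the dimension theory.\<close>

lemma oproj_graph_mem: assumes G: "closed G" "linear_graph G" "affiliated A G"
 shows "(%u. fst (oproj G (u, 0))) : A" "(%v. fst (oproj G (0, v))) : A"
proof -
 note sG = lg_subspace[OF G(2)]
 interpret P: bounded_linear "oproj G" by (rule bounded_linear_oproj[OF G(1) sG])
 have inv: "(b u, b v) : G" if "b : commutant A" "(u, v) : G" for b u v using G(3) that unfolding affiliated_def by auto
 have comm: "oproj G (b u, b v) = (b (fst (oproj G (u, v))), b (snd (oproj G (u, v))))" if b: "b : commutant A" for b u v
 proof -
  note bb = commutant_bo[OF b]
  have "oproj G ((%p. (b (fst p), b (snd p))) (u, v)) = (%p. (b (fst p), b (snd p))) (oproj G (u, v))"
   by (rule oproj_commute[OF G(1) sG, of _ "%p. (adj b (fst p), adj b (snd p))"]) (use inv[OF b] inv[OF commutant_adj[OF b]] in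
     "auto simp: linear_iff bo_simps[OF bb] adj_inner[OF bb]")
  thus ?thesis by simp
 qed
 have i: "oproj G (\<i> *c u, \<i> *c v) = (\<i> *c fst (oproj G (u, v)), \<i> *c snd (oproj G (u, v)))" for u v
 proof -
  have g: "(c *c u, c *c v) : G" if "(u, v) : G" for c u v using lg_scaleC[OF G(2) that] .
  have "oproj G ((%p. (\<i> *c fst p, \<i> *c snd p)) (u, v)) = (%p. (\<i> *c fst p, \<i> *c snd p)) (oproj G (u, v))"
   by (rule oproj_commute[OF G(1) sG, of _ "%p. ((- \<i>) *c fst p, (- \<i>) *c snd p)"])
    (use g[of _ _ \<i>] g[of _ _ "- \<i>"] in
     "auto simp: linear_iff scaleC_add_right scaleC_scaleR inner_scaleC_left")
  thus ?thesis by simp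
 qed
 have bl: "bop (%u. fst (oproj G (u, 0)))" "bop (%v. fst (oproj G (0, v)))" using i[of _ 0] i[of 0]
  by (auto intro!: boI bounded_linear_compose[OF bounded_linear_fst]
    bounded_linear_compose[OF P.bounded_linear_axioms] bounded_linear_Pair bounded_linear_ident bounded_linear_zero)
 show "(%u. fst (oproj G (u, 0))) : A" by (rule memI[OF bl(1)]) (use comm[of _ _ 0] commutant_bo bo_zero in fastforce)
 show "(%v. fst (oproj G (0, v))) : A" by (rule memI[OF bl(2)]) (use comm[of _ 0] commutant_bo bo_zero in fastforce)
qed

end

section \<open>The dimension function of a trace\<close>

locale weighted = von_neumann A for A :: "'h::complex_hilbert operator set" +
 fixes \<tau> :: "'h operator => ennreal" assumes fns: "fns_weight A \<tau>"
begin

lemma pos_part_iff: "x : pos_part A <-> x : A & posop x" by (auto simp: pos_part_def)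

lemma tau_plus: assumes "x : pos_part A" "y : pos_part A" shows "\<tau> (%v. x v + y v) = \<tau> x + \<tau> y"
 using fns assms unfolding fns_weight_def weight_def by auto

lemma tau_scale: assumes "x : pos_part A" "c >= 0" shows "\<tau> (%v. c *r x v) = ennreal c * \<tau> x"
 using fns assms unfolding fns_weight_def weight_def by auto

lemma pos_part_plus: "x : pos_part A ==> y : pos_part A ==> (%v. x v + y v) : pos_part A"
 by (auto simp: pos_part_iff posop_plus plus_mem)

lemma pos_part_scale: "x : pos_part A ==> c >= 0 ==> (%v. c *r x v) : pos_part A"
 by (auto simp: pos_part_iff posop_mult scaleR_mem)

lemma zero_pos_part: "(%v. 0) : pos_part A" by (auto simp: pos_part_iff zero_mem posop_iff bo_0)

lemma tau_zero [simp]: "\<tau> (%v. 0) = 0" using tau_scale[OF zero_pos_part, of 0] by simp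

lemma tau_mono: assumes x: "x : pos_part A" and y: "y : pos_part A" and le: "!!v. inner v (x v) <= inner v (y v)"
 shows "\<tau> x <= \<tau> y"
proof -
 have "posop (%v. y v - x v)" using x y le op_le_iff[of x y] by (auto simp: pos_part_iff op_le_def)
 hence d: "(%v. y v - x v) : pos_part A" using x y by (auto simp: pos_part_iff minus_mem)
 have "\<tau> y = \<tau> (%v. x v + (y v - x v))" by simp
 also have "... = \<tau> x + \<tau> (%v. y v - x v)" by (rule tau_plus[OF x d])
 finally show ?thesis by simp
qed

text \<open>Normality is stated for directed sets with a least upper bound; a sequence that
  increases to \<open>y\<close> in the sense of quadratic forms is such a set.\<close>

lemma tau_sup: assumes x: "!!n. x n : pos_part A" and y: "y : pos_part A"
  and inc: "!!n v. inner v (x n v) <= inner v (x (Suc n) v)" and lim: "!!v. (%n. inner v (x n v)) ----> inner v (y v)"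
 shows "\<tau> y = (SUP n. \<tau> (x n))"
proof -
 have mono: "inner v (x m v) <= inner v (x n v)" if "m <= n" for m n v
  using that by (induction n rule: dec_induct) (auto intro: order_trans inc)
 have ole: "op_le a b <-> (ALL v. inner v (a v) <= inner v (b v))" if "a : pos_part A" "b : pos_part A" for a b
  using that op_le_iff by (auto simp: pos_part_iff)
 have "normal_weight A \<tau>" using fns by (simp add: fns_weight_def)
 moreover have "ALL a : range x. ALL b : range x. EX c : range x. op_le a c & op_le b c"
 proof clarify
  fix m n
  show "EX c : range x. op_le (x m) c & op_le (x n) c" by (rule bexI[of _ "x (max m n)"]) (auto simp: ole x intro: mono)
 qed
 moreover have "ALL a : range x. op_le a y"
 proof -
  have "inner v (x n v) <= inner v (y v)" for n v by (rule LIMSEQ_le_const[OF lim]) (use mono in blast)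
  thus ?thesis by (auto simp: ole x y)
 qed
 moreover have "op_le y z" if z: "z : pos_part A" "ALL a : range x. op_le a z" for z
  using LIMSEQ_le_const2[OF lim] z by (auto simp: ole x y)
 ultimately have "\<tau> y = (SUP a\<in>range x. \<tau> a)"
  unfolding normal_weight_def using x y by (elim allE[of _ "range x"] allE[of _ y]) (auto simp: image_subset_iff)
 thus ?thesis by (simp add: image_image)
qed

definition dim :: "'h set => ennreal" where "dim K = \<tau> (oproj K)"

abbreviation codim :: "'h set => ennreal" where "codim K == dim (K\<bottom>)"

lemma oproj_pos_part: assumes "reducing K" shows "oproj K : pos_part A" unfolding pos_part_iff posop_iff
 using oproj_mem_algebra[OF assms] bounded inner_oproj_self[OF redD(1,3)[OF assms]]
  oproj_sym[OF redD(1,3)[OF assms]] by (auto simp: inner_commute)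

lemma dim_mono: assumes "reducing K" "reducing L" "K <= L" shows "dim K <= dim L" unfolding dim_def
proof (intro tau_mono oproj_pos_part assms)
 fix v
 note K = redD(1,3)[OF assms(1)] and L = redD(1,3)[OF assms(2)]
 have "oproj K v = oproj K (oproj L v)"
 proof (rule oproj_eqI[OF K(2) oproj_mem[OF K]])
  have "v - oproj L v : K\<bottom>" using oproj_diff[OF L] orthogonal_comp_anti_mono[OF assms(3)] by blast
  thus "v - oproj K (oproj L v) : K\<bottom>"
   using subspace_add[OF subspace_orthogonal_comp _ oproj_diff[OF K, of "oproj L v"], of "v - oproj L v"] by simp
 qed
 hence "norm (oproj K v) <= norm (oproj L v)" using norm_oproj_le[OF K] by metis
 thus "inner v (oproj K v) <= inner v (oproj L v)"
  using inner_oproj_self[OF K, of v] inner_oproj_self[OF L, of v] by (simp add: inner_commute power_mono)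
qed

lemma dim_eq_0: assumes K: "reducing K" and "dim K = 0" shows "K = {0}"
proof -
 have "oproj K = (%v. 0)" using fns assms oproj_pos_part[OF K] unfolding fns_weight_def faithful_weight_def dim_def by auto
 thus ?thesis using range_oproj[OF redD(1,3)[OF K]] by auto
qed

lemma dim_zero [simp]: "dim {0} = 0"
proof -
 have "oproj {0} = (%v::'h. 0)" using oproj_mem[of "{0::'h}"] by (auto simp: subspace_single_0 fun_eq_iff)
 thus ?thesis by (simp add: dim_def)
qed

lemma dim_perp_comp: "reducing K ==> codim (K\<bottom>) = dim K" using perp_comp[OF redD(1,3)] by metis

lemma oproj_split:
 fixes K L :: "'h set" assumes "reducing K" "reducing L" "K <= L"
 shows "oproj L v = oproj K v + oproj (L Int K\<bottom>) v"
proof (rule oproj_eqI[OF redD(3)[OF assms(2)]])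
 note K = redD(1,3)[OF assms(1)] and L = redD(1,3)[OF assms(2)]
 note M = redD(1,3)[OF red_Int[OF assms(2) red_perp[OF assms(1)]]]
 show "oproj K v + oproj (L Int K\<bottom>) v : L"
  using oproj_mem[OF K, of v] oproj_mem[OF M, of v] assms(3) by (auto intro: subspace_add[OF L(2)])
 have "inner (v - (oproj K v + oproj (L Int K\<bottom>) v)) y = 0" if y: "y : L" for y
 proof -
  define a where "a = oproj K y"
  have aK: "a : K" by (simp add: a_def oproj_mem[OF K])
  have bM: "y - a : L Int K\<bottom>"
   using oproj_diff[OF K, of y] subspace_diff[OF L(2) y, of a] aK assms(3) by (auto simp: a_def)
  have "inner (v - oproj K v) a = 0" "inner (oproj (L Int K\<bottom>) v) a = 0"
   using oproj_diff[OF K, of v] oproj_mem[OF M, of v] aK by (auto simp: perp_iff)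
  moreover have "inner (v - oproj (L Int K\<bottom>) v) (y - a) = 0" using oproj_diff[OF M, of v] bM by (auto simp: perp_iff)
  moreover have "inner (oproj K v) (y - a) = 0" using oproj_mem[OF K, of v] bM by (auto simp: perp_iff inner_commute)
  ultimately show ?thesis by (simp add: inner_sums)
 qed
 thus "v - (oproj K v + oproj (L Int K\<bottom>) v) : L\<bottom>" by (simp add: perp_iff)
qed

lemma dim_split: assumes "reducing K" "reducing L" "K <= L"
 shows "dim L = dim K + dim (L Int K\<bottom>)"
proof -
 have "oproj L = (%v. oproj K v + oproj (L Int K\<bottom>) v)" using oproj_split[OF assms] by auto
 thus ?thesis unfolding dim_def using tau_plus[OF oproj_pos_part oproj_pos_part] assms by (simp add: red_Int red_perp)
qed

text \<open>Chebyshev's inequality: \<open>X\<close> dominates \<open>k\<close> times the projection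
  onto \<open>L\<bottom>\<close>. The invariance clause is used for operators of which
  \<open>X\<close> is a polynomial.\<close>

lemma weight_cut: assumes X: "X : pos_part A" and k: "k > 0"
 obtains L where "reducing L" "!!b. bop b ==> (ALL v. b (X v) = X (b v)) ==> b ` L <= L"
  "!!v. v : L ==> inner v (X v) <= k * (norm v)^2" "ennreal k * codim L <= \<tau> X"
proof -
 have X': "X : A" "posop X" using X by (auto simp: pos_part_iff)
 note bX = posop_bounded[OF X'(2)] and sX = posop_sym[OF X'(2)]
 obtain L where L: "closed L" "csubspace L"
  "!!b. bop b ==> (ALL v. b (X v) = X (b v)) ==> b ` L <= L"
  "!!v. v : L ==> inner v (X v) <= k * (norm v)^2"
  "!!v. v : L\<bottom> ==> k * (norm v)^2 <= inner v (X v)" using spectral_cut[OF bX sX, of k] by blast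
 have rL: "reducing L" by (rule commuting_invariant_reducing[OF X'(1) L(1-3)])
 note L' = redD(1,3)[OF rL] and rLo = red_perp[OF rL]
 have XL: "X v : L" if "v : L" for v using L(3)[OF bX] that by auto
 have "inner v (k *r oproj (L\<bottom>) v) <= inner v (X v)" for v
 proof -
  define a b where "a = oproj L v" and "b = oproj (L\<bottom>) v"
  have v: "v = a + b" by (simp add: a_def b_def oproj_comp[OF L'])
  have aL: "a : L" and bL: "b : L\<bottom>" unfolding a_def b_def by (intro oproj_mem L' redD[OF rLo])+
  have "inner b (X a) = 0" using bL XL[OF aL] by (auto simp: perp_iff)
  moreover have "inner a (X b) = 0" using calculation sX[of b a] sX[of a b] by (simp add: inner_commute)
  ultimately have "inner v (X v) = inner a (X a) + inner b (X b)" by (simp add: v bo_add[OF bX] inner_sums)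
  moreover have "inner v b = (norm b)^2" using inner_oproj_self[OF redD(1,3)[OF rLo], of v] by (simp add: b_def inner_commute)
  ultimately show ?thesis using L(5)[OF bL] posop_nonneg[OF X'(2), of a] by (simp add: b_def)
 qed
 hence "\<tau> (%v. k *r oproj (L\<bottom>) v) <= \<tau> X" using k by (intro tau_mono pos_part_scale oproj_pos_part rLo X) auto
 hence "ennreal k * codim L <= \<tau> X" using k by (simp add: tau_scale oproj_pos_part rLo dim_def)
 thus thesis using that rL L by blast
qed

end

section \<open>Dimension theory under a trace\<close>

locale tracial = weighted A \<tau> for A :: "'h::complex_hilbert operator set" and \<tau> +
 assumes trace: "a : A ==> \<tau> (adj a o a) = \<tau> (a o adj a)"
begin

lemma dim_support: assumes s: "s : A" "posop s" and k: "k > 0" "!!v. inner v (s v) <= k * (norm v)^2"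
 shows "(%v. s (gsum k s n v)) : pos_part A" "codim {v. s v = 0} = (SUP n. \<tau> (%v. s (gsum k s n v)))"
proof -
 have A: "gsum k s n : A" for n by (rule memI[OF posop_bounded[OF posop_gsum[OF s(2) k]] gsum_commute[OF s(2) k commutant_bo]])
   (auto intro: commutantD[OF _ s(1)])
 show p: "(%v. s (gsum k s n v)) : pos_part A" for n
  using comp_mem[OF s(1) A] posop_support[OF s(2) k] by (simp add: pos_part_iff o_def)
 show "codim {v. s v = 0} = (SUP n. \<tau> (%v. s (gsum k s n v)))" unfolding dim_def
  by (intro tau_sup oproj_pos_part red_perp red_kernel s p support_mono[OF s(2) k] tendsto_intros support_lim[OF s(2) k])
qed

text \<open>Left and right supports are compared through the approximants of the supports of
  \<open>s\<close> and \<open>t\<close>: with \<open>r\<close> the square root of the polynomial in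
  \<open>t\<close>, the trace property for \<open>r o x\<close> shows that corresponding
  approximants have equal trace.\<close>

lemma dim_kernel_range: assumes x: "x : A" shows "codim {v. x v = 0} = dim (closure (range x))"
proof -
 define s t where "s = adj x o x" and "t = x o adj x"
 note bx = bounded[OF x] and ax = adj_mem[OF x]
 have st: "s : A" "posop s" "t : A" "posop t"
  using posop_adj_comp[OF bx] posop_comp_adj[OF bx] comp_mem[OF ax x] comp_mem[OF x ax] by (auto simp: s_def t_def)
 obtain k1 k2 where k: "k1 > 0" "!!v. inner v (s v) <= k1 * (norm v)^2" "k2 > 0" "!!v. inner v (t v) <= k2 * (norm v)^2"
  using posop_bound st by metis
 \<comment> \<open>The polynomials depend on the bound, so \<open>s\<close> and \<open>t\<close>
   need a common one.\<close>
 define k where "k = k1 + k2"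
 have "k > 0" "inner v (s v) <= k * (norm v)^2" "inner v (t v) <= k * (norm v)^2" for v
  using k(1,3) k(2)[of v] k(4)[of v] by (auto simp: k_def distrib_right add_increasing add_increasing2)
 note ks = this(1,2) and kt = this(1,3)
 have xs: "x (s v) = t (x v)" "adj x (x v) = s v" "x (adj x v) = t v" for v by (simp_all add: s_def t_def)
 have "\<tau> (%v. s (gsum k s n v)) = \<tau> (%v. t (gsum k t n v))" for n
 proof -
  have i: "x (gsum k s n v) = gsum k t n (x v)" for v by (induction n) (auto simp: bo_simps[OF bx] xs)
  have "gsum k t n : A" by (rule memI[OF posop_bounded[OF posop_gsum[OF st(4) kt]] gsum_commute[OF st(4) kt commutant_bo]])
    (auto intro: commutantD[OF _ st(3)])
  then obtain r where r: "r : A" "posop r" "r o r = gsum k t n"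
   "!!b v. bop b ==> ALL v. b (gsum k t n v) = gsum k t n (b v) ==> b (r v) = r (b v)"
   using sqrt_mem[OF _ posop_gsum[OF st(4) kt, of n]] by metis
  have ar: "adj r = r" using adj_eqI[OF bounded[OF r(1)], of r] posop_sym[OF r(2)] by simp
  have rr: "r (r v) = gsum k t n v" for v using r(3) by (metis o_apply)
  have "t (r v) = r (t v)" for v by (rule r(4)[OF bounded[OF st(3)]]) (simp add: gsum_commute[OF st(4) kt bounded[OF st(3)]])
  hence "(r o x) o adj (r o x) = (%v. t (gsum k t n v))"
   by (auto simp: adj_comp[OF bounded[OF r(1)] bx] ar xs rr `!!v. t (r v) = r (t v)` gsum_commute[OF st(4) kt bounded[OF st(3)]])
  moreover have "adj (r o x) o (r o x) = (%v. s (gsum k s n v))"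
   by (auto simp: adj_comp[OF bounded[OF r(1)] bx] ar xs rr i[symmetric])
  ultimately show ?thesis using trace[OF comp_mem[OF r(1) x]] by simp
 qed
 hence "codim {v. s v = 0} = codim {v. t v = 0}" by (simp add: dim_support(2)[OF st(1,2) ks] dim_support(2)[OF st(3,4) kt])
 moreover have "{v. s v = 0} = {v. x v = 0}" "{v. t v = 0} = {v. adj x v = 0}"
  using adj_inner[OF bx] adj_inner'[OF bx] bo_zero[OF bx] bo_zero[OF bounded[OF ax]] unfolding s_def t_def
  by (auto; metis inner_eq_zero_iff inner_zero_right)+
 moreover have "{v. adj x v = 0}\<bottom> = closure (range x)"
  using closure_range_adj[OF bounded[OF ax]] by (simp add: adj_adj[OF bx])
 ultimately show ?thesis by simp
qed

text \<open>The preimage is the kernel of \<open>x\<close> followed by the projection onto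
  \<open>K\<bottom>\<close>; the right support of this operator has the dimension of its left
  support, which lies in \<open>K\<bottom>\<close>. All domain estimates for products rest on
  this.\<close>

lemma codim_vimage: assumes K: "reducing K" and x: "x : A" shows "codim (x -` K) <= codim K"
proof -
 note K' = redD(1,3)[OF K] and Ko = red_perp[OF K]
 have eq: "x -` K = {v. (oproj (K\<bottom>) o x) v = 0}"
  using K' by (auto simp: oproj_comp oproj_id dest: oproj_mem[of K] simp flip: oproj_eq_iff[of K])
 have y: "oproj (K\<bottom>) o x : A" by (intro comp_mem oproj_mem_algebra Ko x)
 have "range (oproj (K\<bottom>) o x) <= K\<bottom>" using oproj_mem[OF redD(1,3)[OF Ko]] by auto
 hence "closure (range (oproj (K\<bottom>) o x)) <= K\<bottom>" by (rule closure_minimal[OF _ closed_perp])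
 thus ?thesis unfolding eq dim_kernel_range[OF y] by (intro dim_mono red_closure_range y Ko)
qed

text \<open>The part \<open>M\<close> of \<open>K\<close> orthogonal to \<open>K Int L\<close> meets
  \<open>L\<close> trivially, so the preimage of \<open>L\<close> under the projection onto
  \<open>M\<close> is \<open>M\<bottom>\<close>, and \<open>codim_vimage\<close> bounds the
  dimension of \<open>M\<close> by the codimension of \<open>L\<close>.\<close>

lemma codim_Int: assumes K: "reducing K" and L: "reducing L" shows "codim (K Int L) <= codim K + codim L"
proof -
 define N where "N = (K Int L)\<bottom>"
 have N: "reducing N" unfolding N_def by (intro red_perp red_Int K L)
 have KN: "K\<bottom> <= N" unfolding N_def by (intro orthogonal_comp_anti_mono) auto
 define M where "M = N Int K\<bottom>\<bottom>"
 have M: "reducing M" unfolding M_def by (intro red_Int N red_perp K)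
 have "M Int L <= {0}"
 proof
  fix v assume "v : M Int L"
  hence "v : K Int L" "v : N" using perp_comp[OF redD(1,3)[OF K]] by (auto simp: M_def)
  hence "inner v v = 0" unfolding N_def perp_iff by blast
  thus "v : {0}" by simp
 qed
 hence "oproj M -` L = M\<bottom>" using oproj_mem[OF redD(1,3)[OF M]] oproj_diff[OF redD(1,3)[OF M]]
   oproj_zero[OF redD(1,3)[OF M]] subspace_0[OF redD(3)[OF L]] by (auto; metis IntI diff_zero singletonD subsetD)
 hence "dim M = codim (oproj M -` L)" using dim_perp_comp[OF M] by simp
 also have "... <= codim L" by (intro codim_vimage L oproj_mem_algebra M)
 finally have "dim M <= codim L" .
 thus ?thesis using dim_split[OF red_perp[OF K] N KN] unfolding M_def[symmetric] N_def[symmetric] by (simp add: add_left_mono)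
qed

text \<open>The projections onto the complements of the finite intersections increase to the one for
  the whole intersection, and normality passes the finite estimate to the limit.\<close>

lemma codim_INT: assumes L: "!!n. reducing (L n)" shows "codim (INT n. L n) <= (\<Sum>n. codim (L n))"
proof -
 define K where "K n = (INT k<=n. L k)" for n :: nat
 have KS: "K (Suc n) = K n Int L (Suc n)" and K0: "K 0 = L 0" for n by (auto simp: K_def atMost_Suc)
 have K: "reducing (K n)" for n by (induction n) (auto simp: K0 KS L red_Int)
 note K' = redD(1,3)[OF K] and Ko = red_perp[OF K]
 have cK: "codim (K n) <= (SUM k<Suc n. codim (L k))" for n
 proof (induction n)
  case (Suc n)
  thus ?case unfolding KS using order_trans[OF codim_Int[OF K L] add_right_mono[OF Suc]] by simp
 qed (simp add: K0)
 define Q where "Q n = oproj ((K n)\<bottom>)" for n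
 have Qp: "Q n : pos_part A" for n unfolding Q_def by (rule oproj_pos_part[OF Ko])
 have decK: "K (Suc n) <= K n" for n by (auto simp: KS)
 have incQ: "inner v (Q n v) <= inner v (Q (Suc n) v)" for n v
 proof -
  have "oproj ((K (Suc n))\<bottom>) v = oproj ((K n)\<bottom>) v + oproj ((K (Suc n))\<bottom> Int (K n)\<bottom>\<bottom>) v"
   by (intro oproj_split Ko orthogonal_comp_anti_mono decK)
  thus ?thesis using posop_nonneg[of "oproj ((K (Suc n))\<bottom> Int (K n)\<bottom>\<bottom>)" v]
    oproj_pos_part[of "(K (Suc n))\<bottom> Int (K n)\<bottom>\<bottom>"]
   by (simp add: Q_def inner_add_right pos_part_iff red_Int red_perp K)
 qed
 have Q1: "inner v (Q n v) <= 1 * (norm v)^2" for n v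
  using inner_oproj_self[OF redD(1,3)[OF Ko], of n v] norm_oproj_le[OF redD(1,3)[OF Ko], of n v]
  by (simp add: Q_def inner_commute power_mono)
 obtain x where x: "posop x" "!!v. (%n. Q n v) ----> x v"
  using incseq_positive_operators_converge[of Q 1] Qp incQ Q1 by (auto simp: pos_part_iff)
 define J where "J = (INT n. L n)"
 have J: "reducing J" unfolding J_def by (intro red_INT L)
 have JK: "J = (INT n. K n)" by (auto simp: J_def K_def)
 have xJ: "x v = oproj (J\<bottom>) v" for v
 proof (rule oproj_eqI[OF subspace_orthogonal_comp, symmetric])
  have "Q n v : J\<bottom>" for n
   using oproj_mem[OF redD(1,3)[OF Ko]] orthogonal_comp_anti_mono[of J "K n"] JK by (auto simp: Q_def)
  thus "x v : J\<bottom>" using closed_sequentially[OF closed_perp _ x(2)] by metis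
  have "v - x v : K m" for m
  proof (rule Lim_in_closed_set[OF K'(1) _ _ tendsto_diff[OF tendsto_const x(2)]])
   have "v - Q n v : K n" for n by (simp add: Q_def oproj_comp[OF K'] oproj_mem[OF K'])
   thus "\<forall>\<^sub>F n in sequentially. v - Q n v : K m" by (intro eventually_sequentiallyI[of m]) (force simp: K_def)
  qed simp
  hence "v - x v : J" by (auto simp: JK)
  thus "v - x v : J\<bottom>\<bottom>" using orthogonal_comp_subset by auto
 qed
 have "codim J = (SUP n. \<tau> (Q n))" unfolding dim_def
 proof (rule tau_sup)
  show "oproj (J\<bottom>) : pos_part A" by (intro oproj_pos_part red_perp J)
  show "(%n. inner v (Q n v)) ----> inner v (oproj (J\<bottom>) v)" for v
   using tendsto_inner[OF tendsto_const x(2)] by (simp add: xJ)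
 qed (intro Qp incQ)+
 also have "... <= (\<Sum>n. codim (L n))"
 proof (rule SUP_least)
  show "\<tau> (Q n) <= (\<Sum>n. codim (L n))" for n
   using order_trans[OF cK[of n] sum_le_suminf[OF summableI]] by (simp add: Q_def dim_def)
 qed
 finally show ?thesis by (simp add: J_def)
qed


text \<open>The substitute for "almost everywhere". Such sets are stable under finite intersections
  and preimages, and measurable operators that agree on one of them are equal.\<close>

definition tdense :: "'h set => bool" where "tdense D <-> (ALL dl>0. EX K. reducing K & K <= D & codim K <= ennreal dl)"

lemma tdD: assumes "tdense D" "dl > 0" obtains K where "reducing K" "K <= D" "codim K <= ennreal dl"
 using assms unfolding tdense_def by blast

lemma td_UNIV: "tdense UNIV" unfolding tdense_def by (auto intro!: exI[of _ UNIV] red_UNIV)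

lemma td_mono: "tdense D ==> D <= D' ==> tdense D'" unfolding tdense_def by blast

lemma td_Int: assumes "tdense D" "tdense D'" shows "tdense (D Int D')" unfolding tdense_def
proof (intro allI impI)
 fix dl :: real assume "dl > 0"
 then obtain K L where K: "reducing K" "K <= D" "codim K <= ennreal (dl/2)"
  and L: "reducing L" "L <= D'" "codim L <= ennreal (dl/2)" using assms by (metis half_gt_zero tdD)
 have "codim (K Int L) <= ennreal (dl/2) + ennreal (dl/2)"
  by (rule order_trans[OF codim_Int[OF K(1) L(1)] add_mono[OF K(3) L(3)]])
 also have "... = ennreal dl" using `dl > 0` by (simp flip: ennreal_plus)
 finally show "EX K. reducing K & K <= D Int D' & codim K <= ennreal dl"
  using K L by (intro exI[of _ "K Int L"]) (auto intro: red_Int)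
qed

lemma ennreal_zero_if_small: "(!!dl::real. dl > 0 ==> (x::ennreal) <= ennreal dl) ==> x = 0"
 by (metis ennreal_le_epsilon add_0 le_zero_eq zero_less_iff_neq_zero)

text \<open>A vector orthogonal to \<open>D\<close> lies in the complements of all the
  \<open>K n\<close>, whose intersection has dimension 0; faithfulness of the trace makes it
  trivial.\<close>

lemma dense_if_tau_dense: assumes D: "tdense D" "subspace D" shows "closure D = UNIV"
proof (rule dense_if_perp[OF D(2)])
 have "ALL n. EX K. reducing K & K <= D & codim K <= ennreal (1 / real (Suc n))" using D(1) unfolding tdense_def by simp
 then obtain K where K: "!!n. reducing (K n)" "!!n. K n <= D" "!!n. codim (K n) <= ennreal (1 / real (Suc n))" by metis
 define N where "N = (INT n. (K n)\<bottom>)"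
 have N: "reducing N" unfolding N_def by (intro red_INT red_perp K)
 have "dim N <= ennreal (1 / real (Suc n))" for n
  by (rule order_trans[OF dim_mono[OF N red_perp[OF K(1)[of n]]] K(3)]) (auto simp: N_def)
 hence "dim N <= ennreal dl" if "dl > 0" for dl using nat_approx_posE[OF that] by (metis ennreal_leI less_imp_le order_trans)
 hence "N = {0}" by (intro dim_eq_0[OF N] ennreal_zero_if_small)
 moreover have "D\<bottom> <= N" using orthogonal_comp_anti_mono[OF K(2)] by (auto simp: N_def)
 ultimately show "x = 0" if "x : D\<bottom>" for x using that by auto
qed

end

section \<open>Measurable operators\<close>

lemma affiliatedD: "affiliated A T ==> b : commutant A ==> (u, v) : T ==> (b u, b v) : T" unfolding affiliated_def by auto

lemma affiliatedI: "(!!b u v. b : commutant A ==> (u, v) : T ==> (b u, b v) : T) ==> affiliated A T"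
 unfolding affiliated_def by auto

lemma lg_Int: "linear_graph S ==> linear_graph T ==> linear_graph (S Int T)"
 unfolding linear_graph_def by (auto intro: subspace_inter)

lemma lg_perp: assumes "linear_graph T" shows "linear_graph (T\<bottom>)" unfolding linear_graph_def
proof (intro conjI subspace_orthogonal_comp ballI, clarify)
 fix u v assume uv: "(u, v) : T\<bottom>"
 have "inner (\<i> *c u, \<i> *c v) (x, y) = 0" if "(x, y) : T" for x y
  using uv lg_scaleC[OF assms that, of \<i>] by (auto simp: perp_iff inner_i_left)
 thus "(\<i> *c u, \<i> *c v) : T\<bottom>" by (auto simp: perp_iff)
qed

section \<open>Graphs affiliated with the algebra\<close>

context von_neumann
begin

lemma affiliated_perp: assumes "affiliated A T" shows "affiliated A (T\<bottom>)"
proof (rule affiliatedI)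
 fix b u v assume b: "b : commutant A" and uv: "(u, v) : T\<bottom>"
 have "inner (b u, b v) (x, y) = 0" if "(x, y) : T" for x y using uv affiliatedD[OF assms commutant_adj[OF b] that]
  by (auto simp: perp_iff adj_inner[OF commutant_bo[OF b]])
 thus "(b u, b v) : T\<bottom>" by (auto simp: perp_iff)
qed

lemma affiliated_closure: assumes "affiliated A T" shows "affiliated A (closure T)"
proof (rule affiliatedI)
 fix b u v assume b: "b : commutant A" and uv: "(u, v) : closure T"
 obtain X where X: "!!n. X n : T" "X ----> (u, v)" using uv unfolding closure_sequential by auto
 have "(%n. (b (fst (X n)), b (snd (X n)))) ----> (b (fst (u, v)), b (snd (u, v)))"
  by (intro tendsto_Pair bo_tendsto[OF commutant_bo[OF b]] tendsto_fst tendsto_snd X)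
 moreover have "(b (fst (X n)), b (snd (X n))) : T" for n
  using affiliatedD[OF assms b, of "fst (X n)" "snd (X n)"] X(1)[of n] by simp
 ultimately show "(b u, b v) : closure T" unfolding closure_sequential by fastforce
qed

lemma affiliated_adj_graph: assumes "affiliated A T" "linear_graph T" shows "affiliated A (adjg T)"
proof (rule affiliatedI)
 fix b u v assume b: "b : commutant A" and uv: "(u, v) : adjg T"
 have "(b v, b (- u)) : T\<bottom>"
  by (rule affiliatedD[OF affiliated_perp[OF assms(1)] b]) (use uv adj_graph_orthogonal[OF assms(2)] in auto)
 thus "(b u, b v) : adjg T" using adj_graph_orthogonal[OF assms(2)] by (simp add: bo_minus[OF commutant_bo[OF b]])
qed

lemma affiliated_op_graph: "x : A ==> affiliated A (op_graph x)" using commutantD by (intro affiliatedI) simp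

text \<open>By the closed graph theorem.\<close>

lemma bounded_on_reducing: assumes T: "linear_graph T" "closed T" "single_valued T" "affiliated A T"
  and K: "reducing K" "K <= Domain T"
 shows "gop T o oproj K : A"
proof (rule memI)
 note K' = redD(1,3)[OF K(1)]
 note bP = bounded[OF oproj_mem_algebra[OF K(1)]]
 have in_T: "(oproj K u, gop T (oproj K u)) : T" for u using graph_op_mem[OF T(3)] oproj_mem[OF K'] K(2) by blast
 have eq: "gop T (oproj K u) = w" if "(oproj K u, w) : T" for u w using graph_op_eq[OF T(3) that] .
 have lin: "linear (gop T o oproj K)"
 proof (rule linearI)
  show "(gop T o oproj K) (u + v) = (gop T o oproj K) u + (gop T o oproj K) v" for u v
   using lg_add[OF T(1) in_T[of u] in_T[of v]] by (auto simp: bo_add[OF bP, symmetric] intro!: eq)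
  show "(gop T o oproj K) (c *r u) = c *r (gop T o oproj K) u" for c u using lg_scaleC[OF T(1) in_T[of u], of "of_real c"]
   by (auto simp: bo_scaleR[OF bP, symmetric] scaleC_of_real intro!: eq)
 qed
 have "{(u, (gop T o oproj K) u) |u. True} = (%p. (oproj K (fst p), snd p)) -` T" using in_T eq by auto
 hence "closed {(u, (gop T o oproj K) u) |u. True}"
  using T(2) by (auto intro!: closed_vimage continuous_intros bo_continuous[OF bP])
 hence "bounded_linear (gop T o oproj K)" by (rule closed_graph_bounded_linear[OF lin])
 thus "bop (gop T o oproj K)"
 proof (rule boI)
  show "(gop T o oproj K) (\<i> *c u) = \<i> *c (gop T o oproj K) u" for u
   using lg_scaleC[OF T(1) in_T[of u], of "\<i>"] by (auto simp: bo_scaleC[OF bP, symmetric] intro!: eq)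
 qed
 fix b u assume b: "b : commutant A"
 have "(oproj K (b u), b (gop T (oproj K u))) : T"
  using affiliatedD[OF T(4) b in_T[of u]] by (simp add: commutantD[OF b oproj_mem_algebra[OF K(1)]])
 thus "b ((gop T o oproj K) u) = (gop T o oproj K) (b u)" using eq by auto
qed

end

context tracial
begin

abbreviation meas :: "'h graph set" where "meas == measurable_operators A \<tau>"

lemma codim_range: assumes "is_projection e" shows "\<tau> (%v. v - e v) = codim (range e)"
proof -
 note e = isp_eq_oproj[OF assms]
 have "oproj ((range e)\<bottom>) = (%v. v - e v)" using oproj_comp[OF e(1), of] e by (auto simp: csubspace_def)
 thus ?thesis by (simp add: dim_def)
qed

lemma projection_iff_reducing:
 "(EX e : A. is_projection e & P (range e) & \<tau> (%v. v - e v) <= c) <-> (EX K. reducing K & P K & codim K <= c)"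
proof
 assume "EX K. reducing K & P K & codim K <= c"
 then obtain K where K: "reducing K" "P K" "codim K <= c" by blast
 thus "EX e : A. is_projection e & P (range e) & \<tau> (%v. v - e v) <= c"
  using isp_oproj[OF redD(1,2)[OF K(1)]] range_oproj[OF redD(1,3)[OF K(1)]]
  by (intro bexI[of _ "oproj K"] oproj_mem_algebra) (auto simp: codim_range)
qed (use codim_range red_range in force)

lemma meas_iff:
 "a : meas <-> linear_graph a & single_valued a & closed a & affiliated A a & tdense (Domain a)"
proof -
 have "a : meas <-> closed_densely_defined a & affiliated A a & tdense (Domain a)"
  unfolding measurable_operators_def tdense_def using projection_iff_reducing[of "%K. K <= Domain a"] by auto
 thus ?thesis using dense_if_tau_dense csubspace_Domain by (auto simp: closed_densely_defined_iff csubspace_def)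
qed

lemma measD: assumes "a : meas"
 shows "linear_graph a" "single_valued a" "closed a" "affiliated A a" "tdense (Domain a)"
  "v : Domain a ==> (v, gop a v) : a" "(v, w) : a ==> gop a v = w" using assms by (auto simp: meas_iff graph_op_eq)

lemma msv: "a : meas ==> (x, y) : a ==> (x, z) : a ==> y = z" using measD(2) by (auto dest: single_valuedD)

lemma op_graph_meas: "x : A ==> op_graph x : meas"
 by (auto simp: meas_iff lg_op_graph bounded closed_op_graph affiliated_op_graph single_valued_def td_UNIV)

text \<open>The part \<open>G\<close> of \<open>T\<close> orthogonal to \<open>S\<close> gives an
  element \<open>x\<close> of \<open>A\<close>, a corner of the projection onto \<open>G\<close>.
  For \<open>K\<close> inside the domain of \<open>S\<close> the preimage of \<open>K\<close> under
  \<open>x\<close> is already its kernel, so the kernel has codimension 0 and \<open>G\<close> is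
  trivial. This is what makes closures of sums and products canonical.\<close>

lemma closed_extension_unique: assumes S: "linear_graph S" "closed S" "affiliated A S" "tdense (Domain S)"
  and T: "linear_graph T" "closed T" "single_valued T" "affiliated A T" and sub: "S <= T"
 shows "S = T"
proof -
 define G where "G = T Int S\<bottom>"
 have G: "linear_graph G" "closed G" "affiliated A G" unfolding G_def using S T
  by (auto intro!: lg_Int lg_perp closed_Int closed_perp affiliatedI
    dest: affiliatedD affiliatedD[OF affiliated_perp])
 note sG = lg_subspace[OF G(1)] and sS = lg_subspace[OF S(1)]
 note P = oproj_mem[OF G(2) sG]
 define x where "x u = fst (oproj G (u, 0))" for u
 have xA: "x : A" unfolding x_def by (rule oproj_graph_mem(1)[OF G(2,1,3)])
 have x0: "x u = 0" if K: "reducing K" "K <= Domain S" and xK: "x u : K" for K u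
 proof -
  have 1: "oproj G (u, 0) : T" "oproj G (u, 0) : S\<bottom>" using P[of "(u,0)"] by (auto simp: G_def)
  obtain w where w: "(x u, w) : S" using K xK by blast
  have "(x u, snd (oproj G (u, 0))) : T" using 1 by (simp add: x_def)
  hence "snd (oproj G (u, 0)) = w" using w sub T(3) by (auto dest: single_valuedD)
  hence "oproj G (u, 0) : S" using w unfolding x_def by (metis prod.collapse)
  hence "inner (oproj G (u, 0)) (oproj G (u, 0)) = 0" using 1(2) by (auto simp: perp_iff)
  thus ?thesis by (simp add: x_def)
 qed
 have "codim {u. x u = 0} <= ennreal dl" if d: "dl > 0" for dl
 proof -
  obtain K where K: "reducing K" "K <= Domain S" "codim K <= ennreal dl" using tdD[OF S(4) d] .
  have "{u. x u = 0} = x -` K" using x0[OF K(1,2)] subspace_0[OF redD(3)[OF K(1)]] by auto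
  thus ?thesis using codim_vimage[OF K(1) xA] K(3) by simp
 qed
 hence "{u. x u = 0}\<bottom> = {0}" by (intro dim_eq_0 ennreal_zero_if_small red_perp red_kernel xA)
 hence xz: "x u = 0" for u using perp_comp[OF redD(1,3)[OF red_kernel[OF xA]]] by auto
 have "p = 0" if p: "p : G" for p
 proof -
  have "inner (oproj G (fst p, 0)) (fst p, 0) = inner (x (fst p)) (fst p)" by (simp add: x_def inner_prod_def)
  hence "oproj G (fst p, 0) = 0" using xz inner_oproj_self[OF G(2) sG, of "(fst p, 0)"] by simp
  hence "inner (fst p, 0) p = 0" using oproj_diff[OF G(2) sG, of "(fst p, 0)"] p by (auto simp: perp_iff)
  hence "fst p = 0" by (simp add: inner_prod_def)
  moreover have "snd p = 0" using calculation p lg_0[OF T(1)] T(3) by (cases p) (auto simp: G_def dest: single_valuedD)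
  ultimately show ?thesis by (simp add: prod_eq_iff)
 qed
 moreover have "p - oproj S p : G" if "p : T" for p
  using oproj_diff[OF S(2) sS, of p] subsetD[OF sub oproj_mem[OF S(2) sS, of p]] that
   subspace_diff[OF lg_subspace[OF T(1)]] by (simp add: G_def)
 ultimately have "p : S" if "p : T" for p using that oproj_mem[OF S(2) sS, of p] by fastforce
 thus ?thesis using sub by blast
qed

lemma meas_subgraph_eq: assumes "T : meas" "S <= T" "linear_graph S" "closed S" "affiliated A S" "tdense (Domain S)"
 shows "S = T" by (rule closed_extension_unique) (use assms measD[OF assms(1)] in auto)

text \<open>Identities between strong sums and products are checked through this, on a common
  tau-dense domain where the closures are invisible.\<close>

lemma meas_eqI: assumes a: "a : meas" and b: "b : meas" and D: "tdense D" "D <= Domain (a Int b)"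
 shows "a = b"
proof -
 note Sab = lg_Int[OF measD(1)[OF a] measD(1)[OF b]]
 have aff: "affiliated A (a Int b)" by (rule affiliatedI) (auto intro: affiliatedD measD(4)[OF a] measD(4)[OF b])
 have "a Int b = a" by (rule meas_subgraph_eq[OF a]) (auto intro!: Sab aff td_mono[OF D] closed_Int measD(3)[OF a] measD(3)[OF b])
 moreover have "a Int b = b"
  by (rule meas_subgraph_eq[OF b]) (auto intro!: Sab aff td_mono[OF D] closed_Int measD(3)[OF a] measD(3)[OF b])
 ultimately show ?thesis by simp
qed

text \<open>On a reducing part of its domain \<open>a\<close> is a bounded element of
  \<open>A\<close>, along which \<open>L\<close> can be pulled back without increasing its
  codimension.\<close>

lemma td_pullback: assumes a: "a : meas" and D: "tdense D"
 shows "tdense {v. EX w : D. (v, w) : a}" unfolding tdense_def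
proof (intro allI impI)
 fix dl :: real assume "dl > 0"
 then obtain K L where K: "reducing K" "K <= Domain a" "codim K <= ennreal (dl/2)"
  and L: "reducing L" "L <= D" "codim L <= ennreal (dl/2)" using measD(5)[OF a] D by (metis half_gt_zero tdD)
 define x where "x = gop a o oproj K"
 have x: "x : A" unfolding x_def by (intro bounded_on_reducing measD[OF a] K)
 have "codim (K Int x -` L) <= ennreal (dl/2) + ennreal (dl/2)"
  using codim_Int[OF K(1) red_vimage[OF L(1) x]] codim_vimage[OF L(1) x] K(3) L(3) by (meson add_mono order_trans)
 also have "... = ennreal dl" using `dl > 0` by (simp flip: ennreal_plus)
 finally have "codim (K Int x -` L) <= ennreal dl" .
 moreover have "K Int x -` L <= {v. EX w : D. (v, w) : a}"
 proof
  fix v assume v: "v : K Int x -` L"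
  hence "gop a v : D" using L(2) oproj_id[OF redD(1,3)[OF K(1)], of v] by (auto simp: x_def)
  moreover have "(v, gop a v) : a" using v K(2) measD(6)[OF a] by blast
  ultimately show "v : {v. EX w : D. (v, w) : a}" by blast
 qed
 ultimately show "EX K. reducing K & K <= {v. EX w : D. (v, w) : a} & codim K <= ennreal dl"
  by (intro exI[of _ "K Int x -` L"]) (auto intro: red_Int red_vimage K L x)
qed

text \<open>\<open>L\<close> is the orthogonal complement of \<open>T(K\<^sup>\<bottom> \<inter> dom T)\<close>; its codimension is that of the kernel of
  an off-diagonal entry of the projection onto the graph of \<open>T\<close> restricted to \<open>K\<^sup>\<bottom>\<close>.\<close>

lemma adjoint_cut: assumes T: "linear_graph T" "closed T" "single_valued T" "affiliated A T" and K: "reducing K" "K <= Domain T"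
 obtains L where "reducing L" "codim L <= codim K" "L <= Domain (adjg T)"
  "!!u v w. v : L ==> (u, w) : T ==> inner v w = inner v (gop T (oproj K u))"
proof -
 note K' = redD(1,3)[OF K(1)] and Ko = red_perp[OF K(1)]
 define G where "G = {(u, v). (u, v) : T & u : K\<bottom>}"
 have lG: "linear_graph G" unfolding G_def using linear_graphD[OF T(1)] csubspaceD[OF redD(2)[OF Ko]] by (intro lgI) auto
 have "G = T Int fst -` (K\<bottom>)" by (auto simp: G_def)
 hence cG: "closed G" using T(2) by (auto intro!: closed_Int closed_vimage closed_perp continuous_intros)
 have aG: "affiliated A G" unfolding G_def by (rule affiliatedI) (auto intro: affiliatedD[OF T(4)] redD(4)[OF Ko])
 note sG = lg_subspace[OF lG]
 define x where "x v = fst (oproj G (0, v))" for v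
 have xA: "x : A" unfolding x_def by (rule oproj_graph_mem(2)[OF cG lG aG])
 define L where "L = {v. x v = 0}"
 have rL: "reducing L" unfolding L_def by (rule red_kernel[OF xA])
 have "x v : K\<bottom>" for v using oproj_mem[OF cG sG, of "(0, v)"] by (cases "oproj G (0, v)") (auto simp: x_def G_def)
 hence "range x <= K\<bottom>" by blast
 hence "closure (range x) <= K\<bottom>" by (rule closure_minimal[OF _ closed_perp])
 hence codim: "codim L <= codim K" unfolding L_def dim_kernel_range[OF xA] by (intro dim_mono red_closure_range xA Ko)
 have perp: "inner v w = 0" if v: "v : L" and uw: "(u, w) : G" for u v w
 proof -
  have "(0, snd (oproj G (0, v))) : T"
   using oproj_mem[OF cG sG, of "(0, v)"] v by (cases "oproj G (0, v)") (auto simp: L_def x_def G_def)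
  hence "snd (oproj G (0, v)) = 0" using lg_0[OF T(1)] T(3) by (auto dest: single_valuedD)
  hence "oproj G (0, v) = 0" using v by (simp add: L_def x_def prod_eq_iff)
  thus ?thesis using oproj_diff[OF cG sG, of "(0, v)"] uw by (auto simp: perp_iff)
 qed
 have TK: "(oproj K u, gop T (oproj K u)) : T" for u using graph_op_mem[OF T(3)] oproj_mem[OF K'] K(2) by blast
 have eq: "inner v w = inner v (gop T (oproj K u))" if "v : L" "(u, w) : T" for u v w
 proof -
  have "(u - oproj K u, w - gop T (oproj K u)) : G"
   using lg_diff[OF T(1) that(2) TK[of u]] oproj_diff[OF K', of u] by (simp add: G_def)
  from perp[OF that(1) this] show ?thesis by (simp add: inner_diff_right)
 qed
 have bx: "bop (gop T o oproj K)" by (intro bounded bounded_on_reducing T K)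
 have "L <= Domain (adjg T)"
 proof
  fix v assume v: "v : L"
  have "(v, adj (gop T o oproj K) v) : adjg T"
   unfolding adj_graph_iff[OF T(1)] using eq[OF v] adj_inner[OF bx] by (auto simp: inner_commute)
  thus "v : Domain (adjg T)" by blast
 qed
 with that rL codim eq show thesis by blast
qed

lemma td_Domain_adj: assumes "a : meas" shows "tdense (Domain (adjg a))" unfolding tdense_def
proof (intro allI impI)
 fix dl :: real assume "dl > 0"
 then obtain K where K: "reducing K" "K <= Domain a" "codim K <= ennreal dl" using measD(5)[OF assms] by (metis tdD)
 obtain L where "reducing L" "codim L <= codim K" "L <= Domain (adjg a)"
  using adjoint_cut[OF measD(1,3,2,4)[OF assms] K(1,2)] by metis
 thus "EX K. reducing K & K <= Domain (adjg a) & codim K <= ennreal dl" using K(3) order_trans by blast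
qed

lemma meas_adj: assumes "a : meas" shows "adjg a : meas"
proof -
 have "closure (Domain a) = UNIV"
  using dense_if_tau_dense[OF measD(5)[OF assms]] csubspace_Domain[OF measD(1)[OF assms]] by (simp add: csubspace_def)
 thus ?thesis unfolding meas_iff using measD[OF assms] td_Domain_adj[OF assms]
  by (simp add: lg_adj closed_adj_graph affiliated_adj_graph single_valued_adj_graph)
qed

text \<open>The double adjoint is the closure, and it is single valued as soon as the adjoint has a
  dense domain.\<close>

lemma meas_closureI: assumes T: "linear_graph T" "affiliated A T" "tdense (Domain T)" and D: "tdense D" "D <= Domain (adjg T)"
 shows "closure T : meas"
proof -
 have "tdense (Domain (adjg T))" by (rule td_mono[OF D])
 hence "closure (Domain (adjg T)) = UNIV"
  using dense_if_tau_dense csubspace_Domain[OF lg_adj[OF T(1)]] by (simp add: csubspace_def)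
 hence "single_valued (closure T)" using single_valued_adj_graph adj_adj_graph[OF T(1)] by metis
 moreover have "tdense (Domain (closure T))" by (rule td_mono[OF T(3)]) (use closure_subset in blast)
 ultimately show ?thesis unfolding meas_iff using T by (simp add: lg_closure affiliated_closure)
qed

section \<open>Strong sums, products and multiples\<close>

lemma assumes a: "a : meas" and b: "b : meas"
 shows meas_strong_sum: "strong_sum a b : meas" and strong_sum_mem: "(x, y) : a ==> (x, z) : b ==> (x, y + z) : strong_sum a b"
proof -
 let ?T = "{(x, y + z) | x y z. (x, y) : a & (x, z) : b}"
 have lT: "linear_graph ?T"
 proof (rule lgI)
  show "(0, 0) : ?T" using lg_0[OF measD(1)[OF a]] lg_0[OF measD(1)[OF b]] by force
  show "(u + u', v + v') : ?T" if uv: "(u, v) : ?T" "(u', v') : ?T" for u v u' v'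
  proof -
   obtain y z y' z' where "(u, y) : a" "(u, z) : b" "v = y + z" "(u', y') : a" "(u', z') : b" "v' = y' + z'" using uv by blast
   hence "(u + u', y + y') : a" "(u + u', z + z') : b" "v + v' = (y + y') + (z + z')"
    using lg_add[OF measD(1)[OF a]] lg_add[OF measD(1)[OF b]] by auto
   thus ?thesis by blast
  qed
  show "(c *c u, c *c v) : ?T" if "(u, v) : ?T" for c u v
   using that lg_scaleC[OF measD(1)[OF a]] lg_scaleC[OF measD(1)[OF b]] by (fastforce simp: scaleC_add_right)
 qed
 have "affiliated A ?T"
 proof (rule affiliatedI)
  fix c u v assume c: "c : commutant A" and "(u, v) : ?T"
  then obtain y z where "(u, y) : a" "(u, z) : b" "v = y + z" by blast
  hence "(c u, c y) : a" "(c u, c z) : b" "c v = c y + c z"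
   using affiliatedD[OF measD(4)[OF a] c] affiliatedD[OF measD(4)[OF b] c] by (auto simp: bo_add[OF commutant_bo[OF c]])
  thus "(c u, c v) : ?T" by blast
 qed
 moreover have "tdense (Domain ?T)" by (rule td_mono[OF td_Int[OF measD(5)[OF a] measD(5)[OF b]]]) blast
 \<comment> \<open>The adjoint of the sum extends the sum of the adjoints, which supplies the
   tau-dense domain that closability asks for.\<close>
 moreover have "Domain (adjg a) Int Domain (adjg b) <= Domain (adjg ?T)"
 proof clarify
  fix u v w assume uv: "(u, v) : adjg a" and uw: "(u, w) : adjg b"
  have "inner (y + z) u = inner x (v + w)" if "(x, y) : a" "(x, z) : b" for x y z
   using adj_graph_inner[OF uv that(1)] adj_graph_inner[OF uw that(2)] by (simp add: inner_sums)
  hence "(u, v + w) : adjg ?T" unfolding adj_graph_iff[OF lT] by blast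
  thus "u : Domain (adjg ?T)" by blast
 qed
 ultimately show "strong_sum a b : meas" unfolding strong_sum_def
  by (intro meas_closureI[OF lT _ _ td_Int[OF td_Domain_adj[OF a] td_Domain_adj[OF b]]])
 show "(x, y + z) : strong_sum a b" if "(x, y) : a" "(x, z) : b"
  unfolding strong_sum_def using that closure_subset[of ?T] by blast
qed

lemma assumes a: "a : meas" and b: "b : meas"
 shows meas_strong_prod: "strong_prod a b : meas" and strong_prod_mem: "(x, y) : b ==> (y, z) : a ==> (x, z) : strong_prod a b"
proof -
 let ?T = "{(x, z) | x y z. (x, y) : b & (y, z) : a}"
 have lT: "linear_graph ?T"
 proof (rule lgI)
  show "(0, 0) : ?T" using lg_0[OF measD(1)[OF a]] lg_0[OF measD(1)[OF b]] by force
  show "(u + u', v + v') : ?T" if uv: "(u, v) : ?T" "(u', v') : ?T" for u v u' v'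
  proof -
   obtain y y' where "(u, y) : b" "(y, v) : a" "(u', y') : b" "(y', v') : a" using uv by blast
   hence "(u + u', y + y') : b" "(y + y', v + v') : a" using lg_add[OF measD(1)[OF a]] lg_add[OF measD(1)[OF b]] by auto
   thus ?thesis by blast
  qed
  show "(c *c u, c *c v) : ?T" if "(u, v) : ?T" for c u v
   using that lg_scaleC[OF measD(1)[OF a]] lg_scaleC[OF measD(1)[OF b]] by blast
 qed
 have "affiliated A ?T" using affiliatedD[OF measD(4)[OF a]] affiliatedD[OF measD(4)[OF b]] by (intro affiliatedI) blast
 moreover have "tdense (Domain ?T)" by (rule td_mono[OF td_pullback[OF b measD(5)[OF a]]]) blast
 \<comment> \<open>Likewise the adjoint of the product extends the product of the adjoints in
   reverse order.\<close>
 moreover have "{u. EX v : Domain (adjg b). (u, v) : adjg a} <= Domain (adjg ?T)"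
 proof clarify
  fix u v w assume "(u, v) : adjg a" "(v, w) : adjg b"
  hence "(u, w) : adjg ?T" unfolding adj_graph_def by fastforce
  thus "u : Domain (adjg ?T)" by blast
 qed
 ultimately show "strong_prod a b : meas" unfolding strong_prod_def
  by (intro meas_closureI[OF lT _ _ td_pullback[OF meas_adj[OF a] td_Domain_adj[OF b]]])
 show "(x, z) : strong_prod a b" if "(x, y) : b" "(y, z) : a" unfolding strong_prod_def using that closure_subset[of ?T] by blast
qed

lemma strong_scale_prod: "strong_scale c a = strong_prod (op_graph (%v. c *c v)) a"
 unfolding strong_scale_def strong_prod_def op_graph_def by (rule arg_cong[of _ _ closure]) auto

lemma meas_strong_scale: "a : meas ==> strong_scale c a : meas"
 unfolding strong_scale_prod by (intro meas_strong_prod op_graph_meas scaleC_mem id_mem)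

lemma strong_scale_mem: "a : meas ==> (x, y) : a ==> (x, c *c y) : strong_scale c a" unfolding strong_scale_prod
 by (rule strong_prod_mem[OF op_graph_meas[OF scaleC_mem[OF id_mem]]]) (auto simp: op_graph_def)

lemma meas_strong_diff: "a : meas ==> b : meas ==> strong_diff a b : meas"
 by (simp add: strong_diff_def meas_strong_sum meas_strong_scale)

lemma strong_diff_mem:
 "a : meas ==> b : meas ==> (x, y) : a ==> (x, z) : b ==> (x, y - z) : strong_diff a b"
 using strong_sum_mem[OF _ meas_strong_scale[of b "-1"] _ strong_scale_mem[of b x z "-1"]] by (simp add: strong_diff_def)

subsection \<open>Neighbourhoods of zero\<close>

abbreviation nbhd :: "real => real => 'h graph set" where "nbhd == measure_nbhd A \<tau>"

lemma nbhd_iff: assumes "ep > 0"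
 shows "a : nbhd ep dl <-> a : meas & (EX K. reducing K & K <= Domain a &
  (ALL v w. v : K --> (v, w) : a --> norm w <= ep * norm v) & codim K <= ennreal dl)"
proof -
 have *: "(ALL v w. (e v, w) : a --> norm w <= ep * norm v) <->
   (ALL v w. v : range e --> (v, w) : a --> norm w <= ep * norm v)" if e: "is_projection e" for e
 proof (intro iffI allI impI)
  fix v w assume "ALL v w. (e v, w) : a --> norm w <= ep * norm v" "v : range e" "(v, w) : a"
  thus "norm w <= ep * norm v" using e by (metis imageE isp_iff)
 next
  fix v w assume "ALL v w. v : range e --> (v, w) : a --> norm w <= ep * norm v" "(e v, w) : a"
  hence "norm w <= ep * norm (e v)" by blast
  also have "norm (e v) <= norm v" using norm_oproj_le[of "range e" v] isp_eq_oproj[OF e] by (simp add: csubspace_def)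
  finally show "norm w <= ep * norm v" using assms by simp
 qed
 show ?thesis unfolding measure_nbhd_def
  using projection_iff_reducing[of "%K. K <= Domain a & (ALL v w. v : K --> (v, w) : a --> norm w <= ep * norm v)"]
  by (simp add: conj_assoc * cong: conj_cong)
qed

lemma nbhdE: assumes "a : nbhd ep dl" "ep > 0"
 obtains K where "reducing K" "K <= Domain a" "!!v w. v : K ==> (v, w) : a ==> norm w <= ep * norm v"
  "codim K <= ennreal dl" using assms by (auto simp: nbhd_iff)

lemma nbhd_meas: "a : nbhd ep dl ==> a : meas" by (simp add: measure_nbhd_def)

text \<open>The gap between \<open>c\<close> and \<open>dl\<close> pays for restricting to the
  tau-dense set \<open>D\<close>, where the estimate is known.\<close>

lemma nbhdI: assumes a: "a : meas" and D: "tdense D" and K: "reducing K" "codim K <= ennreal c" "0 <= c" "c < dl"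
  and le: "!!v. v : K ==> v : D ==> EX w. (v, w) : a & norm w <= ep * norm v" and "ep > 0"
 shows "a : nbhd ep dl"
proof -
 obtain L where L: "reducing L" "L <= D" "codim L <= ennreal (dl - c)" using tdD[OF D, of "dl - c"] K by auto
 have "codim (K Int L) <= ennreal c + ennreal (dl - c)" by (rule order_trans[OF codim_Int[OF K(1) L(1)] add_mono[OF K(2) L(3)]])
 hence "codim (K Int L) <= ennreal dl" using K by (simp flip: ennreal_plus)
 moreover have "K Int L <= Domain a" "v : K Int L ==> (v, w) : a ==> norm w <= ep * norm v" for v w
  using le L(2) measD(2)[OF a] by (blast, metis IntE single_valuedD subsetD)
 ultimately show ?thesis unfolding nbhd_iff[OF `ep > 0`] using a red_Int[OF K(1) L(1)] by blast
qed

lemma nbhd_strong_sum: assumes "a : nbhd ep dl" "b : nbhd ep' dl'" "ep > 0" "ep' > 0" "dl >= 0" "dl' >= 0"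
 shows "strong_sum a b : nbhd (ep + ep') (dl + dl')"
proof -
 note am = nbhd_meas[OF assms(1)] and bm = nbhd_meas[OF assms(2)]
 obtain K where K: "reducing K" "K <= Domain a" "!!v w. v : K ==> (v, w) : a ==> norm w <= ep * norm v"
  "codim K <= ennreal dl" using nbhdE[OF assms(1,3)] by metis
 obtain L where L: "reducing L" "L <= Domain b" "!!v w. v : L ==> (v, w) : b ==> norm w <= ep' * norm v"
  "codim L <= ennreal dl'" using nbhdE[OF assms(2,4)] by metis
 have "codim (K Int L) <= ennreal (dl + dl')"
  using order_trans[OF codim_Int[OF K(1) L(1)] add_mono[OF K(4) L(4)]] assms by (simp add: ennreal_plus)
 moreover have "EX w. (v, w) : strong_sum a b & norm w <= (ep + ep') * norm v" if v: "v : K Int L" for v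
 proof -
  obtain y z where yz: "(v, y) : a" "(v, z) : b" using v K(2) L(2) by blast
  have "norm (y + z) <= (ep + ep') * norm v"
   using norm_triangle_ineq[of y z] K(3)[OF _ yz(1)] L(3)[OF _ yz(2)] v by (simp add: distrib_right)
  thus ?thesis using strong_sum_mem[OF am bm yz] by blast
 qed
 ultimately show ?thesis using assms unfolding nbhd_iff[OF add_pos_pos[OF assms(3,4)]]
  by (intro conjI meas_strong_sum am bm exI[of _ "K Int L"] red_Int K L)
   (blast, metis measD(2)[OF meas_strong_sum[OF am bm]] single_valuedD)
qed

text \<open>Hausdorffness of the topology. Bounds \<open>1 / n\<close> on subspaces whose
  codimensions add up to \<open>dl\<close> leave a subspace of codimension at most \<open>dl\<close>
  on which \<open>a\<close> vanishes.\<close>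

lemma nbhd_trivial: assumes a: "a : meas" and "!!ep dl. ep > 0 ==> dl > 0 ==> a : nbhd ep dl"
 shows "a = op_graph (%v. 0)"
proof (rule meas_eqI[OF a op_graph_meas[OF zero_mem]])
 show "tdense {v. (v, 0) : a}" unfolding tdense_def
 proof (intro allI impI)
  fix dl :: real assume dl: "dl > 0"
  have "EX K. reducing K & K <= Domain a & (ALL v w. v : K --> (v, w) : a --> norm w <= (1 / real (Suc n)) * norm v) &
    codim K <= ennreal (dl * (1/2) ^ Suc n)" for n
   using assms(2)[of "1 / real (Suc n)" "dl * (1/2) ^ Suc n"] dl by (simp add: nbhd_iff del: of_nat_Suc power_Suc)
  then obtain K where K: "!!n. reducing (K n)" "!!n. K n <= Domain a"
   "!!n v w. v : K n ==> (v, w) : a ==> norm w <= (1 / real (Suc n)) * norm v"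
   "!!n. codim (K n) <= ennreal (dl * (1/2) ^ Suc n)" by metis
  have "(%n. dl * (1/2) ^ Suc n) sums (dl * 1)" by (intro sums_mult power_half_series)
  hence "(\<Sum>n. ennreal (dl * (1/2) ^ Suc n)) = ennreal dl" using dl by (intro suminf_ennreal_eq) auto
  moreover have "codim (INT n. K n) <= (\<Sum>n. ennreal (dl * (1/2) ^ Suc n))"
   by (rule order_trans[OF codim_INT[OF K(1)]]) (intro suminf_le K(4) summableI)
  moreover have "(v, 0) : a" if v: "v : (INT n. K n)" for v
  proof -
   obtain w where w: "(v, w) : a" using v K(2)[of 0] by blast
   have "(%n. (1 / real (Suc n)) * norm v) ----> 0 * norm v" by (intro tendsto_intros LIMSEQ_Suc lim_1_over_n)
   hence "norm w <= 0 * norm v" by (rule LIMSEQ_le_const) (use K(3)[OF _ w] v in auto)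
   thus ?thesis using w by simp
  qed
  ultimately show "EX K. reducing K & K <= {v. (v, 0) : a} & codim K <= ennreal dl"
   by (intro exI[of _ "INT n. K n"]) (auto intro: red_INT K(1))
 qed
qed auto

end

section \<open>Spectral integrals\<close>

text \<open>The sets in a list may overlap, so that adding step functions is appending lists and no
  common refinement is ever formed.\<close>

definition stf :: "(complex \<times> real set) list => real => complex" where "stf l u = (\<Sum>(c, B)\<leftarrow>l. c * ind B u)"

definition step_op :: "(real set => 'h::complex_hilbert operator) => (complex \<times> real set) list => 'h operator"
 where "step_op E l v = (\<Sum>(c, B)\<leftarrow>l. c *c E B v)"

definition step_list :: "(complex \<times> real set) list => bool" where "step_list l <-> (ALL (c, B) : set l. B : sets borel)"

lemma scaleC_minus_left [simp]: "(- c) *c (x::'a::complex_hilbert) = - (c *c x)" using scaleC_scaleC[of "-1" c x] by simp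

lemma stf_simps [simp]:
 "stf [] u = 0" "stf ((c, B) # l) u = c * ind B u + stf l u"
 "step_list []" "step_list ((c, B) # l) <-> B : sets borel & step_list l" by (auto simp: stf_def step_list_def)

lemma step_op_simps [simp]:
 "step_op E [] v = 0" "step_op E ((c, B) # l) v = c *c E B v + step_op E l v" by (auto simp: step_op_def)

lemma step_append [simp]:
 "stf (l @ l') u = stf l u + stf l' u"
 "step_op E (l @ l') v = step_op E l v + step_op E l' v"
 "step_list (l @ l') <-> step_list l & step_list l'" by (auto simp: stf_def step_op_def step_list_def)

lemma borel_measurable_cnj [measurable (raw)]:
 "f : borel_measurable M ==> (%x. cnj (f x)) : borel_measurable M"
 by (rule borel_measurable_continuous_on[OF continuous_on_cnj[OF continuous_on_id]])

lemma stf_meas: "step_list l ==> stf l : BM"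
proof (induction l)
 case Nil
 have "stf [] = (%u. 0)" by (rule ext) simp
 thus ?case by simp
next
 case (Cons p l)
 obtain c B where p: "p = (c, B)" by (cases p)
 have "stf (p # l) = (%u. c * ind B u + stf l u)" by (rule ext) (simp add: p)
 thus ?case using Cons by (auto simp: p intro!: borel_measurable_add borel_measurable_times borel_measurable_indicator)
qed

lemma stf_bounded: "EX C. ALL u. cmod (stf l u) <= C"
proof (induction l)
 case (Cons p l)
 obtain c B where p: "p = (c, B)" by (cases p)
 obtain C where "!!u. cmod (stf l u) <= C" using Cons by blast
 hence "cmod (stf (p # l) u) <= cmod c + C" for u
  unfolding p stf_simps by (intro norm_triangle_mono) (auto simp: norm_mult indicator_def)
 thus ?case by blast
qed (auto intro!: exI[of _ 0])

lemma step_approximation: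
 fixes g :: "real => complex" assumes "g : BM"
 obtains l where "!!n::nat. step_list (l n)" "!!u. (%n. stf (l n) u) ----> g u"
  "!!n u. cmod (stf (l n) u) <= 2 * cmod (g u)"
proof -
 from borel_measurable_implies_sequence_metric[OF assms, of 0]
 obtain F where F: "!!i. simple_function borel (F i)" "!!x. (%i. F i x) ----> g x"
  "!!i x. dist (F i x) 0 <= 2 * dist (g x) 0" by auto
 have "EX l. step_list l & stf l = F i" for i
 proof -
  have fin: "finite (range (F i))" using simple_functionD(1)[OF F(1)[of i]] by simp
  then obtain xs where xs: "set xs = range (F i)" "distinct xs" using finite_distinct_list by blast
  define l where "l = map (%y. (y, F i -` {y})) xs"
  have "F i -` {y} : sets borel" for y using simple_functionD(2)[OF F(1)[of i], of "{y}"] by simp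
  hence "step_list l" by (auto simp: step_list_def l_def)
  moreover have "stf l u = F i u" for u
  proof -
   have "stf l u = (SUM y : range (F i). y * ind (F i -` {y}) u)"
    unfolding stf_def l_def using xs by (simp add: sum_list_distinct_conv_sum_set o_def)
   also have "... = (SUM y : range (F i). if y = F i u then y else 0)" by (intro sum.cong) (auto simp: indicator_def)
   also have "... = F i u" using fin by (simp add: sum.delta')
   finally show ?thesis .
  qed
  ultimately show ?thesis by blast
 qed
 then obtain l where "!!i. step_list (l i)" "!!i. stf (l i) = F i" by metis
 thus thesis using F(2,3) by (intro that[of l]) auto
qed

section \<open>Spectral measures and their scalar measures\<close>

locale spectral =
 fixes E :: "real set => 'h::complex_hilbert operator" assumes spectral: "spectral_measure E"
begin

lemma projection: "B : sets borel ==> is_projection (E B)" using spectral by (auto simp: spectral_measure_def)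

lemma E_bounded: "B : sets borel ==> bop (E B)" using projection by (auto simp: isp_iff)

lemma E_idem: "B : sets borel ==> E B (E B v) = E B v"
 and E_sym: "B : sets borel ==> inner (E B u) v = inner u (E B v)" using projection by (auto simp: isp_iff)

lemma E_UNIV [simp]: "E UNIV v = v" using spectral by (auto simp: spectral_measure_def)

lemma E_sums:
 "(!!n::nat. B n : sets borel) ==> disjoint_family B ==> (%n. E (B n) v) sums E (UN n. B n) v"
 using spectral by (auto simp: spectral_measure_def)

lemma E_empty [simp]: "E {} v = 0"
proof -
 have "(%n::nat. E {} v) sums E (UN n::nat. {}) v" by (rule E_sums) (auto simp: disjoint_family_on_def)
 hence "(%n::nat. E {} v) ----> 0" by (intro summable_LIMSEQ_zero sums_summable)
 thus ?thesis by (simp add: LIMSEQ_const_iff)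
qed

lemma E_Un: assumes "B : sets borel" "C : sets borel" "B Int C = {}" shows "E (B Un C) v = E B v + E C v"
proof -
 define D where "D n = (if n = 0 then B else if n = 1 then C else {})" for n :: nat
 have "(%n. E (D n) v) sums E (UN n. D n) v" by (rule E_sums) (use assms in "auto simp: D_def disjoint_family_on_def")
 moreover have "(UN n. D n) = B Un C" by (auto simp: D_def split: if_splits)
 moreover have "(%n. E (D n) v) sums (SUM n : {0,1}. E (D n) v)" by (rule sums_finite) (auto simp: D_def)
 ultimately show ?thesis using sums_unique2 by (fastforce simp: D_def)
qed

text \<open>The sum of two projections can be a contraction only if they are orthogonal.
  Multiplicativity of \<open>E\<close> is deduced from this and additivity.\<close>

lemma E_disjoint: assumes "B : sets borel" "C : sets borel" "B Int C = {}" shows "E B (E C v) = 0"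
proof -
 define w where "w = E C v"
 have "E (B Un C) w = E B w + w" using E_Un[OF assms] E_idem[OF assms(2)] by (simp add: w_def)
 moreover have "inner w (E (B Un C) w) <= inner w w"
  using norm_oproj_le[of "range (E (B Un C))" w] inner_oproj_self[of "range (E (B Un C))" w]
   isp_eq_oproj[OF projection[of "B Un C"]] assms by (simp add: csubspace_def inner_commute norm_sq[symmetric] power_mono)
 ultimately have "inner w (E B w) <= 0" by (simp add: inner_add_right)
 hence "inner (E B w) (E B w) <= 0" using E_sym[OF assms(1), of w "E B w"] E_idem[OF assms(1)] by simp
 thus ?thesis by (metis w_def inner_gt_zero_iff not_le)
qed

lemma E_Int: assumes "B : sets borel" "C : sets borel" shows "E B (E C v) = E (B Int C) v"
proof -
 have "E B w = E (B Int C) w + E (B - C) w" for w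
  using E_Un[of "B Int C" "B - C" w] assms by (simp add: Int_Diff_Un Int_Diff_disjoint)
 moreover have "E (B - C) (E C v) = 0" by (rule E_disjoint) (use assms in auto)
 ultimately have 1: "E B (E C v) = E (B Int C) (E C v)" by simp
 have 2: "E C v = E (B Int C) v + E (C - B) v"
  using E_Un[of "B Int C" "C - B" v] assms by (simp add: Int_commute[of B] Int_Diff_Un Int_Diff_disjoint)
 have "E (B Int C) (E (C - B) v) = 0" by (rule E_disjoint) (use assms in auto)
 thus ?thesis using 1 E_idem[of "B Int C" v] assms unfolding 2 by (simp add: bo_add[OF E_bounded] sets.Int)
qed

lemma inner_E: "B : sets borel ==> inner v (E B v) = (norm (E B v))^2"
 using E_sym[of B v "E B v"] E_idem[of B v] by (simp add: norm_sq)

lemma E_cinner: "B : sets borel ==> cinner (E B u) v = cinner u (E B v)"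
 using adjoint_iff[of "E B" "E B"] E_bounded E_sym by blast

abbreviation mu :: "'h => real measure" where "mu v == smeas E v"

lemma sets_scalar [simp, measurable_cong]: "sets (mu v) = sets borel" and space_scalar [simp]: "space (mu v) = UNIV"
 using sets.sigma_sets_eq[of "borel :: real measure"] by (simp_all add: scalar_measure_def)

lemma em_scalar: assumes "B : sets borel" shows "emeasure (mu v) B = ennreal ((norm (E B v))^2)" unfolding scalar_measure_def
proof (rule emeasure_measure_of_sigma)
 show "sigma_algebra UNIV (sets borel)" using sets.sigma_algebra_axioms[of borel] by simp
 show "positive (sets borel) (%B. ennreal ((norm (E B v))^2))" by (auto simp: positive_def)
 show "countably_additive (sets borel) (%B. ennreal ((norm (E B v))^2))"
 proof (rule countably_additiveI)
  fix B :: "nat => real set" assume B: "range B <= sets borel" "disjoint_family B" "(UN i. B i) : sets borel"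
  have "(%n. inner v (E (B n) v)) sums inner v (E (UN n. B n) v)"
   by (rule bounded_linear.sums[OF bounded_linear_inner_right E_sums]) (use B in auto)
  hence "(%n. (norm (E (B n) v))^2) sums (norm (E (UN n. B n) v))^2" using B by (simp add: inner_E image_subset_iff)
  thus "(\<Sum>i. ennreal ((norm (E (B i) v))^2)) = ennreal ((norm (E (UN i. B i) v))^2)" by (intro suminf_ennreal_eq) auto
 qed
qed fact

lemma finite_scalar: "finite_measure (mu v)" by (rule finite_measureI) (simp add: em_scalar)

lemma measure_scalar: "B : sets borel ==> measure (mu v) B = (norm (E B v))^2" by (simp add: measure_def em_scalar)

lemma integrable_bounded:
 fixes f :: "real => 'b::{banach,second_countable_topology}" assumes "f : BM" "!!u. norm (f u) <= C"
 shows "integrable (mu v) f" by (rule finite_measure.integrable_const_bound[OF finite_scalar, of _ C]) (use assms in auto)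

lemma integrable_step_mult: "step_list l ==> step_list l' ==> integrable (mu v) (%u. cnj (stf l u) * stf l' u)"
proof -
 assume l: "step_list l" "step_list l'"
 obtain C C' where C: "!!u. cmod (stf l u) <= C" "!!u. cmod (stf l' u) <= C'" using stf_bounded by metis
 note [measurable] = stf_meas[OF l(1)] stf_meas[OF l(2)]
 show ?thesis
 proof (rule integrable_bounded[where C="C * C'"])
  show "cmod (cnj (stf l u) * stf l' u) <= C * C'" for u
   unfolding norm_mult complex_mod_cnj by (intro mult_mono C order_trans[OF norm_ge_zero C(1)]) auto
 qed measurable
qed

lemma integrable_indicator_step: assumes [measurable]: "B : sets borel" and l: "step_list l"
 shows "integrable (mu v) (%u. ind B u * stf l u)"
proof -
 obtain C where C: "!!u. cmod (stf l u) <= C" using stf_bounded by metis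
 note [measurable] = stf_meas[OF l]
 show ?thesis
 proof (rule integrable_bounded[where C=C])
  show "cmod (ind B u * stf l u) <= C" for u using C[of u] order_trans[OF norm_ge_zero C] by (auto simp: indicator_def)
 qed measurable
qed

lemma cinner_E_step: assumes "B : sets borel" "step_list l"
 shows "cinner (E B v) (step_op E l v) = (LINT u|mu v. ind B u * stf l u)" using assms(2)
proof (induction l)
 case (Cons p l)
 obtain c C where p: "p = (c, C)" by (cases p)
 have C: "C : sets borel" "step_list l" using Cons.prems by (auto simp: p)
 have "cinner (E B v) (E C v) = cinner v (E (B Int C) v)" using E_cinner[OF assms(1)] E_Int[OF assms(1) C(1)] by simp
 also have "... = of_real ((norm (E (B Int C) v))^2)"
  using E_cinner[of "B Int C" v "E (B Int C) v"] E_idem[of "B Int C" v] assms C cinner_self by (metis sets.Int)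
 also have "... = of_real (LINT u|mu v. ind (B Int C) u)" using assms C by (simp add: measure_scalar)
 also have "... = (LINT u|mu v. of_real (ind (B Int C) u))" by (rule integral_complex_of_real[symmetric])
 also have "... = (LINT u|mu v. ind (B Int C) u)" by (intro Bochner_Integration.integral_cong) (auto simp: indicator_def)
 finally have 1: "cinner (E B v) (c *c E C v) = (LINT u|mu v. c * ind (B Int C) u)" by (simp add: cinner_scaleC_right)
 have "(LINT u|mu v. ind B u * stf (p # l) u) = (LINT u|mu v. c * ind (B Int C) u + ind B u * stf l u)"
  by (intro Bochner_Integration.integral_cong) (auto simp: p indicator_def)
 also have "... = (LINT u|mu v. c * ind (B Int C) u) + (LINT u|mu v. ind B u * stf l u)"
  using assms C by (intro Bochner_Integration.integral_add integrable_indicator_step integrable_bounded[where C="cmod c"])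
   (auto simp: norm_mult indicator_def)
 finally show ?case using Cons.IH[OF C(2)] 1 by (simp add: p cinner_add_right)
qed simp

lemma cinner_step: assumes "step_list l" "step_list l'"
 shows "cinner (step_op E l v) (step_op E l' v) = (LINT u|mu v. cnj (stf l u) * stf l' u)" using assms(1)
proof (induction l)
 case (Cons p l)
 obtain c B where p: "p = (c, B)" by (cases p)
 have B: "B : sets borel" "step_list l" using Cons.prems by (auto simp: p)
 have "(LINT u|mu v. cnj (stf (p # l) u) * stf l' u) = (LINT u|mu v. cnj c * (ind B u * stf l' u) + cnj (stf l u) * stf l' u)"
  by (intro Bochner_Integration.integral_cong) (auto simp: p indicator_def algebra_simps)
 also have "... = cnj c * (LINT u|mu v. ind B u * stf l' u) + (LINT u|mu v. cnj (stf l u) * stf l' u)"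
  using B assms by (subst Bochner_Integration.integral_add) (auto intro: integrable_step_mult integrable_indicator_step)
 finally show ?case using Cons.IH[OF B(2)] cinner_E_step[OF B(1) assms(2)] by (simp add: p cinner_add_left cinner_scaleC_left)
qed simp

lemma step_neg:
 "stf (map (%(c, B). (- c, B)) l) u = - stf l u" "step_op E (map (%(c, B). (- c, B)) l) v = - step_op E l v"
 "step_list (map (%(c, B). (- c, B)) l) <-> step_list l" by (induction l) auto

lemma norm_step_diff: assumes "step_list l" "step_list l'"
 shows "(norm (step_op E l v - step_op E l' v))^2 = (LINT u|mu v. (cmod (stf l u - stf l' u))^2)"
proof -
 define m where "m = l @ map (%(c, B). (- c, B)) l'"
 have m: "step_list m" "stf m u = stf l u - stf l' u" "step_op E m v = step_op E l v - step_op E l' v" for u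
  using assms by (auto simp: m_def step_neg)
 have "complex_of_real ((norm (step_op E m v))^2) = (LINT u|mu v. cnj (stf m u) * stf m u)"
  by (simp only: cinner_step[OF m(1) m(1), symmetric] cinner_self)
 also have "... = (LINT u|mu v. complex_of_real ((cmod (stf m u))^2))" by (simp only: complex_norm_square mult.commute)
 also have "... = complex_of_real (LINT u|mu v. (cmod (stf m u))^2)" by (rule integral_complex_of_real)
 finally show ?thesis unfolding m of_real_eq_iff .
qed

section \<open>The spectral integral as a strong limit of step operators\<close>

lemma sdom_iff: assumes [measurable]: "g : BM"
 shows "v : sdom E g <-> integrable (mu v) (%u. (cmod (g u))^2)" by (simp add: spectral_domain_def integrable_iff_bounded)

definition L2lim :: "'h => (nat => (complex \<times> real set) list) => (real => complex) => bool"
 where "L2lim v l g <-> (ALL n. step_list (l n)) & (%n. \<integral>u. (cmod (stf (l n) u - g u))^2 \<partial>mu v) ----> 0"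

lemma norm_square_le:
 fixes x y :: "'a::real_inner"
 shows "(norm (x + y))^2 <= 2 * (norm x)^2 + 2 * (norm y)^2" "(norm (x - y))^2 <= 2 * (norm x)^2 + 2 * (norm y)^2"
 using zero_le_power2[of "norm (x - y)"] zero_le_power2[of "norm (x + y)"] by (simp_all add: norm_sq inner_sums inner_commute)

lemma integrable_square_diff:
 fixes f g :: "real => complex" assumes [measurable]: "f : BM" "g : BM"
  and i: "integrable (mu v) (%u. (cmod (f u))^2)" "integrable (mu v) (%u. (cmod (g u))^2)"
 shows "integrable (mu v) (%u. (cmod (f u - g u))^2)" "integrable (mu v) (%u. (cmod (f u + g u))^2)"
proof -
 have j: "integrable (mu v) (%u. 2 * (cmod (f u))^2 + 2 * (cmod (g u))^2)" using i by simp
 show "integrable (mu v) (%u. (cmod (f u - g u))^2)" "integrable (mu v) (%u. (cmod (f u + g u))^2)"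
  by (rule Bochner_Integration.integrable_bound[OF j]; auto simp: norm_square_le)+
qed

lemma integrable_square_step: "step_list l ==> integrable (mu v) (%u. (cmod (stf l u))^2)"
proof -
 assume l: "step_list l"
 obtain C where C: "!!u. cmod (stf l u) <= C" using stf_bounded by blast
 note [measurable] = stf_meas[OF l]
 show ?thesis
 proof (rule integrable_bounded[where C="C^2"])
  show "norm ((cmod (stf l u))^2) <= C^2" for u using C by (auto intro!: power_mono)
 qed measurable
qed

lemma L2lim_close: assumes g[measurable]: "g : BM" and v: "v : sdom E g" and l: "L2lim v l g" and l': "L2lim v l' g"
 shows "(norm (step_op E (l n) v - step_op E (l' m) v))^2 <=
  2 * (LINT u|mu v. (cmod (stf (l n) u - g u))^2) + 2 * (LINT u|mu v. (cmod (stf (l' m) u - g u))^2)"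
proof -
 have sl: "step_list (l n)" "step_list (l' m)" using l l' by (auto simp: L2lim_def)
 note [measurable] = stf_meas[OF sl(1)] stf_meas[OF sl(2)]
 have gi: "integrable (mu v) (%u. (cmod (g u))^2)" using v sdom_iff[OF g] by simp
 have *: "(cmod (x - y))^2 <= 2 * (cmod (x - z))^2 + 2 * (cmod (y - z))^2" for x y z :: complex
  using norm_square_le(2)[of "x - z" "y - z"] by simp
 have i: "integrable (mu v) (%u. (cmod (stf (l n) u - g u))^2)" "integrable (mu v) (%u. (cmod (stf (l' m) u - g u))^2)"
  by (rule integrable_square_diff; use sl gi in "auto intro: integrable_square_step")+
 have "(LINT u|mu v. (cmod (stf (l n) u - stf (l' m) u))^2)
   <= (LINT u|mu v. 2 * (cmod (stf (l n) u - g u))^2 + 2 * (cmod (stf (l' m) u - g u))^2)"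
  by (rule integral_mono) (use sl i * in "auto intro!: integrable_square_diff integrable_square_step")
 thus ?thesis unfolding norm_step_diff[OF sl] using i by simp
qed

lemma L2lim_convergent: assumes g: "g : BM" and v: "v : sdom E g" and l: "L2lim v l g"
 shows "convergent (%n. step_op E (l n) v)"
proof (rule Cauchy_convergent, rule metric_CauchyI)
 fix e :: real assume e: "e > 0"
 define d where "d n = (LINT u|mu v. (cmod (stf (l n) u - g u))^2)" for n
 have "d ----> 0" using l by (simp add: L2lim_def d_def[abs_def])
 hence "\<forall>\<^sub>F n in sequentially. d n < e^2 / 4" using e by (intro order_tendstoD) auto
 then obtain M where M: "!!n. n >= M ==> d n < e^2 / 4" by (auto simp: eventually_sequentially)
 have "dist (step_op E (l m) v) (step_op E (l n) v) < e" if "m >= M" "n >= M" for m n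
 proof (rule power2_less_imp_less)
  show "(dist (step_op E (l m) v) (step_op E (l n) v))^2 < e^2"
   using L2lim_close[OF g v l l, of m n] M[OF that(1)] M[OF that(2)] by (simp add: dist_norm d_def)
 qed (use e in simp)
 thus "EX M. ALL m>=M. ALL n>=M. dist (step_op E (l m) v) (step_op E (l n) v) < e" by blast
qed

lemma L2lim_dominated: assumes [measurable]: "g : BM" "f : BM" and v: "v : sdom E f" and l: "!!n::nat. step_list (l n)"
  and lim: "!!u. (%n. stf (l n) u) ----> g u" and b: "!!n u. cmod (stf (l n) u - g u) <= cmod (f u)"
 shows "L2lim v l g" unfolding L2lim_def
proof (intro conjI allI l)
 note [measurable] = stf_meas[OF l]
 have "(%n. \<integral>u. (cmod (stf (l n) u - g u))^2 \<partial>mu v) ----> (LINT u|mu v. 0)"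
 proof (rule integral_dominated_convergence[where w="%u. (cmod (f u))^2"])
  show "integrable (mu v) (%u. (cmod (f u))^2)" using v sdom_iff by simp
  have "(%n. (cmod (stf (l n) u - g u))^2) ----> (cmod (g u - g u))^2" for u by (intro tendsto_intros lim)
  thus "AE u in mu v. (%n. (cmod (stf (l n) u - g u))^2) ----> 0" by simp
 qed (use b in "auto intro!: power_mono")
 thus "(%n. \<integral>u. (cmod (stf (l n) u - g u))^2 \<partial>mu v) ----> 0" by simp
qed

text \<open>One sequence depends on \<open>g\<close> alone and serves every vector of the domain, so
  linearity of \<open>I g\<close> passes to the limit from the step operators.\<close>

definition approx :: "(real => complex) => nat => (complex \<times> real set) list"
 where "approx g = (SOME l. (ALL n. step_list (l n)) & (ALL u. (%n. stf (l n) u) ----> g u) &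
  (ALL n u. cmod (stf (l n) u) <= 2 * cmod (g u)))"

definition I :: "(real => complex) => 'h => 'h" where "I g v = lim (%n. step_op E (approx g n) v)"

lemma approx: assumes "g : BM"
 shows "step_list (approx g n)" "(%n. stf (approx g n) u) ----> g u"
  "cmod (stf (approx g n) u) <= 2 * cmod (g u)"
proof -
 have "EX l. (ALL n. step_list (l n)) & (ALL u. (%n. stf (l n) u) ----> g u) &
  (ALL n u. cmod (stf (l n) u) <= 2 * cmod (g u))" using step_approximation[OF assms] by metis
 from someI_ex[OF this] show "step_list (approx g n)" "(%n. stf (approx g n) u) ----> g u"
  "cmod (stf (approx g n) u) <= 2 * cmod (g u)" by (auto simp: approx_def)
qed

lemma sdom_mult: assumes [measurable]: "g : BM" "f : BM" and v: "v : sdom E g" and le: "!!u. cmod (f u) <= c * cmod (g u)"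
 shows "v : sdom E f"
proof -
 have "integrable (mu v) (%u. c^2 * (cmod (g u))^2)" using v by (simp add: sdom_iff)
 hence "integrable (mu v) (%u. (cmod (f u))^2)" by (rule Bochner_Integration.integrable_bound)
   (auto simp flip: power_mult_distrib intro!: power_mono le)
 thus ?thesis by (simp add: sdom_iff)
qed

lemma approx_L2lim: assumes [measurable]: "g : BM" and v: "v : sdom E g"
 shows "L2lim v (approx g) g"
proof (rule L2lim_dominated[where f="%u. 3 * g u"])
 show "v : sdom E (%u. 3 * g u)" by (rule sdom_mult[OF _ _ v, of _ 3]) (auto simp: norm_mult)
 show "cmod (stf (approx g n) u - g u) <= cmod (3 * g u)" for n u
  using norm_triangle_ineq4[of "stf (approx g n) u" "g u"] approx(3)[OF assms(1), of n u] by (simp add: norm_mult)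
qed (auto intro: approx)

lemma I_lim: assumes g: "g : BM" and v: "v : sdom E g" and l: "L2lim v l g"
 shows "(%n. step_op E (l n) v) ----> I g v"
proof -
 have a: "(%n. step_op E (approx g n) v) ----> I g v"
  unfolding I_def using L2lim_convergent[OF g v approx_L2lim[OF g v]] by (simp add: convergent_LIMSEQ_iff)
 define d where "d n = 2 * (LINT u|mu v. (cmod (stf (l n) u - g u))^2)
  + 2 * (LINT u|mu v. (cmod (stf (approx g n) u - g u))^2)" for n
 have "d ----> 2 * 0 + 2 * 0" unfolding d_def using l approx_L2lim[OF g v] by (intro tendsto_intros) (auto simp: L2lim_def)
 hence "(%n. sqrt (d n)) ----> sqrt 0" by (intro tendsto_intros) simp
 hence "(%n. step_op E (l n) v - step_op E (approx g n) v) ----> 0"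
 proof (rule Lim_null_comparison[rotated, OF tendsto_eq_rhs])
  show "\<forall>\<^sub>F n in sequentially. norm (step_op E (l n) v - step_op E (approx g n) v) <= sqrt (d n)"
   using L2lim_close[OF g v l approx_L2lim[OF g v]] by (intro always_eventually allI real_le_rsqrt) (simp add: d_def)
 qed simp
 from tendsto_add[OF this a] show ?thesis by simp
qed

lemma I_approx: assumes "g : BM" "v : sdom E g"
 shows "(%n. step_op E (approx g n) v) ----> I g v" by (rule I_lim[OF assms approx_L2lim[OF assms]])

text \<open>On Borel sets the measure of \<open>v + w\<close> is at most twice the sum of those of
  \<open>v\<close> and \<open>w\<close>; simple functions carry this over to the integrals.\<close>

lemma sdom_add: assumes [measurable]: "g : BM" and "v : sdom E g" "w : sdom E g"
 shows "v + w : sdom E g"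
proof -
 let ?f = "%u. ennreal ((cmod (g u))^2)"
 have ind: "emeasure (mu (v + w)) B <= 2 * emeasure (mu v) B + 2 * emeasure (mu w) B" if B: "B : sets borel" for B
  using ennreal_leI[OF norm_square_le(1)[of "E B v" "E B w"]] B
  by (simp add: em_scalar bo_add[OF E_bounded] ennreal_plus ennreal_mult)
 have "(nni (mu (v + w)) (%u. ?f u)) <= 2 * (nni (mu v) (%u. ?f u)) + 2 * (nni (mu w) (%u. ?f u))"
  unfolding nn_integral_def[of "mu (v + w)"]
 proof (rule SUP_least)
  fix s assume "s : {s. simple_function (mu (v + w)) s & s <= ?f}"
  hence s: "simple_function (mu x) s" "s <= ?f" for x using simple_function_cong_algebra[of "mu x" "mu (v + w)"] by auto
  have le: "integral\<^sup>S (mu x) s <= (nni (mu x) (%u. ?f u))" for x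
   using s by (auto simp: le_fun_def simp flip: nn_integral_eq_simple_integral intro!: nn_integral_mono)
  have "s -` {y} : sets borel" for y using simple_functionD(2)[OF s(1)[of v], of "{y}"] by simp
  hence "integral\<^sup>S (mu (v + w)) s <= 2 * integral\<^sup>S (mu v) s + 2 * integral\<^sup>S (mu w) s"
   unfolding simple_integral_def sum_distrib_left sum.distrib[symmetric] space_scalar
   using mult_left_mono[OF ind] by (intro sum_mono) (simp add: distrib_left mult.left_commute)
  also have "... <= 2 * (nni (mu v) (%u. ?f u)) + 2 * (nni (mu w) (%u. ?f u))" by (intro add_mono mult_left_mono le) auto
  finally show "integral\<^sup>S (mu (v + w)) s <= ..." .
 qed
 thus ?thesis using assms(2,3) by (auto simp: spectral_domain_def ennreal_mult_less_top intro: le_less_trans)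
qed

lemma em_scalar_scaleC:
 "B : sets borel ==> emeasure (mu (c *c v)) B = ennreal ((cmod c)^2) * emeasure (mu v) B"
 by (simp add: em_scalar bo_scaleC[OF E_bounded] norm_scaleC power_mult_distrib ennreal_mult)

lemma scalar_measure_scaleC: "mu (c *c v) = scale_measure (ennreal ((cmod c)^2)) (mu v)"
 by (rule measure_eqI) (auto simp: em_scalar_scaleC)

lemma sdom_scaleC: assumes [measurable]: "g : BM" and "v : sdom E g"
 shows "c *c v : sdom E g" using assms(2)
 by (simp add: spectral_domain_def scalar_measure_scaleC nn_integral_scale_measure ennreal_mult_less_top)

lemma sdom_zero: "0 : sdom E g"
proof -
 have "mu 0 = null_measure borel" by (rule measure_eqI) (auto simp: em_scalar bo_zero[OF E_bounded])
 thus ?thesis by (simp add: spectral_domain_def)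
qed

lemma step_op_add: "step_list l ==> step_op E l (v + w) = step_op E l v + step_op E l w"
 and step_op_scaleC: "step_list l ==> step_op E l (c *c v) = c *c step_op E l v"
 by (induction l) (auto simp: bo_simps[OF E_bounded]
   scaleC_add_right scaleC_scaleC mult.commute)

context
 fixes g :: "real => complex" assumes g: "g : BM"
begin

lemma I_add: assumes v: "v : sdom E g" and w: "w : sdom E g"
 shows "I g (v + w) = I g v + I g w"
proof (rule LIMSEQ_unique[OF I_approx[OF g sdom_add[OF g v w]]])
 show "(%n. step_op E (approx g n) (v + w)) ----> I g v + I g w"
  using tendsto_add[OF I_approx[OF g v] I_approx[OF g w]] by (simp add: step_op_add approx[OF g])
qed

lemma I_scaleC: assumes v: "v : sdom E g" shows "I g (c *c v) = c *c I g v"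
proof (rule LIMSEQ_unique[OF I_approx[OF g sdom_scaleC[OF g v]]])
 show "(%n. step_op E (approx g n) (c *c v)) ----> c *c I g v"
  using tendsto_scaleC[OF I_approx[OF g v]] by (simp add: step_op_scaleC approx[OF g])
qed

lemma norm_I: assumes v: "v : sdom E g"
 shows "(norm (I g v))^2 = (LINT u|mu v. (cmod (g u))^2)"
proof (rule LIMSEQ_unique)
 note [measurable] = g stf_meas[OF approx(1)[OF g]]
 show "(%n. (norm (step_op E (approx g n) v))^2) ----> (norm (I g v))^2" by (intro tendsto_intros I_approx g v)
 have "(%n. \<integral>u. (cmod (stf (approx g n) u))^2 \<partial>mu v) ----> (LINT u|mu v. (cmod (g u))^2)"
 proof (rule integral_dominated_convergence[where w="%u. 4 * (cmod (g u))^2"])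
  show "integrable (mu v) (%u. 4 * (cmod (g u))^2)" using v g by (simp add: sdom_iff)
  show "AE u in mu v. norm ((cmod (stf (approx g n) u))^2) <= 4 * (cmod (g u))^2" for n
   using power_mono[OF approx(3)[OF g], of n _ 2] by (simp add: power_mult_distrib)
 qed (auto intro!: tendsto_intros approx g)
 moreover have "(norm (step_op E l v))^2 = (LINT u|mu v. (cmod (stf l u))^2)" if "step_list l" for l
  using norm_step_diff[OF that, of "[]" v] by simp
 ultimately show "(%n. (norm (step_op E (approx g n) v))^2) ----> (LINT u|mu v. (cmod (g u))^2)" using approx(1)[OF g] by simp
qed

end

end

section \<open>Functional calculus\<close>

context spectral
begin

lemma sdom_bounded: assumes [measurable]: "g : BM" and "!!u. cmod (g u) <= C"
 shows "v : sdom E g"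
proof -
 have "integrable (mu v) (%u. (cmod (g u))^2)"
  by (rule integrable_bounded[where C="C^2"]) (use assms in "auto intro!: power_mono")
 thus ?thesis by (simp add: sdom_iff)
qed

lemma integrable_spectral_domain: assumes [measurable]: "g : BM" and v: "v : sdom E g"
 shows "integrable (mu v) g"
proof (rule Bochner_Integration.integrable_bound)
 show "integrable (mu v) (%u. 1 + (cmod (g u))^2)" using v integrable_bounded[of "%u. 1::real" 1 v] by (simp add: sdom_iff)
 have "cmod (g u) <= 1 + (cmod (g u))^2" for u
  using sum_squares_ge_zero[of "cmod (g u) - 1" 0] by (simp add: power2_eq_square algebra_simps)
   (use zero_le_square[of "cmod (g u)"] in linarith)
 thus "AE u in mu v. norm (g u) <= norm (1 + (cmod (g u))^2)" by simp
qed simp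

lemma cinner_step_op: assumes "step_list l" shows "cinner v (step_op E l v) = (LINT u|mu v. stf l u)"
 using cinner_E_step[of UNIV l v] assms by simp

lemma polarization_E: assumes B: "B : sets borel"
 shows "cinner z (E B x) = (1/4) * (SUM k<4. \<i> ^ k * of_real ((norm (E B (x + (\<i> ^ k) *c z)))^2))"
proof -
 have n: "complex_of_real ((norm (E B (x + c *c z)))^2) = cinner x (E B x) + c * cinner x (E B z)
   + cnj c * cinner z (E B x) + cnj c * c * cinner z (E B z)" for c
  unfolding cinner_self[symmetric] E_cinner[OF B] E_idem[OF B] by (simp add: bo_simps[OF E_bounded[OF B]]
    cinner_add_left cinner_add_right cinner_scaleC_left cinner_scaleC_right algebra_simps)
 show ?thesis unfolding n by (simp add: eval_nat_numeral algebra_simps)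
qed

lemma polarization_step: assumes "step_list l"
 shows "cinner z (step_op E l x) = (1/4) * (SUM k<4. \<i> ^ k * (LINT u|mu (x + (\<i> ^ k) *c z). stf l u))" using assms
proof (induction l)
 case Nil
 have "stf [] = (%u. 0)" by (rule ext) simp
 thus ?case by simp
next
 case (Cons p l)
 obtain c B where p: "p = (c, B)" by (cases p)
 have B: "B : sets borel" "step_list l" using Cons.prems by (auto simp: p)
 have "(LINT u|mu v. stf (p # l) u) = c * of_real ((norm (E B v))^2) + (LINT u|mu v. stf l u)" for v
  unfolding cinner_step_op[OF Cons.prems, symmetric] cinner_step_op[OF B(2), symmetric]
  using E_cinner[OF B(1), of v "E B v"] E_idem[OF B(1), of v] cinner_self[of "E B v"]
  by (simp add: p cinner_add_right cinner_scaleC_right)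
 thus ?case unfolding p step_op_simps cinner_add_right cinner_scaleC_right Cons.IH[OF B(2)] polarization_E[OF B(1)]
  by (simp add: sum.distrib sum_distrib_left algebra_simps)
qed

context
 fixes g :: "real => complex" assumes g: "g : BM"
begin

lemma tendsto_integral_approx: assumes v: "v : sdom E g"
 shows "(%n. \<integral>u. stf (approx g n) u \<partial>mu v) ----> (LINT u|mu v. g u)"
proof (rule integral_dominated_convergence[where w="%u. 2 * cmod (g u)"])
 show "integrable (mu v) (%u. 2 * cmod (g u))" using integrable_spectral_domain[OF g v] by simp
qed (use stf_meas[OF approx(1)[OF g]] g in "auto intro!: approx g")

lemma cinner_I: assumes v: "v : sdom E g" shows "cinner v (I g v) = (LINT u|mu v. g u)"
proof (rule LIMSEQ_unique[OF _ tendsto_integral_approx[OF v]])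
 have "(%n. cinner v (step_op E (approx g n) v)) ----> cinner v (I g v)"
  unfolding cinner_def by (intro tendsto_intros I_approx g v)
 thus "(%n. \<integral>u. stf (approx g n) u \<partial>mu v) ----> cinner v (I g v)" by (simp add: cinner_step_op approx[OF g])
qed

text \<open>The bridge between the strong limit \<open>I\<close> and the weak, polarized definition
  of \<open>spectral_integral\<close>.\<close>

lemma polarization_I: assumes x: "x : sdom E g" and z: "z : sdom E g"
 shows "cinner z (I g x) = (1/4) * (SUM k<4. \<i> ^ k * (LINT u|mu (x + (\<i> ^ k) *c z). g u))"
proof (rule LIMSEQ_unique)
 show "(%n. cinner z (step_op E (approx g n) x)) ----> cinner z (I g x)"
  unfolding cinner_def by (intro tendsto_intros I_approx g x)
 have "(%n. (1/4) * (SUM k<4. \<i> ^ k * (LINT u|mu (x + (\<i> ^ k) *c z). stf (approx g n) u)))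
  ----> (1/4) * (SUM k<4. \<i> ^ k * (LINT u|mu (x + (\<i> ^ k) *c z). g u))"
  by (intro tendsto_intros tendsto_integral_approx sdom_add sdom_scaleC g x z)
 thus "(%n. cinner z (step_op E (approx g n) x)) ---->
   (1/4) * (SUM k<4. \<i> ^ k * (LINT u|mu (x + (\<i> ^ k) *c z). g u))" by (simp add: polarization_step approx[OF g])
qed

end

context
 fixes g :: "real => complex" assumes g: "g : BM"
begin

lemma I_adjoint: assumes v: "v : sdom E g" and w: "w : sdom E g"
 shows "cinner w (I g v) = cinner (I (%u. cnj (g u)) w) v"
proof -
 have c: "v : sdom E (%u. cnj (g u))" "w : sdom E (%u. cnj (g u))" using v w by (simp_all add: spectral_domain_def)
 have m: "(%u. cnj (g u)) : BM" using g by measurable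
 \<comment> \<open>The measure does not change when its vector is multiplied by a scalar of modulus
   1.\<close>
 have "mu (w + (\<i> ^ k) *c v) = mu (v + (cnj \<i> ^ k) *c w)" for k
 proof -
  have "w + (\<i> ^ k) *c v = (\<i> ^ k) *c (v + (cnj \<i> ^ k) *c w)"
   by (simp add: scaleC_add_right scaleC_scaleC flip: power_mult_distrib)
  thus ?thesis by (simp add: scalar_measure_scaleC norm_power)
 qed
 hence "cinner v (I (%u. cnj (g u)) w) = (1/4) * (SUM k<4. \<i> ^ k * cnj (LINT u|mu (v + (cnj \<i> ^ k) *c w). g u))"
  by (simp add: polarization_I[OF m c(2,1)])
 from arg_cong[OF this, of cnj] show ?thesis
  unfolding polarization_I[OF g v w] cinner_commute[of _ v] by (simp add: eval_nat_numeral)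
qed

text \<open>The projections \<open>E (level n)\<close> map every vector into the domain of
  \<open>g\<close> and tend strongly to the identity, which serves as density of the domain in what
  follows.\<close>

definition level :: "nat => real set" where "level n = {u. cmod (g u) <= real n}"

lemma level_sets [measurable]: "level n : sets borel" unfolding level_def using g by measurable

lemma E_level_tendsto: "(%n. E (level n) v) ----> v"
proof -
 interpret finite_measure "mu v" by (rule finite_scalar)
 have "(%n. measure (mu v) (level n)) ----> measure (mu v) (UN n. level n)"
 proof (rule finite_Lim_measure_incseq)
  show "incseq level" by (force simp: incseq_def level_def)
 qed auto
 moreover have "(UN n. level n) = UNIV" by (auto simp: level_def real_arch_simple)
 ultimately have "(%n. (norm (E (level n) v))^2) ----> (norm v)^2" by (simp add: measure_scalar)
 hence "(%n. sqrt ((norm v)^2 - (norm (E (level n) v))^2)) ----> sqrt ((norm v)^2 - (norm v)^2)"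
  by (rule tendsto_real_sqrt[OF tendsto_diff[OF tendsto_const]])
 moreover have "(norm (E B v - v))^2 = (norm v)^2 - (norm (E B v))^2" if "B : sets borel" for B
  using inner_E[OF that, of v] by (simp add: norm_sq inner_sums inner_commute)
 hence "sqrt ((norm v)^2 - (norm (E (level n) v))^2) = norm (E (level n) v - v)" for n
  by (metis level_sets norm_ge_zero real_sqrt_unique)
 ultimately have "(%n. norm (E (level n) v - v)) ----> 0" by simp
 thus ?thesis by (metis LIM_zero_cancel tendsto_norm_zero_iff)
qed

lemma scalar_measure_E: assumes B: "B : sets borel" shows "mu (E B v) = density (mu v) (ind B)"
proof (rule measure_eqI)
 fix C assume "C : sets (mu (E B v))"
 hence C: "C : sets borel" by simp
 have "emeasure (density (mu v) (ind B)) C = (nni (mu v) (%u. ind B u * ind C u))" using B C by (simp add: emeasure_density)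
 also have "... = (nni (mu v) (%u. ind (B Int C) u))" by (intro nn_integral_cong) (auto simp: indicator_def)
 also have "... = emeasure (mu v) (B Int C)" using B C by (intro nn_integral_indicator) simp
 finally have "emeasure (density (mu v) (ind B)) C = emeasure (mu v) (B Int C)" .
 thus "emeasure (mu (E B v)) C = emeasure (density (mu v) (ind B)) C" using B C by (simp add: em_scalar E_Int Int_commute)
qed simp

lemma sdom_E: assumes B: "B : sets borel" and i: "v : sdom E (%u. ind B u * g u)"
 shows "E B v : sdom E g"
proof -
 have "(nni (mu (E B v)) (%u. ennreal ((cmod (g u))^2))) = (nni (mu v) (%u. ind B u * ennreal ((cmod (g u))^2)))"
  using B g by (simp add: scalar_measure_E nn_integral_density)
 also have "... = (nni (mu v) (%u. ennreal ((cmod (ind B u * g u))^2)))" by (intro nn_integral_cong) (auto simp: indicator_def)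
 finally show ?thesis using i by (simp add: spectral_domain_def)
qed

lemma E_level_spectral_domain: "E (level n) v : sdom E g" by (rule sdom_E[OF level_sets], rule sdom_bounded[where C="real n"])
  (use g level_sets[of n] in "auto simp: indicator_def level_def")

lemma sdom_separating: assumes "!!z. z : sdom E g ==> cinner z y = cinner z y'" shows "y = y'"
proof -
 have "inner (E (level n) z) (y - y') = 0" for n z
  using arg_cong[OF assms[OF E_level_spectral_domain[of n z]], of Re] by (simp add: inner_diff_right)
 hence "(%n. inner (E (level n) z) (y - y')) ----> 0" for z by simp
 moreover have "(%n. inner (E (level n) z) (y - y')) ----> inner z (y - y')" for z by (intro tendsto_intros E_level_tendsto)
 ultimately have "inner (y - y') (y - y') = 0" using LIMSEQ_unique by blast
 thus ?thesis by simp
qed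

lemma I_E: assumes B: "B : sets borel" and v: "v : sdom E g"
 shows "E B v : sdom E g" "I g (E B v) = E B (I g v)"
proof -
 have v': "v : sdom E (%u. ind B u * g u)" by (rule sdom_mult[OF g _ v, of _ 1]) (use g B in "auto simp: norm_mult indicator_def")
 show d: "E B v : sdom E g" by (rule sdom_E[OF B v'])
 have "E B (step_op E l v) = step_op E l (E B v)" if "step_list l" for l
  using that B by (induction l) (auto simp: bo_simps[OF E_bounded] E_Int Int_commute)
 hence "(%n. E B (step_op E (approx g n) v)) ----> I g (E B v)" using I_approx[OF g d] by (simp add: approx[OF g])
 moreover have "(%n. E B (step_op E (approx g n) v)) ----> E B (I g v)" by (intro bo_tendsto[OF E_bounded[OF B]] I_approx g v)
 ultimately show "I g (E B v) = E B (I g v)" by (rule LIMSEQ_unique)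
qed

lemma spectral_integral_eq: "si E g = {(x, I g x) | x. x : sdom E g}"
proof (intro equalityI subsetI; clarify)
 fix x y assume xy: "(x, y) : si E g"
 hence x: "x : sdom E g" by (auto simp: spectral_integral_def)
 have "y = I g x"
 proof (rule sdom_separating)
  show "cinner z y = cinner z (I g x)" if "z : sdom E g" for z
   unfolding polarization_I[OF g x that] using xy that unfolding spectral_integral_def by blast
 qed
 thus "EX x'. (x, y) = (x', I g x') & x' : sdom E g" using x by auto
next
 fix x assume "x : sdom E g"
 thus "(x, I g x) : si E g" using polarization_I[OF g] by (auto simp: spectral_integral_def)
qed

lemma mem_si: "(x, y) : si E g <-> x : sdom E g & y = I g x" unfolding spectral_integral_eq by auto

lemma lg_spectral_integral: "linear_graph (si E g)"
proof (rule lgI)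
 show "(0, 0) : si E g" using I_scaleC[OF g sdom_zero, of 0] by (simp add: mem_si sdom_zero)
qed (auto simp: mem_si sdom_add[OF g] sdom_scaleC[OF g] I_add[OF g] I_scaleC[OF g])

lemma single_valued_spectral_integral: "single_valued (si E g)" by (auto simp: single_valued_def mem_si)

end

lemma I_add_fun: assumes f[measurable]: "f : BM" and g[measurable]: "g : BM" and v: "v : sdom E f" "v : sdom E g"
 shows "v : sdom E (%u. f u + g u)" "I (%u. f u + g u) v = I f v + I g v"
proof -
 show d: "v : sdom E (%u. f u + g u)" using v integrable_square_diff(2)[OF f g] by (simp add: sdom_iff)
 \<comment> \<open>The domain for this weight lies in those of \<open>f\<close>, \<open>g\<close>
   and \<open>f + g\<close> and still separates vectors, so the identity can be tested weakly on
   it.\<close>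
 let ?h = "%u. complex_of_real (cmod (f u) + cmod (g u))"
 have h: "?h : BM" and fg: "(%u. f u + g u) : BM" by measurable
 show "I (%u. f u + g u) v = I f v + I g v"
 proof (rule sdom_separating[OF h])
  fix z assume z: "z : sdom E ?h"
  have zs: "z : sdom E f" "z : sdom E g" "z : sdom E (%u. f u + g u)"
   by (rule sdom_mult[OF h _ z, of _ 1]; simp add: norm_triangle_ineq flip: of_real_add)+
  have "integrable (mu (v + c *c z)) f" "integrable (mu (v + c *c z)) g" for c
   by (intro integrable_spectral_domain f g sdom_add sdom_scaleC v zs)+
  thus "cinner z (I (%u. f u + g u) v) = cinner z (I f v + I g v)"
   by (simp add: cinner_add_right polarization_I[OF f v(1) zs(1)] polarization_I[OF g v(2) zs(2)]
    polarization_I[OF fg d zs(3)] sum.distrib distrib_left)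
 qed
qed

lemma I_scale_fun: assumes g[measurable]: "g : BM" and v: "v : sdom E g"
 shows "v : sdom E (%u. c * g u)" "I (%u. c * g u) v = c *c I g v"
proof -
 have d: "v : sdom E (%u. c * g u)" if "v : sdom E g" for v by (rule sdom_mult[OF _ _ that, of _ "cmod c"]) (auto simp: norm_mult)
 show "v : sdom E (%u. c * g u)" by (rule d[OF v])
 have m: "(%u. c * g u) : BM" by measurable
 show "I (%u. c * g u) v = c *c I g v"
 proof (rule sdom_separating[OF g])
  fix z assume z: "z : sdom E g"
  show "cinner z (I (%u. c * g u) v) = cinner z (c *c I g v)"
   by (simp add: cinner_scaleC_right polarization_I[OF g v z] polarization_I[OF m d[OF v] d[OF z]]
    sum_distrib_left mult_ac)
 qed
qed

lemma norm_I_diff: assumes f: "f : BM" and g: "g : BM" and v: "v : sdom E f" "v : sdom E g"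
 shows "(norm (I f v - I g v))^2 = (LINT u|mu v. (cmod (f u - g u))^2)"
proof -
 note m = I_scale_fun[OF g v(2), of "-1"]
 have gm: "(%u. - 1 * g u) : BM" using g by measurable
 note a = I_add_fun[OF f gm v(1) m(1)]
 have "(%u. f u + - 1 * g u) : BM" using f gm by measurable
 from norm_I[OF this a(1)] show ?thesis unfolding a(2) m(2) by simp
qed

lemma I_eq_AE: assumes f: "f : BM" and g: "g : BM" and ae: "AE u in mu v. f u = g u"
 shows "v : sdom E f <-> v : sdom E g"
  "v : sdom E f ==> I f v = I g v"
proof -
 show *: "v : sdom E f <-> v : sdom E g"
  unfolding spectral_domain_def mem_Collect_eq using ae by (subst nn_integral_cong_AE[of _ "%u. ennreal ((cmod (g u))^2)"]) auto
 assume v: "v : sdom E f"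
 have "(LINT u|mu v. (cmod (f u - g u))^2) = (LINT u|mu v. 0)" using f g ae by (intro integral_cong_AE) auto
 hence "(norm (I f v - I g v))^2 = 0" using norm_I_diff[OF f g v] v * by simp
 thus "I f v = I g v" by simp
qed

lemma I_zero: "I (%u. 0) v = 0" using norm_I[of "%u. 0" v] sdom_bounded[of "%u. 0" 0 v] by simp

lemma AE_scalar_E: assumes B: "B : sets borel" shows "AE u in mu (E B v). u : B"
proof (rule AE_I[where N="- B"])
 show "emeasure (mu (E B v)) (- B) = 0" "- B : sets (mu (E B v))" using B by (simp_all add: em_scalar E_Int)
qed auto

lemma E_I: assumes g: "g : BM" and B: "B : sets borel" and v: "v : sdom E g"
 shows "E B (I g v) = I (%u. ind B u * g u) v"
proof -
 let ?f = "%u. ind B u * g u"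
 note [measurable] = g B
 have f: "?f : BM" and C: "- B : sets borel" by measurable
 have v': "v : sdom E ?f" by (rule sdom_mult[OF g f v, of 1]) (auto simp: norm_mult indicator_def)
 note d = I_E(1)[OF f B v'] I_E(1)[OF f C v']
 have "E B v + E (- B) v = v" using E_Un[OF B C] by simp
 hence "I ?f v = I ?f (E B v) + I ?f (E (- B) v)" using I_add[OF f d] by simp
 also have "I ?f (E (- B) v) = I (%u. 0) (E (- B) v)"
  by (rule I_eq_AE(2)[OF f _ _ d(2)]) (use AE_scalar_E[OF C, of v] in "auto simp: indicator_def elim: AE_mp")
 also have "I ?f (E B v) = I g (E B v)"
  by (rule I_eq_AE(2)[OF f g _ d(1)]) (use AE_scalar_E[OF B, of v] in "auto simp: indicator_def elim: AE_mp")
 finally show ?thesis by (simp add: I_zero I_E(2)[OF g B v])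
qed

lemma scalar_measure_I: assumes g[measurable]: "g : BM" and v: "v : sdom E g"
 shows "mu (I g v) = density (mu v) (%u. ennreal ((cmod (g u))^2))"
proof (rule measure_eqI)
 fix B assume "B : sets (mu (I g v))"
 hence B[measurable]: "B : sets borel" by simp
 have v': "v : sdom E (%u. ind B u * g u)" by (rule sdom_mult[OF g _ v, of _ 1]) (auto simp: norm_mult indicator_def)
 have "(norm (E B (I g v)))^2 = (LINT u|mu v. (cmod (ind B u * g u))^2)"
  unfolding E_I[OF g B v] by (rule norm_I[OF _ v']) measurable
 hence "emeasure (mu (I g v)) B = (nni (mu v) (%u. ennreal ((cmod (ind B u * g u))^2)))"
  using v' by (subst nn_integral_eq_integral) (auto simp: em_scalar sdom_iff)
 also have "... = (nni (mu v) (%u. ennreal ((cmod (g u))^2) * ind B u))" by (intro nn_integral_cong) (auto simp: indicator_def)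
 also have "... = emeasure (density (mu v) (%u. ennreal ((cmod (g u))^2))) B" by (simp add: emeasure_density)
 finally show "emeasure (mu (I g v)) B = ..." .
qed simp

lemma step_op_I: assumes g[measurable]: "g : BM" and v: "v : sdom E g" and l: "step_list l"
 shows "v : sdom E (%u. stf l u * g u) & step_op E l (I g v) = I (%u. stf l u * g u) v" using l
proof (induction l)
 case Nil
 show ?case using sdom_bounded[of "%u. 0" 0 v] by (simp add: I_zero)
next
 case (Cons p l)
 obtain c B where p: "p = (c, B)" by (cases p)
 have B[measurable]: "B : sets borel" and sl: "step_list l" using Cons.prems by (auto simp: p)
 note [measurable] = stf_meas[OF sl]
 have v': "v : sdom E (%u. ind B u * g u)" by (rule sdom_mult[OF g _ v, of _ 1]) (auto simp: norm_mult indicator_def)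
 have m: "(%u. ind B u * g u) : BM" "(%u. c * (ind B u * g u)) : BM"
  "(%u. stf l u * g u) : BM" by measurable
 note s = I_scale_fun[OF m(1) v', of c]
 note a = I_add_fun[OF m(2,3) s(1) conjunct1[OF Cons.IH[OF sl]]]
 have eq: "(%u. stf (p # l) u * g u) = (%u. c * (ind B u * g u) + stf l u * g u)" by (auto simp: p algebra_simps)
 show ?case unfolding eq using a s(2) conjunct2[OF Cons.IH[OF sl]] E_I[OF g B v] by (simp add: p)
qed

text \<open>\<open>I g\<close> multiplies scalar measures by \<open>(cmod (g u))^2\<close>, so
  convergence of step functions to \<open>f\<close> for the measure of \<open>I g v\<close> is
  convergence of their products with \<open>g\<close> for that of \<open>v\<close>.\<close>

lemma I_comp: assumes f[measurable]: "f : BM" and g[measurable]: "g : BM" and v: "v : sdom E g"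
 shows "I g v : sdom E f <-> v : sdom E (%u. f u * g u)"
  "v : sdom E (%u. f u * g u) ==> I f (I g v) = I (%u. f u * g u) v"
proof -
 have "(nni (mu (I g v)) (%u. ennreal ((cmod (f u))^2))) = (nni (mu v) (%u. ennreal ((cmod (f u * g u))^2)))"
  unfolding scalar_measure_I[OF g v]
  by (subst nn_integral_density) (auto simp: norm_mult power_mult_distrib ennreal_mult mult.commute)
 thus *: "I g v : sdom E f <-> v : sdom E (%u. f u * g u)" by (simp add: spectral_domain_def)
 assume d: "v : sdom E (%u. f u * g u)"
 have dI: "I g v : sdom E f" using d * by simp
 note [measurable] = stf_meas[OF approx(1)[OF f]]
 have fg: "(%u. f u * g u) : BM" and sg: "(%u. stf (approx f n) u * g u) : BM" for n by measurable
 note s = step_op_I[OF g v approx(1)[OF f]]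
 have e: "cmod (stf (approx f n) u * g u - f u * g u) = cmod (g u) * cmod (stf (approx f n) u - f u)" for n u
  by (metis left_diff_distrib mult.commute norm_mult)
 have 1: "(LINT u|mu (I g v). (cmod (stf (approx f n) u - f u))^2)
  = (LINT u|mu v. (cmod (g u))^2 *r (cmod (stf (approx f n) u - f u))^2)" for n
  unfolding scalar_measure_I[OF g v] by (rule integral_density; measurable?; simp)
 have "(norm (step_op E (approx f n) (I g v) - I (%u. f u * g u) v))^2
  = (LINT u|mu (I g v). (cmod (stf (approx f n) u - f u))^2)" for n
  unfolding 1 using s norm_I_diff[OF sg fg conjunct1[OF s] d] by (simp add: e power_mult_distrib)
 hence "(%n. (norm (step_op E (approx f n) (I g v) - I (%u. f u * g u) v))^2) ----> 0"
  using approx_L2lim[OF f dI] by (simp add: L2lim_def)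
 hence "(%n. step_op E (approx f n) (I g v) - I (%u. f u * g u) v) ----> 0" by (simp add: tendsto_norm_zero_iff)
 hence "(%n. step_op E (approx f n) (I g v)) ----> I (%u. f u * g u) v" by (simp add: LIM_zero_iff)
 with I_approx[OF f dI] show "I f (I g v) = I (%u. f u * g u) v" by (rule LIMSEQ_unique)
qed

lemma I_bounded_operator: assumes g: "g : BM" and b: "!!u. cmod (g u) <= C"
 shows "bop (I g)" "norm (I g v) <= C * norm v"
proof -
 note d = sdom_bounded[OF g b]
 have C: "0 <= C" using b[of 0] norm_ge_zero order_trans by blast
 have n: "norm (I g v) <= C * norm v" for v
 proof (rule power2_le_imp_le)
  have "(norm (I g v))^2 <= (LINT u|mu v. C^2)" unfolding norm_I[OF g d] using d[of v] g b
   by (intro integral_mono) (auto simp: sdom_iff intro!: integrable_bounded[where C="C^2"] power_mono)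
  thus "(norm (I g v))^2 <= (C * norm v)^2" using measure_scalar[of UNIV v] by (simp add: power_mult_distrib mult.commute)
 qed (use C in simp)
 show "norm (I g v) <= C * norm v" by (rule n)
 show "bop (I g)" by (rule boI, rule bounded_linear_intro[where K=C])
   (use n I_add[OF g d d] I_scaleC[OF g d] in "auto simp: mult.commute scaleC_of_real[symmetric]")
qed

lemma spectral_integral_op_graph: assumes "g : BM" "!!u. cmod (g u) <= C"
 shows "si E g = op_graph (I g)" using sdom_bounded[OF assms] by (auto simp: mem_si[OF assms(1)] op_graph_def)


text \<open>If \<open>y\<close> belongs to the domain of the adjoint with value \<open>z\<close>,
  its truncations satisfy \<open>I g (E (level g n) y) = E (level g n) z\<close>. The truncated
  integrals of \<open>(cmod (g u))^2\<close> are thus bounded by \<open>(norm z)^2\<close>, and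
  monotone convergence puts \<open>y\<close> into the domain.\<close>

lemma adj_spectral_integral: assumes g[measurable]: "g : BM" and real: "!!u. cnj (g u) = g u"
 shows "adjg (si E g) = si E g"
proof (intro equalityI subsetI; clarify)
 fix y z assume yz: "(y, z) : adjg (si E g)"
 note d = E_level_spectral_domain[OF g] and ls = level_sets[OF g]
 have sym: "inner (I g v) w = inner v (I g w)" if "v : sdom E g" "w : sdom E g" for v w
  using arg_cong[OF I_adjoint[OF g that(1,2)], of Re] real by (simp add: inner_commute)
 have Ez: "I g (E (level g n) y) = E (level g n) z" for n
 proof (rule vector_eq_ldot[THEN iffD1], rule allI)
  fix x
  define e where "e = E (level g n)"
  have "inner x (I g (e y)) = inner x (e (I g (e y)))"
   using I_E(2)[OF g ls[of n] d[of n y]] E_idem[OF ls[of n]] by (simp add: e_def)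
  also have "... = inner (I g (e x)) (e y)" using sym[OF d[of n x] d[of n y]] E_sym[OF ls[of n]] by (simp add: e_def)
  also have "... = inner (e (I g (e x))) y" using E_sym[OF ls[of n]] by (simp add: e_def)
  also have "... = inner (I g (e x)) y" using I_E(2)[OF g ls[of n] d[of n x]] E_idem[OF ls[of n]] by (simp add: e_def)
  also have "... = inner (e x) z" using d[of n x] by (intro adj_graph_inner[OF yz]) (simp add: mem_si[OF g] e_def)
  also have "... = inner x (e z)" using E_sym[OF ls[of n]] by (simp add: e_def)
  finally show "inner x (I g (E (level g n) y)) = inner x (E (level g n) z)" by (simp add: e_def)
 qed
 have bound: "(nni (mu y) (%u. ennreal ((cmod (g u))^2) * ind (level g n) u)) <= ennreal ((norm z)^2)" for n
 proof -
  have "(nni (mu y) (%u. ennreal ((cmod (g u))^2) * ind (level g n) u))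
    = (nni (mu (E (level g n) y)) (%u. ennreal ((cmod (g u))^2)))"
   using ls[of n] by (simp add: scalar_measure_E[OF g] nn_integral_density mult.commute)
  also have "... = ennreal ((norm (E (level g n) z))^2)"
   using d[of n y] norm_I[OF g d[of n y]] Ez[of n] by (subst nn_integral_eq_integral) (auto simp: sdom_iff)
  also have "... <= ennreal ((norm z)^2)"
   using finite_measure.bounded_measure[OF finite_scalar, of z "level g n"] measure_scalar[OF ls[of n], of z]
    measure_scalar[of UNIV z] by (simp add: ennreal_leI)
  finally show ?thesis .
 qed
 have "(nni (mu y) (%u. ennreal ((cmod (g u))^2))) = (nni (mu y) (%u. (SUP n. ennreal ((cmod (g u))^2) * ind (level g n) u)))"
 proof (intro nn_integral_cong antisym)
  fix u
  obtain n where "u : level g n" using real_arch_simple[of "cmod (g u)"] by (auto simp: level_def[OF g])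
  thus "ennreal ((cmod (g u))^2) <= (SUP n. ennreal ((cmod (g u))^2) * ind (level g n) u)" by (intro SUP_upper2[of n]) auto
 qed (auto intro!: SUP_least simp: indicator_def)
 also have "... = (SUP n. \<integral>\<^sup>+u. ennreal ((cmod (g u))^2) * ind (level g n) u \<partial>mu y)"
  by (rule nn_integral_monotone_convergence_SUP) (auto simp: incseq_def le_fun_def level_def[OF g] indicator_def)
 also have "... <= ennreal ((norm z)^2)" by (intro SUP_least bound)
 finally have y: "y : sdom E g" by (auto simp: spectral_domain_def intro: le_less_trans)
 have "(%n. E (level g n) (I g y)) ----> I g y" "(%n. E (level g n) z) ----> z" by (rule E_level_tendsto[OF g])+
 moreover have "E (level g n) (I g y) = E (level g n) z" for n using I_E(2)[OF g ls y] Ez by simp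
 ultimately have "z = I g y" using LIMSEQ_unique by simp
 thus "(y, z) : si E g" using y by (simp add: mem_si[OF g])
next
 fix y z assume "(y, z) : si E g"
 thus "(y, z) : adjg (si E g)" using I_adjoint[OF g] real unfolding adj_graph_def by (auto simp: mem_si[OF g])
qed

end


text \<open>An intertwiner bounded by \<open>C\<close> multiplies scalar measures by at most
  \<open>C^2\<close>, hence maps domains to domains, and it carries step operators to step
  operators. Used for elements of commutants, shifts and phases alike.\<close>

lemma intertwine_spectral_integral: assumes E: "spectral E" and E': "spectral E'" and x: "bop x"
  and xE: "!!B v. B : sets borel ==> x (E B v) = E' B (x v)" and g: "g : BM" and v: "v : sdom E g"
 shows "x v : sdom E' g & spectral.I E' g (x v) = x (spectral.I E g v)"
proof -
 interpret E: spectral E by fact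
 interpret E': spectral E' by fact
 obtain C where C: "C > 0" "!!v. norm (x v) <= C * norm v" using bo_bound[OF x] by blast
 have "(nni (smeas E' (x v)) (%u. ennreal ((cmod (g u))^2)))
   <= (nni (scale_measure (ennreal (C^2)) (smeas E v)) (%u. ennreal ((cmod (g u))^2)))"
 proof (rule nn_integral_mono_measure)
  show "smeas E' (x v) <= scale_measure (ennreal (C^2)) (smeas E v)" unfolding le_measure_iff
  proof (simp add: space_scale_measure, rule le_funI)
   fix B
   show "emeasure (smeas E' (x v)) B <= emeasure (scale_measure (ennreal (C^2)) (smeas E v)) B"
   proof (cases "B : sets borel")
    case True
    have "(norm (E' B (x v)))^2 <= (C * norm (E B v))^2" using C by (intro power_mono) (auto simp flip: xE[OF True])
    thus ?thesis using True by (simp add: E.em_scalar E'.em_scalar power_mult_distrib flip: ennreal_mult)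
   qed (simp add: emeasure_notin_sets)
  qed
 qed simp
 also have "... = ennreal (C^2) * (nni (smeas E v) (%u. ennreal ((cmod (g u))^2)))"
  by (rule nn_integral_scale_measure) (use g in measurable)
 finally have d: "x v : sdom E' g" using v by (auto simp: spectral_domain_def ennreal_mult_less_top intro: le_less_trans)
 have "x (step_op E m v) = step_op E' m (x v)" if "step_list m" for m using that by (induction m) (auto simp: bo_simps[OF x] xE)
 hence "(%n. step_op E' (E.approx g n) (x v)) ----> x (E.I g v)"
  using bo_tendsto[OF x E.I_approx[OF g v]] E.approx(1)[OF g] by simp
 with E'.I_approx[OF g d] d show ?thesis using LIMSEQ_unique by blast
qed


text \<open>If \<open>E\<close> belongs to \<open>h\<close>, the rescaled measure belongs to
  \<open>c h\<close>; the dual action produces these.\<close>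

lemma assumes "spectral E" and c: "c > 0"
 shows spectral_rescale: "spectral (%B. E ((%u. c * u) -` B))"
  and scalar_measure_rescale: "smeas (%B. E ((%u. c * u) -` B)) v = distr (smeas E v) borel (%u. c * u)"
  and I_rescale: "g : BM ==> v : sdom (%B. E ((%u. c * u) -` B)) g ==>
   spectral.I (%B. E ((%u. c * u) -` B)) g v = spectral.I E (%u. g (c * u)) v" and sdom_rescale: "g : BM ==>
   sdom (%B. E ((%u. c * u) -` B)) g = sdom E (%u. g (c * u))"
proof -
 interpret E: spectral E by fact
 let ?E = "%B. E ((%u. c * u) -` B)"
 have pre: "(%u. c * u) -` B : sets borel" if "B : sets borel" for B :: "real set"
  using measurable_sets[of "%u::real. c * u" borel borel B] that by simp
 show sE: "spectral ?E"
 proof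
  show "spectral_measure ?E" unfolding spectral_measure_def
  proof (intro conjI ballI allI impI)
   show "is_projection (?E B)" if "B : sets borel" for B by (rule E.projection[OF pre[OF that]])
   show "?E UNIV = (%v. v)" by (rule ext) simp
   fix B :: "nat => real set" and v assume "range B <= sets borel & disjoint_family B"
   hence "(%n. E ((%u. c * u) -` B n) v) sums E (UN n. (%u. c * u) -` B n) v"
    by (intro E.E_sums pre) (auto simp: disjoint_family_on_def)
   thus "(%n. ?E (B n) v) sums ?E (UN n. B n) v" by (simp add: vimage_UN)
  qed
 qed
 interpret S: spectral ?E by fact
 show m: "smeas ?E v = distr (smeas E v) borel (%u. c * u)" for v
  by (rule measure_eqI) (auto simp: S.em_scalar E.em_scalar emeasure_distr pre)
 show d: "sdom ?E g = sdom E (%u. g (c * u))" if g: "g : BM" for g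
  unfolding spectral_domain_def m using g by (simp add: nn_integral_distr)
 show "S.I g v = E.I (%u. g (c * u)) v" if g[measurable]: "g : BM" and v: "v : sdom ?E g"
 proof -
  have gc: "(%u. g (c * u)) : BM" by measurable
  show ?thesis
  proof (rule S.sdom_separating[OF g])
   fix z assume z: "z : sdom ?E g"
   show "cinner z (S.I g v) = cinner z (E.I (%u. g (c * u)) v)" using v z unfolding d[OF g]
    by (simp add: S.polarization_I[OF g v z] E.polarization_I[OF gc] m integral_distr)
  qed
 qed
qed

text \<open>A unitary intertwining the imaginary powers \<open>\<integral> u\<^sup>i\<^sup>t dE\<close> intertwines the spectral measures, by
  the uniqueness of characteristic functions on the logarithmic scale.\<close>

definition ipower :: "real => real => complex" where "ipower t u = (if 0 < u then cis (t * ln u) else 0)"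

lemma ipower_meas [measurable]: "ipower t : BM"
proof -
 have "ipower t = (%u. if 0 < u then exp (\<i> * of_real (t * ln u)) else 0)" by (auto simp: ipower_def cis_conv_exp)
 thus ?thesis by simp
qed

lemma norm_ipower_le: "cmod (ipower t u) <= 1" by (auto simp: ipower_def)

lemma spectral_intertwine: assumes E: "spectral E" "!!v. E {0<..} v = v" and E': "spectral E'" "!!v. E' {0<..} v = v"
  and x: "bop x" "!!v. norm (x v) = norm v" "surj x"
  and c: "!!t v. x (spectral.I E (ipower t) v) = spectral.I E' (ipower t) (x v)" and B: "B : sets borel"
 shows "x (E B v) = E' B (x v)"
proof -
 interpret E: spectral E by fact
 interpret E': spectral E' by fact
 have ae: "AE u in smeas F v. 0 < u" if F: "spectral F" "!!v. F {0<..} v = v" for F :: "real set => 'a operator" and v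
 proof -
  interpret F: spectral F by fact
  have "{..0::real} Int {0<..} = {}" by auto
  hence "F {..0} v = 0" using F.E_disjoint[of "{..0}" "{0<..}" v] F(2)[of v] by simp
  hence "{..0} : null_sets (F.mu v)" by (auto simp: null_sets_def F.em_scalar)
  thus ?thesis by (rule AE_I') auto
 qed
 define M where "M F v = distr (smeas F v) borel ln" for F :: "real set => 'a operator" and v
 have char: "char (M F v) t = cinner v (spectral.I F (ipower t) v)" if F: "spectral F" "!!v. F {0<..} v = v"
  for F :: "real set => 'a operator" and v t
 proof -
  interpret F: spectral F by fact
  have "char (M F v) t = (LINT u|F.mu v. iexp (t * ln u))" unfolding char_def M_def by (subst integral_distr) auto
  also have "... = (LINT u|F.mu v. ipower t u)"
  proof (rule integral_cong_AE)
   show "(%u. iexp (t * ln u)) : borel_measurable (F.mu v)" "ipower t : borel_measurable (F.mu v)"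
    unfolding measurable_cong_sets[OF F.sets_scalar refl] by measurable
   show "AE u in F.mu v. iexp (t * ln u) = ipower t u" using ae[OF F, of v] by eventually_elim (simp add: ipower_def cis_conv_exp)
  qed
  also have "... = cinner v (F.I (ipower t) v)" by (rule F.cinner_I[symmetric]) (auto intro!: F.sdom_bounded norm_ipower_le)
  finally show ?thesis .
 qed
 have xx: "cinner (x u) (x w) = cinner u w" for u w
 proof -
  have "inner (x u) (x w) = inner u w" for u w
  proof -
   have "4 * inner (x u) (x w) = (norm (x (u + w)))^2 - (norm (x (u - w)))^2" by (simp add: bo_simps[OF x(1)] norm_sq
      inner_sums inner_commute)
   also have "... = 4 * inner u w" unfolding x(2) by (simp add: norm_sq inner_sums inner_commute)
   finally show ?thesis by simp
  qed
  thus ?thesis by (intro cinner_eqI) (simp_all flip: bo_scaleC[OF x(1)])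
 qed
 \<comment> \<open>Uniqueness of characteristic functions concerns probability measures, hence unit
   vectors; other vectors are scaled afterwards.\<close>
 have rd: "real_distribution (M F v)" if F: "spectral F" "norm v = 1" for F :: "real set => 'a operator" and v
 proof -
  interpret F: spectral F by fact
  have "prob_space (F.mu v)" by (rule prob_spaceI) (simp add: F.em_scalar F(2))
  hence "prob_space (M F v)" unfolding M_def by (rule prob_space.prob_space_distr) simp
  thus ?thesis by (simp add: real_distribution_def real_distribution_axioms_def M_def)
 qed
 have n1: "norm (E B v) = norm (E' B (x v))" if v: "norm v = 1" for v
 proof -
  have "char (M E v) = char (M E' (x v))" by (rule ext) (simp add: char[OF E] char[OF E'] c[symmetric] xx)
  hence eq: "M E v = M E' (x v)" by (intro Levy_uniqueness rd E E') (use v x in auto)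
  define C where "C = exp -` (B Int {0<..})"
  have C: "C : sets borel" unfolding C_def using measurable_sets[of exp borel borel "B Int {0<..}"] B by simp
  have "emeasure (M F w) C = ennreal ((norm (F B w))^2)" if F: "spectral F" "!!v. F {0<..} v = v"
   for F :: "real set => 'a operator" and w
  proof -
   interpret F: spectral F by fact
   have "emeasure (M F w) C = emeasure (F.mu w) (ln -` C)" unfolding M_def using C by (subst emeasure_distr) auto
   also have "... = emeasure (F.mu w) B"
   proof (rule emeasure_eq_AE)
    show "AE u in F.mu w. u : ln -` C <-> u : B" using ae[OF F, of w] by eventually_elim (auto simp: C_def)
    show "ln -` C : sets (F.mu w)" using measurable_sets[of ln borel borel C] C by simp
   qed (use B in simp)
   finally show ?thesis using B by (simp add: F.em_scalar)
  qed
  hence "ennreal ((norm (E B v))^2) = ennreal ((norm (E' B (x v)))^2)" using eq E E' by metis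
  thus ?thesis by simp
 qed
 have n: "norm (E B v) = norm (E' B (x v))" for v
 proof (cases "v = 0")
  case False
  define r where "r = 1 / norm v"
  have r: "r > 0" "norm (r *r v) = 1" using False by (auto simp: r_def)
  from n1[OF r(2)] show ?thesis using r(1) by (simp add: bo_scaleR[OF x(1)] bo_scaleR[OF E.E_bounded[OF B]]
     bo_scaleR[OF E'.E_bounded[OF B]])
 qed (simp add: bo_zero[OF x(1)] bo_zero[OF E.E_bounded[OF B]]
     bo_zero[OF E'.E_bounded[OF B]])
 \<comment> \<open>A projection is recovered from the norms of its values by polarization.\<close>
 have q: "4 * inner u (F w) = (norm (F (u + w)))^2 - (norm (F (u - w)))^2" if "is_projection F" for F :: "'a operator" and u w
 proof -
  have F: "bop F" "!!v. F (F v) = F v" "!!u v. inner (F u) v = inner u (F v)" using that by (auto simp: isp_iff)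
  show ?thesis by (simp add: bo_simps[OF F(1)] norm_sq
    inner_sums F(2,3) inner_commute[of w "F u"] )
 qed
 have "inner (x u) (E' B (x v)) = inner (x u) (x (E B v))" for u
  using q[OF E.projection[OF B], of u v] q[OF E'.projection[OF B], of "x u" "x v"] n[of "u + v"] n[of "u - v"]
   arg_cong[OF xx[of u "E B v"], of Re] by (simp add: bo_simps[OF x(1)])
 hence "inner w (E' B (x v)) = inner w (x (E B v))" for w using x(3) by (metis surjD)
 thus ?thesis by (metis vector_eq_ldot)
qed

text \<open>The elements of a selfadjoint commutant are combinations of its unitaries.\<close>

lemma commutant_unitary_induct: assumes S: "!!y. y : commutant S ==> adj y : commutant S" "S <= Collect bop"
  and A: "!!x. bop x ==> P x ==> P (adj x)" and U: "!!x. x : commutant S ==> (!!v. norm (x v) = norm v) ==> surj x ==> P x"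
  and P: "!!x y. P x ==> P y ==> P (%v. x v + y v)" "!!c x. P x ==> P (%v. c *c x v)" and y: "y : commutant S"
 shows "P (y :: 'h::complex_hilbert operator)"
proof -
 have comm: "x (z v) = z (x v)" if "x : S" "z : commutant S" for x z v using that by (auto simp: commutant_def fun_eq_iff)
 have mem: "z : commutant S" if "bop z" "!!x v. x : S ==> x (z v) = z (x v)" for z
  using that by (auto simp: commutant_def fun_eq_iff)
 have sb: "bop x" if "x : S" for x using S(2) that by auto
 have sa: "P z" if z: "z : commutant S" and sym: "!!u v. inner (z u) v = inner u (z v)" for z
 proof -
  have bz: "bop z" using z by (auto simp: commutant_def)
  obtain C where C: "C > 0" "!!v. norm (z v) <= C * norm v" using bo_bound[OF bz] by blast
  define b where "b v = (1/C) *r z v" for v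
  have bb: "bop b" unfolding b_def by (rule bo_real_mult[OF bz])
  have bs: "inner (b u) v = inner u (b v)" for u v using sym by (simp add: b_def)
  have b1: "norm (b v) <= norm v" for v using C by (simp add: b_def field_simps)
  have bc: "x (b v) = b (x v)" if "x : S" for x v using comm[OF that z] by (simp add: b_def bo_scaleR[OF sb[OF that]])
  define X where "X v = v - b (b v)" for v
  have X: "posop X" unfolding posop_iff X_def
  proof (intro conjI allI)
   show "bop (%v. v - b (b v))" using bo_minus'[OF bo_id bo_comp[OF bb bb]] by (simp add: o_def)
   show "0 <= inner v (v - b (b v))" for v
    using power_mono[OF b1[of v], of 2] bs[of v "b v"] by (simp add: inner_diff_right norm_sq)
  qed (simp add: inner_sums bs)
  obtain r where r: "posop r" "r o r = X"
   "!!a v. bop a ==> (ALL v. a (X v) = X (a v)) ==> a (r v) = r (a v)" using positive_sqrt_exists[OF X] by blast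
  note br = posop_bounded[OF r(1)]
  have rr: "r (r v) = v - b (b v)" for v using fun_cong[OF r(2), of v] by (simp add: X_def)
  have rb: "b (r v) = r (b v)" for v by (rule r(3)[OF bb]) (simp add: X_def bo_diff[OF bb])
  have rS: "x (r v) = r (x v)" if "x : S" for x v
   by (rule r(3)[OF sb[OF that]]) (simp add: X_def bo_diff[OF sb[OF that]] bc[OF that])
  \<comment> \<open>\<open>b + \<i> r\<close> with \<open>r^2 = 1 - b^2\<close> is unitary, and
    \<open>b\<close> is its real part.\<close>
  let ?u = "%v. b v + \<i> *c r v" and ?u' = "%v. b v - \<i> *c r v"
  have bu: "bop ?u" by (intro bo_plus bb bo_mult br)
  have au: "adj ?u = ?u'"
   using posop_sym[OF r(1)] by (intro adj_eqI[OF bu]) (simp add: inner_sums bs inner_i_left bo_scaleC[OF br])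
  have inv: "?u (?u' v) = v" "?u' (?u v) = v" for v by (auto simp: bo_add[OF bb] bo_add[OF br] bo_diff[OF bb] bo_diff[OF br]
     bo_scaleC[OF bb] bo_scaleC[OF br] scaleC_add_right scaleC_diff_right scaleC_scaleC rr rb algebra_simps)
  have "P ?u"
  proof (rule U)
   show "?u : commutant S" by (rule mem[OF bu]) (simp add: bo_simps[OF sb] bc rS)
   show "norm (?u v) = norm v" for v using adj_inner[OF bu, of v "?u v"] by (simp only: au inv norm_eq_sqrt_inner)
   show "surj ?u" using inv by (intro surjI[where f="?u'"])
  qed
  moreover from A[OF bu this] have "P ?u'" by (simp only: au)
  ultimately have "P (%v. of_real (C/2) *c (?u v + ?u' v))" by (rule P(2)[OF P(1)])
  moreover have "of_real (C/2) *c (?u v + ?u' v) = z v" for v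
   using C(1) scaleC_of_real[of "C/2" "(2 / C) *r z v"] by (simp add: b_def flip: scaleR_2)
  ultimately show ?thesis by simp
 qed
 note by' = CollectD[OF y[unfolded commutant_def], THEN conjunct1]
 have ay: "adj y : commutant S" by (rule S(1)[OF y])
 \<comment> \<open>Twice the real part of \<open>y\<close>; \<open>q\<close> is minus twice its
   imaginary part.\<close>
 define p where "p v = y v + adj y v" for v
 define q where "q v = \<i> *c y v - \<i> *c adj y v" for v
 have "P p"
 proof (rule sa)
  show "p : commutant S" unfolding p_def
   by (rule mem) (auto intro: bo_plus by' bo_adj simp: bo_add[OF sb] comm[OF _ y] comm[OF _ ay])
 qed (simp add: p_def inner_sums adj_inner[OF by'] adj_inner'[OF by'])
 moreover have "P q"
 proof (rule sa)
  show "q : commutant S" unfolding q_def by (rule mem, intro bo_minus' bo_mult by' bo_adj)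
    (simp add: bo_simps[OF sb] comm[OF _ y] comm[OF _ ay])
 qed (simp add: q_def inner_sums inner_i_left adj_inner[OF by'] adj_inner'[OF by']
   bo_scaleC[OF by'] bo_scaleC[OF bo_adj[OF by']])
 ultimately have "P (%v. (1/2) *c (p v + (- \<i>) *c q v))" by (intro P)
 moreover have "(1/2) *c (p v + (- \<i>) *c q v) = y v" for v
 proof -
  have "(- \<i>) *c q v = y v - adj y v" by (simp add: q_def scaleC_diff_right scaleC_scaleC)
  hence "p v + (- \<i>) *c q v = 2 *c y v" using scaleC_add_left[of 1 1 "y v"] by (simp add: p_def)
  thus ?thesis by (simp add: scaleC_scaleC)
 qed
 ultimately show ?thesis by simp
qed

section \<open>Decomposable operators on L2(R, H)\<close>

lemma L2_eq_iff: assumes "square_integrable f" "square_integrable g"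
 shows "abs_L2 f = abs_L2 g <-> (AE t in lborel. f t = g t)" using Quotient3_rel[OF Quotient3_L2, of f g] assms by auto

lemma rep_abs_L2: "square_integrable f ==> AE t in lborel. rep_L2 (abs_L2 f) t = f t"
 using L2_eq_iff[OF square_integrable_rep[of "abs_L2 f"], of f] by (simp add: abs_rep_L2)

lemma L2_eqI: "AE t in lborel. rep_L2 x t = rep_L2 y t ==> x = y"
 using L2_eq_iff[OF square_integrable_rep square_integrable_rep, of x y] by (simp add: abs_rep_L2)

lemma L2_zero_iff: "x = 0 <-> (AE t in lborel. rep_L2 x t = 0)"
 using L2_eq_iff[OF square_integrable_rep square_integrable_zero, of x] by (simp add: abs_rep_L2 zero_L2_def)

lemma inner_L2_rep: "inner x y = (LINT t|lborel. inner (rep_L2 x t) (rep_L2 y t))"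
 using inner_L2.abs_eq[of "rep_L2 x" "rep_L2 y"] by (simp add: square_integrable_rep abs_rep_L2)

lemma rep_L2_plus: "AE t in lborel. rep_L2 (x + y) t = rep_L2 x t + rep_L2 y t"
 using rep_abs_L2[OF square_integrable_add[OF square_integrable_rep[of x] square_integrable_rep[of y]]]
  plus_L2.abs_eq[of "rep_L2 x" "rep_L2 y"] by (simp add: square_integrable_rep abs_rep_L2)

lemma rep_L2_scaleC: "AE t in lborel. rep_L2 (c *c x) t = c *c rep_L2 x t"
 using rep_abs_L2[OF square_integrable_scaleC[OF square_integrable_rep[of x]], of c]
  scaleC_L2.abs_eq[of "rep_L2 x" c] by (simp add: square_integrable_rep abs_rep_L2)


definition operator_field :: "(real => 'h::complex_hilbert operator) => bool"
 where "operator_field F <-> (ALL t. bop (F t)) & (EX C. ALL t v. norm (F t v) <= C * norm v) &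
  (ALL v. continuous_on UNIV (%t. F t v))"

definition decomposable :: "(real => 'h::complex_hilbert operator) => 'h L2 operator"
 where "decomposable F x = abs_L2 (%t. F t (rep_L2 x t))"

lemma strongly_measurable_continuous:
 fixes f :: "real => 'a::metric_space" assumes "continuous_on UNIV f" shows "strongly_measurable f"
 unfolding strongly_measurable_def
proof (intro conjI exI)
 show "f : borel_measurable lborel" using borel_measurable_continuous_onI[OF assms] by simp
 show "countable (f ` \<rat>)" by (simp add: countable_rat)
 show "range f <= closure (f ` \<rat>)"
 proof clarify
  fix t :: real
  have "t : closure \<rat>" by (simp add: Rats_closure_real)
  then obtain X where X: "!!n. X n : \<rat>" "X ----> t" unfolding closure_sequential by auto
  have "(%n. f (X n)) ----> f t" by (rule continuous_on_tendsto_compose[OF assms X(2)]) auto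
  thus "f t : closure (f ` \<rat>)" unfolding closure_sequential using X(1) by (intro exI[of _ "%n. f (X n)"]) auto
 qed
qed

text \<open>The argument is a limit of functions with countably many values, and for each fixed
  value \<open>F t (d k)\<close> is continuous in \<open>t\<close>.\<close>

lemma strongly_measurable_field: assumes F: "operator_field F" and f: "strongly_measurable f"
 shows "strongly_measurable (%t. F t (f t))"
proof -
 obtain i d where i[measurable]: "!!n. i n : measurable lborel (count_space (UNIV::nat set))"
  and d: "!!t. (%n. d (i n t)) ----> f t" using strongly_measurable_approx[OF f] by blast
 have sm: "strongly_measurable (%t. F t (d k))" for k
  using F by (intro strongly_measurable_continuous) (simp add: operator_field_def)
 then obtain C where C: "!!k. countable (C k)" "!!k. range (%t. F t (d k)) <= closure (C k)"
  unfolding strongly_measurable_def by metis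
 have "strongly_measurable (%t. F t (d (i n t)))" for n unfolding strongly_measurable_def
 proof (intro conjI exI)
  show "(%t. F t (d (i n t))) : borel_measurable lborel"
   by (rule measurable_compose_countable[OF strongly_measurable_borel[OF sm] i])
  show "countable (UN k. C k)" using C(1) by simp
  show "range (%t. F t (d (i n t))) <= closure (UN k. C k)"
  proof clarify
   fix t
   have "F t (d (i n t)) : closure (C (i n t))" using C(2) by blast
   thus "F t (d (i n t)) : closure (UN k. C k)" using closure_mono[of "C (i n t)" "UN k. C k"] by blast
  qed
 qed
 moreover have "bop (F t)" for t using F by (simp add: operator_field_def)
 hence "(%n. F t (d (i n t))) ----> F t (f t)" for t by (rule bo_tendsto[OF _ d])
 ultimately show ?thesis by (rule strongly_measurable_lim)
qed

lemma square_integrable_field: assumes F: "operator_field F" and f: "square_integrable f"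
 shows "square_integrable (%t. F t (f t))"
proof -
 obtain C where C: "!!t v. norm (F t v) <= C * norm v" using F unfolding operator_field_def by blast
 have sm: "strongly_measurable (%t. F t (f t))"
  by (rule strongly_measurable_field[OF F]) (use f in "simp add: square_integrable_alt")
 moreover have "integrable lborel (%t. (norm (F t (f t)))^2)"
 proof (rule Bochner_Integration.integrable_bound)
  show "integrable lborel (%t. C^2 * (norm (f t))^2)" using f by (simp add: square_integrable_alt)
  show "(%t. (norm (F t (f t)))^2) : borel_measurable lborel" using strongly_measurable_borel[OF sm] by measurable
  show "AE t in lborel. norm ((norm (F t (f t)))^2) <= norm (C^2 * (norm (f t))^2)"
   using power_mono[OF C norm_ge_zero, where n=2] by (simp add: power_mult_distrib)
 qed
 ultimately show ?thesis by (simp add: square_integrable_alt)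
qed

lemma rep_decomposable:
 "operator_field F ==> AE t in lborel. rep_L2 (decomposable F x) t = F t (rep_L2 x t)"
 unfolding decomposable_def by (rule rep_abs_L2[OF square_integrable_field[OF _ square_integrable_rep]])

lemma decomposable_comp: assumes F: "operator_field F" and G: "operator_field G" and H: "operator_field H"
  and FG: "!!t v. F t (G t v) = H t v"
 shows "decomposable F (decomposable G x) = decomposable H x"
proof (rule L2_eqI)
 show "AE t in lborel. rep_L2 (decomposable F (decomposable G x)) t = rep_L2 (decomposable H x) t"
  using rep_decomposable[OF F, of "decomposable G x"] rep_decomposable[OF G, of x] rep_decomposable[OF H, of x]
  by eventually_elim (simp add: FG)
qed

lemma inner_decomposable:
 assumes F: "operator_field F" and G: "operator_field G" and FG: "!!t u v. inner (F t u) v = inner u (G t v)"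
 shows "inner (decomposable F x) y = inner x (decomposable G y)" unfolding inner_L2_rep
proof (rule integral_cong_AE)
 have sm: "strongly_measurable (rep_L2 z)" for z :: "'a L2" using square_integrable_rep[of z] by (simp add: square_integrable_alt)
 show "(%t. inner (rep_L2 (decomposable F x) t) (rep_L2 y t)) : borel_measurable lborel"
  "(%t. inner (rep_L2 x t) (rep_L2 (decomposable G y) t)) : borel_measurable lborel" by (intro measurable_inner_strongly sm)+
 show "AE t in lborel. inner (rep_L2 (decomposable F x) t) (rep_L2 y t) = inner (rep_L2 x t) (rep_L2 (decomposable G y) t)"
  using rep_decomposable[OF F, of x] rep_decomposable[OF G, of y] by eventually_elim (simp add: FG)
qed

lemma norm_decomposable_le: assumes F: "operator_field F" and C: "!!t v. norm (F t v) <= C * norm v" and "C >= 0"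
 shows "norm (decomposable F x) <= C * norm x"
proof (rule power2_le_imp_le)
 have s: "square_integrable (%t. F t (rep_L2 x t))" by (rule square_integrable_field[OF F square_integrable_rep])
 have "(norm (decomposable F x))^2 = (LINT t|lborel. (norm (F t (rep_L2 x t)))^2)"
  unfolding decomposable_def by (rule norm_abs_L2[OF s])
 also have "... <= (LINT t|lborel. C^2 * (norm (rep_L2 x t))^2)"
 proof (rule integral_mono)
  show "integrable lborel (%t. (norm (F t (rep_L2 x t)))^2)" "integrable lborel (%t. C^2 * (norm (rep_L2 x t))^2)"
   using s square_integrable_rep[of x] by (auto simp: square_integrable_alt)
  show "(norm (F t (rep_L2 x t)))^2 <= C^2 * (norm (rep_L2 x t))^2" for t
   using power_mono[OF C norm_ge_zero, where n=2] by (simp add: power_mult_distrib)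
 qed
 also have "... = (C * norm x)^2" using norm_abs_L2[OF square_integrable_rep[of x]] by (simp add: abs_rep_L2 power_mult_distrib)
 finally show "(norm (decomposable F x))^2 <= (C * norm x)^2" .
qed (use assms in simp)

lemma bo_decomposable: assumes F: "operator_field F" shows "bop (decomposable F)"
proof -
 obtain C where C: "!!t v. norm (F t v) <= C * norm v" using F unfolding operator_field_def by blast
 have C': "norm (F t v) <= \<bar>C\<bar> * norm v" for t v
  using order_trans[OF C mult_right_mono[OF abs_ge_self[of C] norm_ge_zero]] .
 have Fb: "bop (F t)" for t using F by (simp add: operator_field_def)
 have sc: "decomposable F (c *c x) = c *c decomposable F x" for c x
 proof (rule L2_eqI)
  show "AE t in lborel. rep_L2 (decomposable F (c *c x)) t = rep_L2 (c *c decomposable F x) t"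
   using rep_decomposable[OF F, of "c *c x"] rep_L2_scaleC[of c x] rep_L2_scaleC[of c "decomposable F x"]
    rep_decomposable[OF F, of x] by eventually_elim (simp add: bo_scaleC[OF Fb])
 qed
 have "decomposable F (x + y) = decomposable F x + decomposable F y" for x y
 proof (rule L2_eqI)
  show "AE t in lborel. rep_L2 (decomposable F (x + y)) t = rep_L2 (decomposable F x + decomposable F y) t"
   using rep_decomposable[OF F, of "x + y"] rep_L2_plus[of x y] rep_L2_plus[of "decomposable F x" "decomposable F y"]
    rep_decomposable[OF F, of x] rep_decomposable[OF F, of y] by eventually_elim (simp add: bo_add[OF Fb])
 qed
 thus ?thesis using sc[of "of_real _"] norm_decomposable_le[OF F C']
  by (intro boI bounded_linear_intro[where K="\<bar>C\<bar>"]) (auto simp: scaleC_of_real sc mult.commute)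
qed

section \<open>Shifts and phases\<close>

lemma AE_lborel_shift: assumes "AE t in lborel. P t" shows "AE t in lborel. P (t - s :: real)"
proof -
 obtain N where N: "{t. ~ P t} <= N" "N : null_sets lborel" using assms by (auto elim!: AE_E simp: null_sets_def)
 hence "AE t in lborel. t ~: N" by (intro AE_not_in)
 moreover have "Measurable.pred borel (%t. t ~: N)" using N(2) by (auto simp: null_sets_def)
 ultimately have "AE t in lborel. (- s) + 1 * t ~: N" by (intro AE_borel_affine) auto
 thus ?thesis by eventually_elim (use N(1) in auto)
qed

lemma square_integrable_shift:
 fixes f :: "real => 'a::complex_hilbert" assumes f: "square_integrable f" shows "square_integrable (%t. f (t - s))"
proof -
 have sm: "strongly_measurable f" and i: "integrable lborel (%t. (norm (f t))^2)" using f by (auto simp: square_integrable_alt)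
 have "strongly_measurable (%t. f (t - s))" using sm unfolding strongly_measurable_def
  by (auto intro: measurable_compose[of "%t. t - s" lborel borel f])
 moreover have "integrable lborel (%t. (norm (f (t - s)))^2)" using lborel_integrable_real_affine[OF i, of 1 "- s"] by simp
 ultimately show ?thesis by (simp add: square_integrable_alt)
qed

lemma rep_shift: "AE t in lborel. rep_L2 (sft s x) t = rep_L2 x (t - s)"
 unfolding shift_op_def by (rule rep_abs_L2[OF square_integrable_shift[OF square_integrable_rep]])

lemma shift_shift: "sft s (sft r x) = sft (s + r) x"
proof (rule L2_eqI)
 show "AE t in lborel. rep_L2 (sft s (sft r x)) t = rep_L2 (sft (s + r) x) t"
  using rep_shift[of s "sft r x"] AE_lborel_shift[OF rep_shift[of r x], of s] rep_shift[of "s + r" x]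
  by eventually_elim (simp add: algebra_simps)
qed

lemma shift_zero [simp]: "sft 0 x = x" by (rule L2_eqI) (use rep_shift[of 0 x] in simp)

lemma inner_shift: "inner (sft s x) y = inner x (sft (- s) y)"
proof -
 have sm: "strongly_measurable (rep_L2 z)" for z :: "'a L2" using square_integrable_rep[of z] by (simp add: square_integrable_alt)
 have sm': "strongly_measurable (%t. rep_L2 z (t - r))" for z :: "'a L2" and r
  using square_integrable_shift[OF square_integrable_rep[of z], of r] by (simp add: square_integrable_alt)
 have "inner (sft s x) y = (LINT t|lborel. inner (rep_L2 x (t - s)) (rep_L2 y t))" unfolding inner_L2_rep
  by (intro integral_cong_AE measurable_inner_strongly sm sm') (use rep_shift[of s x] in "auto elim: eventually_mono")
 also have "... = (LINT t|lborel. inner (rep_L2 x t) (rep_L2 y (t - (- s))))"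
  using lborel_integral_real_affine[of 1 "%t. inner (rep_L2 x (t - s)) (rep_L2 y t)" s] by (simp add: add.commute)
 also have "... = inner x (sft (- s) y)" unfolding inner_L2_rep
  by (intro integral_cong_AE measurable_inner_strongly sm sm') (use rep_shift[of "- s" y] in "auto elim: eventually_mono")
 finally show ?thesis .
qed

lemma norm_shift: "norm (sft s x) = norm x" unfolding norm_eq_sqrt_inner inner_shift shift_shift by simp

lemma bo_shift: "bop (sft s)"
proof -
 have sc: "sft s (c *c x) = c *c sft s x" for c and x :: "'a L2"
 proof (rule L2_eqI)
  show "AE t in lborel. rep_L2 (sft s (c *c x)) t = rep_L2 (c *c sft s x) t"
   using rep_shift[of s "c *c x"] AE_lborel_shift[OF rep_L2_scaleC[of c x], of s] rep_L2_scaleC[of c "sft s x"] rep_shift[of s x]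
   by eventually_elim simp
 qed
 have "sft s (x + y) = sft s x + sft s y" for x y :: "'a L2"
 proof (rule L2_eqI)
  show "AE t in lborel. rep_L2 (sft s (x + y)) t = rep_L2 (sft s x + sft s y) t"
   using rep_shift[of s "x + y"] AE_lborel_shift[OF rep_L2_plus[of x y], of s] rep_L2_plus[of "sft s x" "sft s y"]
    rep_shift[of s x] rep_shift[of s y] by eventually_elim simp
 qed
 thus ?thesis using sc[of "of_real _"] by (intro boI bounded_linear_intro[where K=1]) (auto simp: scaleC_of_real sc norm_shift)
qed

lemma adj_shift: "adj (sft s) = sft (- s)" by (rule adj_eqI[OF bo_shift inner_shift])

lemma operator_field_phase: "operator_field (%t v::'h::complex_hilbert. cis (- (s * t)) *c v)" unfolding operator_field_def
proof (intro conjI allI)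
 show "bop (%v::'h. cis (- (s * t)) *c v)" for t by (rule bo_mult[OF bo_id])
 show "EX C. ALL t (v::'h). norm (cis (- (s * t)) *c v) <= C * norm v" by (intro exI[of _ 1]) (simp add: norm_scaleC)
 show "continuous_on UNIV (%t. cis (- (s * t)) *c v)" for v :: 'h
  unfolding scaleC_conv[of "cis _"] by (auto intro!: continuous_intros)
qed

lemma phase_op_decomposable: "ph s = decomposable (%t v. cis (- (s * t)) *c v)" by (auto simp: phase_op_def decomposable_def)

lemma bo_phase: "bop (ph s)" unfolding phase_op_decomposable by (rule bo_decomposable[OF operator_field_phase])

lemma rep_phase: "AE t in lborel. rep_L2 (ph s x) t = cis (- (s * t)) *c rep_L2 x t"
 unfolding phase_op_decomposable by (rule rep_decomposable[OF operator_field_phase])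

lemma phase_phase: "ph s (ph r x) = ph (s + r) x" unfolding phase_op_decomposable
 by (rule decomposable_comp[OF operator_field_phase operator_field_phase operator_field_phase])
  (simp add: scaleC_scaleC cis_mult algebra_simps)

lemma phase_zero [simp]: "ph 0 x = x" by (rule L2_eqI) (use rep_phase[of 0 x] in simp)

lemma inner_phase: "inner (ph s x) y = inner x (ph (- s) y)" unfolding phase_op_decomposable
 by (rule inner_decomposable[OF operator_field_phase operator_field_phase]) (simp add: inner_scaleC_left cis_cnj)

lemma norm_phase: "norm (ph s x) = norm x" unfolding norm_eq_sqrt_inner inner_phase phase_phase by simp

text \<open>The Weyl relation. Since the imaginary powers of \<open>h\<close> are the shifts, it is
  the source of \<open>\<theta>\<^sub>s(h) = e\<^sup>-\<^sup>s h\<close>.\<close>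

lemma phase_shift: "ph s (sft r x) = cis (- (s * r)) *c sft r (ph s x)"
proof (rule L2_eqI)
 show "AE t in lborel. rep_L2 (ph s (sft r x)) t = rep_L2 (cis (- (s * r)) *c sft r (ph s x)) t"
  using rep_phase[of s "sft r x"] rep_shift[of r x] rep_L2_scaleC[of "cis (- (s * r))" "sft r (ph s x)"]
   rep_shift[of r "ph s x"] AE_lborel_shift[OF rep_phase[of s x], of r]
  by eventually_elim (simp add: scaleC_scaleC cis_mult algebra_simps)
qed

lemma (in spectral) I_indicator: assumes "B : sets borel" shows "I (ind B) v = E B v"
proof -
 have d: "v : sdom E (ind B)" by (rule sdom_bounded[where C=1]) (use assms in "auto simp: indicator_def")
 have "L2lim v (%k. [(1, B)]) (ind B)" by (rule L2lim_dominated[OF _ _ sdom_bounded[of "%u. 0" 0]]) (use assms in auto)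
 hence "(%k::nat. step_op E [(1, B)] v) ----> I (ind B) v" by (intro I_lim d) (use assms in measurable)
 thus ?thesis by (simp add: LIMSEQ_const_iff)
qed

section \<open>The crossed product\<close>

locale crossed =
 fixes M :: "'h::complex_hilbert operator set" and \<nu> :: "'h operator => ennreal"
  and \<sigma> :: "real => 'h operator => 'h operator" and \<tau> :: "'h L2 operator => ennreal" and h :: "'h L2 graph"
 assumes vM: "von_neumann_algebra M" and nu: "fns_weight M \<nu>" and modular: "modular_group M \<nu> \<sigma>"
  and canonical: "canonical_trace M \<nu> \<sigma> \<tau> h"
begin

sublocale M: weighted M \<nu> by standard (rule vM, rule nu)

lemma star: "star_automorphism M (\<sigma> t)" using modular by (simp add: modular_group_def one_parameter_automorphism_group_def)

lemma sigma_mem: "x : M ==> \<sigma> t x : M" using star[of t] by (auto simp: star_automorphism_def bij_betw_def)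

lemma sigma_comp: "x : M ==> y : M ==> \<sigma> t (x o y) = \<sigma> t x o \<sigma> t y"
 and sigma_plus: "x : M ==> y : M ==> \<sigma> t (%v. x v + y v) = (%v. \<sigma> t x v + \<sigma> t y v)"
 and sigma_scaleC: "x : M ==> \<sigma> t (%v. c *c x v) = (%v. c *c \<sigma> t x v)"
 and sigma_adj: "x : M ==> \<sigma> t (adj x) = adj (\<sigma> t x)" using star[of t] by (auto simp: star_automorphism_def)

lemma sigma_group: "x : M ==> \<sigma> (s + t) x = \<sigma> s (\<sigma> t x)"
 using modular by (simp add: modular_group_def one_parameter_automorphism_group_def)

lemma sigma_continuous: "x : M ==> continuous_on UNIV (%t. \<sigma> t x v)"
 using modular by (simp add: modular_group_def one_parameter_automorphism_group_def)

lemma sigma_zero: "x : M ==> \<sigma> 0 x = x" using sigma_group[of x 0 0] star[of 0] sigma_mem[of x 0]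
 by (auto simp: star_automorphism_def bij_betw_def inj_on_def)

lemma sigma_minus: "x : M ==> \<sigma> (- t) (\<sigma> t x) = x" "x : M ==> \<sigma> t (\<sigma> (- t) x) = x"
 using sigma_group[of x "- t" t] sigma_group[of x t "- t"] sigma_zero by auto

lemma sigma_id: "\<sigma> t (%v. v) = (%v. v)"
proof -
 have "\<sigma> t (\<sigma> (- t) (%v. v)) = \<sigma> t ((%v. v) o \<sigma> (- t) (%v. v))" by (simp add: o_def)
 also have "... = \<sigma> t (%v. v) o \<sigma> t (\<sigma> (- t) (%v. v))" by (intro sigma_comp M.id_mem sigma_mem)
 finally show ?thesis using sigma_minus(2)[OF M.id_mem, of t] by (auto simp: fun_eq_iff)
qed

lemma sigma_invariant: "x : pos_part M ==> \<nu> (\<sigma> t x) = \<nu> x" using modular by (simp add: modular_group_def)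

text \<open>Star automorphisms are given by algebraic conditions; they are contractive because
  \<open>C^2 - adj x o x\<close> is the square of a selfadjoint element of \<open>M\<close>, and so
  is its image.\<close>

lemma sigma_norm_le: assumes x: "x : M" and C: "!!v. norm (x v) <= C * norm v"
 shows "norm (\<sigma> t x v) <= \<bar>C\<bar> * norm v"
proof -
 note bx = M.bounded[OF x]
 \<comment> \<open>Written with complex multiples and sums so that the algebraic rules for
   \<open>\<sigma> t\<close> apply term by term.\<close>
 define X where "X v = of_real (C^2) *c v + (- 1) *c (adj x o x) v" for v
 have XM: "X : M" unfolding X_def by (intro M.plus_mem M.scaleC_mem M.id_mem M.comp_mem M.adj_mem x)
 have "posop X" unfolding posop_iff
 proof (intro conjI allI)
  show "bop X" by (rule M.bounded[OF XM])
  show "inner (X u) v = inner u (X v)" for u v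
   by (simp add: X_def scaleC_of_real[of "C^2", simplified] inner_sums adj_inner'[OF bx] adj_inner[OF bx, symmetric])
  show "0 <= inner v (X v)" for v using power_mono[OF C norm_ge_zero, where n=2, of v]
   by (simp add: X_def scaleC_of_real[of "C^2", simplified] inner_diff_right adj_inner[OF bx, symmetric] norm_sq[symmetric] power_mult_distrib)
 qed
 then obtain r where r: "r : M" "posop r" "r o r = X" using M.sqrt_mem[OF XM] by metis
 have "adj r = r" using selfadjoint_iff[OF M.bounded[OF r(1)]] posop_sym[OF r(2)] by blast
 hence as: "adj (\<sigma> t r) = \<sigma> t r" using sigma_adj[OF r(1), of t] by simp
 have "\<sigma> t X = (%v. of_real (C^2) *c v + (- 1) *c (adj (\<sigma> t x) o \<sigma> t x) v)" unfolding X_def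
  by (simp only: sigma_plus sigma_scaleC sigma_comp sigma_adj M.scaleC_mem M.id_mem M.comp_mem M.adj_mem x sigma_id)
 moreover have "\<sigma> t X = \<sigma> t r o \<sigma> t r" using sigma_comp[OF r(1) r(1)] r(3) by simp
 ultimately have "\<sigma> t r (\<sigma> t r v) = of_real (C^2) *c v + (- 1) *c adj (\<sigma> t x) (\<sigma> t x v)" by (auto simp: fun_eq_iff)
 hence "inner v (\<sigma> t r (\<sigma> t r v)) = C^2 * (norm v)^2 - (norm (\<sigma> t x v))^2"
  by (simp add: scaleC_of_real[of "C^2", simplified] inner_diff_right adj_inner[OF M.bounded[OF sigma_mem[OF x]], symmetric] norm_sq)
 moreover have "inner v (\<sigma> t r (\<sigma> t r v)) >= 0"
  using adj_inner[OF M.bounded[OF sigma_mem[OF r(1)]], of t v "\<sigma> t r v"] as by simp (metis inner_ge_zero)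
 ultimately have "(norm (\<sigma> t x v))^2 <= (\<bar>C\<bar> * norm v)^2" by (simp add: power_mult_distrib)
 thus ?thesis by (rule power2_le_imp_le) simp
qed

abbreviation \<pi> :: "'h operator => 'h L2 operator" where "\<pi> == crossed_embed \<sigma>"

lemma pi_decomposable: "\<pi> x = decomposable (%t. \<sigma> (- t) x)" by (auto simp: crossed_embed_def decomposable_def)

lemma operator_field_pi: assumes x: "x : M" shows "operator_field (%t. \<sigma> (- t) x)" unfolding operator_field_def
proof (intro conjI allI)
 show "bop (\<sigma> (- t) x)" for t by (intro M.bounded sigma_mem x)
 obtain C where C: "C > 0" "!!v. norm (x v) <= C * norm v" using bo_bound[OF M.bounded[OF x]] by blast
 show "EX C. ALL t v. norm (\<sigma> (- t) x v) <= C * norm v" using sigma_norm_le[OF x C(2)] by blast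
 show "continuous_on UNIV (%t. \<sigma> (- t) x v)" for v
  by (rule continuous_on_compose2[OF sigma_continuous[OF x]]) (auto intro: continuous_intros)
qed

lemma rep_pi: "x : M ==> AE t in lborel. rep_L2 (\<pi> x xi) t = \<sigma> (- t) x (rep_L2 xi t)"
 unfolding pi_decomposable by (rule rep_decomposable[OF operator_field_pi])

lemma bo_pi: "x : M ==> bop (\<pi> x)" unfolding pi_decomposable by (rule bo_decomposable[OF operator_field_pi])

lemma pi_comp: assumes "x : M" "y : M" shows "\<pi> (x o y) xi = \<pi> x (\<pi> y xi)" unfolding pi_decomposable
 by (rule decomposable_comp[OF operator_field_pi[OF assms(1)] operator_field_pi[OF assms(2)]
    operator_field_pi[OF M.comp_mem[OF assms]], symmetric]) (simp add: sigma_comp assms)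

lemma adj_pi: assumes x: "x : M" shows "adj (\<pi> x) = \<pi> (adj x)" unfolding pi_decomposable
 by (intro adj_eqI bo_decomposable operator_field_pi x inner_decomposable M.adj_mem)
  (simp add: sigma_adj[OF x] adj_inner[OF M.bounded[OF sigma_mem[OF x]]])

lemma isp_pi: assumes "is_projection e" "e : M" shows "is_projection (\<pi> e)"
proof -
 have e: "e o e = e" "adj e = e" using assms(1) by (auto simp: is_projection_def)
 have "\<pi> e o \<pi> e = \<pi> e" by (rule ext) (simp add: pi_comp[OF assms(2) assms(2), symmetric] e)
 thus ?thesis using adj_pi[OF assms(2)] bo_pi[OF assms(2)] by (simp add: is_projection_def e)
qed

lemma phase_pi: assumes x: "x : M" shows "ph s (\<pi> x xi) = \<pi> x (ph s xi)"
proof (rule L2_eqI)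
 show "AE t in lborel. rep_L2 (ph s (\<pi> x xi)) t = rep_L2 (\<pi> x (ph s xi)) t"
  using rep_phase[of s "\<pi> x xi"] rep_pi[OF x, of xi] rep_pi[OF x, of "ph s xi"] rep_phase[of s xi]
  by eventually_elim (simp add: bo_scaleC[OF M.bounded[OF sigma_mem[OF x]]])
qed

lemma shift_pi: assumes x: "x : M" shows "sft s (\<pi> x xi) = \<pi> (\<sigma> s x) (sft s xi)"
proof (rule L2_eqI)
 show "AE t in lborel. rep_L2 (sft s (\<pi> x xi)) t = rep_L2 (\<pi> (\<sigma> s x) (sft s xi)) t"
  using rep_shift[of s "\<pi> x xi"] AE_lborel_shift[OF rep_pi[OF x, of xi], of s] rep_pi[OF sigma_mem[OF x], of s "sft s xi"] rep_shift[of s xi]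
  by eventually_elim (simp add: sigma_group[OF x, symmetric] algebra_simps)
qed

definition gens :: "'h L2 operator set" where "gens = \<pi> ` M Un range sft"

abbreviation A :: "'h L2 operator set" where "A == crossed_product M \<sigma>"

lemma A_def': "A = commutant (commutant gens)" by (simp add: crossed_product_def gens_def)

lemma gens_bounded: "x : gens ==> bop x" by (auto simp: gens_def bo_pi bo_shift)

lemma gens_subset: "gens <= A" unfolding A_def' by (auto simp: commutant_def gens_bounded)

lemma commutant_A: "commutant A = commutant gens" using gens_subset unfolding A_def' by (auto simp: commutant_def)

lemma adj_commutant_gens: "b : commutant gens ==> adj b : commutant gens"
 by (rule adj_commutant[OF gens_bounded]) (auto simp: gens_def adj_shift adj_pi M.adj_mem)

lemma adj_A: "y : A ==> adj y : A" unfolding A_def' by (rule adj_commutant[OF _ adj_commutant_gens]) (simp_all add: commutant_def)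

lemma von_neumann_A: "von_neumann_algebra A" unfolding von_neumann_algebra_def commutant_A A_def'[symmetric]
 using adj_A by (auto simp: A_def' commutant_def)

sublocale tracial A \<tau> using canonical von_neumann_A by unfold_locales (auto simp: canonical_trace_def)

lemma pi_mem: "x : M ==> \<pi> x : A" and shift_mem: "sft s : A" using gens_subset by (auto simp: gens_def)

text \<open>Phases commute with the image of \<open>M\<close>, and with the shifts up to scalars, so
  conjugation by a phase preserves the commutant of the generators. The dual action therefore
  preserves \<open>A\<close> as well as affiliation.\<close>

lemma phase_commutant: assumes b: "b : commutant A" shows "(%v. ph s (b (ph (- s) v))) : commutant A"
proof -
 have b': "b : commutant gens" using b commutant_A by simp
 have bb: "bop b" using b' by (simp add: commutant_def)
 have bc: "x (b v) = b (x v)" if "x : gens" for x v using b' that by (auto simp: commutant_def fun_eq_iff)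
 have bd: "bop (%v. ph s (b (ph (- s) v)))" using bo_comp[OF bo_phase bo_comp[OF bb bo_phase]] by (simp add: o_def)
 have "x (ph s (b (ph (- s) v))) = ph s (b (ph (- s) (x v)))" if x: "x : gens" for x v
 proof -
  consider m where "m : M" "x = \<pi> m" | r where "x = sft r" using x by (auto simp: gens_def)
  thus ?thesis
 proof cases
  case (1 m)
  have "x (ph s (b (ph (- s) v))) = ph s (\<pi> m (b (ph (- s) v)))" unfolding 1(2) by (rule phase_pi[OF 1(1), symmetric])
  also have "\<pi> m (b (ph (- s) v)) = b (\<pi> m (ph (- s) v))" using bc[OF x] unfolding 1(2) .
  also have "\<pi> m (ph (- s) v) = ph (- s) (x v)" unfolding 1(2) by (rule phase_pi[OF 1(1), symmetric])
  finally show ?thesis .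
 next
  case (2 r)
  have "sft r (ph s w) = cis (s * r) *c ph s (sft r w)" for w by (simp add: phase_shift scaleC_scaleC cis_mult)
  from this[of "b (ph (- s) v)"]
  have "x (ph s (b (ph (- s) v))) = cis (s * r) *c ph s (b (sft r (ph (- s) v)))"
   unfolding 2 using bc[OF x, of "ph (- s) v"] unfolding 2 by metis
  also have "... = ph s (b (ph (- s) (x v)))" using phase_shift[of "- s" r v] 2
   by (simp add: bo_scaleC[OF bb] bo_scaleC[OF bo_phase])
  finally show ?thesis by simp
 qed
 qed
 hence "(%v. ph s (b (ph (- s) v))) : commutant gens" unfolding commutant_def fun_eq_iff o_apply using bd by blast
 thus ?thesis unfolding commutant_A .
qed

lemma dual_action_mem: assumes y: "y : A" shows "dual_action s y : A"
proof (rule memI)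
 show "bop (dual_action s y)" unfolding dual_action_def by (intro bo_comp bo_phase bounded y)
 fix b v assume b: "b : commutant A"
 have "ph (- s) (b (ph s (y w))) = y (ph (- s) (b (ph s w)))" for w
  using commutantD[OF phase_commutant[OF b, of "- s"] y, of w] by simp
 from this[of "ph (- s) v"] have "ph (- s) (b (dual_action s y v)) = y (ph (- s) (b v))"
  by (simp add: dual_action_def phase_phase)
 hence "ph s (ph (- s) (b (dual_action s y v))) = dual_action s y (b v)" by (simp add: dual_action_def)
 thus "b (dual_action s y v) = dual_action s y (b v)" by (simp add: phase_phase)
qed

lemma tau_dual_action: "a : pos_part A ==> \<tau> (dual_action s a) = ennreal (exp (- s)) * \<tau> a"
 using canonical by (simp add: canonical_trace_def)

lemma dual_action_pos_part: assumes "a : pos_part A" shows "dual_action s a : pos_part A"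
proof -
 have a: "a : A" "posop a" using assms by (auto simp: pos_part_iff)
 have "inner v (dual_action s a v) = inner (ph (- s) v) (a (ph (- s) v))" for v
  using inner_phase[of "- s" v "a (ph (- s) v)"] by (simp add: dual_action_def)
 moreover have "inner (dual_action s a u) v = inner u (dual_action s a v)" for u v
  using inner_phase[of "- s" u "a (ph (- s) v)"] posop_sym[OF a(2)] by (simp add: dual_action_def inner_phase)
 ultimately show ?thesis using dual_action_mem[OF a(1)] bounded posop_nonneg[OF a(2)] by (auto simp: pos_part_iff posop_iff)
qed

lemma assumes K: "reducing K"
 shows red_phase: "reducing (ph s ` K)" and dim_phase: "dim (ph s ` K) = ennreal (exp (- s)) * dim K"
  and perp_phase: "(ph s ` K)\<bottom> = ph s ` (K\<bottom>)"
proof -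
 note K' = redD(1,3)[OF K]
 have im: "ph s ` L = ph (- s) -` L" for L :: "'h L2 set"
 proof (intro equalityI subsetI)
  fix v assume "v : ph (- s) -` L"
  thus "v : ph s ` L" by (intro image_eqI[of _ _ "ph (- s) v"]) (auto simp: phase_phase)
 qed (auto simp: phase_phase)
 have P: "is_projection (dual_action s (oproj K))" unfolding isp_iff using dual_action_mem[OF oproj_mem_algebra[OF K]] bounded
  by (auto simp: dual_action_def phase_phase oproj_id[OF K'] oproj_mem[OF K'] inner_phase oproj_sym[OF K']
    intro!: arg_cong2[where f=inner])
 have r: "range (dual_action s (oproj K)) = ph s ` K"
 proof -
  have "range (dual_action s (oproj K)) = ph s ` (oproj K ` range (ph (- s)))" by (auto simp: dual_action_def)
  also have "range (ph (- s)) = (UNIV :: 'h L2 set)" using phase_phase[of "- s" s] by (metis add.left_inverse phase_zero surjI)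
  finally show ?thesis using range_oproj[OF K'] by simp
 qed
 show "reducing (ph s ` K)" using red_range[OF P dual_action_mem[OF oproj_mem_algebra[OF K]]] r by simp
 show "dim (ph s ` K) = ennreal (exp (- s)) * dim K"
  using isp_eq_oproj(3)[OF P] tau_dual_action[OF oproj_pos_part[OF K], of s] unfolding r dim_def by simp
 show "(ph s ` K)\<bottom> = ph s ` (K\<bottom>)"
 proof -
  have "inner x (ph s y) = inner (ph (- s) x) y" for x y :: "'h L2" using inner_phase[of "- s" x y] by simp
  thus ?thesis unfolding im[of "K\<bottom>"] by (auto simp: perp_iff)
 qed
qed

lemma codim_phase: "reducing K ==> codim (ph s ` K) = ennreal (exp (- s)) * codim K" by (simp add: perp_phase dim_phase red_perp)

lemma td_phase: assumes D: "tdense D" shows "tdense (ph s ` D)" unfolding tdense_def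
proof (intro allI impI)
 fix dl :: real assume "dl > 0"
 then obtain K where K: "reducing K" "K <= D" "codim K <= ennreal (exp s * dl)"
  using tdD[OF D, of "exp s * dl"] by (metis exp_gt_zero mult_pos_pos)
 have "codim (ph s ` K) <= ennreal (exp (- s)) * ennreal (exp s * dl)"
  unfolding codim_phase[OF K(1)] by (rule mult_left_mono[OF K(3)]) simp
 also have "... = ennreal dl" by (simp flip: ennreal_mult' mult.assoc exp_add)
 finally show "EX K. reducing K & K <= ph s ` D & codim K <= ennreal dl" using red_phase[OF K(1)] K(2) by blast
qed

end

section \<open>The spectral measure of \<open>h\<close> and the dual action\<close>

context crossed
begin

lemma h_calculus:
 shows spectral_measure_exists: "EX E. spectral_measure E & h = si E complex_of_real"
  and I_ipower: "spectral_measure E ==> h = si E complex_of_real ==>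
   spectral.I E (ipower t) v = sft t v"
proof -
 have bc: "borel_calculus (ipower t) h = op_graph (sft t)" for t
  using canonical unfolding canonical_trace_def ipower_def[abs_def] by blast
 \<comment> \<open>\<open>borel_calculus\<close> ranges over the spectral measures of
   \<open>h\<close>; its value here is a nonempty graph, so there is one.\<close>
 have "(0, 0) : op_graph (sft 0 :: 'h L2 operator)" by simp
 thus "EX E. spectral_measure E & h = si E complex_of_real" unfolding bc[symmetric] borel_calculus_def by blast
 assume E: "spectral_measure E" "h = si E complex_of_real"
 interpret E: spectral E by standard (rule E)
 have "(v, E.I (ipower t) v) : si E (ipower t)" by (simp add: E.spectral_integral_op_graph[OF ipower_meas norm_ipower_le])
 hence "(v, E.I (ipower t) v) : borel_calculus (ipower t) h" unfolding borel_calculus_def using E by blast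
 thus "E.I (ipower t) v = sft t v" unfolding bc by simp
qed

text \<open>The case \<open>t = 0\<close> of \<open>h\<^sup>i\<^sup>t = \<lambda>(t)\<close>: the
  indicator function of the positive axis gives the identity, so \<open>h\<close> is
  injective.\<close>

lemma E_support: assumes E: "spectral_measure E" "h = si E complex_of_real"
 shows "E {0<..} v = v"
proof -
 interpret E: spectral E by standard (rule E)
 have "E {0<..} v = E.I (ind {0<..}) v" by (rule E.I_indicator[symmetric]) simp
 also have "(ind {0<..} :: real => complex) = ipower 0" by (auto simp: ipower_def indicator_def)
 finally show ?thesis using I_ipower[OF E, of 0 v] by simp
qed

definition E :: "real set => 'h L2 operator" where "E = (SOME E. spectral_measure E & h = si E complex_of_real)"

lemma E_spectral: "spectral_measure E" and h_eq: "h = si E complex_of_real"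
 using someI_ex[OF spectral_measure_exists] by (auto simp: E_def)

sublocale S: spectral E by standard (rule E_spectral)

lemma E_pos [simp]: "E {0<..} v = v" by (rule E_support[OF E_spectral h_eq])

lemma AE_pos: "AE u in smeas E v. u > 0"
proof -
 have "E (UNIV - {0<..}) v = 0" using S.E_disjoint[of "{0<..}" "UNIV - {0<..}" v] by simp
 hence "emeasure (smeas E v) (UNIV - {0<..}) = 0" by (simp add: S.em_scalar)
 thus ?thesis by (intro AE_I[where N="UNIV - {0<..}"]) auto
qed

lemma I_ipower_E: "S.I (ipower t) v = sft t v" by (rule I_ipower[OF E_spectral h_eq])

text \<open>For unitaries commuting with the shifts this is \<open>spectral_intertwine\<close>; as
  the set of shifts is selfadjoint, the general case reduces to them.\<close>

lemma commute_E: assumes b: "bop b" "!!t v. b (sft t v) = sft t (b v)" and B: "B : sets borel"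
 shows "b (E B v) = E B (b v)"
proof -
 let ?S = "range sft :: 'h L2 operator set"
 have "ALL v. b (E B v) = E B (b v)"
 proof (rule commutant_unitary_induct[where S="?S" and P="%x. ALL v. x (E B v) = E B (x v)" and y=b])
  show "adj y : commutant ?S" if "y : commutant ?S" for y by (rule adj_commutant[OF _ _ that]) (auto simp: bo_shift adj_shift)
  show "b : commutant ?S" using b by (auto simp: commutant_def)
  fix x assume "bop x" "ALL v. x (E B v) = E B (x v)"
  hence "inner u (adj x (E B v)) = inner u (E B (adj x v))" for u v using S.E_sym[OF B] by (metis adj_inner)
  thus "ALL v. adj x (E B v) = E B (adj x v)" by (metis vector_eq_ldot)
 next
  fix x assume x: "x : commutant ?S" "!!v. norm (x v) = norm v" "surj x"
  hence "bop x" "x (sft t v) = sft t (x v)" for t v by (auto simp: commutant_def fun_eq_iff)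
  thus "ALL v. x (E B v) = E B (x v)"
   using spectral_intertwine[OF S.spectral_axioms E_pos S.spectral_axioms E_pos _ x(2,3) _ B] by (simp add: I_ipower_E)
 qed (use S.E_bounded[OF B] in "auto simp: bo_shift bo_add bo_scaleC")
 thus ?thesis by blast
qed

text \<open>All spectral measures of \<open>h\<close> have the shifts as imaginary powers and
  therefore coincide on Borel sets, so the choice made in \<open>E\<close> is immaterial.\<close>

lemma borel_calculus_h: "borel_calculus f h = si E f"
proof -
 have "si F f = si E f" if F: "spectral_measure F" "h = si F complex_of_real" for F
 proof -
  have sF: "spectral F" by standard (rule F)
  have "F B v = E B v" if "B : sets borel" for B v
   by (rule spectral_intertwine[OF sF E_support[OF F] S.spectral_axioms E_pos bo_id _ _ _ that])
    (simp_all add: I_ipower[OF F] I_ipower_E surj_def)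
  hence "smeas F v = smeas E v" for v
   by (intro measure_eqI) (simp_all add: spectral.em_scalar[OF sF] S.em_scalar spectral.sets_scalar[OF sF])
  thus ?thesis by (simp add: spectral_integral_def spectral_domain_def)
 qed
 thus ?thesis unfolding borel_calculus_def using E_spectral h_eq by blast
qed

lemma E_mem: "B : sets borel ==> E B : A" by (rule memI[OF S.E_bounded commute_E[OF commutant_bo commutantD[OF _ shift_mem]]])

text \<open>By the Weyl relation the phase carries the imaginary powers of \<open>E\<close> to those
  of the rescaled measure.\<close>

lemma phase_E: assumes B: "B : sets borel"
 shows "ph s (E B v) = E ((%u. exp (- s) * u) -` B) (ph s v)"
proof (rule spectral_intertwine[OF S.spectral_axioms E_pos spectral_rescale[OF S.spectral_axioms] _ bo_phase norm_phase _ _ B])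
 have "(%u. exp (- s) * u) -` {0::real<..} = {0<..}" by (auto simp: zero_less_mult_iff)
 thus "E ((%u. exp (- s) * u) -` {0<..}) v = v" for v by simp
 show "surj (ph s :: 'h L2 operator)" by (rule surjI[where f="ph (- s)"]) (simp add: phase_phase)
 show "ph s (S.I (ipower t) v) = spectral.I (%B. E ((%u. exp (- s) * u) -` B)) (ipower t) (ph s v)" for t v
 proof -
  have d: "w : sdom F (ipower t)" if "spectral F" for F and w :: "'h L2"
   by (rule spectral.sdom_bounded[OF that ipower_meas norm_ipower_le])
  have r: "spectral (%B. E ((%u. exp (- s) * u) -` B))" by (rule spectral_rescale[OF S.spectral_axioms]) simp
  have eq: "ipower t (exp (- s) * u) = cis (- (s * t)) * ipower t u" for u
   by (auto simp: ipower_def zero_less_mult_iff ln_mult cis_mult algebra_simps)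
  have "spectral.I (%B. E ((%u. exp (- s) * u) -` B)) (ipower t) (ph s v) = S.I (%u. ipower t (exp (- s) * u)) (ph s v)"
   by (rule I_rescale[OF S.spectral_axioms _ ipower_meas d[OF r]]) simp
  also have "... = cis (- (s * t)) *c sft t (ph s v)"
   unfolding eq using S.I_scale_fun(2)[OF ipower_meas d[OF S.spectral_axioms]] by (simp add: I_ipower_E)
  finally show ?thesis by (simp add: I_ipower_E phase_shift)
 qed
qed simp

lemma phase_I: assumes g: "g : BM"
 shows "ph s v : sdom E (%u. g (exp (- s) * u)) <-> v : sdom E g"
  and "v : sdom E g ==> ph s (S.I g v) = S.I (%u. g (exp (- s) * u)) (ph s v)"
proof -
 have *: "ph s v : sdom E (%u. g (exp (- s) * u)) & S.I (%u. g (exp (- s) * u)) (ph s v) = ph s (S.I g v)"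
  if g[measurable]: "g : BM" and v: "v : sdom E g" for s v g
 proof -
  have r: "spectral (%B. E ((%u. exp (- s) * u) -` B))" by (rule spectral_rescale[OF S.spectral_axioms]) simp
  have "ph s v : sdom (%B. E ((%u. exp (- s) * u) -` B)) g &
   spectral.I (%B. E ((%u. exp (- s) * u) -` B)) g (ph s v) = ph s (S.I g v)"
   by (rule intertwine_spectral_integral[OF S.spectral_axioms r bo_phase _ g v]) (rule phase_E)
  thus ?thesis using I_rescale[OF S.spectral_axioms exp_gt_zero g, of "ph s v" "- s"]
    sdom_rescale[OF S.spectral_axioms exp_gt_zero g, of "- s"] by simp
 qed
 thus "v : sdom E g ==> ph s (S.I g v) = S.I (%u. g (exp (- s) * u)) (ph s v)" using g by simp
 have [measurable]: "g : BM" by (rule g)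
 have "v : sdom E g" if "ph s v : sdom E (%u. g (exp (- s) * u))"
  using *[of "%u. g (exp (- s) * u)" "ph s v" "- s", OF _ that] by (simp add: phase_phase flip: mult.assoc exp_add)
 thus "ph s v : sdom E (%u. g (exp (- s) * u)) <-> v : sdom E g" using *[OF g] by blast
qed

lemma affiliated_spectral: assumes g: "g : BM" shows "affiliated A (si E g)"
proof (rule affiliatedI)
 fix b u v assume b: "b : commutant A" and uv: "(u, v) : si E g"
 have "b u : sdom E g & S.I g (b u) = b (S.I g u)"
 proof (rule intertwine_spectral_integral[OF S.spectral_axioms S.spectral_axioms commutant_bo[OF b] _ g])
  show "b (E B v) = E B (b v)" if "B : sets borel" for B v by (rule commutantD[OF b E_mem[OF that]])
 qed (use uv in "simp add: S.mem_si[OF g]")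
 thus "(b u, b v) : si E g" using uv by (simp add: S.mem_si[OF g])
qed

lemma I_mem: assumes g: "g : BM" "!!u. cmod (g u) <= C" shows "S.I g : A"
proof (rule memI[OF S.I_bounded_operator(1)[OF g]])
 fix b v assume b: "b : commutant A"
 have "(v, S.I g v) : si E g" by (simp add: S.spectral_integral_op_graph[OF g])
 from affiliatedD[OF affiliated_spectral[OF g(1)] b this] show "b (S.I g v) = S.I g (b v)"
  by (simp add: S.spectral_integral_op_graph[OF g])
qed

section \<open>Projections of finite weight\<close>

definition fin :: "'h operator set" where "fin = {f : M. is_projection f & \<nu> f < \<infinity>}"

lemma fin_iff: "is_projection f & f : n_ideal M \<nu> <-> f : fin" by (auto simp: fin_def n_ideal_def is_projection_def)

lemma finD: "f : fin ==> f : M" "f : fin ==> is_projection f" "f : fin ==> \<nu> f < \<infinity>" by (auto simp: fin_def)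

lemma projection_pos_part: "f : M ==> is_projection f ==> f : pos_part M"
 unfolding M.pos_part_iff posop_iff isp_iff by (metis inner_ge_zero)

lemma isp_sigma: assumes "f : M" "is_projection f" shows "is_projection (\<sigma> t f)"
proof -
 have "f o f = f" "adj f = f" using assms(2) by (auto simp: is_projection_def)
 thus ?thesis using sigma_comp[OF assms(1) assms(1), of t] sigma_adj[OF assms(1), of t] M.bounded[OF sigma_mem[OF assms(1)]]
  by (simp add: is_projection_def)
qed

lemma sigma_fin: "f : fin ==> \<sigma> t f : fin" by (auto simp: fin_def sigma_mem isp_sigma sigma_invariant projection_pos_part)

text \<open>Semifiniteness gives \<open>x\<close> of finite square weight with \<open>x y\<close>
  close to \<open>y\<close>. By Chebyshev's inequality the spectral projection of
  \<open>adj x o x\<close> above \<open>ep^2\<close> has finite weight, so it annihilates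
  \<open>y\<close>, and \<open>x y\<close> is small.\<close>

lemma fin_separating: assumes y: "!!f. f : fin ==> f y = 0" shows "y = 0"
proof -
 have *: "norm y <= ep * (1 + norm y)" if e: "ep > 0" for ep
 proof -
  obtain x where x: "x : n_ideal M \<nu>" and xy: "norm (y - x y) < ep"
   using nu[unfolded fns_weight_def semifinite_weight_def] M.id_mem e
   by (metis (mono_tags, lifting) finite.emptyI finite_insert insertI1)
  have xM: "x : M" and fin: "\<nu> (adj x o x) < \<infinity>" using x by (auto simp: n_ideal_def)
  have X: "adj x o x : pos_part M"
   using M.comp_mem[OF M.adj_mem[OF xM] xM] posop_adj_comp[OF M.bounded[OF xM]] by (simp add: M.pos_part_iff)
  obtain L where L: "M.reducing L" "!!v. v : L ==> inner v ((adj x o x) v) <= ep^2 * (norm v)^2"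
   "ennreal (ep^2) * M.codim L <= \<nu> (adj x o x)" using M.weight_cut[OF X, of "ep^2"] e by (metis zero_less_power)
  have cl: "M.codim L < \<infinity>" using L(3) fin e by (auto simp: ennreal_mult_eq_top_iff top.not_eq_extremum[symmetric] top_unique)
  note L' = M.redD[OF L(1)] and Lc = M.red_perp[OF L(1)]
  have "oproj (L\<bottom>) : fin"
   using M.oproj_mem_algebra[OF Lc] isp_oproj[OF M.redD(1,2)[OF Lc]] cl by (simp add: fin_def M.dim_def)
  hence "oproj L y = y" using y[of "oproj (L\<bottom>)"] oproj_comp[OF L'(1,3), of y] by simp
  hence "y : L" using oproj_mem[OF L'(1,3)] by metis
  from L(2)[OF this] have "(norm (x y))^2 <= (ep * norm y)^2"
   by (simp add: adj_inner[OF M.bounded[OF xM], symmetric] norm_sq[of "x y"] power_mult_distrib)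
  hence "norm (x y) <= ep * norm y" by (rule power2_le_imp_le) (use e in simp)
  thus ?thesis using xy norm_triangle_ineq[of "y - x y" "x y"] by (simp add: algebra_simps)
 qed
 show ?thesis
 proof (rule ccontr)
  assume "y ~= 0"
  hence y: "norm y > 0" by simp
  define r where "r = 1 + norm y"
  have r: "r > 0" using y unfolding r_def by linarith
  hence "norm y / (2 * r) > 0" using y by simp
  from *[OF this] have "norm y <= norm y / 2" using r by (simp add: r_def[symmetric])
  thus False using y by simp
 qed
qed

text \<open>The annihilated fibers form a closed subspace at each time, and a Lindelof argument reduces the
  uncountably many conditions defining it to countably many.\<close>

lemma pi_separating: assumes xi: "!!f. f : fin ==> \<pi> f xi = 0" shows "xi = 0"
proof -
 define T where "T F s = span {\<sigma> s f z | f z. f : F}" for F s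
 \<comment> \<open>Sections of the fibers spanned by countably many projections. Their continuity
   spreads an approximation at one time to a neighbourhood, as the Lindelof argument
   requires.\<close>
 define V where "V = {g. continuous_on UNIV g & (EX F<=fin. countable F & (ALL s. g s : T F s))}"
 have T_mono: "F <= G ==> T F s <= T G s" for F G s unfolding T_def by (intro span_mono) auto
 have app: "EX g : V. norm (g s - y) < ep" if "ep > 0" for ep s y
 proof -
  have "closure ((%g. g s) ` V) = UNIV"
  proof (rule dense_if_perp)
   show "subspace ((%g. g s) ` V)" unfolding subspace_def
   proof (intro conjI ballI allI)
    show "0 : (%g. g s) ` V" by (rule image_eqI[of _ _ "%s. 0"]) (auto simp: V_def T_def span_zero)
    fix c x x' assume "x : (%g. g s) ` V"
    then obtain g where g: "g : V" "x = g s" by auto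
    thus "c *r x : (%g. g s) ` V"
     by (intro image_eqI[of _ _ "%s. c *r g s"]) (auto simp: V_def T_def intro!: continuous_intros span_scale)
    assume "x' : (%g. g s) ` V"
    then obtain g' where g': "g' : V" "x' = g' s" by auto
    obtain F F' where "F <= fin" "countable F" "ALL s. g s : T F s" "F' <= fin" "countable F'" "ALL s. g' s : T F' s"
     using g g' by (auto simp: V_def)
    hence "EX F<=fin. countable F & (ALL s. g s + g' s : T F s)"
     using T_mono[of F "F Un F'"] T_mono[of F' "F Un F'"] unfolding T_def
     by (intro exI[of _ "F Un F'"]) (auto simp: subset_iff intro!: span_add)
    thus "x + x' : (%g. g s) ` V"
     by (intro image_eqI[of _ _ "%s. g s + g' s"]) (use g g' in "auto simp: V_def intro!: continuous_intros")
   qed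
   fix x assume x: "x : ((%g. g s) ` V)\<bottom>"
   show "x = 0"
   proof (rule fin_separating)
    fix f assume f: "f : fin"
    \<comment> \<open>A section through \<open>f x\<close> at time \<open>s\<close>.\<close>
    have "(%t. \<sigma> t (\<sigma> (- s) f) x) : V" using sigma_fin[OF f] finD(1) unfolding V_def T_def
     by (auto intro!: sigma_continuous exI[of _ "{\<sigma> (- s) f}"] span_base)
    hence "inner x (f x) = 0" using x finD(1)[OF f] by (force simp: perp_iff sigma_minus)
    hence "inner (f x) (f x) = 0" using finD(2)[OF f] by (auto simp: isp_iff)
    thus "f x = 0" by simp
   qed
  qed
  thus ?thesis using closure_approachable[of y "(%g. g s) ` V"] that by (auto simp: dist_norm)
 qed
 have "EX F<=fin. countable F & (ALL s. y : closure (T F s))" for y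
 proof -
  have "EX G<=V. countable G & (ALL s. EX g : G. norm (g s - y) < ep)" if "ep > 0" for ep
  proof -
   define Op where "Op g = {s. norm (g s - y) < ep}" for g :: "real => 'h"
   have "open S" if "S : Op ` V" for S using that unfolding Op_def V_def by (auto intro!: open_Collect_less continuous_intros)
   from Lindelof[OF this] obtain G where G: "G <= Op ` V" "countable G" "Union G = Union (Op ` V)" by blast
   obtain F where F: "F <= V" "countable F" "G = Op ` F" using G(1,2) by (metis countable_subset_image)
   have "EX g : F. norm (g s - y) < ep" for s using G(3) app[OF that, of s y] unfolding F(3) by (auto simp: Op_def set_eq_iff)
   thus ?thesis using F by blast
  qed
  hence "ALL n. EX G<=V. countable G & (ALL s. EX g : G. norm (g s - y) < 1 / real (Suc n))" by simp
  then obtain G where G: "!!n::nat. G n <= V" "!!n. countable (G n)" "!!n s. EX g : G n. norm (g s - y) < 1 / real (Suc n)" by metis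
  have "ALL g : V. EX F<=fin. countable F & (ALL s. g s : T F s)" by (auto simp: V_def)
  then obtain F where F: "!!g. g : V ==> F g <= fin & countable (F g) & (ALL s. g s : T (F g) s)" by metis
  define FF where "FF = (UN n. UN g : G n. F g)"
  have "y : closure (T FF s)" for s unfolding closure_approachable
  proof (intro allI impI)
   fix e :: real assume "0 < e"
   then obtain n where n: "1 / real (Suc n) < e" by (metis nat_approx_posE)
   obtain g where g: "g : G n" "norm (g s - y) < 1 / real (Suc n)" using G(3) by blast
   have "F g <= FF" unfolding FF_def using g(1) by auto
   hence "g s : T FF s" using T_mono F G(1) g(1) by blast
   thus "EX x : T FF s. dist x y < e" using g(2) n by (auto simp: dist_norm intro!: bexI[of _ "g s"])
  qed
  moreover have "FF <= fin" unfolding FF_def using F G(1) by blast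
  moreover have "countable FF" unfolding FF_def using F G(1,2) by (intro countable_UN) auto
  ultimately show ?thesis by blast
 qed
 then obtain F where F: "!!y. F y <= fin" "!!y. countable (F y)" "!!y s. y : closure (T (F y) s)" by metis
 obtain C where C: "countable C" "range (rep_L2 xi) <= closure C"
  using square_integrable_rep[of xi] by (auto simp: square_integrable_alt strongly_measurable_def)
 define FF where "FF = (UN y : C. F y)"
 have "countable FF" using C(1) F(2) by (auto simp: FF_def)
 have "AE t in lborel. \<sigma> (- t) f (rep_L2 xi t) = 0" if "f : FF" for f
 proof -
  have "\<pi> f xi = 0" "f : M" using that F(1) xi finD(1) by (auto simp: FF_def)
  thus ?thesis using rep_pi[of f xi] by (simp add: L2_zero_iff) (auto elim: AE_mp)
 qed
 hence "AE t in lborel. ALL f : FF. \<sigma> (- t) f (rep_L2 xi t) = 0" by (simp add: AE_ball_countable[OF `countable FF`])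
 hence "AE t in lborel. rep_L2 xi t = 0"
 proof eventually_elim
  case (elim t)
  let ?x = "rep_L2 xi t"
  have "inner (\<sigma> (- t) f z) ?x = 0" if f: "f : FF" for f z
  proof -
   have "f : fin" using f F(1) by (auto simp: FF_def)
   thus ?thesis using isp_sigma[OF finD(1,2), of f "- t"] elim f by (simp add: isp_iff)
  qed
  hence "T FF (- t) <= {?x}\<bottom>" unfolding T_def by (intro span_minimal subspace_orthogonal_comp) (auto simp: perp_iff)
  hence "closure (T FF (- t)) <= {?x}\<bottom>" by (intro closure_minimal closed_perp)
  moreover have "C <= closure (T FF (- t))" using F(3) closure_mono[OF T_mono] unfolding FF_def by blast
  ultimately have "closure C <= {?x}\<bottom>" by (intro closure_minimal closed_perp) auto
  hence "?x : {?x}\<bottom>" using C(2) by blast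
  thus "?x = 0" by (simp add: perp_iff)
 qed
 thus ?thesis by (simp add: L2_zero_iff)
qed

end

text \<open>A monotone convergence theorem. Along a subsequence the increments have traces at most
  \<open>(1/4)^j\<close>; by Chebyshev's inequality their forms are bounded by
  \<open>(1/2)^j\<close> off codimension \<open>(1/2)^j\<close>, and the tails of both series are
  small.\<close>

lemma (in tracial) td_bounded_increasing:
 assumes x: "!!n. x n : pos_part A" and inc: "!!n v. inner v (x n v) <= inner v (x (Suc n) v)"
  and K: "!!n. \<tau> (x n) <= ennreal K"
 shows "tdense {v. EX C. ALL n. inner v (x n v) <= C}"
proof -
 have mono: "inner v (x m v) <= inner v (x n v)" if "m <= n" for m n v
  using that by (induction n rule: dec_induct) (auto intro: order_trans inc)
 define S where "S = (SUP n. \<tau> (x n))"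
 have S: "S <= ennreal K" unfolding S_def by (rule SUP_least) (rule K)
 hence Sfin: "S < \<infinity>" by (auto simp: less_top[symmetric] top_unique)
 have "EX m. S <= \<tau> (x m) + ennreal ((1/4)^j)" for j
 proof (rule ccontr)
  assume "~ (EX m. S <= \<tau> (x m) + ennreal ((1/4)^j))"
  hence *: "\<tau> (x m) + ennreal ((1/4)^j) <= S" for m by (meson less_imp_le not_le)
  have "S + ennreal ((1/4)^j) = (SUP m. \<tau> (x m) + ennreal ((1/4)^j))" unfolding S_def by (rule ennreal_SUP_add_left[symmetric]) auto
  also have "... <= S" by (rule SUP_least) (rule *)
  finally have "S + ennreal ((1/4)^j) <= S + 0" by simp
  hence "ennreal ((1/4)^j) <= 0" using Sfin by (subst (asm) ennreal_add_left_cancel_le) auto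
  thus False by simp
 qed
 then obtain m where m: "!!j. S <= \<tau> (x (m j)) + ennreal ((1/4)^j)" by metis
 \<comment> \<open>An increasing choice of indices above the \<open>m j\<close> that tends to
   infinity.\<close>
 define N where "N j = (SUM i<=j. Suc (m i))" for j
 have N: "m j <= N j" "N j <= N (Suc j)" "j <= N j" for j
 proof -
  have "Suc (m j) <= N j" unfolding N_def by (rule member_le_sum) auto
  thus "m j <= N j" by simp
  show "N j <= N (Suc j)" by (simp add: N_def)
  have "(SUM i<=j. 1) <= N j" unfolding N_def by (rule sum_mono) simp
  thus "j <= N j" by simp
 qed
 define d where "d j v = x (N (Suc j)) v - x (N j) v" for j v
 have xp: "x n : A" "posop (x n)" for n using x[of n] by (auto simp: pos_part_iff)
 have d: "d j : pos_part A" for j unfolding pos_part_iff posop_iff d_def[abs_def]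
  using minus_mem[OF xp(1) xp(1)] bounded mono[OF N(2)] posop_sym[OF xp(2)] by (auto simp: inner_sums)
 have td: "\<tau> (d j) <= ennreal ((1/4)^j)" for j
 proof -
  have "\<tau> (x (N j)) + \<tau> (d j) = \<tau> (x (N (Suc j)))" using tau_plus[OF x[of "N j"] d[of j]] by (simp add: d_def)
  also have "... <= S" unfolding S_def by (rule SUP_upper) simp
  also have "... <= \<tau> (x (m j)) + ennreal ((1/4)^j)" by (rule m)
  also have "... <= \<tau> (x (N j)) + ennreal ((1/4)^j)" by (intro add_right_mono tau_mono x mono N(1))
  finally show ?thesis using K[of "N j"] by (subst (asm) ennreal_add_left_cancel_le) (auto simp: top_unique)
 qed
 have "EX L. reducing L & (ALL v : L. inner v (d j v) <= (1/2)^j * (norm v)^2) & codim L <= ennreal ((1/2)^j)" for j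
 proof -
  obtain L where L: "reducing L" "!!v. v : L ==> inner v (d j v) <= (1/2)^j * (norm v)^2" "ennreal ((1/2)^j) * codim L <= \<tau> (d j)"
   using weight_cut[OF d[of j], of "(1/2)^j"] by (metis half_gt_zero zero_less_one zero_less_power)
  have "codim L = ennreal (2^j) * (ennreal ((1/2)^j) * codim L)"
   by (simp add: mult.assoc[symmetric] power_mult_distrib[symmetric] flip: ennreal_mult')
  also have "... <= ennreal (2^j) * ennreal ((1/4)^j)" by (intro mult_left_mono order_trans[OF L(3) td]) simp
  also have "... = ennreal ((1/2)^j)" by (simp add: power_mult_distrib[symmetric] flip: ennreal_mult')
  finally show ?thesis using L by blast
 qed
 then obtain L where L: "!!j. reducing (L j)" "!!j v. v : L j ==> inner v (d j v) <= (1/2)^j * (norm v)^2"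
  "!!j. codim (L j) <= ennreal ((1/2)^j)" by metis
 show ?thesis unfolding tdense_def
 proof (intro allI impI)
  fix dl :: real assume "dl > 0"
  then obtain J where J: "(1/2::real)^J < dl/2" using real_arch_pow_inv[of "dl/2" "1/2"] by auto
  define P where "P = (INT j. L (J + j))"
  have "codim P <= (\<Sum>j. codim (L (J + j)))" unfolding P_def by (rule codim_INT) (rule L(1))
  also have "... <= (\<Sum>j. ennreal ((1/2)^(J + j)))" by (intro suminf_le L(3)) auto
  also have "... = ennreal (\<Sum>j. (1/2)^J * (1/2)^j)"
   by (simp add: power_add) (intro suminf_ennreal2, auto intro!: summable_mult summable_geometric)
  also have "(\<Sum>j. (1/2::real)^J * (1/2)^j) = (1/2)^J * 2" by (subst suminf_mult) (auto simp: suminf_geometric)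
  also have "ennreal ... <= ennreal dl" using J by (intro ennreal_leI) simp
  finally have c: "codim P <= ennreal dl" .
  have "EX C. ALL n. inner v (x n v) <= C" if v: "v : P" for v
  proof (intro exI allI)
   fix n
   have "inner v (x (N (J + j)) v) <= inner v (x (N J) v) + (SUM i<j. (1/2)^(J+i)) * (norm v)^2" for j
   proof (induction j)
    case (Suc j)
    have "inner v (d (J + j) v) <= (1/2)^(J+j) * (norm v)^2" by (rule L(2)) (use v in "auto simp: P_def")
    thus ?case using Suc by (simp add: d_def inner_diff_right distrib_right)
   qed simp
   moreover have "(SUM i<n. (1/2::real)^(J+i)) <= 2"
   proof -
    have "(SUM i<n. (1/2::real)^(J+i)) <= (SUM i<n. (1/2)^i)" by (intro sum_mono power_decreasing) auto
    also have "... <= 2" by (simp add: geometric_sum)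
    finally show ?thesis .
   qed
   moreover have "inner v (x n v) <= inner v (x (N (J + n)) v)" by (rule mono) (use N(3)[of "J+n"] in simp)
   ultimately show "inner v (x n v) <= inner v (x (N J) v) + 2 * (norm v)^2"
    using mult_right_mono[of "SUM i<n. (1/2::real)^(J+i)" 2 "(norm v)^2"] by (meson add_left_mono order_trans zero_le_power2)
  qed
  moreover have "reducing P" unfolding P_def by (rule red_INT) (rule L(1))
  ultimately show "EX K. reducing K & K <= {v. EX C. ALL n. inner v (x n v) <= C} & codim K <= ennreal dl" using c by blast
 qed
qed

text \<open>Translation invariance makes the integral telescope: over \<open>{- n..n}\<close> only a
  boundary layer of length \<open>l\<close> survives. Orbits of the dual action are integrated this
  way.\<close>

lemma nn_integral_mono_increments:
 fixes F :: "real => real" assumes F: "mono F" "!!s. 0 <= F s" "!!s. F s <= B" and l: "l >= 0"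
 shows "(nni lborel (%s. ennreal (F s - F (s - l)))) <= ennreal (l * B)"
proof -
 have [measurable]: "F : BM" by (rule borel_measurable_mono[OF F(1)])
 have B: "B >= 0" using F(2)[of 0] F(3)[of 0] by simp
 have le: "F (s - l) <= F s" for s using F(1) l by (simp add: mono_def)
 have *: "(nni lborel (%s. ennreal (F s - F (s - l)) * ind {- real n..real n} s)) <= ennreal (l * B)" for n
 proof -
  let ?G = "\<integral>\<^sup>+s. ennreal (F (s - l)) * ind {- real n..real n} s \<partial>lborel"
  have sh: "?G = (nni lborel (%s. ennreal (F s) * ind {- real n - l..real n - l} s))"
   by (subst nn_integral_real_affine[where c=1 and t="l"]) (auto intro!: nn_integral_cong simp: indicator_def)
  have "?G <= (nni lborel (%s. ennreal B * ind {- real n..real n} s))"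
   by (intro nn_integral_mono mult_right_mono ennreal_leI F) simp
  also have "... = ennreal (B * (2 * real n))" using B by (simp add: nn_integral_cmult flip: ennreal_mult')
  finally have fin: "?G ~= \<infinity>" by (auto simp: top_unique)
  have "?G + (nni lborel (%s. ennreal (F s - F (s - l)) * ind {- real n..real n} s))
    = (nni lborel (%s. ennreal (F s) * ind {- real n..real n} s))" by (subst nn_integral_add[symmetric])
    (auto intro!: nn_integral_cong simp: indicator_def le F simp flip: ennreal_plus)
  also have "... <= (nni lborel (%s. ennreal (F s) * ind {- real n - l..real n - l} s + ennreal B * ind {real n - l..real n} s))"
  proof (rule nn_integral_mono)
   fix s :: real
   show "ennreal (F s) * ind {- real n..real n} s <=
     ennreal (F s) * ind {- real n - l..real n - l} s + ennreal B * ind {real n - l..real n} s"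
    using ennreal_leI[OF F(3)[of s]] l by (cases "s <= real n - l") (auto simp: indicator_def)
  qed
  also have "... = ?G + ennreal (l * B)"
   unfolding sh using l B by (subst nn_integral_add) (auto simp: nn_integral_cmult mult.commute simp flip: ennreal_mult')
  finally show ?thesis using fin by (subst (asm) ennreal_add_left_cancel_le) auto
 qed
 have "(nni lborel (%s. ennreal (F s - F (s - l)))) =
   (nni lborel (%s. (SUP n. ennreal (F s - F (s - l)) * ind {- real n..real n} s)))"
 proof (rule nn_integral_cong)
  fix s
  obtain n where n: "\<bar>s\<bar> <= real n" using real_arch_simple by blast
  have "ennreal (F s - F (s - l)) <= (SUP n. ennreal (F s - F (s - l)) * ind {- real n..real n} s)"
   by (rule SUP_upper2[of n]) (use n in "auto simp: indicator_def")
  moreover have "(SUP n. ennreal (F s - F (s - l)) * ind {- real n..real n} s) <= ennreal (F s - F (s - l))"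
   by (rule SUP_least) (auto simp: indicator_def)
  ultimately show "ennreal (F s - F (s - l)) = (SUP n. ennreal (F s - F (s - l)) * ind {- real n..real n} s)" by simp
 qed
 also have "... = (SUP n. \<integral>\<^sup>+s. ennreal (F s - F (s - l)) * ind {- real n..real n} s \<partial>lborel)"
  by (rule nn_integral_monotone_convergence_SUP) (auto simp: incseq_def le_fun_def indicator_def split: if_splits)
 also have "... <= ennreal (l * B)" by (rule SUP_least) (rule *)
 finally show ?thesis .
qed

section \<open>The dual weight and truncated square roots of \<open>h\<close>\<close>

context crossed
begin

text \<open>The hypothesis says that the integral of the orbit of \<open>a\<close> is at most
  \<open>B\<close> as a form. Since the dual action fixes \<open>\<pi> f\<close>, the orbit of
  \<open>\<pi> f o a o \<pi> f\<close> integrates to at most \<open>B\<close> times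
  \<open>\<pi> f\<close>.\<close>

lemma dual_weight_le: assumes f: "f : fin" and a: "posop a" and m: "!!v. (%s. inner v (dual_action s a v)) : BM"
  and B: "!!v. (nni lborel (%s. ennreal (inner v (dual_action s a v)))) <= ennreal B * ennreal ((norm v)^2)"
 shows "dual_weight M \<nu> \<sigma> (\<pi> f o a o \<pi> f) <= ennreal B * \<nu> f" unfolding dual_weight_def
proof (rule SUP_least, clarify)
 fix xi :: "nat => 'h L2"
 assume le: "ALL x : pos_part M. vector_functional xi (\<pi> x) <= \<nu> x"
 note fP = isp_pi[OF finD(2,1)[OF f], unfolded isp_iff]
 have sym: "inner (\<pi> f u) v = inner u (\<pi> f v)" "\<pi> f (\<pi> f v) = \<pi> f v" for u v using fP by auto
 have eq: "inner v (dual_action s (\<pi> f o a o \<pi> f) v) = inner (\<pi> f v) (dual_action s a (\<pi> f v))" for s v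
  by (simp add: dual_action_def phase_pi[OF finD(1)[OF f]] sym)
 have "(nni lborel (%s. vector_functional xi (dual_action s (\<pi> f o a o \<pi> f))))
   = (nni lborel (%s. (\<Sum>n. ennreal (inner (\<pi> f (xi n)) (dual_action s a (\<pi> f (xi n)))))))"
  by (simp add: vector_functional_def eq)
 also have "... = (\<Sum>n. \<integral>\<^sup>+ s. ennreal (inner (\<pi> f (xi n)) (dual_action s a (\<pi> f (xi n)))) \<partial>lborel)"
  by (rule nn_integral_suminf) (use m in measurable)
 also have "... <= (\<Sum>n. ennreal B * ennreal ((norm (\<pi> f (xi n)))^2))" by (intro suminf_le B) auto
 also have "... = ennreal B * vector_functional xi (\<pi> f)" by (simp add: vector_functional_def norm_sq sym)
 also have "... <= ennreal B * \<nu> f" using le projection_pos_part[OF finD(1,2)[OF f]] by (intro mult_left_mono) auto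
 finally show "(nni lborel (%s. vector_functional xi (dual_action s (\<pi> f o a o \<pi> f)))) <= ennreal B * \<nu> f" .
qed

definition hsqrt :: "real => complex" where "hsqrt u = (if 0 < u then of_real (sqrt u) else 0)"

text \<open>The square roots of the operators \<open>h\<^sub>\<epsilon>\<close> in the definition of
  the density, for \<open>\<epsilon> = 1 / (n + 1)\<close>. The value 0 on the negative axis hides
  the pole and makes the function bounded.\<close>

definition hsqrt_cut :: "nat => real => complex"
 where "hsqrt_cut n u = (if 0 < u then of_real (sqrt (u / (1 + (1 / real (Suc n)) * u))) else 0)"

lemma hsqrt_meas [measurable]: "hsqrt : BM" "hsqrt_cut n : BM" unfolding hsqrt_def[abs_def] hsqrt_cut_def[abs_def] by measurable

lemma hsqrt_cut_bounded: "cmod (hsqrt_cut n u) <= sqrt (real (Suc n))"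
proof -
 have "u / (1 + (1 / real (Suc n)) * u) <= real (Suc n)" if "u > 0" using that by (simp add: field_simps add_pos_pos)
 thus ?thesis by (auto simp: hsqrt_cut_def simp del: of_nat_Suc)
qed

abbreviation k :: "nat => 'h L2 operator" where "k n == S.I (hsqrt_cut n)"

lemma k_mem: "k n : A" by (rule I_mem[OF hsqrt_meas(2) hsqrt_cut_bounded])

lemma k_sym: "inner (k n u) v = inner u (k n v)"
proof -
 have d: "w : sdom E (hsqrt_cut n)" for w by (rule S.sdom_bounded[OF hsqrt_meas(2) hsqrt_cut_bounded])
 have "(%u. cnj (hsqrt_cut n u)) = hsqrt_cut n" by (auto simp: hsqrt_cut_def)
 thus ?thesis using S.I_adjoint[OF hsqrt_meas(2)[of n] d[of v] d[of u]] by (metis Re_cinner)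
qed

lemma tau_k_le: assumes a: "a : pos_part A" shows "\<tau> (k n o a o k n) <= dual_weight M \<nu> \<sigma> a"
proof -
 define ep where "ep = 1 / real (Suc n)"
 have e: "ep > 0" by (simp add: ep_def)
 let ?g = "%u. complex_of_real (sqrt (u / (1 + ep * u)))"
 have g: "?g : BM" by measurable
 have "AE u in smeas E v. ?g u = hsqrt_cut n u" for v using AE_pos by eventually_elim (simp add: hsqrt_cut_def ep_def)
 hence "(x, y) : si E ?g <-> (x, y) : si E (hsqrt_cut n)" for x y
  using S.I_eq_AE[OF g hsqrt_meas(2)[of n], of x] by (auto simp: S.mem_si g)
 hence "si E ?g = op_graph (k n)"
  using S.spectral_integral_op_graph[OF hsqrt_meas(2)[of n] hsqrt_cut_bounded] by (auto simp: set_eq_iff)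
 hence "gop (borel_calculus ?g h) = k n" by (simp add: borel_calculus_h)
 moreover have "dual_weight M \<nu> \<sigma> a = (SUP ep\<in>{0<..}.
   let k = gop (borel_calculus (%u. of_real (sqrt (u / (1 + ep * u)))) h) in \<tau> (k o a o k))"
  using canonical a by (simp add: canonical_trace_def is_density_def)
 ultimately show ?thesis using e by (auto simp: Let_def intro!: SUP_upper2[of ep])
qed

text \<open>Monotone convergence in the scalar measure: boundedness of the truncations decides
  whether a vector lies in the domain of \<open>h\<^sup>1\<^sup>/\<^sup>2\<close>.\<close>

lemma norm_k_mono: "(norm (k n v))^2 <= (norm (k (Suc n) v))^2"
 and norm_k_SUP: "(SUP n. ennreal ((norm (k n v))^2)) = (nni (smeas E v) (%u. ennreal ((cmod (hsqrt u))^2)))"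
proof -
 have c2: "(cmod (hsqrt_cut n u))^2 = (if 0 < u then u / (1 + (1 / real (Suc n)) * u) else 0)" for n u
  by (auto simp: hsqrt_cut_def simp del: of_nat_Suc)
 have cm: "(cmod (hsqrt_cut m u))^2 <= (cmod (hsqrt_cut n u))^2" if "m <= n" for m n u
  unfolding c2 using that by (auto intro!: divide_left_mono mult_pos_pos add_pos_pos mult_right_mono simp: frac_le)
 have eq: "ennreal ((norm (k n v))^2) = (nni (smeas E v) (%u. ennreal ((cmod (hsqrt_cut n u))^2)))" for n
 proof -
  have d: "v : sdom E (hsqrt_cut n)" by (rule S.sdom_bounded[OF hsqrt_meas(2) hsqrt_cut_bounded])
  thus ?thesis unfolding S.norm_I[OF hsqrt_meas(2) d] using S.sdom_iff[OF hsqrt_meas(2)]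
   by (intro nn_integral_eq_integral[symmetric]) auto
 qed
 show "(norm (k n v))^2 <= (norm (k (Suc n) v))^2"
 proof -
  have "ennreal ((norm (k n v))^2) <= ennreal ((norm (k (Suc n) v))^2)"
   unfolding eq by (intro nn_integral_mono ennreal_leI cm) simp
  thus ?thesis by simp
 qed
 have lim: "(SUP n. ennreal ((cmod (hsqrt_cut n u))^2)) = ennreal ((cmod (hsqrt u))^2)" for u
 proof (rule LIMSEQ_unique[OF LIMSEQ_SUP])
  show "incseq (%n. ennreal ((cmod (hsqrt_cut n u))^2))" unfolding incseq_def by (intro allI impI ennreal_leI cm)
  have "(%n. u / (1 + (1 / real (Suc n)) * u)) ----> u / (1 + 0 * u)"
   by (intro tendsto_intros LIMSEQ_inverse_real_of_nat[unfolded inverse_eq_divide]) simp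
  thus "(%n. ennreal ((cmod (hsqrt_cut n u))^2)) ----> ennreal ((cmod (hsqrt u))^2)"
   unfolding c2 by (intro tendsto_intros) (auto simp: hsqrt_def)
 qed
 have "(SUP n. ennreal ((norm (k n v))^2)) = (nni (smeas E v) (%u. (SUP n. ennreal ((cmod (hsqrt_cut n u))^2))))" unfolding eq
 proof (rule nn_integral_monotone_convergence_SUP[symmetric])
  show "incseq (%n u. ennreal ((cmod (hsqrt_cut n u))^2))" unfolding incseq_def le_fun_def by (intro allI impI ennreal_leI cm)
 qed measurable
 thus "(SUP n. ennreal ((norm (k n v))^2)) = (nni (smeas E v) (%u. ennreal ((cmod (hsqrt u))^2)))" unfolding lim .
qed

lemma hsqrt_domain: assumes "!!n. (norm (k n v))^2 <= C" shows "v : sdom E hsqrt"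
proof -
 have "(nni (smeas E v) (%u. ennreal ((cmod (hsqrt u))^2))) <= ennreal C"
  unfolding norm_k_SUP[symmetric] by (intro SUP_least ennreal_leI assms)
 thus ?thesis by (auto simp: spectral_domain_def le_less_trans)
qed

lemma norm_k_tendsto: assumes v: "v : sdom E hsqrt" shows "(%n. (norm (k n v))^2) ----> (norm (S.I hsqrt v))^2"
proof -
 have "(%n. ennreal ((norm (k n v))^2)) ----> (SUP n. ennreal ((norm (k n v))^2))"
  by (rule LIMSEQ_SUP) (auto simp: incseq_Suc_iff norm_k_mono intro!: ennreal_leI)
 also have "(SUP n. ennreal ((norm (k n v))^2)) = ennreal ((norm (S.I hsqrt v))^2)"
  unfolding norm_k_SUP S.norm_I[OF hsqrt_meas(1) v] using v S.sdom_iff[OF hsqrt_meas(1)] by (intro nn_integral_eq_integral) auto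
 finally show ?thesis by (subst (asm) tendsto_ennreal_iff) auto
qed

text \<open>The operator \<open>g(h) \<pi>(f)\<close> on its natural domain.\<close>

definition comp_pi :: "(real => complex) => 'h operator => 'h L2 graph" where "comp_pi g f = {(x, y). (\<pi> f x, y) : si E g}"

context
 fixes g :: "real => complex" and f assumes g: "g : BM" and real: "!!u. cnj (g u) = g u" and f: "f : M"
begin

lemma closed_spectral_integral: "closed (si E g)"
 using closed_adj_graph[OF S.lg_spectral_integral[OF g]] by (simp add: S.adj_spectral_integral[OF g real])

lemma comp_pi_graph:
 shows lg_comp_pi: "linear_graph (comp_pi g f)" and closed_comp_pi: "closed (comp_pi g f)"
  and single_valued_comp_pi: "single_valued (comp_pi g f)" and affiliated_comp_pi: "affiliated A (comp_pi g f)"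
proof -
 note b = bo_pi[OF f] and l = S.lg_spectral_integral[OF g]
 show "linear_graph (comp_pi g f)"
  by (rule lgI) (auto simp: comp_pi_def bo_simps[OF b] intro: lg_add[OF l] lg_scaleC[OF l] lg_0[OF l])
 have "comp_pi g f = (%p. (\<pi> f (fst p), snd p)) -` si E g" by (auto simp: comp_pi_def)
 moreover have "continuous_on UNIV (%p. (\<pi> f (fst p), snd p))" by (intro continuous_intros bo_continuous[OF b])
 ultimately show "closed (comp_pi g f)" using closed_vimage[OF closed_spectral_integral] by simp
 show "single_valued (comp_pi g f)" using S.single_valued_spectral_integral[OF g] by (auto simp: comp_pi_def single_valued_def)
 show "affiliated A (comp_pi g f)"
  by (rule affiliatedI) (auto simp: comp_pi_def commutantD[OF _ pi_mem[OF f], symmetric] intro: affiliatedD[OF affiliated_spectral[OF g]])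
qed

end

end

lemma (in weighted) pos_part_conj: assumes x: "x : pos_part A" and y: "y : A" "!!u v. inner (y u) v = inner u (y v)"
 shows "y o x o y : pos_part A"
proof -
 have "adj y = y" by (rule adj_eqI[OF bounded[OF y(1)] y(2)])
 thus ?thesis using posop_conj[of x y] x y(1) bounded[OF y(1)] by (auto simp: pos_part_iff intro!: comp_mem)
qed

section \<open>Measurability of \<open>h\<^sup>1\<^sup>/\<^sup>2\<pi>(f)\<close>\<close>

context crossed
begin

lemma hsqrt_real: "cnj (hsqrt u) = hsqrt u" by (simp add: hsqrt_def)

context
 fixes f assumes f: "f : fin"
begin

abbreviation T :: "'h L2 graph" where "T == comp_pi hsqrt f"

lemmas T_graph = comp_pi_graph[OF hsqrt_meas(1) hsqrt_real finD(1)[OF f]]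

lemma pi_f: "inner (\<pi> f u) v = inner u (\<pi> f v)" "\<pi> f (\<pi> f v) = \<pi> f v" "bop (\<pi> f)" "\<pi> f : A"
 using isp_pi[OF finD(2,1)[OF f]] pi_mem[OF finD(1)[OF f]] by (auto simp: isp_iff)

lemma T_mem: "(x, y) : T <-> \<pi> f x : sdom E hsqrt & y = S.I hsqrt (\<pi> f x)" by (simp add: comp_pi_def S.mem_si)

text \<open>With \<open>p = \<pi> f\<close> the trace property gives \<open>\<tau>(c p k k p c) =
  \<tau>(k p c c p k) <= \<tau>(k p a p k)\<close>, and the last is one of the values whose supremum
  is the dual weight of \<open>p a p\<close>.\<close>

lemma tau_k_pi: assumes c: "c : A" "!!u v. inner (c u) v = inner u (c v)"
  and a: "a : A" "posop a" "!!v. inner v (c (c v)) <= inner v (a v)" and m: "!!v. (%s. inner v (dual_action s a v)) : BM"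
  and B: "!!v. (nni lborel (%s. ennreal (inner v (dual_action s a v)))) <= ennreal B * ennreal ((norm v)^2)"
 shows "(%v. c (\<pi> f (k n (k n (\<pi> f (c v)))))) : pos_part A"
  "\<tau> (%v. c (\<pi> f (k n (k n (\<pi> f (c v)))))) <= ennreal B * \<nu> f"
proof -
 let ?y = "c o \<pi> f o k n"
 have y: "?y : A" by (intro comp_mem c(1) pi_f(4) k_mem)
 have ay: "adj ?y = (%v. k n (\<pi> f (c v)))" by (rule adj_eqI[OF bounded[OF y]]) (simp add: c(2) pi_f(1) k_sym)
 show "(%v. c (\<pi> f (k n (k n (\<pi> f (c v)))))) : pos_part A"
  using posop_comp_adj[OF bounded[OF y]] comp_mem[OF y adj_mem[OF y]] unfolding ay pos_part_iff by (simp add: o_def)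
 have a': "\<pi> f o a o \<pi> f : pos_part A" using pos_part_conj[of a "\<pi> f"] a(1,2) pi_f by (simp add: pos_part_iff)
 have ka: "k n o (\<pi> f o a o \<pi> f) o k n : pos_part A" by (rule pos_part_conj[OF a' k_mem k_sym])
 have "\<tau> (%v. c (\<pi> f (k n (k n (\<pi> f (c v)))))) = \<tau> (?y o adj ?y)" unfolding ay by (simp add: o_def)
 also have "... = \<tau> (adj ?y o ?y)" by (rule trace[OF y, symmetric])
 also have "... <= \<tau> (k n o (\<pi> f o a o \<pi> f) o k n)"
 proof (rule tau_mono[OF _ ka])
  show "adj ?y o ?y : pos_part A" using posop_adj_comp[OF bounded[OF y]] comp_mem[OF adj_mem[OF y] y] by (simp add: pos_part_iff)
  show "inner v ((adj ?y o ?y) v) <= inner v ((k n o (\<pi> f o a o \<pi> f) o k n) v)" for v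
   using a(3)[of "\<pi> f (k n v)"] unfolding ay by (simp add: k_sym[symmetric] pi_f(1)[symmetric])
 qed
 also have "... <= dual_weight M \<nu> \<sigma> (\<pi> f o a o \<pi> f)" by (rule tau_k_le[OF a'])
 also have "... <= ennreal B * \<nu> f" by (rule dual_weight_le[OF f a(2) m B])
 finally show "\<tau> (%v. c (\<pi> f (k n (k n (\<pi> f (c v)))))) <= ennreal B * \<nu> f" .
qed

lemma nu_f: "ennreal B * \<nu> f = ennreal (B * enn2real (\<nu> f))" if "B >= 0"
 using finD(3)[OF f] that by (simp add: ennreal_mult' ennreal_enn2real)

lemma inner_k: "inner v (c (\<pi> f (k n (k n (\<pi> f (c v)))))) = (norm (k n (\<pi> f (c v))))^2"
 if "!!u v. inner (c u) v = inner u (c v)" by (simp add: that[symmetric] pi_f(1)[symmetric] k_sym[symmetric] norm_sq)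

text \<open>For the spectral projection \<open>b\<close> of \<open>h\<close> on a band of
  logarithmic length \<open>2 n\<close>, the orbit integral is at most \<open>2 n\<close>. So
  \<open>h\<^sup>1\<^sup>/\<^sup>2 \<pi>(f) b\<close> has a tau-dense domain, and a vector
  orthogonal to the domain of \<open>T\<close> is annihilated by all bands. Tau-density of the
  domain of \<open>T\<close> itself is obtained later with another choice of \<open>c\<close> and
  \<open>a\<close>.\<close>

lemma dense_Domain_T: "closure (Domain T) = UNIV"
proof (rule dense_if_perp)
 show sT: "subspace (Domain T)" by (rule csubspace_subspace[OF csubspace_Domain[OF T_graph(1)]])
 fix v assume v: "v : (Domain T)\<bottom>"
 define B where "B n = {exp (- real n)..<exp (real n)}" for n
 have B: "B n : sets borel" for n by (simp add: B_def)
 have Ev: "E (B n) v = 0" for n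
 proof -
  let ?b = "E (B n)"
  have bs: "inner (?b u) w = inner u (?b w)" "?b (?b u) = ?b u" for u w using S.E_sym[OF B] S.E_idem[OF B] by auto
  have bA: "?b : A" by (rule E_mem[OF B])
  have bp: "posop ?b" unfolding posop_iff using bounded[OF bA] bs by (metis inner_ge_zero)
  \<comment> \<open>A distribution function of \<open>h\<close> on the logarithmic scale; the orbit
    of the band is an increment of it.\<close>
  define G where "G w s = measure (smeas E w) {..<exp (s + real n)}" for w s
  have Gd: "inner w (dual_action s ?b w) = G w s - G w (s - 2 * real n)" for w s
  proof -
   have "dual_action s ?b w = E ((%u. exp (- s) * u) -` B n) w"
    using phase_E[OF B, of s n "ph (- s) w"] by (simp add: dual_action_def phase_phase)
   also have "(%u. exp (- s) * u) -` B n = {..<exp (s + real n)} - {..<exp (s - real n)}"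
    by (auto simp: B_def exp_add exp_diff exp_minus field_simps)
   finally have "inner w (dual_action s ?b w) = measure (smeas E w) ({..<exp (s + real n)} - {..<exp (s - real n)})"
    by (simp add: S.inner_E S.measure_scalar)
   also have "... = G w s - G w (s - 2 * real n)"
    unfolding G_def by (subst finite_measure.finite_measure_Diff[OF S.finite_scalar]) (auto simp: algebra_simps)
   finally show ?thesis .
  qed
  interpret fm: finite_measure "smeas E w" for w by (rule S.finite_scalar)
  have Gm: "mono (G w)" for w unfolding G_def mono_def by (auto intro!: fm.finite_measure_mono)
  have Gb: "0 <= G w s" "G w s <= (norm w)^2" for w s
   using fm.bounded_measure[of w "{..<exp (s + real n)}"] S.measure_scalar[of UNIV w] by (auto simp: G_def)
  have [measurable]: "G w : BM" for w by (rule borel_measurable_mono[OF Gm])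
  have "tdense {u. EX C. ALL m. inner u (?b (\<pi> f (k m (k m (\<pi> f (?b u)))))) <= C}"
  proof (rule td_bounded_increasing)
   have *: "(%v. ?b (\<pi> f (k m (k m (\<pi> f (?b v)))))) : pos_part A & \<tau> (%v. ?b (\<pi> f (k m (k m (\<pi> f (?b v)))))) <= ennreal (2 * real n) * \<nu> f" for m
   proof -
    have m: "(%s. inner w (dual_action s ?b w)) : BM" for w unfolding Gd by measurable
    have "(nni lborel (%s. ennreal (inner w (dual_action s ?b w)))) <= ennreal (2 * real n * (norm w)^2)" for w
     unfolding Gd by (rule nn_integral_mono_increments[OF Gm Gb]) simp
    hence i: "(nni lborel (%s. ennreal (inner w (dual_action s ?b w)))) <= ennreal (2 * real n) * ennreal ((norm w)^2)" for w
     by (simp add: ennreal_mult)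
    have "inner w (?b (?b w)) <= inner w (?b w)" for w by (simp add: bs)
    from tau_k_pi[OF bA bs(1) bA bp this m i, of m] show ?thesis by blast
   qed
   thus "(%v. ?b (\<pi> f (k m (k m (\<pi> f (?b v)))))) : pos_part A" for m by blast
   show "\<tau> (%v. ?b (\<pi> f (k m (k m (\<pi> f (?b v)))))) <= ennreal (2 * real n * enn2real (\<nu> f))" for m
    using * nu_f[of "2 * real n"] by simp
   show "inner w (?b (\<pi> f (k m (k m (\<pi> f (?b w)))))) <= inner w (?b (\<pi> f (k (Suc m) (k (Suc m) (\<pi> f (?b w))))))" for m w
    unfolding inner_k[OF bs(1)] by (rule norm_k_mono)
  qed
  hence "tdense {u. ?b u : Domain T}" by (rule td_mono) (auto simp: inner_k[OF bs(1)] T_mem Domain_iff intro: hsqrt_domain)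
  hence "closure {u. ?b u : Domain T} = UNIV"
  proof (rule dense_if_tau_dense)
   show "subspace {u. ?b u : Domain T}" using sT bounded[OF bA] by (auto simp: subspace_def bo_add bo_zero bo_scaleR)
  qed
  moreover have "?b v : {u. ?b u : Domain T}\<bottom>" using v by (auto simp: perp_iff bs)
  ultimately have "?b v : UNIV\<bottom>" using perp_closure[of "{u. ?b u : Domain T}"] by simp
  hence "inner (?b v) (?b v) = 0" by (auto simp: perp_iff simp del: inner_eq_zero_iff)
  thus ?thesis by simp
 qed
 \<comment> \<open>On the positive axis the level sets of the logarithm lie in the bands, and their
   spectral projections tend to the identity.\<close>
 let ?g = "%u. if 0 < u then complex_of_real (ln u) else 0"
 have g: "?g : BM" by measurable
 have "E (S.level ?g n) v = 0" for n
 proof -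
  have l: "S.level ?g n : sets borel" by (rule S.level_sets[OF g])
  have "S.level ?g n Int {0<..} <= B (Suc n)"
  proof
   fix u assume u: "u : S.level ?g n Int {0<..}"
   hence "\<bar>ln u\<bar> <= real n" "u > 0" by (auto simp: S.level_def[OF g])
   hence "- real (Suc n) <= ln u" "ln u < real (Suc n)" by linarith+
   hence "exp (- real (Suc n)) <= exp (ln u)" "exp (ln u) < exp (real (Suc n))" by (simp_all only: exp_le_cancel_iff exp_less_cancel_iff)
   thus "u : B (Suc n)" using `u > 0` by (simp add: B_def)
  qed
  hence "E (S.level ?g n) v = E (S.level ?g n Int {0<..}) (E (B (Suc n)) v)"
   using S.E_Int[of "S.level ?g n" "{0<..}" v] S.E_Int[of "S.level ?g n Int {0<..}" "B (Suc n)" v] l B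
   by (simp add: Int_absorb2 sets.Int)
  thus ?thesis using Ev l by (simp add: bo_zero[OF S.E_bounded] sets.Int)
 qed
 thus "v = 0" using S.E_level_tendsto[OF g, of v] LIMSEQ_unique by (auto simp: LIMSEQ_const_iff)
qed

abbreviation Tk :: "real => 'h L2 graph" where "Tk kap == {(x, z). (x, (1 / sqrt kap) *r z) : T}"

text \<open>\<open>Tk kap\<close> is the graph of \<open>sqrt kap\<close> times \<open>T\<close>.
  With \<open>S\<close> the composition of \<open>T\<close> with its adjoint, projecting
  \<open>(u, 0)\<close> onto this graph yields the resolvent
  \<open>rs kap = (1 + kap S)\<^sup>-\<^sup>1\<close>, and \<open>rt kap\<close> is \<open>T\<close>
  applied to it.\<close>

definition rs :: "real => 'h L2 operator" where "rs kap u = fst (oproj (Tk kap) (u, 0))"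

definition rt :: "real => 'h L2 operator" where "rt kap u = (1 / sqrt kap) *r snd (oproj (Tk kap) (u, 0))"

lemma Tk: "closed (Tk kap)" "linear_graph (Tk kap)"
proof -
 have "Tk kap = (%p. (fst p, (1 / sqrt kap) *r snd p)) -` T" by auto
 thus "closed (Tk kap)" using closed_vimage[OF T_graph(2), of "%p. (fst p, (1 / sqrt kap) *r snd p)"] by (simp add: continuous_intros)
 show "linear_graph (Tk kap)" using lg_0[OF T_graph(1)] lg_add[OF T_graph(1)] lg_scaleC[OF T_graph(1)]
  by (intro lgI) (auto simp: scaleR_add_right scaleC_scaleR[symmetric])
qed

lemma rs_mem: "rs kap : A" unfolding rs_def[abs_def]
proof (rule oproj_graph_mem(1)[OF Tk])
 show "affiliated A (Tk kap)"
  by (rule affiliatedI) (auto simp: bo_scaleR[OF commutant_bo, symmetric] intro: affiliatedD[OF T_graph(4)])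
qed

lemma rs_graph: "(rs kap u, rt kap u) : T"
 using oproj_mem[OF Tk(1) lg_subspace[OF Tk(2)], of kap "(u, 0)"] by (auto simp: rs_def rt_def)

lemma rs_inner: assumes l: "kap > 0" and x: "(x', y') : T" shows "inner (u - rs kap u) x' = kap * inner (rt kap u) y'"
proof -
 have "(x', sqrt kap *r y') : Tk kap" using x l by simp
 hence "inner ((u, 0) - oproj (Tk kap) (u, 0)) (x', sqrt kap *r y') = 0"
  using oproj_diff[OF Tk(1) lg_subspace[OF Tk(2)], of "(u, 0)" kap] unfolding perp_iff by blast
 hence "inner (u - rs kap u) x' = sqrt kap * inner (snd (oproj (Tk kap) (u, 0))) y'" by (simp add: inner_prod_def rs_def)
 also have "... = kap / sqrt kap * inner (snd (oproj (Tk kap) (u, 0))) y'" using l by (simp only: real_div_sqrt less_imp_le)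
 finally show ?thesis by (simp add: rt_def)
qed

lemma rs_eqI: assumes l: "kap > 0" and x: "(x, y) : T" "!!x' y'. (x', y') : T ==> inner (u - x) x' = kap * inner y y'"
 shows "rs kap u = x"
proof -
 define z where "z = rt kap u"
 have d: "(x - rs kap u, y - z) : T" unfolding z_def by (rule lg_diff[OF T_graph(1) x(1) rs_graph])
 have "inner (x - rs kap u) (x - rs kap u) = kap * inner z (y - z) - kap * inner y (y - z)"
  unfolding x(2)[OF d, symmetric] rs_inner[OF l d, of u, folded z_def, symmetric] by (simp add: inner_diff_left)
 also have "... = - (kap * inner (y - z) (y - z))" by (simp add: inner_diff_left algebra_simps)
 also have "... <= 0" using l by simp
 finally show ?thesis by (metis inner_ge_zero antisym inner_eq_zero_iff eq_iff_diff_eq_0)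
qed

lemma rs_bounded: "bop (rs kap)" by (rule bounded[OF rs_mem])

lemma rs_props: assumes l: "kap > 0"
 shows rs_sym: "inner (rs kap u) v = inner u (rs kap v)" and rs_square: "(norm (rs kap u))^2 <= inner u (rs kap u)"
  and rs_le: "inner u (rs kap u) <= (norm u)^2" and rs_nonneg: "0 <= inner u (rs kap u)"
proof -
 have 1: "inner (u - rs kap u) (rs kap v) = inner (v - rs kap v) (rs kap u)" for u v
  by (simp only: rs_inner[OF l rs_graph] inner_commute[of "rt kap u" "rt kap v"])
 show "inner (rs kap u) v = inner u (rs kap v)"
  using 1[of u v] inner_commute[of "rs kap u" v] inner_commute[of "rs kap u" "rs kap v"] unfolding inner_diff_left by linarith
 have "inner (u - rs kap u) (rs kap u) >= 0" unfolding rs_inner[OF l rs_graph] using l by simp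
 thus 2: "(norm (rs kap u))^2 <= inner u (rs kap u)" by (simp add: inner_diff_left norm_sq)
 thus "0 <= inner u (rs kap u)" by (rule order_trans[OF zero_le_power2])
 have "inner (u - rs kap u) (u - rs kap u) >= 0" by simp
 thus "inner u (rs kap u) <= (norm u)^2" using 2 by (simp add: inner_sums norm_sq inner_commute)
qed

text \<open>Testing both resolvent equations against the difference of the two solutions shows that
  \<open>inner y z >= 0\<close>; each equation tested against the other solution then gives the
  comparison.\<close>

lemma rs_antimono: assumes l: "kap > 0" "kap <= kap'" shows "inner u (rs kap' u) <= inner u (rs kap u)"
proof -
 have l': "kap' > 0" using l by simp
 let ?x = "rs kap u" and ?x' = "rs kap' u"
 define y z where "y = rt kap u" and "z = rt kap' u"
 note y = rs_graph[of kap u, folded y_def] rs_inner[OF l(1), of _ _ u, folded y_def]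
 note z = rs_graph[of kap' u, folded z_def] rs_inner[OF l', of _ _ u, folded z_def]
 note d = lg_diff[OF T_graph(1) y(1) z(1)]
 have "inner (?x - ?x') (?x - ?x') = kap' * inner z (y - z) - kap * inner y (y - z)"
  unfolding y(2)[OF d, symmetric] z(2)[OF d, symmetric] by (simp add: inner_diff_left)
 hence "(kap + kap') * inner y z = inner (?x - ?x') (?x - ?x') + kap * inner y y + kap' * inner z z"
  by (simp add: inner_diff_right inner_commute algebra_simps)
 also have "... >= 0" using l l' by simp
 finally have "inner y z >= 0" using l l' by (simp add: zero_le_mult_iff)
 hence "kap * inner y z <= kap' * inner y z" using l by (simp add: mult_right_mono)
 thus ?thesis using y(2)[OF z(1)] z(2)[OF y(1)] inner_commute[of ?x ?x']
  unfolding inner_diff_left inner_commute[of z y] by linarith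
qed

lemma phase_T: assumes "(x, y) : T" shows "(ph s x, exp (s / 2) *r ph s y) : T"
proof -
 let ?x = "\<pi> f x"
 have x: "?x : sdom E hsqrt" "y = S.I hsqrt ?x" using assms by (auto simp: T_mem)
 have eq: "hsqrt (exp (- s) * u) = of_real (exp (- s / 2)) * hsqrt u" for u
 proof -
  have "sqrt (exp (- s)) = exp (- s / 2)" by (rule real_sqrt_unique) (simp_all flip: exp_double)
  thus ?thesis by (auto simp: hsqrt_def real_sqrt_mult zero_less_mult_iff)
 qed
 have "ph s ?x : sdom E (%u. of_real (exp (- s / 2)) * hsqrt u)"
  "ph s y = S.I (%u. of_real (exp (- s / 2)) * hsqrt u) (ph s ?x)"
  using phase_I[OF hsqrt_meas(1), where s=s and v="?x"] x by (simp_all only: eq)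
 moreover from this(1) have d: "ph s ?x : sdom E hsqrt"
  by (rule S.sdom_mult[where c="exp (s / 2)", rotated 2]) (auto simp: norm_mult simp flip: mult.assoc exp_add)
 ultimately have "ph s y = of_real (exp (- s / 2)) *c S.I hsqrt (ph s ?x)" using S.I_scale_fun(2)[OF hsqrt_meas(1) d] by simp
 hence "exp (s / 2) *r ph s y = S.I hsqrt (ph s ?x)" by (simp add: scaleC_of_real flip: exp_add)
 thus ?thesis using d by (simp add: T_mem phase_pi[OF finD(1)[OF f], symmetric])
qed

text \<open>The dual action scales \<open>h\<close>, so it runs through the family of resolvents;
  differences of resolvents therefore have telescoping orbits.\<close>

lemma dual_action_rs: assumes l: "kap > 0" shows "dual_action s (rs kap) v = rs (exp (- s) * kap) v"
proof -
 let ?u = "ph (- s) v" and ?e = "exp (s / 2)"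
 define y where "y = rt kap ?u"
 have "rs (exp (- s) * kap) v = ph s (rs kap ?u)"
 proof (rule rs_eqI[OF _ phase_T[OF rs_graph, of s kap ?u]])
  fix x' y' assume "(x', y') : T"
  from phase_T[OF this, of "- s"] have xy: "(ph (- s) x', exp (- s / 2) *r ph (- s) y') : T" by simp
  have "inner (v - ph s (rs kap ?u)) x' = inner (?u - rs kap ?u) (ph (- s) x')"
   using inner_phase[of s "?u - rs kap ?u" x'] by (simp add: bo_diff[OF bo_phase] phase_phase)
  also have "... = kap * (exp (- s / 2) * inner (ph s y) y')" using rs_inner[OF l xy, of ?u] by (simp add: inner_phase y_def)
  also have "exp (- s / 2) = exp (- s) * ?e" by (simp flip: exp_add)
  finally show "inner (v - ph s (rs kap ?u)) x' = exp (- s) * kap * inner (?e *r ph s (rt kap ?u)) y'" by (simp add: y_def)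
 qed (use l in simp)
 thus ?thesis by (simp add: dual_action_def)
qed

end

end

context crossed
begin

text \<open>Let \<open>S\<close> be the composition of \<open>T\<close> with its adjoint,
  \<open>w = (1 + S)\<^sup>-\<^sup>1\<close>, \<open>w2 = (1 + 2 S)\<^sup>-\<^sup>1\<close>,
  \<open>c = (w - w\<^sup>2)\<^sup>1\<^sup>/\<^sup>2\<close> and \<open>a = 2 (w - w2)\<close>. Then
  \<open>c\<^sup>2 <= a\<close>, the orbit of \<open>a\<close> telescopes, and \<open>T c\<close>
  has the same norms as \<open>1 - w\<close>, so \<open>(1 - w)\<^sup>2\<close> has trace at most
  \<open>2 ln 2\<close> times the weight of \<open>f\<close>. The dual action makes this trace
  arbitrarily small at the price of passing to \<open>rs kap\<close>. Where
  \<open>1 - rs kap\<close> is at most 1/2, \<open>rs kap\<close> is invertible, and its range lies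
  in the domain of \<open>T\<close>.\<close>

lemma td_Domain_T: assumes f: "f : fin" shows "tdense (Domain (comp_pi hsqrt f))"
proof -
 let ?T = "comp_pi hsqrt f"
 note T_graph = T_graph[OF f]
 note inner_eq_zero_iff[simp del]
 define w where "w = rs f 1"
 define w2 where "w2 = rs f 2"
 have wA: "w : A" "w2 : A" unfolding w_def w2_def by (rule rs_mem[OF f])+
 note bw = bounded[OF wA(1)] and bw2 = bounded[OF wA(2)]
 have ws: "inner (w u) v = inner u (w v)" "inner (w2 u) v = inner u (w2 v)" for u v
  unfolding w_def w2_def by (rule rs_sym[OF f]; simp)+
 \<comment> \<open>The resolvent identity \<open>w2 (2 - w) = w\<close>, from uniqueness of the
   solution that defines \<open>w2\<close>.\<close>
 have w2w: "w2 (2 *r u - w u) = w u" for u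
 proof -
  have "rs f 2 (2 *r u - w u) = rs f 1 u" by (rule rs_eqI[OF f _ rs_graph[OF f]])
    (use rs_inner[OF f zero_less_one, of _ _ u] in "auto simp: w_def inner_diff_left algebra_simps")
  thus ?thesis by (simp add: w_def w2_def)
 qed
 have comm: "w2 (w v) = w (w2 v)" for v
 proof -
  have "inner u (w2 (w v)) = inner u (w (w2 v))" for u
  proof -
   have "inner (w2 (2 *r u - w u)) v = inner u (2 *r w2 v - w (w2 v))" by (simp add: ws inner_sums)
   moreover have "inner (w2 (2 *r u - w u)) v = inner u (w2 (2 *r v - w v))" by (simp add: w2w ws)
   ultimately show ?thesis by (simp add: bo_simps[OF bw2] inner_diff_right)
  qed
  from this[of "w2 (w v) - w (w2 v)"] show ?thesis by (metis inner_diff_right eq_iff_diff_eq_0 inner_eq_zero_iff)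
 qed
 define X where "X v = w v - w (w v)" for v
 have XA: "X : A" unfolding X_def[abs_def] using minus_mem[OF wA(1) comp_mem[OF wA(1) wA(1)]] by (simp add: o_def)
 have "posop X" unfolding posop_iff
 proof (intro conjI allI)
  show "inner (X u) v = inner u (X v)" for u v by (simp add: X_def inner_sums ws)
  show "0 <= inner v (X v)" for v
   using rs_square[OF f zero_less_one, of v] ws(1)[of v "w v"] by (simp add: X_def inner_diff_right w_def norm_sq)
 qed (rule bounded[OF XA])
 then obtain c where c: "c : A" "posop c" "c o c = X"
  "!!b v. bop b ==> (ALL v. b (X v) = X (b v)) ==> b (c v) = c (b v)" using sqrt_mem[OF XA] by metis
 have cs: "inner (c u) v = inner u (c v)" for u v by (rule posop_sym[OF c(2)])
 have cc: "c (c v) = w v - w (w v)" for v using fun_cong[OF c(3), of v] by (simp add: X_def)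
 note bc = bounded[OF c(1)]
 have cw: "w (c v) = c (w v)" "w2 (c v) = c (w2 v)" for v by (rule c(4)[OF bw], simp add: X_def bo_diff[OF bw])
   (rule c(4)[OF bw2], simp add: X_def bo_diff[OF bw2] comm)
 define a where "a v = 2 *r (w v - w2 v)" for v
 have aA: "a : A" unfolding a_def[abs_def] by (intro scaleR_mem minus_mem wA)
 \<comment> \<open>The resolvent identity gives \<open>a = c\<^sup>2 + c\<^sup>2 w2\<close>, and the
   second term is positive.\<close>
 have le: "inner v (c (c v)) <= inner v (a v)" for v
 proof -
  have e: "2 *r w2 v = w v + w (w2 v)" for v using w2w[of v] by (simp add: bo_simps[OF bw2] comm algebra_simps)
  have "w w2' - w (w w2') = w (w v) - w w2'" if "w2' = w2 v" for w2' using arg_cong[OF e[of v], of w] that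
   by (simp add: bo_simps[OF bw] scaleR_2 algebra_simps)
  hence "a v = c (c v) + c (c (w2 v))" unfolding cc a_def using e[of v] by (simp add: scaleR_diff_right scaleR_2)
  moreover have "inner v (c (c (w2 v))) = inner (c v) (w2 (c v))" by (simp add: cs cw)
  ultimately show ?thesis using rs_nonneg[OF f, of 2 "c v"] by (simp add: inner_add_right w2_def)
 qed
 have ap: "posop a" unfolding posop_iff
 proof (intro conjI allI)
  show "inner (a u) v = inner u (a v)" for u v by (simp add: a_def inner_sums ws)
  show "0 <= inner v (a v)" for v using rs_antimono[OF f, of 1 2 v] by (simp add: a_def inner_diff_right w_def w2_def)
 qed (rule bounded[OF aA])
 \<comment> \<open>On the scale \<open>kap = exp (- s)\<close> passing from \<open>rs 1\<close> to
   \<open>rs 2\<close> is a shift by \<open>ln 2\<close>.\<close>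
 define G where "G v s = 2 * inner v (rs f (exp (- s)) v)" for v s
 have G: "mono (G v)" "0 <= G v s" "G v s <= 2 * (norm v)^2" for v s
  unfolding G_def mono_def using rs_antimono[OF f] rs_nonneg[OF f] rs_le[OF f] by auto
 have [measurable]: "G v : BM" for v by (rule borel_measurable_mono[OF G(1)])
 have Ga: "inner v (dual_action s a v) = G v s - G v (s - ln 2)" for v s
 proof -
  have "dual_action s a v = 2 *r (dual_action s w v - dual_action s w2 v)"
   by (simp add: dual_action_def a_def bo_simps[OF bo_phase])
  moreover have "exp (- (s - ln 2)) = exp (- s) * (2::real)" by (simp add: exp_diff exp_minus field_simps)
  ultimately show ?thesis unfolding G_def using dual_action_rs[OF f, of 1 s v] dual_action_rs[OF f, of 2 s v]
   by (simp add: w_def w2_def inner_diff_right)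
 qed
 have m: "(%s. inner v (dual_action s a v)) : BM" for v unfolding Ga by measurable
 have i: "(nni lborel (%s. ennreal (inner v (dual_action s a v)))) <= ennreal (2 * ln 2) * ennreal ((norm v)^2)" for v
 proof -
  have "(nni lborel (%s. ennreal (inner v (dual_action s a v)))) <= ennreal (ln 2 * (2 * (norm v)^2))"
   unfolding Ga by (rule nn_integral_mono_increments[OF G]) simp
  also have "ln 2 * (2 * (norm v)^2) = 2 * ln 2 * (norm v)^2" by simp
  finally show ?thesis by (simp only: ennreal_mult' zero_le_power2 ln_ge_zero)(simp add: ennreal_mult)
 qed
 note tk = tau_k_pi[OF f c(1) cs aA ap le m i]
 have rangew: "EX y. (w v, y) : ?T & (norm y)^2 = inner (v - w v) (w v)" for v
  using rs_graph[OF f, of 1 v] rs_inner[OF f zero_less_one rs_graph[OF f, of 1 v], of v] by (auto simp: w_def norm_sq)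
 have kerw: "v = 0" if v: "w v = 0" for v
 proof -
  have "rt f 1 v = 0" using rs_inner[OF f zero_less_one rs_graph[OF f, of 1 v], of v] v by (simp add: w_def inner_eq_zero_iff)
  hence "v : (Domain ?T)\<bottom>" using rs_inner[OF f zero_less_one, of _ _ v] v by (auto simp: perp_iff w_def)
  hence "v : (closure (Domain ?T))\<bottom>" by (simp add: perp_closure)
  hence "inner v v = 0" unfolding dense_Domain_T[OF f] by (auto simp: perp_iff)
  thus ?thesis by (simp add: inner_eq_zero_iff)
 qed
 \<comment> \<open>On \<open>D\<close> one has \<open>c z = w r\<close>, where the resolvent
   equation computes \<open>T\<close>. The set contains the range and the kernel of
   \<open>c\<close>, hence is dense, and closedness of \<open>T\<close> extends the formula to all
   \<open>z\<close>.\<close>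
 define D where "D = {z. EX u. c z = c (c u)}"
 have D: "EX y. (c z, y) : ?T & norm y = norm (z - w z)" if zD: "z : D" for z
 proof -
  obtain u where u: "c z = c (c u)" using zD by (auto simp: D_def)
  define v where "v = z - c u"
  have z: "z = c u + v" "c v = 0" using u by (simp_all add: v_def bo_diff[OF bc])
  define r where "r = u - w u"
  \<comment> \<open>On the kernel of \<open>c\<close> the operator \<open>w\<close> is the identity,
    as \<open>w\<close> is injective.\<close>
  have "w (v - w v) = 0" using cc[of v] z(2) by (simp add: bo_diff[OF bw] bo_zero[OF bc])
  hence v: "w v = v" using kerw by force
  have cz: "c z = w r" by (simp add: z bo_add[OF bc] cc r_def bo_diff[OF bw])
  have zw: "z - w z = c r" by (simp add: z bo_add[OF bw] v cw r_def bo_diff[OF bc])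
  obtain y where y: "(w r, y) : ?T" "(norm y)^2 = inner (r - w r) (w r)" using rangew by blast
  have "(norm y)^2 = inner r (c (c r))" unfolding y(2) cc by (simp add: inner_sums ws)
  also have "... = (norm (c r))^2" by (simp add: cs[symmetric] norm_sq)
  finally have "norm y = norm (c r)" by simp
  thus ?thesis using y(1) cz zw by auto
 qed
 have "D = c -` range (c o c)" by (auto simp: D_def)
 hence sD: "subspace D"
  by (metis linear_subspace_vimage[OF bounded_linear.linear[OF bo_linear[OF bc]] csubspace_subspace[OF csubspace_range[OF bo_comp[OF bc bc]]]])
 have dD: "closure D = UNIV"
 proof (rule dense_if_perp[OF sD])
  fix x assume x: "x : D\<bottom>"
  have cD: "c u : D" for u by (auto simp: D_def)
  have "inner x (c (c x)) = 0" using x cD by (simp add: perp_iff)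
  hence "c x = 0" using inner_eq_zero_iff[of "c x"] by (simp add: cs)
  hence "x : D" unfolding D_def by (intro CollectI exI[of _ 0]) (simp add: bo_zero[OF bc])
  hence "inner x x = 0" using x by (simp add: perp_iff)
  thus "x = 0" by (simp add: inner_eq_zero_iff)
 qed
 have Tc: "EX y. (c z, y) : ?T & norm y = norm (z - w z)" for z
 proof -
  have "z : closure D" unfolding dD by simp
  then obtain x where x: "!!n. x n : D" "x ----> z" unfolding closure_sequential by blast
  obtain y where y: "!!n. (c (x n), y n) : ?T" "!!n. norm (y n) = norm (x n - w (x n))" using D[OF x(1)] by metis
  have nd: "norm (y n - y m) = norm ((x n - x m) - w (x n - x m))" for n m
  proof -
   obtain y' where y': "(c (x n - x m), y') : ?T" "norm y' = norm ((x n - x m) - w (x n - x m))"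
    using D[OF subspace_diff[OF sD x(1) x(1)]] by blast
   have "(c (x n - x m), y n - y m) : ?T" using lg_diff[OF T_graph(1) y(1)[of n] y(1)[of m]] by (simp add: bo_diff[OF bc])
   thus ?thesis using y' T_graph(3) by (auto dest: single_valuedD)
  qed
  define q where "q v = v - w v" for v
  have tq: "(%n. q (x n)) ----> q z" unfolding q_def by (intro tendsto_diff bo_tendsto[OF bw] x(2))
  have "Cauchy (%n. q (x n))" using tq by (rule LIMSEQ_imp_Cauchy)
  moreover have "dist (y n) (y m) = dist (q (x n)) (q (x m))" for n m
   using nd[of n m] by (simp add: dist_norm q_def bo_diff[OF bw] algebra_simps)
  ultimately have "Cauchy y" by (simp add: Cauchy_def)
  then obtain y0 where y0: "y ----> y0" using Cauchy_convergent convergent_def by blast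
  have "(%n. (c (x n), y n)) ----> (c z, y0)" by (intro tendsto_Pair bo_tendsto[OF bc] x(2) y0)
  hence "(c z, y0) : ?T" using closed_sequentially[OF T_graph(2), of "%n. (c (x n), y n)"] y(1) by blast
  moreover have "norm y0 = norm (q z)"
   by (rule LIMSEQ_unique[OF tendsto_norm[OF y0]]) (use tendsto_norm[OF tq] y(2) in "simp add: q_def")
  ultimately show ?thesis by (auto simp: q_def)
 qed
 define Y where "Y v = (v - w v) - w (v - w v)" for v
 have YA: "Y : A" unfolding Y_def[abs_def]
  using minus_mem[OF minus_mem[OF id_mem wA(1)] comp_mem[OF wA(1) minus_mem[OF id_mem wA(1)]]] by (simp add: o_def)
 have Yi: "inner v (Y v) = (norm (v - w v))^2" for v by (simp add: Y_def inner_sums norm_sq ws bo_diff[OF bw])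
 have Yp: "Y : pos_part A"
  unfolding pos_part_iff posop_iff using YA bounded[OF YA] Yi by (simp add: Y_def inner_sums ws bo_diff[OF bw])
 define K where "K = 2 * ln 2 * enn2real (\<nu> f)"
 have K0: "K >= 0" by (simp add: K_def)
 have tY: "\<tau> Y <= ennreal K"
 proof -
  have "\<tau> Y = (SUP n. \<tau> (%v. c (\<pi> f (k n (k n (\<pi> f (c v)))))))"
  proof (rule tau_sup[OF tk(1) Yp])
   show "inner v (c (\<pi> f (k n (k n (\<pi> f (c v)))))) <= inner v (c (\<pi> f (k (Suc n) (k (Suc n) (\<pi> f (c v))))))" for n v
    unfolding inner_k[OF f cs] by (rule norm_k_mono)
   show "(%n. inner v (c (\<pi> f (k n (k n (\<pi> f (c v))))))) ----> inner v (Y v)" for v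
    unfolding inner_k[OF f cs] Yi using Tc[of v] norm_k_tendsto[of "\<pi> f (c v)"] by (auto simp: T_mem[OF f])
  qed
  also have "... <= ennreal K" unfolding K_def using tk(2) nu_f[OF f, of "2 * ln 2"] by (intro SUP_least) simp
  finally show ?thesis .
 qed
 show ?thesis unfolding tdense_def
 proof (intro allI impI)
  fix dl :: real assume d: "dl > 0"
  \<comment> \<open>Chosen for \<open>kap K <= dl / 4\<close>; \<open>K + 1\<close> guards against
    \<open>K = 0\<close>.\<close>
  define s where "s = ln (4 * (K + 1) / dl)"
  define kap where "kap = exp (- s)"
  have kap: "kap > 0" "4 * (kap * K) <= dl"
  proof -
   show k: "kap > 0" by (simp add: kap_def)
   define r where "r = K + 1"
   have r: "r > 0" using K0 by (simp add: r_def)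
   have "kap = dl / (4 * r)" using d r by (simp add: kap_def s_def exp_minus r_def[symmetric])
   hence "4 * (kap * (K + 1)) = dl" using r by (simp add: r_def[symmetric])
   thus "4 * (kap * K) <= dl" using k by (simp add: distrib_left)
  qed
  let ?r = "rs f kap"
  note br = rs_bounded[OF f, of kap] and rsy = rs_sym[OF f kap(1)]
  define Z where "Z = dual_action s Y"
  have Zr: "Z v = (v - ?r v) - ?r (v - ?r v)" for v
  proof -
   have dr: "w (ph (- s) v) = ph (- s) (?r v)" for v
    using dual_action_rs[OF f zero_less_one, of s v] phase_phase[of "- s" s "w (ph (- s) v)"]
    by (simp add: dual_action_def w_def kap_def)
   have "Y (ph (- s) v) = ph (- s) ((v - ?r v) - ?r (v - ?r v))"
    by (simp add: Y_def dr bo_diff[OF bo_phase] bo_diff[OF bw] bo_diff[OF br])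
   thus ?thesis by (simp add: Z_def dual_action_def phase_phase)
  qed
  have Zp: "Z : pos_part A" unfolding Z_def by (rule dual_action_pos_part[OF Yp])
  have "\<tau> Z <= ennreal kap * ennreal K" unfolding Z_def tau_dual_action[OF Yp] kap_def by (rule mult_left_mono[OF tY]) simp
  hence tZ: "\<tau> Z <= ennreal (kap * K)" using kap(1) by (simp add: ennreal_mult')
  \<comment> \<open>The level 1/4 is the square of the contraction factor 1/2 used below.
    \<open>L\<close> is invariant under \<open>rs kap\<close> because \<open>Z\<close> is a
    polynomial in it.\<close>
  obtain L where L: "reducing L" "!!b. bop b ==> (ALL v. b (Z v) = Z (b v)) ==> b ` L <= L"
   "!!v. v : L ==> inner v (Z v) <= 1/4 * (norm v)^2" "ennreal (1/4) * codim L <= \<tau> Z"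
   using weight_cut[OF Zp, of "1/4"] by auto
  note L' = redD[OF L(1)]
  have rL: "?r v : L" if "v : L" for v using L(2)[OF br] that by (auto simp: Zr bo_diff[OF br])
  have rn: "norm (v - ?r v) <= 1/2 * norm v" if "v : L" for v
  proof (rule power2_le_imp_le)
   have "(norm (v - ?r v))^2 = inner v (Z v)" by (simp add: Zr inner_sums norm_sq rsy bo_diff[OF br])
   also have "... <= (1/2 * norm v)^2" using L(3)[OF that] by (simp add: power_mult_distrib power2_eq_square)
   finally show "(norm (v - ?r v))^2 <= (1/2 * norm v)^2" .
  qed simp
  have "v : Domain ?T" if v: "v : L" for v
  proof -
   \<comment> \<open>The fixed point solves \<open>rs kap x = v\<close> inside \<open>L\<close>,
     where \<open>1 - rs kap\<close> contracts.\<close>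
   have "EX! x : L. v + (x - ?r x) = x"
   proof (rule Banach_fix[where c="1/2"])
    show "complete L" using L'(1) complete_eq_closed by blast
    show "L ~= {}" using v by blast
    show "(%x. v + (x - ?r x)) ` L <= L" using v rL subspace_add[OF L'(3)] subspace_diff[OF L'(3)] by auto
    show "!!x y. x : L ==> y : L ==> dist (v + (x - ?r x)) (v + (y - ?r y)) <= 1/2 * dist x y"
     using rn[OF subspace_diff[OF L'(3)]] by (simp add: dist_norm bo_diff[OF br] algebra_simps)
   qed auto
   then obtain x where "v + (x - ?r x) = x" by blast
   hence "?r x = v" by (simp add: algebra_simps)
   thus ?thesis using rs_graph[OF f, of kap x] by auto
  qed
  moreover have "codim L <= ennreal dl"
  proof -
   have "ennreal 4 * ennreal (1/4) = 1" by (subst ennreal_mult'[symmetric]) auto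
   hence "codim L = ennreal 4 * (ennreal (1/4) * codim L)" by (simp only: mult.assoc[symmetric] mult_1)
   also have "... <= ennreal 4 * ennreal (kap * K)" by (intro mult_left_mono order_trans[OF L(4) tZ]) simp
   also have "... = ennreal (4 * (kap * K))" by (rule ennreal_mult'[symmetric]) simp
   also have "... <= ennreal dl" by (rule ennreal_leI[OF kap(2)])
   finally show ?thesis .
  qed
  ultimately show "EX K. reducing K & K <= Domain ?T & codim K <= ennreal dl" using L(1) by blast
 qed
qed

end

section \<open>Measurability of \<open>g(h) \<pi>(f)\<close> for \<open>g\<close> of square root
  growth\<close>

context crossed
begin

text \<open>The growth bound puts the domain of \<open>h\<^sup>1\<^sup>/\<^sup>2\<close> into that
  of \<open>g(h)\<close>; absence of zeros on the positive axis keeps \<open>g(h)\<close>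
  injective.\<close>

definition sqrt_growth :: "(real => complex) => bool"
 where "sqrt_growth g <-> g : BM & (ALL u. cnj (g u) = g u) & (ALL u<=0. g u = 0) &
  (ALL u>0. g u ~= 0) & (EX C. ALL u>0. cmod (g u) <= C * (1 + sqrt u))"

lemma sqrt_growthD: assumes "sqrt_growth g"
 shows "g : BM" "!!u. cnj (g u) = g u" "!!u. u > 0 ==> g u ~= 0" using assms by (auto simp: sqrt_growth_def)

lemma sqrt_growth_domain: assumes g: "sqrt_growth g" and v: "v : sdom E hsqrt"
 shows "v : sdom E g"
proof -
 obtain C where C: "!!u. u > 0 ==> cmod (g u) <= C * (1 + sqrt u)" using g by (auto simp: sqrt_growth_def)
 have one: "v : sdom E (%u. 1)" by (rule S.sdom_bounded[where C=1]) auto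
 show ?thesis
 proof (rule S.sdom_mult)
  show "v : sdom E (%u. hsqrt u + 1)" by (rule S.I_add_fun(1)[OF hsqrt_meas(1) _ v one]) simp
  show "cmod (g u) <= C * cmod (hsqrt u + 1)" for u
  proof (cases "u > 0")
   case True
   hence "hsqrt u + 1 = of_real (1 + sqrt u)" by (simp add: hsqrt_def)
   hence "cmod (hsqrt u + 1) = 1 + sqrt u" using True by (simp only: norm_of_real) simp
   thus ?thesis using C[OF True] by simp
  next
   case False
   have "C * (1 + sqrt 1) >= 0" using C[of 1] norm_ge_zero order_trans by (metis zero_less_one)
   thus ?thesis using False g by (auto simp: sqrt_growth_def zero_le_mult_iff)
  qed
 qed (use sqrt_growthD[OF g] in measurable)
qed

context
 fixes g assumes g: "sqrt_growth g"
begin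

lemmas comp_pi_props = comp_pi_graph[OF sqrt_growthD(1,2)[OF g] finD(1)]

lemma comp_pi_meas: assumes f: "f : fin" shows "comp_pi g f : meas"
proof -
 have "Domain (comp_pi hsqrt f) <= Domain (comp_pi g f)"
  using sqrt_growth_domain[OF g] by (auto simp: comp_pi_def S.mem_si sqrt_growthD[OF g])
 hence td: "tdense (Domain (comp_pi g f))" by (rule td_mono[OF td_Domain_T[OF f]])
 thus ?thesis using comp_pi_props[OF f] by (simp add: meas_iff)
qed

lemma strong_prod_right: assumes f: "f : fin" shows "strong_prod (si E g) (op_graph (\<pi> f)) = comp_pi g f"
proof -
 have "{(x, z) | x y z. (x, y) : op_graph (\<pi> f) & (y, z) : si E g} = comp_pi g f" by (auto simp: comp_pi_def)
 thus ?thesis using comp_pi_props(2)[OF f] by (simp add: strong_prod_def)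
qed

text \<open>As \<open>g(h)\<close> is selfadjoint, \<open>comp_pi g f\<close> is the adjoint of the
  unclosed product \<open>\<pi>(f) g(h)\<close>, whose closure is the double adjoint.\<close>

lemma strong_prod_left: assumes f: "f : fin" shows "strong_prod (op_graph (\<pi> f)) (si E g) = adjg (comp_pi g f)"
proof -
 let ?R = "{(x, \<pi> f z) | x z. (x, z) : si E g}"
 note b = bo_pi[OF finD(1)[OF f]] and l = S.lg_spectral_integral[OF sqrt_growthD(1)[OF g]]
 have R: "linear_graph ?R"
 proof (rule lgI)
  show "(0, 0) : ?R" using lg_0[OF l] bo_zero[OF b] by force
  show "(u + u', v + v') : ?R" if uv: "(u, v) : ?R" "(u', v') : ?R" for u v u' v'
  proof -
   obtain z z' where z: "(u, z) : si E g" "v = \<pi> f z" "(u', z') : si E g" "v' = \<pi> f z'" using uv by blast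
   show ?thesis using lg_add[OF l z(1,3)] unfolding z(2,4) bo_add[OF b, symmetric] by blast
  qed
  show "(c *c u, c *c v) : ?R" if uv: "(u, v) : ?R" for c u v
  proof -
   obtain z where z: "(u, z) : si E g" "v = \<pi> f z" using uv by blast
   show ?thesis using lg_scaleC[OF l z(1)] unfolding z(2) bo_scaleC[OF b, symmetric] by blast
  qed
 qed
 have "(u, v) : adjg ?R <-> (u, v) : comp_pi g f" for u v
 proof -
  have "(u, v) : adjg ?R <-> (ALL x z. (x, z) : si E g --> inner (\<pi> f z) u = inner x v)" unfolding adj_graph_iff[OF R] by auto
  also have "... <-> (\<pi> f u, v) : adjg (si E g)" by (simp add: adj_graph_iff[OF l] pi_f(1)[OF f])
  also have "adjg (si E g) = si E g" by (rule S.adj_spectral_integral[OF sqrt_growthD(1,2)[OF g]])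
  finally show ?thesis by (simp add: comp_pi_def)
 qed
 hence "adjg ?R = comp_pi g f" by auto
 hence "closure ?R = adjg (comp_pi g f)" using adj_adj_graph[OF R] by simp
 moreover have "{(x, z) | x y z. (x, y) : si E g & (y, z) : op_graph (\<pi> f)} = ?R" by auto
 ultimately show ?thesis by (simp add: strong_prod_def)
qed

lemma shift_comp_pi: assumes f: "f : fin" and xz: "(x, z) : comp_pi g f" shows "(sft t x, sft t z) : comp_pi g (\<sigma> t f)"
proof -
 have "sft t (\<pi> f x) : sdom E g & S.I g (sft t (\<pi> f x)) = sft t (S.I g (\<pi> f x))"
 proof (rule intertwine_spectral_integral[where x="sft t", OF S.spectral_axioms S.spectral_axioms bo_shift _ sqrt_growthD(1)[OF g]])
  show "sft t (E B v) = E B (sft t v)" if "B : sets borel" for B v by (rule commute_E[OF bo_shift _ that]) (simp add: shift_shift add.commute)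
  show "\<pi> f x : sdom E g" using xz by (simp add: comp_pi_def S.mem_si sqrt_growthD(1)[OF g])
 qed
 thus ?thesis using xz by (simp add: comp_pi_def S.mem_si sqrt_growthD[OF g] shift_pi[OF finD(1)[OF f]])
qed

text \<open>The vectors orthogonal to all these ranges form a subspace invariant under shifts, since
  a shift turns \<open>f\<close> into \<open>\<sigma> t f\<close>, and so under \<open>E\<close>. A
  truncation of \<open>g(h)\<close> applied to such a vector is annihilated by every
  \<open>\<pi> f\<close>, hence is 0, and \<open>g\<close> has no positive zeros to hide the
  vector.\<close>

lemma comp_pi_total: assumes y: "!!f x z. f : fin ==> (x, z) : comp_pi g f ==> inner y z = 0"
 shows "y = 0"
proof -
 note gm = sqrt_growthD(1)[OF g]
 define Y where "Y = {y. ALL f x z. f : fin --> (x, z) : comp_pi g f --> inner y z = 0}"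
 have Yeq: "Y = (UN f : fin. Range (comp_pi g f))\<bottom>" unfolding Y_def perp_iff set_eq_iff by blast
 have clY: "closed Y" unfolding Yeq by (rule closed_perp)
 have csY: "csubspace Y"
 proof (rule csubspaceI)
  fix c and u assume u: "u : Y"
  have "inner (c *c u) z = 0" if "f : fin" "(x, z) : comp_pi g f" for f x z
   using u lg_scaleC[OF comp_pi_props(1)[OF that(1)] that(2), of "cnj c"] that(1) by (auto simp: Y_def inner_scaleC_left)
  thus "c *c u : Y" by (auto simp: Y_def)
 qed (auto simp: Y_def inner_add_left)
 note sY = csubspace_subspace[OF csY]
 have shY: "sft t u : Y" if "u : Y" for t u unfolding Y_def mem_Collect_eq inner_shift
 proof (intro allI impI)
  fix f x z assume f: "f : fin" and xz: "(x, z) : comp_pi g f"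
  show "inner u (sft (- t) z) = 0" using that sigma_fin[OF f, of "- t"] shift_comp_pi[OF f xz, of "- t"] by (auto simp: Y_def)
 qed
 have ko: "oproj Y (sft t v) = sft t (oproj Y v)" for t v
  by (rule oproj_commute[OF clY sY bounded_linear.linear[OF bo_linear[OF bo_shift]] inner_shift]) (use shY in auto)
 have EY: "E B u : Y" if B: "B : sets borel" and u: "u : Y" for B u
  using commute_E[OF bo_oproj[OF clY csY] ko B, of u] oproj_id[OF clY sY u] oproj_mem[OF clY sY, of "E B u"] by simp
 have yY: "y : Y" using y by (auto simp: Y_def)
 have "E (S.level g n) y = 0" for n
 proof -
  let ?B = "S.level g n" and ?g = "%u. ind (S.level g n) u * g u"
  have B: "?B : sets borel" by (rule S.level_sets[OF gm])
  have g': "?g : BM" using B gm by measurable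
  have bd: "cmod (?g u) <= real n" for u by (auto simp: indicator_def S.level_def[OF gm])
  have d: "v : sdom E ?g" for v by (rule S.sdom_bounded[OF g' bd])
  have "S.I ?g y = 0"
  proof (rule pi_separating)
   fix f assume f: "f : fin"
   have "inner (\<pi> f (S.I ?g y)) x = 0" if x: "x : Domain (comp_pi g f)" for x
   proof -
    have px: "\<pi> f x : sdom E g" and xz: "(x, S.I g (\<pi> f x)) : comp_pi g f" using x by (auto simp: comp_pi_def S.mem_si gm)
    have "inner (E ?B y) (S.I g (\<pi> f x)) = 0" using EY[OF B yY] xz f by (auto simp: Y_def)
    hence "inner y (S.I ?g (\<pi> f x)) = 0" by (simp add: S.E_sym[OF B] S.E_I[OF gm B px])
    moreover have "(%u. cnj (?g u)) = ?g" using sqrt_growthD(2)[OF g] by (auto simp: indicator_def)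
    ultimately have "inner (S.I ?g y) (\<pi> f x) = 0" using S.I_adjoint[OF g' d[of "\<pi> f x"] d[of y]] by (metis Re_cinner)
    thus ?thesis by (simp add: pi_f(1)[OF f])
   qed
   hence "\<pi> f (S.I ?g y) : (Domain (comp_pi g f))\<bottom>" by (auto simp: perp_iff)
   moreover have "closure (Domain (comp_pi g f)) = UNIV"
    using comp_pi_meas[OF f] by (simp add: measurable_operators_def closed_densely_defined_def)
   ultimately have "\<pi> f (S.I ?g y) : UNIV\<bottom>" using perp_closure[of "Domain (comp_pi g f)"] by simp
   thus "\<pi> f (S.I ?g y) = 0" unfolding perp_iff by (metis UNIV_I inner_eq_zero_iff)
  qed
  hence "(LINT u|smeas E y. (cmod (?g u))^2) = 0" using S.norm_I[OF g' d[of y]] by simp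
  hence "AE u in smeas E y. (cmod (?g u))^2 = 0"
   using d[of y] g' by (subst (asm) integral_nonneg_eq_0_iff_AE) (auto simp: S.sdom_iff)
  hence "AE u in smeas E y. u ~: ?B" using AE_pos by eventually_elim (use sqrt_growthD(3)[OF g] in "auto simp: indicator_def")
  hence "emeasure (smeas E y) ?B = 0" using B by (subst (asm) AE_iff_measurable[where N="?B"]) auto
  thus ?thesis using B by (simp add: S.em_scalar)
 qed
 thus ?thesis using S.E_level_tendsto[OF gm, of y] by (simp add: LIMSEQ_const_iff)
qed

end

end

context tracial
begin

lemma meas_dense: "T : meas ==> closure (Domain T) = UNIV" by (simp add: measurable_operators_def closed_densely_defined_iff)

lemma red_Range_perp: assumes T: "linear_graph T" "affiliated A T" shows "reducing ((Range T)\<bottom>)" unfolding reducing_def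
proof (intro conjI ballI subsetI)
 show "closed ((Range T)\<bottom>)" by (rule closed_perp)
 show "csubspace ((Range T)\<bottom>)"
 proof (rule csubspace_perp, rule csubspaceI)
  show "0 : Range T" using lg_0[OF T(1)] by blast
  show "u + v : Range T" if "u : Range T" "v : Range T" for u v using that lg_add[OF T(1)] by blast
  show "c *c u : Range T" if "u : Range T" for c u using that lg_scaleC[OF T(1)] by blast
 qed
 fix b v assume b: "b : commutant A" and v: "v : b ` ((Range T)\<bottom>)"
 then obtain u where u: "u : (Range T)\<bottom>" "v = b u" by blast
 have "inner (b u) z = 0" if "(x, z) : T" for x z
  using u(1) affiliatedD[OF T(2) commutant_adj[OF b] that] by (auto simp: perp_iff adj_inner[OF commutant_bo[OF b]])
 thus "v : (Range T)\<bottom>" by (auto simp: perp_iff u(2))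
qed

text \<open>The restriction of \<open>T\<close> to arguments with values in \<open>K\<close> is
  closed, affiliated and tau-densely defined, so it is all of \<open>T\<close>.\<close>

lemma Range_subset_reducing: assumes T: "T : meas" and K: "reducing K" and D: "tdense D" "!!x. x : D ==> EX v : K. (x, v) : T"
 shows "Range T <= K"
proof -
 note T' = measD[OF T] and K' = redD[OF K]
 have "{(x, v) : T. v : K} = T"
 proof (rule meas_subgraph_eq[OF T])
  show "linear_graph {(x, v) : T. v : K}" by (rule lgI) (auto intro: lg_0[OF T'(1)] lg_add[OF T'(1)] lg_scaleC[OF T'(1)]
     csubspace_0[OF K'(2)] csubspace_add[OF K'(2)] csubspace_scaleC[OF K'(2)])
  have "{(x, v) : T. v : K} = T Int snd -` K" by auto
  thus "closed {(x, v) : T. v : K}"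
   using closed_Int[OF T'(3) closed_vimage[OF K'(1) continuous_on_snd[OF continuous_on_id]]] by simp
  show "affiliated A {(x, v) : T. v : K}" by (rule affiliatedI) (auto intro: affiliatedD[OF T'(4)] K'(4))
  show "tdense (Domain {(x, v) : T. v : K})" by (rule td_mono[OF D(1)]) (use D(2) in blast)
 qed auto
 thus ?thesis by auto
qed

end

section \<open>The dual action on graphs\<close>

context crossed
begin

lemma dual_action_graph_iff: "(u, v) : dag s a <-> (ph (- s) u, ph (- s) v) : a"
proof
 assume "(ph (- s) u, ph (- s) v) : a"
 hence "(%(u, v). (ph s u, ph s v)) (ph (- s) u, ph (- s) v) : dag s a" unfolding dual_action_graph_def by (rule imageI)
 thus "(u, v) : dag s a" by (simp add: phase_phase)
qed (auto simp: dual_action_graph_def phase_phase)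

lemma dual_action_graph_mem: "(u, v) : a ==> (ph s u, ph s v) : dag s a" by (simp add: dual_action_graph_iff phase_phase)

lemma dual_action_graph_meas: assumes a: "a : meas" shows "dag s a : meas"
proof -
 note a' = measD[OF a] and p = bo_phase[of "- s"]
 have l: "linear_graph (dag s a)"
  by (rule lgI) (auto simp: dual_action_graph_iff bo_simps[OF p] intro: lg_0[OF a'(1)] lg_add[OF a'(1)] lg_scaleC[OF a'(1)])
 have "dag s a = (%p. (ph (- s) (fst p), ph (- s) (snd p))) -` a" by (auto simp: dual_action_graph_iff)
 moreover have "continuous_on UNIV (%p. (ph (- s) (fst p), ph (- s) (snd p)))" by (intro continuous_intros bo_continuous[OF p])
 ultimately have c: "closed (dag s a)" using closed_vimage[OF a'(3)] by simp
 have sv: "single_valued (dag s a)"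
 proof (rule single_valuedI)
  fix x y z assume "(x, y) : dag s a" "(x, z) : dag s a"
  hence "ph (- s) y = ph (- s) z" using a'(2) by (auto simp: dual_action_graph_iff dest: single_valuedD)
  hence "ph s (ph (- s) y) = ph s (ph (- s) z)" by simp
  thus "y = z" by (simp add: phase_phase)
 qed
 have af: "affiliated A (dag s a)"
 proof (rule affiliatedI)
  fix b u v assume b: "b : commutant A" and uv: "(u, v) : dag s a"
  show "(b u, b v) : dag s a"
   using affiliatedD[OF a'(4) phase_commutant[OF b, of "- s"]] uv by (fastforce simp: dual_action_graph_iff phase_phase)
 qed
 have "ph s ` Domain a <= Domain (dag s a)" using dual_action_graph_mem by blast
 hence td: "tdense (Domain (dag s a))" by (rule td_mono[OF td_phase[OF a'(5)]])
 show ?thesis using l c sv af td by (simp add: meas_iff)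
qed

end

text \<open>\<open>w\<close> is quasiconcave, as fundamental functions are: \<open>w\<close>
  increases and \<open>w(u) / u\<close> decreases. The pair \<open>q\<close>, \<open>kap\<close>
  carries what the Boyd index contributes.\<close>

locale crossed_growth = crossed M \<nu> \<sigma> \<tau> h
 for M :: "'h::complex_hilbert operator set" and \<nu> \<sigma> \<tau> h +
 fixes w :: "real => real" and q kap :: real assumes w_pos: "u > 0 ==> w u > 0" and w_mono: "0 < u ==> u <= v ==> w u <= w v"
  and w_anti: "0 < u ==> u <= v ==> w v * u <= w u * v" and q: "1 < q" "1 < kap" "u > 0 ==> kap * w u <= w (q * u)"
begin

text \<open>The factor \<open>c\<close> is there because the dual action takes
  \<open>w(h)\<^sup>1\<^sup>/\<^sup>2\<close> to the root of \<open>w\<close> at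
  \<open>exp (- s)\<close> times \<open>h\<close>.\<close>

definition sw :: "real => real => complex" where "sw c u = (if 0 < u then of_real (sqrt (w (c * u))) else 0)"

lemma sqrt_growth_sw: assumes c: "c > 0" shows "sqrt_growth (sw c)" unfolding sqrt_growth_def
proof (intro conjI allI impI)
 define f where "f u = (if 0 < u then sqrt (w (c * u)) else 0)" for u
 have "mono f" unfolding mono_def f_def using c less_imp_le[OF w_pos] w_mono by (auto intro!: real_sqrt_ge_zero mult_left_mono)
 hence "f : BM" by (rule borel_measurable_mono)
 moreover have "sw c = (%u. of_real (f u))" by (auto simp: sw_def f_def)
 ultimately show "sw c : BM" by simp
 show "sw c u ~= 0" if "u > 0" for u using that c w_pos[of "c * u"] by (simp add: sw_def)
 show "EX C. ALL u>0. cmod (sw c u) <= C * (1 + sqrt u)"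
 proof (intro exI allI impI)
  fix u :: real assume u: "u > 0"
  \<comment> \<open>Quasiconcavity bounds \<open>w(c u)\<close> by \<open>w(c)\<close> times the
    maximum of 1 and \<open>u\<close>.\<close>
  have "w (c * u) <= w c * (1 + sqrt u)^2"
  proof (cases "u <= 1")
   case True
   have "w (c * u) <= w c" using w_mono[of "c * u" c] c u True by simp
   also have "... <= w c * (1 + sqrt u)^2" using w_pos[OF c] u by (simp add: one_le_power)
   finally show ?thesis .
  next
   case False
   hence "w (c * u) * c <= w c * (c * u)" using w_anti[of c "c * u"] c by simp
   hence "w (c * u) <= w c * u" using c by (simp add: mult.left_commute mult.commute)
   also have "u <= (1 + sqrt u)^2" using u by (simp add: power2_sum)
   hence "w c * u <= w c * (1 + sqrt u)^2" using w_pos[OF c] by (intro mult_left_mono) auto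
   finally show ?thesis .
  qed
  hence "sqrt (w (c * u)) <= sqrt (w c * (1 + sqrt u)^2)" by (rule real_sqrt_le_mono)
  thus "cmod (sw c u) <= sqrt (w c) * (1 + sqrt u)" using u c w_pos[of "c * u"] by (simp add: sw_def real_sqrt_mult)
 qed
qed (auto simp: sw_def)

abbreviation W :: "real => 'h operator => 'h L2 graph" where "W c f == comp_pi (sw c) f"

lemmas W_meas = comp_pi_meas[OF sqrt_growth_sw]
lemmas sw_measurable = sqrt_growthD(1)[OF sqrt_growth_sw]

abbreviation L :: "'h L2 graph set" where "L == crossed_space w M \<nu> \<sigma> \<tau> h"

abbreviation pairing :: "'h operator => 'h operator => 'h L2 graph => 'h L2 graph"
 where "pairing e f a == strong_prod (strong_prod (adjg (W 1 e)) a) (W 1 f)"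

lemma L_iff: "a : L <-> a : meas & (ALL e : fin. ALL f : fin. pairing e f a : haagerup_L1 M \<sigma> \<tau>)"
proof -
 have "sqrt_calculus w h = si E (sw 1)"
 proof -
  have "(%u. if 0 < u then complex_of_real (sqrt (w u)) else 0) = sw 1" by (auto simp: sw_def)
  thus ?thesis by (simp add: sqrt_calculus_def borel_calculus_h)
 qed
 thus ?thesis using strong_prod_left[OF sqrt_growth_sw[OF zero_less_one]] strong_prod_right[OF sqrt_growth_sw[OF zero_less_one]]
  by (auto simp: crossed_space_def fin_iff[symmetric])
qed

lemma L_meas: "a : L ==> a : meas" by (simp add: L_iff)

definition ratio :: "real => real => complex"
 where "ratio s u = (if 0 < u then of_real (sqrt (w u / (exp s * w (exp (- s) * u)))) else 0)"

lemma ratio_meas [measurable]: "ratio s : BM"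
proof -
 have [measurable]: "(%u. if 0 < u then w u else 0) : BM"
  "(%u. if 0 < u then w (exp (- s) * u) else 0) : BM"
  using less_imp_le[OF w_pos] w_mono by (auto intro!: borel_measurable_mono simp: mono_def)
 have "ratio s = (%u. of_real (sqrt ((if 0 < u then w u else 0) / (exp s * (if 0 < u then w (exp (- s) * u) else 0)))))"
  by (auto simp: ratio_def)
 thus ?thesis by simp
qed

text \<open>For \<open>s >= 0\<close> the quotient under the root is at most 1 because
  \<open>w(u) / u\<close> decreases, for \<open>s < 0\<close> at most \<open>exp (- s)\<close>
  because \<open>w\<close> increases.\<close>

lemma ratio_bounded: "cmod (ratio s u) <= sqrt (max 1 (exp (- s)))"
proof (cases "u > 0")
 case True
 let ?c = "exp (- s)"
 have p: "w (?c * u) > 0" "w u > 0" using w_pos True by simp_all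
 have "w u / (exp s * w (?c * u)) <= max 1 ?c"
 proof (cases "s >= 0")
  case T: True
  have "w u * (?c * u) <= w (?c * u) * u" by (rule w_anti) (use True T in simp_all)
  hence "w u * ?c <= w (?c * u)" using True by (simp add: mult.assoc[symmetric])
  hence "w u <= exp s * w (?c * u)" by (simp add: exp_minus field_simps)
  hence "w u / (exp s * w (?c * u)) <= 1" using p by simp
  thus ?thesis by simp
 next
  case False
  have "w u <= w (?c * u)" by (rule w_mono) (use True False in simp_all)
  hence "w u / (exp s * w (?c * u)) <= ?c" using p by (simp add: exp_minus field_simps)
  thus ?thesis by simp
 qed
 thus ?thesis using True p by (simp add: ratio_def)
qed (auto simp: ratio_def)

abbreviation D :: "real => 'h L2 operator" where "D s == S.I (ratio s)"

lemma D_mem: "D s : A" by (rule I_mem[OF ratio_meas ratio_bounded])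

lemma D_sym: "inner (D s u) v = inner u (D s v)"
proof -
 have d: "x : sdom E (ratio s)" for x by (rule S.sdom_bounded[OF ratio_meas ratio_bounded])
 have "(%u. cnj (ratio s u)) = ratio s" by (auto simp: ratio_def)
 thus ?thesis using S.I_adjoint[OF ratio_meas[of s] d[of v] d[of u]] by (metis Re_cinner)
qed

definition DaD :: "real => 'h L2 graph => 'h L2 graph"
 where "DaD s a = strong_prod (op_graph (D s)) (strong_prod a (op_graph (D s)))"

lemma DaD_meas: "a : meas ==> DaD s a : meas" unfolding DaD_def by (intro meas_strong_prod op_graph_meas D_mem)

lemma DaD_mem: assumes a: "a : meas" "(D s x, y) : a" shows "(x, D s y) : DaD s a" unfolding DaD_def using a
 by (intro strong_prod_mem[OF op_graph_meas[OF D_mem] meas_strong_prod[OF a(1) op_graph_meas[OF D_mem]]]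
   strong_prod_mem[OF a(1) op_graph_meas[OF D_mem]]) auto

lemma W_phase: assumes f: "f : fin" shows "(ph s x, ph s y) : W (exp (- s)) f <-> (x, y) : W 1 f"
proof -
 have "(%u. sw 1 (exp (- s) * u)) = sw (exp (- s))" by (auto simp: sw_def zero_less_mult_iff)
 note * = phase_I[OF sw_measurable[OF zero_less_one], where s=s and v="\<pi> f x", unfolded this]
 have inj: "ph s y = ph s z <-> y = z" for y z :: "'h L2" by (metis add.left_inverse phase_phase phase_zero)
 show ?thesis
  using * inj[of y "S.I (sw 1) (\<pi> f x)"] by (auto simp: comp_pi_def S.mem_si sw_measurable phase_pi[OF finD(1)[OF f], symmetric])
qed

text \<open>Pointwise, \<open>sw 1\<close> is \<open>exp (s / 2)\<close> times the product of
  \<open>ratio s\<close> and \<open>sw (exp (- s))\<close>, and the bounded factor can be applied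
  last.\<close>

lemma W_scale: assumes f: "f : fin" and xy: "(x, y) : W (exp (- s)) f"
 shows "(x, exp (s / 2) *r D s y) : W 1 f"
proof -
 let ?c = "exp (- s)"
 have x: "\<pi> f x : sdom E (sw ?c)" "y = S.I (sw ?c) (\<pi> f x)" using xy by (auto simp: comp_pi_def S.mem_si sw_measurable)
 have d: "v : sdom E (ratio s)" for v by (rule S.sdom_bounded[OF ratio_meas ratio_bounded])
 note c = S.I_comp[OF ratio_meas[of s] sw_measurable[OF exp_gt_zero] x(1)]
 have d1: "\<pi> f x : sdom E (%u. ratio s u * sw ?c u)" using c(1) d by blast
 have "sw 1 u = of_real (exp (s / 2)) * (ratio s u * sw ?c u)" for u
 proof (cases "u > 0")
  case True
  have e: "sqrt (exp s) = exp (s / 2)" by (rule real_sqrt_unique) (simp_all flip: exp_double)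
  have "w (?c * u) > 0" using True by (intro w_pos) simp
  hence "sqrt (w u) = exp (s / 2) * (sqrt (w u / (exp s * w (?c * u))) * sqrt (w (?c * u)))"
   by (simp add: real_sqrt_divide real_sqrt_mult e)
  thus ?thesis using True by (simp add: sw_def ratio_def)
 qed (auto simp: sw_def)
 hence eq: "sw 1 = (%u. of_real (exp (s / 2)) * (ratio s u * sw ?c u))" by auto
 have m: "(%u. ratio s u * sw ?c u) : BM" using sw_measurable[OF exp_gt_zero] by measurable
 have "\<pi> f x : sdom E (sw 1) & S.I (sw 1) (\<pi> f x) = of_real (exp (s / 2)) *c D s y"
  unfolding eq using S.I_scale_fun[OF m d1] c(2)[OF d1] x by simp
 thus ?thesis by (simp add: comp_pi_def S.mem_si sw_measurable scaleC_of_real)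
qed

end

section \<open>The space \<open>L\<close> and its scaling\<close>

context crossed_growth
begin

text \<open>The product before closures are taken. Membership in a strong product yields no
  intermediate vectors, a chain does, and chains start on a tau-dense set.\<close>

definition chain :: "'h operator => 'h operator => 'h L2 graph => 'h L2 => 'h L2 => bool"
 where "chain e f a xi z <-> (EX x y. (xi, x) : W 1 f & (x, y) : a & (y, z) : adjg (W 1 e))"

abbreviation "CS s e f a == {v. EX z0 z. chain e f a (ph (- s) v) z0 & chain e f a v z & ph s z0 = exp (- s) *r z}"

lemmas W1_meas = W_meas[OF zero_less_one]
lemmas W1_adj_meas = meas_adj[OF W1_meas]

lemma chain_pairing: assumes "a : meas" "e : fin" "f : fin" "chain e f a xi z" shows "(xi, z) : pairing e f a"
proof -
 obtain x y where *: "(xi, x) : W 1 f" "(x, y) : a" "(y, z) : adjg (W 1 e)" using assms(4) by (auto simp: chain_def)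
 have "(x, z) : strong_prod (adjg (W 1 e)) a" by (rule strong_prod_mem[OF W1_adj_meas[OF assms(2)] assms(1) *(2,3)])
 thus ?thesis by (rule strong_prod_mem[OF meas_strong_prod[OF W1_adj_meas[OF assms(2)] assms(1)] W1_meas[OF assms(3)] *(1)])
qed

lemma pairing_meas: "a : meas ==> e : fin ==> f : fin ==> pairing e f a : meas" by (intro meas_strong_prod W1_adj_meas W1_meas)

lemma td_chain: assumes "a : meas" "e : fin" "f : fin" shows "tdense {xi. EX z. chain e f a xi z}"
 by (rule td_mono[OF td_pullback[OF W1_meas[OF assms(3)]
  td_pullback[OF assms(1) measD(5)[OF W1_adj_meas[OF assms(2)]]]]]) (auto simp: chain_def)

lemma haagerup_L1_iff:
 "x : haagerup_L1 M \<sigma> \<tau> <-> x : meas & (ALL s. tdense {v. EX z0 z. (ph (- s) v, z0) : x & (v, z) : x & ph s z0 = exp (- s) *r z})"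
  (is "_ <-> _ & (ALL s. tdense (?T s))")
proof -
 have "dag s x = strong_scale (of_real (exp (- s))) x <-> tdense (?T s)" if x: "x : meas" for s
 proof
  let ?c = "complex_of_real (exp (- s))"
  assume eq: "dag s x = strong_scale ?c x"
  show "tdense (?T s)"
  proof (rule td_mono[OF measD(5)[OF x]], rule subsetI)
   fix v assume "v : Domain x"
   then obtain z where z: "(v, z) : x" by blast
   from strong_scale_mem[OF x z, of ?c] have "(ph (- s) v, ph (- s) (?c *c z)) : x"
    by (simp add: eq[symmetric] dual_action_graph_iff)
   thus "v : ?T s" using z
    by (intro CollectI exI[of _ "ph (- s) (?c *c z)"] exI[of _ z] conjI) (simp_all add: phase_phase scaleC_of_real)
  qed
 next
  assume td: "tdense (?T s)"
  show "dag s x = strong_scale (of_real (exp (- s))) x"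
  proof (rule meas_eqI[OF dual_action_graph_meas[OF x] meas_strong_scale[OF x] td], rule subsetI)
   fix v assume "v : ?T s"
   then obtain z0 z where z: "(ph (- s) v, z0) : x" "(v, z) : x" "ph s z0 = exp (- s) *r z" by blast
   have "(v, exp (- s) *r z) : dag s x" using dual_action_graph_mem[OF z(1), of s] by (simp add: phase_phase z(3))
   moreover have "(v, exp (- s) *r z) : strong_scale (of_real (exp (- s))) x"
    using strong_scale_mem[OF x z(2), of "of_real (exp (- s))"] by (simp only: scaleC_of_real)
   ultimately show "v : Domain (dag s x Int strong_scale (of_real (exp (- s))) x)" by blast
  qed
 qed
 thus ?thesis by (auto simp: haagerup_L1_def)
qed

text \<open>On the tau-dense sets of this criterion sums and multiples can be formed vector by
  vector, which makes \<open>L\<close> a vector space.\<close>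

lemma L_iff_chain:
 "a : L <-> a : meas & (ALL e : fin. ALL f : fin. ALL s. tdense (CS s e f a))"
proof -
 have "pairing e f a : haagerup_L1 M \<sigma> \<tau> <-> (ALL s. tdense (CS s e f a))"
  if a: "a : meas" and e: "e : fin" and f: "f : fin" for e f
 proof
  assume p: "pairing e f a : haagerup_L1 M \<sigma> \<tau>"
  show "ALL s. tdense (CS s e f a)"
  proof
   fix s
   let ?S = "{xi. EX z. chain e f a xi z}"
   let ?T = "{v. EX z0 z. (ph (- s) v, z0) : pairing e f a & (v, z) : pairing e f a & ph s z0 = exp (- s) *r z}"
   have "tdense (?T Int (?S Int ph s ` ?S))" using p by (intro td_Int td_phase td_chain[OF a e f]) (simp add: haagerup_L1_iff)
   thus "tdense (CS s e f a)"
   proof (rule td_mono, intro subsetI)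
    fix v assume "v : ?T Int (?S Int ph s ` ?S)"
    then obtain z0 z y y0 v0 where z: "(ph (- s) v, z0) : pairing e f a" "(v, z) : pairing e f a" "ph s z0 = exp (- s) *r z"
     "chain e f a v y" "v = ph s v0" "chain e f a v0 y0" by blast
    have v0: "ph (- s) v = v0" by (simp add: z(5) phase_phase)
    note sv = msv[OF pairing_meas[OF a e f]]
    have "y = z" "y0 = z0"
     using sv[OF chain_pairing[OF a e f z(4)] z(2)] sv[OF chain_pairing[OF a e f z(6)] z(1)[unfolded v0]] by auto
    thus "v : CS s e f a" using z v0 by auto
   qed
  qed
 next
  assume td: "ALL s. tdense (CS s e f a)"
  show "pairing e f a : haagerup_L1 M \<sigma> \<tau>" unfolding haagerup_L1_iff
  proof (intro conjI allI pairing_meas[OF a e f])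
   fix s
   show "tdense {v. EX z0 z. (ph (- s) v, z0) : pairing e f a & (v, z) : pairing e f a & ph s z0 = exp (- s) *r z}"
    by (rule td_mono[OF td[rule_format, of s]]) (use chain_pairing[OF a e f] in blast)
  qed
 qed
 thus ?thesis unfolding L_iff by blast
qed

lemma chain_sum:
 assumes a: "a : meas" and b: "b : meas" and e: "e : fin" and f: "f : fin" and c: "chain e f a xi z" "chain e f b xi z'"
 shows "chain e f (strong_sum a b) xi (z + z')"
proof -
 obtain x y where 1: "(xi, x) : W 1 f" "(x, y) : a" "(y, z) : adjg (W 1 e)" using c by (auto simp: chain_def)
 obtain x' y' where 2: "(xi, x') : W 1 f" "(x', y') : b" "(y', z') : adjg (W 1 e)" using c by (auto simp: chain_def)
 have "x' = x" by (rule msv[OF W1_meas[OF f] 2(1) 1(1)])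
 hence "(x, y + y') : strong_sum a b" using strong_sum_mem[OF a b 1(2)] 2(2) by simp
 thus ?thesis using 1(1) lg_add[OF measD(1)[OF W1_adj_meas[OF e]] 1(3) 2(3)] by (auto simp: chain_def)
qed

lemma chain_scale: assumes a: "a : meas" and e: "e : fin" and f: "f : fin" and c: "chain e f a xi z"
 shows "chain e f (strong_scale c a) xi (c *c z)"
proof -
 obtain x y where 1: "(xi, x) : W 1 f" "(x, y) : a" "(y, z) : adjg (W 1 e)" using c by (auto simp: chain_def)
 thus ?thesis
  using strong_scale_mem[OF a 1(2), of c] lg_scaleC[OF measD(1)[OF W1_adj_meas[OF e]] 1(3), of c] by (auto simp: chain_def)
qed

lemma L_zero: "op_graph (%v. 0) : L" unfolding L_iff_chain
proof (intro conjI ballI allI)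
 show m: "op_graph (%v. 0) : meas" by (rule op_graph_meas[OF zero_mem])
 fix e f s assume e: "e : fin" and f: "f : fin"
 have "chain e f (op_graph (%v. 0)) v 0" if "v : Domain (W 1 f)" for v
  using that lg_0[OF measD(1)[OF W1_adj_meas[OF e]]] by (auto simp: chain_def)
 note * = this
 have "tdense (Domain (W 1 f) Int ph s ` Domain (W 1 f))" by (intro td_Int td_phase measD(5)[OF W1_meas[OF f]])
 thus "tdense (CS s e f (op_graph (%v. 0)))"
 proof (rule td_mono, intro subsetI CollectI exI conjI)
  fix v assume "v : Domain (W 1 f) Int ph s ` Domain (W 1 f)"
  then obtain v0 where v0: "v : Domain (W 1 f)" "v0 : Domain (W 1 f)" "v = ph s v0" by blast
  show "chain e f (op_graph (%v. 0)) (ph (- s) v) 0" "chain e f (op_graph (%v. 0)) v 0"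
   using *[OF v0(1)] *[OF v0(2)] by (simp_all add: v0(3) phase_phase)
 qed (simp add: bo_zero[OF bo_phase])
qed

lemma L_strong_sum: assumes a: "a : L" and b: "b : L" shows "strong_sum a b : L" unfolding L_iff_chain
proof (intro conjI ballI allI)
 note am = L_meas[OF a] and bm = L_meas[OF b]
 show "strong_sum a b : meas" by (rule meas_strong_sum[OF am bm])
 fix e f s assume e: "e : fin" and f: "f : fin"
 have "tdense (CS s e f a Int CS s e f b)" using a b e f unfolding L_iff_chain by (intro td_Int) blast+
 thus "tdense (CS s e f (strong_sum a b))"
 proof (rule td_mono, intro subsetI)
  fix v assume "v : CS s e f a Int CS s e f b"
  then obtain z0 z y0 y where "chain e f a (ph (- s) v) z0" "chain e f a v z" "ph s z0 = exp (- s) *r z"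
   "chain e f b (ph (- s) v) y0" "chain e f b v y" "ph s y0 = exp (- s) *r y" by blast
  thus "v : CS s e f (strong_sum a b)" using chain_sum[OF am bm e f] bo_add[OF bo_phase, of s z0 y0]
   by (intro CollectI exI[of _ "z0 + y0"] exI[of _ "z + y"]) (simp add: scaleR_add_right)
 qed
qed

lemma L_strong_scale: assumes a: "a : L" shows "strong_scale c a : L" unfolding L_iff_chain
proof (intro conjI ballI allI)
 note am = L_meas[OF a]
 show "strong_scale c a : meas" by (rule meas_strong_scale[OF am])
 fix e f s assume e: "e : fin" and f: "f : fin"
 have "tdense (CS s e f a)" using a e f unfolding L_iff_chain by blast
 thus "tdense (CS s e f (strong_scale c a))"
 proof (rule td_mono, intro subsetI)
  fix v assume "v : CS s e f a"
  then obtain z0 z where "chain e f a (ph (- s) v) z0" "chain e f a v z" "ph s z0 = exp (- s) *r z" by blast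
  thus "v : CS s e f (strong_scale c a)" using chain_scale[OF am e f] bo_scaleC[OF bo_phase, of s c z0]
   by (intro CollectI exI[of _ "c *c z0"] exI[of _ "c *c z"]) (simp add: scaleC_scaleR)
 qed
qed

text \<open>The product \<open>w(h)\<^sup>1\<^sup>/\<^sup>2 a w(h)\<^sup>1\<^sup>/\<^sup>2\<close> scales like \<open>h\<close>, so the dual action moves \<open>a\<close> by the bounded
  function \<open>w(h) / (e\<^sup>s w(e\<^sup>-\<^sup>s h))\<close>. Since \<open>w(h)\<^sup>1\<^sup>/\<^sup>2\<pi>(f)\<close> has dense range only jointly over all \<open>f\<close>, it is
  cancelled one side at a time.\<close>

lemma dual_action_L: assumes a: "a : L" shows "dag s a = DaD s a"
proof -
 note am = L_meas[OF a]
 define c where "c = exp (- s)"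
 have c0: "c > 0" by (simp add: c_def)
 define d where "d = strong_diff (dag s a) (DaD s a)"
 note m1 = dual_action_graph_meas[OF am] and m2 = DaD_meas[OF am]
 have dm: "d : meas" unfolding d_def by (rule meas_strong_diff[OF m1 m2])
 \<comment> \<open>The scaling of the pairing says that \<open>d\<close>, placed between
   \<open>W c f\<close> and the adjoint of \<open>W c e\<close>, vanishes on a tau-dense
   set.\<close>
 have A1: "tdense {xi. EX x v. (xi, x) : W c f & (x, v) : d & v : (Range (W c e))\<bottom>}" if e: "e : fin" and f: "f : fin" for e f
 proof -
  have "tdense (CS s e f a)" using a e f by (simp add: L_iff_chain)
  thus ?thesis
  proof (rule td_mono, intro subsetI)
   fix xi assume "xi : CS s e f a"
   then obtain z0 z where ch: "chain e f a (ph (- s) xi) z0" "chain e f a xi z" and zz: "ph s z0 = c *r z" by (auto simp: c_def)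
   obtain x0 y0 where 0: "(ph (- s) xi, x0) : W 1 f" "(x0, y0) : a" "(y0, z0) : adjg (W 1 e)"
    using ch(1) by (auto simp: chain_def)
   obtain x y where 1: "(xi, x) : W 1 f" "(x, y) : a" "(y, z) : adjg (W 1 e)" using ch(2) by (auto simp: chain_def)
   define x' where "x' = ph s x0"
   have xc: "(xi, x') : W c f" using W_phase[OF f, of s "ph (- s) xi" x0] 0(1) by (simp add: x'_def c_def phase_phase)
   have xx: "x = exp (s / 2) *r D s x'" by (rule msv[OF W1_meas[OF f] 1(1) W_scale[OF f xc[unfolded c_def]]])
   have "((of_real (exp (- s / 2))) *c x, (of_real (exp (- s / 2))) *c y) : a" by (rule lg_scaleC[OF measD(1)[OF am] 1(2)])
   hence "(D s x', exp (- s / 2) *r y) : a" by (simp only: scaleC_of_real xx scaleR_scaleR) (simp flip: exp_add)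
   from DaD_mem[OF am this] have b2: "(x', D s (exp (- s / 2) *r y)) : DaD s a" .
   have b1: "(x', ph s y0) : dag s a" unfolding x'_def by (rule dual_action_graph_mem[OF 0(2)])
   define v where "v = ph s y0 - D s (exp (- s / 2) *r y)"
   have vd: "(x', v) : d" unfolding d_def v_def by (rule strong_diff_mem[OF m1 m2 b1 b2])
   have "inner r v = 0" if r: "(et, r) : W c e" for et r
   proof -
    have "(ph (- s) et, ph (- s) r) : W 1 e"
     using W_phase[OF e, of s "ph (- s) et" "ph (- s) r"] r by (simp add: phase_phase c_def)
    from adj_graph_inner[OF 0(3) this] have "inner (ph (- s) r) y0 = inner (ph (- s) et) z0" .
    hence i1: "inner r (ph s y0) = c * inner et z" using zz by (simp add: inner_phase)
    from adj_graph_inner[OF 1(3) W_scale[OF e r[unfolded c_def]]]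
    have i2: "exp (s / 2) * inner r (D s y) = inner et z" by (simp add: D_sym)
    have e2: "exp (- s / 2) = c * exp (s / 2)" by (simp add: c_def flip: exp_add)
    show ?thesis unfolding v_def inner_diff_right i1 i2[symmetric] e2 bo_scaleR[OF bounded[OF D_mem]] inner_scaleR_right by simp
   qed
   hence "v : (Range (W c e))\<bottom>" by (auto simp: perp_iff inner_commute)
   thus "xi : {xi. EX x v. (xi, x) : W c f & (x, v) : d & v : (Range (W c e))\<bottom>}" using xc vd by blast
  qed
 qed
 have Wc: "W c f : meas" if "f : fin" for f by (rule W_meas[OF c0 that])
 have red: "reducing ((Range T)\<bottom>)" if "T : meas" for T using red_Range_perp measD[OF that] by blast
 have tot: "y = 0" if "!!f. f : fin ==> Range (W c f) <= {y}\<bottom>" for y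
 proof (rule comp_pi_total[OF sqrt_growth_sw[OF c0]])
  show "inner y z = 0" if "f : fin" "(x, z) : W c f" for f x z
   using `!!f. f : fin ==> Range (W c f) <= {y}\<bottom>`[OF that(1)] that(2) by (force simp: perp_iff inner_commute)
 qed
 \<comment> \<open>The left factor is cancelled: \<open>v\<close> is orthogonal to the ranges of
   \<open>W c e\<close> for all \<open>e\<close>, and these are jointly total.\<close>
 have A2: "v = 0" if f: "f : fin" and xv: "(xi, x) : W c f" "(x, v) : d" for f xi x v
 proof (rule tot)
  fix e assume e: "e : fin"
  have "Range (strong_prod d (W c f)) <= (Range (W c e))\<bottom>"
  proof (rule Range_subset_reducing[OF meas_strong_prod[OF dm Wc[OF f]] red[OF Wc[OF e]] A1[OF e f]])
   fix xi assume "xi : {xi. EX x v. (xi, x) : W c f & (x, v) : d & v : (Range (W c e))\<bottom>}"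
   thus "EX v : (Range (W c e))\<bottom>. (xi, v) : strong_prod d (W c f)" using strong_prod_mem[OF dm Wc[OF f]] by blast
  qed
  hence "v : (Range (W c e))\<bottom>" using strong_prod_mem[OF dm Wc[OF f] xv] by blast
  thus "Range (W c e) <= {v}\<bottom>" by (intro subsetI) (simp add: perp_iff inner_commute)
 qed
 \<comment> \<open>The right factor is cancelled by the same totality, with the adjoint of
   \<open>d\<close> in place of \<open>d\<close>.\<close>
 have A3: "z = 0" if z: "(y, z) : adjg d" for y z
 proof (rule tot)
  fix f assume f: "f : fin"
  have "Range (W c f) <= (Range (adjg d))\<bottom>"
  proof (rule Range_subset_reducing[OF Wc[OF f] red[OF meas_adj[OF dm]] td_pullback[OF Wc[OF f] measD(5)[OF dm]]])
   fix xi assume "xi : {v. EX x : Domain d. (v, x) : W c f}"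
   then obtain x v where xv: "(xi, x) : W c f" "(x, v) : d" by blast
   have "inner x z = 0" if "(y, z) : adjg d" for y z using adj_graph_inner[OF that xv(2)] A2[OF f xv] by simp
   hence "x : (Range (adjg d))\<bottom>" by (auto simp: perp_iff)
   thus "EX v : (Range (adjg d))\<bottom>. (xi, v) : W c f" using xv by blast
  qed
  thus "Range (W c f) <= {z}\<bottom>" using z by (fastforce simp: perp_iff)
 qed
 have A4: "v = 0" if "(x, v) : d" for x v
 proof -
  have "inner v y = 0" if "y : Domain (adjg d)" for y using that A3 adj_graph_inner[OF _ `(x, v) : d`] by fastforce
  hence "v : (Domain (adjg d))\<bottom>" by (auto simp: perp_iff)
  hence "v : UNIV\<bottom>" using meas_dense[OF meas_adj[OF dm]] perp_closure[of "Domain (adjg d)"] by simp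
  thus ?thesis unfolding perp_iff by (metis UNIV_I inner_eq_zero_iff)
 qed
 show ?thesis
 proof (rule meas_eqI[OF m1 m2 td_Int[OF measD(5)[OF m1] measD(5)[OF m2]]], rule subsetI)
  fix x assume "x : Domain (dag s a) Int Domain (DaD s a)"
  then obtain y z where yz: "(x, y) : dag s a" "(x, z) : DaD s a" by blast
  have "y - z = 0" by (rule A4) (use strong_diff_mem[OF m1 m2 yz] in "simp add: d_def")
  thus "x : Domain (dag s a Int DaD s a)" using yz by auto
 qed
qed

lemma L_scaling: assumes a: "a : L" "a : nbhd ep dl" and ep: "ep > 0"
 shows "a : nbhd (q / kap * ep) (dl / q)"
proof -
 note am = L_meas[OF a(1)]
 \<comment> \<open>With \<open>exp (- s) = q\<close> the growth of \<open>w\<close> bounds the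
   square of \<open>D s\<close> by \<open>q / kap\<close>, and the inverse phase divides
   codimensions by \<open>q\<close>.\<close>
 define s where "s = - ln q"
 have q0: "q > 0" using q(1) by simp
 have es: "exp (- s) = q" "exp s = 1 / q" using q0 by (simp_all add: s_def exp_minus inverse_eq_divide)
 obtain K where K: "reducing K" "K <= Domain a" "!!v w. v : K ==> (v, w) : a ==> norm w <= ep * norm v"
  "codim K <= ennreal dl" using nbhdE[OF a(2) ep] by metis
 define K' where "K' = D s -` K"
 have K': "reducing K'" "codim K' <= ennreal dl"
  unfolding K'_def using red_vimage[OF K(1) D_mem] order_trans[OF codim_vimage[OF K(1) D_mem] K(4)] by auto
 have bd: "norm (D s v) <= sqrt (q / kap) * norm v" for v
 proof (rule S.I_bounded_operator(2)[OF ratio_meas])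
  fix u
  show "cmod (ratio s u) <= sqrt (q / kap)"
  proof (cases "u > 0")
   case True
   have p: "w u > 0" "w (q * u) > 0" using True q0 w_pos by simp_all
   have "kap * w u <= w (q * u)" by (rule q(3)[OF True])
   hence "w u / (1 / q * w (q * u)) <= q / kap" using p q0 q(2) by (simp add: field_simps)
   thus ?thesis using True p q0 by (simp add: ratio_def es)
  qed (use q0 q(2) in "simp add: ratio_def")
 qed
 show ?thesis unfolding nbhd_iff[OF mult_pos_pos[OF divide_pos_pos[OF q0 order.strict_trans[OF zero_less_one q(2)]] ep]]
 proof (intro conjI exI[of _ "ph (- s) ` K'"] am red_phase K')
  have ex: "EX y. (ph (- s) v, ph (- s) (D s y)) : a & norm (D s y) <= q / kap * ep * norm v" if v: "v : K'" for v
  proof -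
   obtain y where y: "(D s v, y) : a" using v K(2) by (auto simp: K'_def)
   have "(v, D s y) : dag s a" unfolding dual_action_L[OF a(1)] by (rule DaD_mem[OF am y])
   hence 1: "(ph (- s) v, ph (- s) (D s y)) : a" by (simp add: dual_action_graph_iff)
   have "norm y <= ep * (sqrt (q / kap) * norm v)"
    using K(3)[OF _ y] v mult_left_mono[OF bd[of v] less_imp_le[OF ep]] by (auto simp: K'_def)
   hence "norm (D s y) <= sqrt (q / kap) * (ep * (sqrt (q / kap) * norm v))"
    by (intro order_trans[OF bd] mult_left_mono) (use q0 q(2) in auto)
   also have "... = (sqrt (q / kap) * sqrt (q / kap)) * (ep * norm v)" by (simp only: ac_simps)
   also have "sqrt (q / kap) * sqrt (q / kap) = q / kap" using q0 q(2) by simp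
   also have "q / kap * (ep * norm v) = q / kap * ep * norm v" by simp
   finally show ?thesis using 1 by blast
  qed
  show "ph (- s) ` K' <= Domain a" using ex by blast
  show "ALL v w. v : ph (- s) ` K' --> (v, w) : a --> norm w <= q / kap * ep * norm v"
  proof (intro allI impI)
   fix v w assume v: "v : ph (- s) ` K'" and vw: "(v, w) : a"
   then obtain v' where v': "v' : K'" "v = ph (- s) v'" by blast
   obtain y where y: "(v, ph (- s) (D s y)) : a" "norm (D s y) <= q / kap * ep * norm v'" using ex[OF v'(1)] v'(2) by blast
   thus "norm w <= q / kap * ep * norm v" using msv[OF am vw y(1)] v'(2) by (simp add: norm_phase)
  qed
  have "codim (ph (- s) ` K') <= ennreal (1 / q) * ennreal dl"
   using codim_phase[OF K'(1), of "- s"] mult_left_mono[OF K'(2), of "ennreal (1 / q)"] by (simp add: es)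
  thus "codim (ph (- s) ` K') <= ennreal (dl / q)" using q0 by (simp flip: ennreal_mult')
 qed
qed

end

section \<open>Convex combinations of a scaling family\<close>

lemma sum_geometric_le:
 fixes r :: real assumes "finite S" "inj_on f S" "0 <= r" "r < 1" shows "(SUM i : S. r ^ f i) <= 1 / (1 - r)"
proof -
 have "(SUM i : S. r ^ f i) = (SUM i : f ` S. r ^ i)" using assms(2) by (simp add: sum.reindex)
 also have "... <= (\<Sum>i. r ^ i)" by (rule sum_le_suminf) (use assms in "auto intro: summable_geometric")
 finally show ?thesis using assms by (simp add: suminf_geometric)
qed

text \<open>A Schur test for the kernel \<open>R\<^sup>2\<^sup>m\<^sup>i\<^sup>n\<^sup>(\<^sup>k\<^sup>,\<^sup>l\<^sup>)\<close>, which is \<open>R\<^sup>k R\<^sup>l R\<^sup>-\<^sup>|\<^sup>k\<^sup>-\<^sup>l\<^sup>|\<close>.\<close>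

lemma schur_test:
 fixes R :: real assumes R: "R > 1" and x: "!!k. x k >= 0" and y: "!!l. y l >= 0"
 shows "(SUM k<=n. SUM l<=n. (R^2) ^ min k l * (x k * y l)) <=
  1 / (1 - 1 / R) * ((SUM k<=n. (R^2) ^ k * (x k)^2) + (SUM l<=n. (R^2) ^ l * (y l)^2))"
proof -
 define r where "r = 1 / R"
 have r: "0 <= r" "r < 1" using R by (simp_all add: r_def)
 define d where "d k l = (k - l) + (l - k)" for k l :: nat
 define X where "X k = (R ^ k * x k)^2" for k
 define Y where "Y k = (R ^ k * y k)^2" for k
 define c where "c = 1 / (1 - r)"
 have le: "(R^2) ^ min k l * (x k * y l) <= r ^ d k l * (1/2 * (X k + Y l))" for k l
 proof -
  have "r ^ i * R ^ i = 1" for i using R by (simp add: r_def flip: power_mult_distrib)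
  moreover have "(R^2) ^ i = R ^ i * R ^ i" for i by (simp add: power2_eq_square power_mult_distrib)
  ultimately have "(R^2) ^ min k l = r ^ d k l * (R ^ k * R ^ l)"
  proof (cases "k <= l")
   case True
   hence "l = k + (l - k)" by simp
   hence "R ^ l = R ^ k * R ^ (l - k)" by (metis power_add)
   thus ?thesis using True `!!i. r ^ i * R ^ i = 1`[of "l - k"] `!!i. (R^2) ^ i = R ^ i * R ^ i`
    by (simp add: d_def min_absorb1 ac_simps)
  next
   case False
   hence "k = l + (k - l)" by simp
   hence "R ^ k = R ^ l * R ^ (k - l)" by (metis power_add)
   thus ?thesis using False `!!i. r ^ i * R ^ i = 1`[of "k - l"] `!!i. (R^2) ^ i = R ^ i * R ^ i`
    by (simp add: d_def min_absorb2 ac_simps)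
  qed
  hence "(R^2) ^ min k l * (x k * y l) = r ^ d k l * ((R ^ k * x k) * (R ^ l * y l))" by simp
  also have "... <= r ^ d k l * (1/2 * (X k + Y l))"
   using sum_squares_bound[of "R ^ k * x k" "R ^ l * y l"] r by (intro mult_left_mono) (simp_all add: X_def Y_def)
  finally show ?thesis .
 qed
 \<comment> \<open>Two geometric series, one on each side of the diagonal.\<close>
 have row: "(SUM l<=n. r ^ d k l) <= 2 * c" for k
 proof -
  have "(SUM l<=n. r ^ d k l) <= (SUM l : {..n} Int {..k}. r ^ (k - l)) + (SUM l : {..n} Int {k..}. r ^ (l - k))"
  proof -
   have "{..n} = ({..n} Int {..k}) Un ({..n} Int {k..})" by auto
   hence "(SUM l<=n. r ^ d k l) <= (SUM l : {..n} Int {..k}. r ^ d k l) + (SUM l : {..n} Int {k..}. r ^ d k l)"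
    using sum.union_inter[of "{..n} Int {..k}" "{..n} Int {k..}" "%l. r ^ d k l"]
     sum_nonneg[of "({..n} Int {..k}) Int ({..n} Int {k..})" "%l. r ^ d k l"] r by (metis (no_types, lifting) add.commute finite_Int finite_atMost le_add_same_cancel2 zero_le_power)
   also have "(SUM l : {..n} Int {..k}. r ^ d k l) = (SUM l : {..n} Int {..k}. r ^ (k - l))" by (rule sum.cong) (auto simp: d_def)
   also have "(SUM l : {..n} Int {k..}. r ^ d k l) = (SUM l : {..n} Int {k..}. r ^ (l - k))" by (rule sum.cong) (auto simp: d_def)
   finally show ?thesis .
  qed
  also have "... <= c + c" unfolding c_def by (intro add_mono sum_geometric_le r) (auto simp: inj_on_def)
  finally show ?thesis by simp
 qed
 have rowm: "(SUM l<=n. 1/2 * s * r ^ d k l) <= c * s" if "0 <= s" for s k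
  unfolding sum_distrib_left[symmetric] using mult_left_mono[OF row[of k], of "1/2 * s"] that by (simp add: mult.commute)
 have sym: "d k l = d l k" for k l by (simp add: d_def)
 have "(SUM k<=n. SUM l<=n. (R^2) ^ min k l * (x k * y l)) <= (SUM k<=n. SUM l<=n. r ^ d k l * (1/2 * (X k + Y l)))"
  by (intro sum_mono le)
 also have "... = (SUM k<=n. SUM l<=n. 1/2 * X k * r ^ d k l) + (SUM k<=n. SUM l<=n. 1/2 * Y l * r ^ d k l)"
  by (simp add: sum.distrib[symmetric] add_divide_distrib algebra_simps)
 also have "(SUM k<=n. SUM l<=n. 1/2 * Y l * r ^ d k l) = (SUM l<=n. SUM k<=n. 1/2 * Y l * r ^ d l k)"
  by (subst sum.swap) (simp add: sym)
 also have "(SUM k<=n. SUM l<=n. 1/2 * X k * r ^ d k l) <= (SUM k<=n. c * X k)" by (intro sum_mono rowm) (simp add: X_def)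
 also have "(SUM l<=n. SUM k<=n. 1/2 * Y l * r ^ d l k) <= (SUM k<=n. c * Y k)" by (intro sum_mono rowm) (simp add: Y_def)
 finally have *: "(SUM k<=n. SUM l<=n. (R^2) ^ min k l * (x k * y l)) <= (SUM k<=n. c * X k) + (SUM k<=n. c * Y k)" by simp
 have "X k = (R^2) ^ k * (x k)^2" "Y k = (R^2) ^ k * (y k)^2" for k
  by (simp_all add: X_def Y_def power_mult_distrib power_mult[symmetric] mult.commute)
 thus ?thesis using * by (simp add: c_def r_def sum_divide_distrib add_divide_distrib)
qed

context tracial
begin

lemma codim_UNIV [simp]: "codim UNIV = 0"
proof -
 have "(UNIV :: 'h set)\<bottom> = {0}" unfolding perp_iff set_eq_iff by (metis UNIV_I inner_eq_zero_iff inner_zero_left singleton_iff)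
 thus ?thesis by simp
qed

lemma codim_finite_INT: assumes "finite J" "!!j. j : J ==> reducing (P j)"
 shows "reducing (INT j : J. P j) & codim (INT j : J. P j) <= (SUM j : J. codim (P j))" using assms
proof (induction J rule: finite_induct)
 case empty thus ?case by (simp add: red_UNIV)
next
 case (insert j J)
 hence "codim (P j Int (INT j : J. P j)) <= codim (P j) + codim (INT j : J. P j)" by (intro codim_Int) auto
 thus ?case using insert by (auto intro: red_Int order_trans[OF _ add_left_mono])
qed

lemma pos_part_sum: assumes "finite J" "!!j. j : J ==> x j : pos_part A"
 shows "(%v. SUM j : J. x j v) : pos_part A & \<tau> (%v. SUM j : J. x j v) = (SUM j : J. \<tau> (x j))" using assms
proof (induction J rule: finite_induct)
 case empty thus ?case by (simp add: zero_pos_part)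
next
 case (insert j J) thus ?case using tau_plus[of "x j"] pos_part_plus[of "x j"] by simp
qed

text \<open>Intersecting all later terms makes the subspaces increasing; summing the geometric
  series of their codimensions costs the factor \<open>q / (q - 1)\<close>.\<close>

lemma chain_of_reducing: assumes K: "!!l. reducing (K l)" "!!l::nat. codim (K l) <= ennreal ((1 / q) ^ l)" and q: "q > 1"
 defines "P == %l. INT m. K (l + m)"
 shows "reducing (P l)" "P l <= P (Suc l)" "P l <= K l" "codim (P l) <= ennreal (q / (q - 1) * (1 / q) ^ l)"
proof -
 show "reducing (P l)" unfolding P_def by (rule red_INT) (rule K(1))
 show "P l <= P (Suc l)"
 proof
  fix v assume v: "v : P l"
  have "v : K (Suc l + m)" for m using v unfolding P_def by (metis INT_E UNIV_I add_Suc_shift)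
  thus "v : P (Suc l)" by (simp add: P_def)
 qed
 show "P l <= K l" unfolding P_def using INT_lower[of 0 UNIV "%m. K (l + m)"] by simp
 have "codim (P l) <= (\<Sum>m. codim (K (l + m)))" unfolding P_def by (rule codim_INT) (rule K(1))
 also have "... <= (\<Sum>m. ennreal ((1 / q) ^ l * (1 / q) ^ m))"
  using K(2)[of "l + _"] by (intro suminf_le) (auto simp: power_add)
 also have "... = ennreal (\<Sum>m. (1 / q) ^ l * (1 / q) ^ m)"
  using q by (intro suminf_ennreal2) (auto intro!: summable_mult summable_geometric)
 also have "(\<Sum>m. (1 / q) ^ l * (1 / q) ^ m) = (1 / q) ^ l * (1 / (1 - 1 / q))"
  using q by (subst suminf_mult) (auto simp: suminf_geometric summable_geometric)
 also have "... = q / (q - 1) * (1 / q) ^ l" using q by (simp add: field_simps)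
 finally show "codim (P l) <= ennreal (q / (q - 1) * (1 / q) ^ l)" .
qed

definition layer :: "(nat => 'h set) => nat => 'h set" where "layer P l = (if l = 0 then P 0 else P l Int (P (l - 1))\<bottom>)"

text \<open>Layer 0 is left out, since it may have infinite dimension; its contribution, of weight
  1, is bounded by the square of the norm instead. Each later layer lies in the complement of some
  \<open>P l\<close>.\<close>

definition layer_op :: "real => (nat => 'h set) => nat => 'h operator"
 where "layer_op Q P n v = (SUM l<n. Q ^ Suc l *r oproj (layer P (Suc l)) v)"

context
 fixes P :: "nat => 'h set" and q Q :: real assumes P: "!!l. reducing (P l)" "!!l. P l <= P (Suc l)"
  and codim_P: "!!l. codim (P l) <= ennreal (q / (q - 1) * (1 / q) ^ l)" and q: "q > 1" "0 <= Q" "Q < q"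
begin

lemma red_layer: "reducing (layer P l)" and layer_subset: "layer P l <= P l"
 unfolding layer_def using P(1) by (auto intro: red_Int red_perp)

lemma oproj_layers: "oproj (P n) v = (SUM l<=n. oproj (layer P l) v)"
proof (induction n)
 case (Suc n) thus ?case using oproj_split[OF P(1)[of n] P(1)[of "Suc n"] P(2)] by (simp add: layer_def)
qed (simp add: layer_def)

lemma layer_op_pos_part: "layer_op Q P n : pos_part A"
 and tau_layer_op: "\<tau> (layer_op Q P n) <= ennreal (q * Q / (q - 1) / (1 - Q / q))"
proof -
 have p: "(%v. Q ^ Suc l *r oproj (layer P (Suc l)) v) : pos_part A" for l
  by (rule pos_part_scale[OF oproj_pos_part[OF red_layer]]) (use q in simp)
 have s: "layer_op Q P n : pos_part A & \<tau> (layer_op Q P n) = (SUM l<n. \<tau> (%v. Q ^ Suc l *r oproj (layer P (Suc l)) v))"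
  unfolding layer_op_def[abs_def] by (rule pos_part_sum) (use p in auto)
 thus "layer_op Q P n : pos_part A" ..
 let ?C = "q * Q / (q - 1)"
 have "\<tau> (%v. Q ^ Suc l *r oproj (layer P (Suc l)) v) <= ennreal (?C * (Q / q) ^ l)" for l
 proof -
  have "dim (layer P (Suc l)) <= codim (P l)" by (rule dim_mono[OF red_layer red_perp[OF P(1)]]) (simp add: layer_def)
  hence d: "dim (layer P (Suc l)) <= ennreal (q / (q - 1) * (1 / q) ^ l)" using codim_P by (rule order_trans)
  have "\<tau> (%v. Q ^ Suc l *r oproj (layer P (Suc l)) v) = ennreal (Q ^ Suc l) * dim (layer P (Suc l))"
   unfolding dim_def by (rule tau_scale[OF oproj_pos_part[OF red_layer]]) (use q in simp)
  also have "... <= ennreal (Q ^ Suc l) * ennreal (q / (q - 1) * (1 / q) ^ l)" by (rule mult_left_mono[OF d]) simp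
  also have "... = ennreal (Q ^ Suc l * (q / (q - 1) * (1 / q) ^ l))" using q by (intro ennreal_mult'[symmetric]) simp
  also have "Q ^ Suc l * (q / (q - 1) * (1 / q) ^ l) = ?C * (Q / q) ^ l" by (simp add: power_divide)
  finally show ?thesis .
 qed
 hence "\<tau> (layer_op Q P n) <= (SUM l<n. ennreal (?C * (Q / q) ^ l))" unfolding conjunct2[OF s] by (rule sum_mono)
 also have "... = ennreal (SUM l<n. ?C * (Q / q) ^ l)" using q by (intro sum_ennreal) simp
 also have "(SUM l<n. ?C * (Q / q) ^ l) <= ?C * (1 / (1 - Q / q))"
  unfolding sum_distrib_left[symmetric] using sum_geometric_le[of "{..<n}" "%i. i" "Q / q"] q by (intro mult_left_mono) auto
 finally show "\<tau> (layer_op Q P n) <= ennreal (?C / (1 - Q / q))" by (simp add: ennreal_leI)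
qed

lemma sum_layers_le: "(SUM l<=n. Q ^ l * (norm (oproj (layer P l) v))^2) <= (norm v)^2 + inner v (layer_op Q P n v)"
proof -
 have "(SUM l<=n. Q ^ l * (norm (oproj (layer P l) v))^2) = (norm (oproj (layer P 0) v))^2 + (SUM l<n. Q ^ Suc l * (norm (oproj (layer P (Suc l)) v))^2)"
  by (simp add: sum.atMost_shift)
 also have "(norm (oproj (layer P 0) v))^2 <= (norm v)^2"
  using norm_oproj_le[OF redD(1,3)[OF red_layer]] by (intro power_mono) auto
 also have "(SUM l<n. Q ^ Suc l * (norm (oproj (layer P (Suc l)) v))^2) = inner v (layer_op Q P n v)"
  unfolding layer_op_def inner_sum_right inner_scaleR_right
  using inner_oproj_self[OF redD(1,3)[OF red_layer], of "Suc _" v] by (simp add: inner_commute)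
 finally show ?thesis by simp
qed

end

text \<open>The right chain \<open>P\<close> bounds \<open>a\<close> on vectors, the left chain
  \<open>P'\<close> bounds its matrix coefficients. The second bound admits every \<open>v\<close>
  in the domain, so that for a pair of layers the smaller of the two indices can be used.\<close>

definition chains :: "real => real => 'h graph => (nat => 'h set) => (nat => 'h set) => bool" where "chains Q q a P P' <->
  (ALL l. reducing (P l) & P l <= P (Suc l) & codim (P l) <= ennreal (q / (q - 1) * (1 / q) ^ l)) &
  (ALL l. reducing (P' l) & P' l <= P' (Suc l) & codim (P' l) <= ennreal (q / (q - 1) * (1 / q) ^ l)) &
  (ALL l. P l <= Domain a) & (ALL l v w. v : P l --> (v, w) : a --> norm w <= Q ^ l * norm v) &
  (ALL l u v w. u : P' l --> (v, w) : a --> cmod (cinner u w) <= Q ^ l * (norm u * norm v))"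

lemma chainsD: assumes "chains Q q a P P'"
 shows "reducing (P l)" "P l <= P (Suc l)" "codim (P l) <= ennreal (q / (q - 1) * (1 / q) ^ l)"
  "reducing (P' l)" "P' l <= P' (Suc l)" "codim (P' l) <= ennreal (q / (q - 1) * (1 / q) ^ l)" "P l <= Domain a"
  "v : P l ==> (v, w) : a ==> norm w <= Q ^ l * norm v"
  "u : P' l ==> (v, w) : a ==> cmod (cinner u w) <= Q ^ l * (norm u * norm v)" using assms unfolding chains_def by blast+

text \<open>The left chain comes from \<open>adjoint_cut\<close>: for \<open>u\<close> in
  \<open>N l\<close> the coefficient of \<open>u\<close> with \<open>a v\<close> only sees the part
  of \<open>v\<close> in \<open>K l\<close>, where \<open>a\<close> is bounded by
  \<open>Q^l\<close>.\<close>

lemma scaling_chains: assumes a: "!!l::nat. a : nbhd (Q ^ l) ((1 / q) ^ l)" and q: "q > 1" "Q > 0"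
 shows "EX P P'. chains Q q a P P'"
proof -
 have am: "a : meas" by (rule nbhd_meas[OF a])
 note a' = measD[OF am]
 have "EX K. reducing K & K <= Domain a & (ALL v w. v : K --> (v, w) : a --> norm w <= Q ^ l * norm v) & codim K <= ennreal ((1 / q) ^ l)" for l
  using a[of l] nbhd_iff[of "Q ^ l" a "(1 / q) ^ l"] q by simp
 then obtain K where K: "!!l. reducing (K l)" "!!l. K l <= Domain a"
  "!!l v w. v : K l ==> (v, w) : a ==> norm w <= Q ^ l * norm v" "!!l. codim (K l) <= ennreal ((1 / q) ^ l)" by metis
 have "EX N. reducing N & codim N <= codim (K l) & (ALL u v w. u : N --> (v, w) : a --> inner u w = inner u (gop a (oproj (K l) v)))" for l
  using adjoint_cut[OF a'(1,3,2,4) K(1,2)] by metis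
 then obtain N where N: "!!l. reducing (N l)" "!!l. codim (N l) <= codim (K l)"
  "!!l u v w. u : N l ==> (v, w) : a ==> inner u w = inner u (gop a (oproj (K l) v))" by metis
 have Nb: "cmod (cinner u w) <= Q ^ l * (norm u * norm v)" if u: "u : N l" and vw: "(v, w) : a" for l u v w
 proof -
  note K' = redD[OF K(1)[of l]]
  let ?g = "gop a (oproj (K l) v)"
  have pv: "oproj (K l) v : K l" by (rule oproj_mem[OF K'(1,3)])
  have "\<i> *c u : N l" by (rule csubspace_scaleC[OF redD(2)[OF N(1)] u])
  hence "cinner u w = cinner u ?g" using N(3)[OF _ vw] u by (intro cinner_eqI) auto
  also have "cmod ... <= norm u * norm ?g" by (rule norm_cinner_le)
  also have "norm ?g <= Q ^ l * norm (oproj (K l) v)" using K(3)[OF pv a'(6)] pv K(2) by blast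
  also have "... <= Q ^ l * norm v" using norm_oproj_le[OF K'(1,3)] q by (intro mult_left_mono) auto
  finally show ?thesis by (simp add: mult.left_commute mult_left_mono)
 qed
 have cN: "codim (N l) <= ennreal ((1 / q) ^ l)" for l using N(2) K(4) by (rule order_trans)
 note cK = chain_of_reducing[of K, OF K(1,4) q(1)] and cN = chain_of_reducing[of N, OF N(1) cN q(1)]
 have h: "(INT m. K (l + m)) <= Domain a" for l using cK(3)[of l] K(2)[of l] by (rule order_trans)
 have h': "norm w <= Q ^ l * norm v" if "v : (INT m. K (l + m))" "(v, w) : a" for l v w
  by (rule K(3)[OF subsetD[OF cK(3) that(1)] that(2)])
 have h'': "cmod (cinner u w) <= Q ^ l * (norm u * norm v)" if "u : (INT m. N (l + m))" "(v, w) : a" for l u v w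
  by (rule Nb[OF subsetD[OF cN(3) that(1)] that(2)])
 have "chains Q q a (%l. INT m. K (l + m)) (%l. INT m. N (l + m))"
  unfolding chains_def by (intro conjI allI impI) (rule cK(1,2,4) cN(1,2,4) h | erule (1) h' | erule (1) h'')+
 thus ?thesis by blast
qed

text \<open>Both vectors are expanded in layers. A coefficient between layers \<open>k\<close> and
  \<open>l\<close> is estimated by the left chain if \<open>k <= l\<close> and by the right chain
  otherwise, so that the smaller exponent always wins and the Schur test applies.\<close>

lemma chains_schur: assumes ch: "chains (R^2) q a P P'" and a: "a : meas" and R: "R > 1" "R^2 < q"
  and v: "v : P n" "(v, w) : a" and u: "u : P' n"
 shows "cmod (cinner u w) <= 1 / (1 - 1 / R) *
  ((norm u)^2 + inner u (layer_op (R^2) P' n u) + ((norm v)^2 + inner v (layer_op (R^2) P n v)))"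
proof -
 note P = chainsD(1-3,7,8)[OF ch] and P' = chainsD(4-6,9)[OF ch]
 have q: "q > 1" "0 <= R^2" using R by (auto intro: order.strict_trans[OF one_less_power[of R 2]])
 note PP = P(1-3) q(1,2) R(2) and PP' = P'(1-3) q(1,2) R(2)
 note lP = red_layer[OF PP] layer_subset[OF PP] and lP' = red_layer[OF PP'] layer_subset[OF PP']
 define x where "x l = oproj (layer P l) v" for l
 define y where "y k = oproj (layer P' k) u" for k
 have xm: "x l : P l" for l using oproj_mem[OF redD(1,3)[OF lP(1)]] lP(2) by (auto simp: x_def)
 have ym: "y k : P' k" for k using oproj_mem[OF redD(1,3)[OF lP'(1)]] lP'(2) by (auto simp: y_def)
 have vs: "v = (SUM l<=n. x l)" using oproj_layers[OF PP, of n v] oproj_id[OF redD(1,3)[OF P(1)] v(1)] by (simp add: x_def)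
 have us: "u = (SUM k<=n. y k)" using oproj_layers[OF PP', of n u] oproj_id[OF redD(1,3)[OF P'(1)] u] by (simp add: y_def)
 define z where "z l = gop a (x l)" for l
 have z: "(x l, z l) : a" for l unfolding z_def by (rule measD(6)[OF a]) (use xm P(4) in blast)
 have "((SUM l : S. x l), (SUM l : S. z l)) : a" if "finite S" for S
  using that by (induction S rule: finite_induct) (auto intro: lg_0[OF measD(1)[OF a]] lg_add[OF measD(1)[OF a]] z)
 hence ws: "w = (SUM l<=n. z l)" using msv[OF a v(2)] by (simp add: vs)
 have b: "cmod (cinner (y k) (z l)) <= (R^2) ^ min k l * (norm (y k) * norm (x l))" for k l
 proof (cases "k <= l")
  case True
  thus ?thesis using P'(4)[OF ym z, of k l] by (simp add: min_absorb1)
 next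
  case False
  have "cmod (cinner (y k) (z l)) <= norm (y k) * norm (z l)" by (rule norm_cinner_le)
  also have "... <= norm (y k) * ((R^2) ^ l * norm (x l))" using P(5)[OF xm z] by (intro mult_left_mono) auto
  finally show ?thesis using False by (simp add: min_absorb2 ac_simps)
 qed
 have sl: "cinner (SUM k : S. y k) s = (SUM k : S. cinner (y k) s)" if "finite S" for S s
  using that by (induction S rule: finite_induct) (auto simp: cinner_add_left)
 have sr: "cinner s (SUM l : S. z l) = (SUM l : S. cinner s (z l))" if "finite S" for S s
  using that by (induction S rule: finite_induct) (auto simp: cinner_add_right)
 have "cinner u w = (SUM k<=n. SUM l<=n. cinner (y k) (z l))" unfolding ws by (subst us) (simp only: sl[OF finite_atMost], simp only: sr[OF finite_atMost])
 also have "cmod ... <= (SUM k<=n. SUM l<=n. (R^2) ^ min k l * (norm (y k) * norm (x l)))" by (intro sum_norm_le b)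
 also have "... <= 1 / (1 - 1 / R) * ((SUM k<=n. (R^2) ^ k * (norm (y k))^2) + (SUM l<=n. (R^2) ^ l * (norm (x l))^2))"
  by (rule schur_test[OF R(1)]) auto
 also have "... <= 1 / (1 - 1 / R) * ((norm u)^2 + inner u (layer_op (R^2) P' n u) + ((norm v)^2 + inner v (layer_op (R^2) P n v)))"
  unfolding x_def y_def using R by (intro mult_left_mono add_mono sum_layers_le[OF PP] sum_layers_le[OF PP']) auto
 finally show ?thesis .
qed

end

lemma ennreal_le_divide: assumes k: "k > 0" and le: "ennreal k * x <= ennreal c" shows "x <= ennreal (c / k)"
proof -
 have "ennreal (1 / k) * ennreal k = 1" using k by (subst ennreal_mult'[symmetric]) auto
 hence "x = ennreal (1 / k) * (ennreal k * x)" by (simp only: mult.assoc[symmetric] mult_1)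
 also have "... <= ennreal (1 / k) * ennreal c" by (rule mult_left_mono[OF le]) simp
 also have "... = ennreal (c / k)" using k by (subst ennreal_mult'[symmetric]) auto
 finally show ?thesis .
qed

section \<open>Boundedness of convex combinations\<close>

context tracial
begin

text \<open>Says that \<open>a\<close> is the strong sum of the listed multiples, in a form that
  involves a single tau-dense set rather than iterated closures.\<close>

definition combination :: "(complex \<times> 'h graph) list => 'h graph => bool" where "combination l a <->
  tdense {x. (ALL p : set l. x : Domain (snd p)) & (x, \<Sum>p\<leftarrow>l. fst p *c gop (snd p) x) : a}"

text \<open>The averaged layer operator has trace at most \<open>t K\<close> for every number
  \<open>m\<close> of summands and every \<open>n\<close>, so cutting it at \<open>8 K t\<close>
  costs codimension 1/8. The intersection of the \<open>P j n\<close> does depend on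
  \<open>m\<close>, but its codimension is pushed down to 1/8 by taking \<open>n\<close>
  large.\<close>

lemma weight_cut_sum:
 fixes P :: "nat => nat => 'h set" assumes P: "!!j l. j < m ==> reducing (P j l)" "!!j l. j < m ==> P j l <= P j (Suc l)"
  "!!j l. j < m ==> codim (P j l) <= ennreal (q / (q - 1) * (1 / q) ^ l)" and q: "q > 1" "0 < Q" "Q < q"
  and n: "real m * (q / (q - 1) * (1 / q) ^ n) <= 1 / 8"
  and c: "!!j. 0 <= c j" "(SUM j<m. c j) <= t" "t > 0" and K_def: "K = q * Q / (q - 1) / (1 - Q / q)"
 shows "EX F. reducing F & codim F <= ennreal (1 / 4) & (ALL j<m. F <= P j n) &
  (ALL v : F. (SUM j<m. c j * inner v (layer_op Q (P j) n v)) <= 8 * K * t * (norm v)^2)"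
proof -
 have K0: "K > 0" using q by (simp add: K_def)
 define X where "X v = (SUM j<m. c j *r layer_op Q (P j) n v)" for v
 have p: "(%v. c j *r layer_op Q (P j) n v) : pos_part A" if "j < m" for j
  by (rule pos_part_scale[OF layer_op_pos_part[OF P[OF that] q(1) less_imp_le[OF q(2)] q(3)] c(1)])
 have X: "X : pos_part A & \<tau> X = (SUM j<m. \<tau> (%v. c j *r layer_op Q (P j) n v))"
  unfolding X_def[abs_def] by (rule pos_part_sum) (use p in auto)
 have "\<tau> (%v. c j *r layer_op Q (P j) n v) <= ennreal (c j * K)" if "j < m" for j
 proof -
  have "\<tau> (%v. c j *r layer_op Q (P j) n v) = ennreal (c j) * \<tau> (layer_op Q (P j) n)"
   by (rule tau_scale[OF layer_op_pos_part[OF P[OF that] q(1) less_imp_le[OF q(2)] q(3)] c(1)])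
  also have "... <= ennreal (c j) * ennreal K"
   unfolding K_def by (intro mult_left_mono tau_layer_op[OF P[OF that] q(1) less_imp_le[OF q(2)] q(3)]) simp
  also have "... = ennreal (c j * K)" using c(1) by (simp add: ennreal_mult')
  finally show ?thesis .
 qed
 hence "\<tau> X <= (SUM j<m. ennreal (c j * K))" unfolding conjunct2[OF X] by (intro sum_mono) auto
 also have "... = ennreal (SUM j<m. c j * K)" using c(1) K0 by (intro sum_ennreal) simp
 also have "... <= ennreal (t * K)" using c(2) K0 by (intro ennreal_leI) (simp add: sum_distrib_right[symmetric] mult_right_mono)
 finally have tX: "\<tau> X <= ennreal (t * K)" .
 have k: "8 * K * t > 0" using K0 c(3) by simp
 obtain L where L: "reducing L" "!!v. v : L ==> inner v (X v) <= 8 * K * t * (norm v)^2" "ennreal (8 * K * t) * codim L <= \<tau> X"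
  using weight_cut[OF conjunct1[OF X] k] by metis
 have "codim L <= ennreal (t * K / (8 * K * t))" by (rule ennreal_le_divide[OF k order_trans[OF L(3) tX]])
 also have "t * K / (8 * K * t) = 1 / 8" using K0 c(3) by simp
 finally have cL: "codim L <= ennreal (1 / 8)" .
 define G where "G = (INT j : {..<m}. P j n)"
 have G: "reducing G & codim G <= (SUM j<m. codim (P j n))" unfolding G_def by (rule codim_finite_INT) (use P(1) in auto)
 have "(SUM j<m. codim (P j n)) <= (SUM j<m. ennreal (q / (q - 1) * (1 / q) ^ n))" by (intro sum_mono P(3)) simp
 also have "... = ennreal (SUM j<m. q / (q - 1) * (1 / q) ^ n)" using q by (intro sum_ennreal) simp
 also have "... <= ennreal (1 / 8)" using n by (intro ennreal_leI) simp
 finally have cG: "codim G <= ennreal (1 / 8)" using G order_trans by blast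
 have "codim (G Int L) <= ennreal (1 / 8) + ennreal (1 / 8)" using codim_Int[of G L] G L(1) cG cL by (meson add_mono order_trans)
 also have "... = ennreal (1 / 4)" by (simp flip: ennreal_plus)
 finally have "codim (G Int L) <= ennreal (1 / 4)" .
 thus ?thesis using red_Int[OF conjunct1[OF G] L(1)] L(2) by (intro exI[of _ "G Int L"]) (auto simp: G_def X_def inner_sum_right)
qed

text \<open>The Schur bound concerns coefficients with \<open>u\<close> in \<open>F'\<close> and
  \<open>v\<close> in \<open>F\<close>. To bound \<open>a v\<close> itself, \<open>v\<close> is
  restricted further so that \<open>a v\<close> lies in \<open>F'\<close>, and \<open>u\<close> is
  taken proportional to it.\<close>

lemma combination_nbhd: assumes l: "!!p i. p : set l ==> snd p : nbhd ((R^2) ^ i) ((1 / q) ^ i)" and R: "R > 1" "R^2 < q"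
  and a: "a : meas" "combination l a" and t: "t > 0" "(\<Sum>p\<leftarrow>l. cmod (fst p)) <= t"
  and K_def: "K = q * R^2 / (q - 1) / (1 - R^2 / q)"
 shows "a : nbhd (2 / (1 - 1 / R) * (1 + 8 * K) * t) 1"
proof -
 have q: "q > 1" "0 < R^2" using R by (auto intro: order.strict_trans[OF one_less_power[of R 2]])
 define m where "m = length l"
 define c where "c j = fst (l ! j)" for j
 define b where "b j = snd (l ! j)" for j
 have bn: "b j : nbhd ((R^2) ^ i) ((1 / q) ^ i)" if "j < m" for i j using l that by (simp add: b_def m_def)
 have bm: "b j : meas" if "j < m" for j by (rule nbhd_meas[OF bn[OF that]])
 have "ALL j. EX P P'. j < m --> chains (R^2) q (b j) P P'" using scaling_chains[OF bn q] by blast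
 then obtain P P' where ch: "!!j. j < m ==> chains (R^2) q (b j) (P j) (P' j)" by metis
 note P = chainsD[OF ch]
 have cs: "(SUM j<m. cmod (c j)) <= t" using t(2) unfolding m_def c_def by (simp add: sum_list_sum_nth atLeast0LessThan)
 have "(%n. real m * (q / (q - 1) * (1 / q) ^ n)) ----> real m * (q / (q - 1) * 0)"
  using q by (intro tendsto_intros LIMSEQ_power_zero) auto
 hence "\<forall>\<^sub>F n in sequentially. real m * (q / (q - 1) * (1 / q) ^ n) < 1 / 8" by (rule order_tendstoD) simp
 then obtain n where n: "real m * (q / (q - 1) * (1 / q) ^ n) <= 1 / 8" by (auto simp: eventually_sequentially intro: less_imp_le)
 obtain F where F: "reducing F" "codim F <= ennreal (1 / 4)" "!!j. j < m ==> F <= P j n"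
  "!!v. v : F ==> (SUM j<m. cmod (c j) * inner v (layer_op (R^2) (P j) n v)) <= 8 * K * t * (norm v)^2"
  using weight_cut_sum[of m P q "R^2" n "%j. cmod (c j)" t K, OF P(1-3) q R(2) n norm_ge_zero cs t(1) K_def] by blast
 obtain F' where F': "reducing F'" "codim F' <= ennreal (1 / 4)" "!!j. j < m ==> F' <= P' j n"
  "!!v. v : F' ==> (SUM j<m. cmod (c j) * inner v (layer_op (R^2) (P' j) n v)) <= 8 * K * t * (norm v)^2"
  using weight_cut_sum[of m P' q "R^2" n "%j. cmod (c j)" t K, OF P(4-6) q R(2) n norm_ge_zero cs t(1) K_def] by blast
 define M where "M = 1 / (1 - 1 / R)"
 have M0: "M > 0" using R by (simp add: M_def)
 define B where "B = 2 * M * (1 + 8 * K) * t"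
 have K0: "K > 0" using q R by (simp add: K_def)
 have B0: "B > 0" using M0 K0 t by (simp add: B_def)
 have bound: "cmod (cinner u (SUM j<m. c j *c y j)) <= B / 2 * ((norm u)^2 + (norm v)^2)"
  if u: "u : F'" and v: "v : F" and y: "!!j. j < m ==> (v, y j) : b j" for u v y
 proof -
  have "cinner u (SUM j : S. c j *c y j) = (SUM j : S. c j * cinner u (y j))" if "finite S" for S
   using that by (induction S rule: finite_induct) (auto simp: cinner_add_right cinner_scaleC_right)
  hence "cmod (cinner u (SUM j<m. c j *c y j)) = cmod (SUM j<m. c j * cinner u (y j))" by simp
  also have "... <= (SUM j<m. cmod (c j) * (M * ((norm u)^2 + inner u (layer_op (R^2) (P' j) n u) + ((norm v)^2 + inner v (layer_op (R^2) (P j) n v)))))"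
  proof (rule sum_norm_le)
   fix j assume "j : {..<m}"
   hence j: "j < m" by simp
   show "cmod (c j * cinner u (y j)) <= cmod (c j) * (M * ((norm u)^2 + inner u (layer_op (R^2) (P' j) n u) + ((norm v)^2 + inner v (layer_op (R^2) (P j) n v))))"
    unfolding norm_mult M_def
    by (rule mult_left_mono[OF chains_schur[OF ch[OF j] bm[OF j] R _ y[OF j]]]) (use F(3)[OF j] F'(3)[OF j] u v in auto)
  qed
  also have "... = M * ((SUM j<m. cmod (c j)) * ((norm u)^2 + (norm v)^2) + (SUM j<m. cmod (c j) * inner u (layer_op (R^2) (P' j) n u)) + (SUM j<m. cmod (c j) * inner v (layer_op (R^2) (P j) n v)))"
   by (simp add: sum_distrib_left sum_distrib_right sum.distrib algebra_simps)
  also have "... <= M * (t * ((norm u)^2 + (norm v)^2) + 8 * K * t * (norm u)^2 + 8 * K * t * (norm v)^2)"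
   using F(4)[OF v] F'(4)[OF u] cs M0 by (intro mult_left_mono add_mono mult_right_mono) auto
  also have "... = B / 2 * ((norm u)^2 + (norm v)^2)" by (simp add: B_def field_simps)
  finally show ?thesis .
 qed
 obtain Ka where Ka: "reducing Ka" "Ka <= Domain a" "codim Ka <= ennreal (1 / 8)"
  using tdD[OF measD(5)[OF a(1)], of "1 / 8"] by auto
 \<comment> \<open>A bounded restriction of \<open>a\<close>, along which \<open>F'\<close> can be
   pulled back without increasing its codimension.\<close>
 define b0 where "b0 = gop a o oproj Ka"
 have b0: "b0 : A" unfolding b0_def by (rule bounded_on_reducing) (use measD[OF a(1)] Ka in auto)
 define V where "V = b0 -` F'"
 have V: "reducing V" "codim V <= ennreal (1 / 4)"
  unfolding V_def using red_vimage[OF F'(1) b0] order_trans[OF codim_vimage[OF F'(1) b0] F'(2)] by auto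
 show ?thesis
 \<comment> \<open>The codimensions 1/4, 1/8 and 1/4 add up to 5/8, which leaves room below 1 for
   the tau-dense set.\<close>
 proof (rule nbhdI[OF a(1) a(2)[unfolded combination_def], where K="F Int (Ka Int V)" and c="5 / 8"])
  show "reducing (F Int (Ka Int V))" by (intro red_Int F(1) Ka(1) V(1))
  have "codim (Ka Int V) <= codim Ka + codim V" by (rule codim_Int[OF Ka(1) V(1)])
  also have "... <= ennreal (1/8) + ennreal (1/4)" by (intro add_mono Ka V)
  finally have "codim (F Int (Ka Int V)) <= ennreal (1/4) + (ennreal (1/8) + ennreal (1/4))"
   using codim_Int[OF F(1) red_Int[OF Ka(1) V(1)]] F(2) by (meson add_mono order_trans)
  also have "... = ennreal (5/8)" by (simp flip: ennreal_plus)
  finally show "codim (F Int (Ka Int V)) <= ennreal (5 / 8)" .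
  show "2 / (1 - 1 / R) * (1 + 8 * K) * t > 0" using B0 by (simp add: B_def M_def)
  fix v assume v: "v : F Int (Ka Int V)"
   and "v : {x. (ALL p : set l. x : Domain (snd p)) & (x, \<Sum>p\<leftarrow>l. fst p *c gop (snd p) x) : a}"
  hence vl: "!!p. p : set l ==> v : Domain (snd p)" "(v, \<Sum>p\<leftarrow>l. fst p *c gop (snd p) v) : a" by auto
  define w where "w = (\<Sum>p\<leftarrow>l. fst p *c gop (snd p) v)"
  have ws: "w = (SUM j<m. c j *c gop (b j) v)" unfolding w_def m_def c_def b_def by (simp add: sum_list_sum_nth atLeast0LessThan)
  have y: "(v, gop (b j) v) : b j" if "j < m" for j by (rule measD(6)[OF bm[OF that]]) (use vl(1) that in "simp add: b_def m_def")
  have "oproj Ka v = v" using oproj_id[OF redD(1,3)[OF Ka(1)]] v by blast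
  hence "b0 v = w" using measD(7)[OF a(1) vl(2)] by (simp add: b0_def w_def)
  hence wF: "w : F'" using v by (simp add: V_def)
  \<comment> \<open>The choice \<open>u = w / B\<close> makes the two terms of the bound comparable,
    and the term with \<open>w\<close> is absorbed.\<close>
  have "of_real (1 / B) *c w : F'" by (rule csubspace_scaleC[OF redD(2)[OF F'(1)] wF])
  from bound[OF this _ y] have "1 / B * (norm w)^2 <= B / 2 * ((1 / B * norm w)^2 + (norm v)^2)"
   using v B0 by (simp add: ws[symmetric] cinner_scaleC_left cinner_self norm_mult norm_scaleC norm_divide norm_power)
  hence "(norm w)^2 <= (B * norm v)^2" using B0 by (simp add: field_simps power2_eq_square)
  hence "norm w <= B * norm v" by (rule power2_le_imp_le) (use B0 in simp)
  thus "EX w. (v, w) : a & norm w <= 2 / (1 - 1 / R) * (1 + 8 * K) * t * norm v" using vl(2) by (auto simp: B_def M_def w_def)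
 qed simp_all
qed

end

text \<open>What the construction of the norm draws from the crossed product: a vector space of
  measurable operators with the scaling inclusion.\<close>

locale scaling_space = tracial A \<tau> for A :: "'h::complex_hilbert operator set" and \<tau> +
 fixes L :: "'h graph set" and R q :: real assumes L_meas: "L <= measurable_operators A \<tau>" and zero: "op_graph (%v. 0) : L"
  and sum: "a : L ==> b : L ==> strong_sum a b : L" and scale: "a : L ==> strong_scale c a : L" and R: "R > 1" "R^2 < q"
  and scaling: "a : L ==> a : measure_nbhd A \<tau> ep dl ==> ep > 0 ==> a : measure_nbhd A \<tau> (R^2 * ep) (dl / q)"
begin

lemma Lm: "a : L ==> a : meas" using L_meas by blast

lemma diff: "a : L ==> b : L ==> strong_diff a b : L" by (simp add: strong_diff_def sum scale)

lemma q_gt: "q > 1" "q > 0" "R^2 > 0"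
proof -
 have "1 < R^2" using R(1) by (simp add: one_less_power)
 with R(2) show "q > 1" "q > 0" "R^2 > 0" by linarith+
qed

lemma scaling_iterate: assumes "a : L" "a : nbhd ep dl" "ep > 0" shows "a : nbhd (ep * (R^2) ^ i) (dl * (1 / q) ^ i)"
proof (induction i)
 case (Suc i)
 have "a : nbhd (R^2 * (ep * (R^2) ^ i)) (dl * (1 / q) ^ i / q)" by (rule scaling[OF assms(1) Suc]) (use assms(3) q_gt in simp)
 thus ?case by (simp add: ac_simps)
qed (use assms in simp)

text \<open>Iterated scaling trades size for codimension, so on \<open>L\<close> the neighbourhoods
  with second parameter 1 already form a base at 0.\<close>

lemma scaling_base: assumes "ep > 0" "dl > 0"
 obtains r where "r > 0" "!!a. a : L ==> a : nbhd r 1 ==> a : nbhd ep dl"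
proof -
 obtain n where n: "(1 / q) ^ n < dl" using real_arch_pow_inv[of dl "1 / q"] q_gt assms by auto
 define r where "r = ep / (R^2) ^ n"
 have r: "r > 0" using q_gt assms by (simp add: r_def)
 have "a : nbhd ep dl" if "a : L" "a : nbhd r 1" for a
 proof -
  have "a : nbhd ep ((1 / q) ^ n)" using scaling_iterate[OF that r, of n] q_gt by (simp add: r_def)
  thus ?thesis using measure_nbhd_mono[of ep ep "(1 / q) ^ n" dl A \<tau>] n by auto
 qed
 with r show thesis by (rule that)
qed

section \<open>The Minkowski functional\<close>

definition unit_lists :: "(complex \<times> 'h graph) list set"
 where "unit_lists = {l. ALL p : set l. snd p : L & snd p : nbhd 1 1}"

abbreviation size_list :: "(complex \<times> 'h graph) list => real" where "size_list l == \<Sum>p\<leftarrow>l. cmod (fst p)"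

text \<open>An infimum over explicit representations instead of dilates of a hull: the triangle
  inequality is then concatenation of lists, and homogeneity acts on the coefficients.\<close>

definition N :: "'h graph => real" where "N a = Inf {size_list l | l. l : unit_lists & combination l a}"

lemma size_nonneg: "size_list l >= 0" by (induction l) auto

lemma N_le: "l : unit_lists ==> combination l a ==> N a <= size_list l"
 unfolding N_def by (rule cInf_lower) (auto intro!: bdd_belowI[of _ 0] size_nonneg)

lemma nbhd_strong_scale:
 assumes a: "a : nbhd ep dl" and pos: "ep > 0" "ep' > 0" and c: "cmod c * ep <= ep'" shows "strong_scale c a : nbhd ep' dl"
proof -
 note am = nbhd_meas[OF a]
 obtain K where K: "reducing K" "K <= Domain a" "!!v w. v : K ==> (v, w) : a ==> norm w <= ep * norm v" "codim K <= ennreal dl"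
  using nbhdE[OF a pos(1)] by metis
 have m: "(v, c *c gop a v) : strong_scale c a" "norm (c *c gop a v) <= ep' * norm v" if v: "v : K" for v
 proof -
  have g: "(v, gop a v) : a" using measD(6)[OF am] v K(2) by blast
  thus "(v, c *c gop a v) : strong_scale c a" by (rule strong_scale_mem[OF am])
  have "norm (c *c gop a v) <= cmod c * (ep * norm v)" unfolding norm_scaleC by (intro mult_left_mono K(3)[OF v g]) simp
  also have "... <= ep' * norm v" using mult_right_mono[OF c norm_ge_zero[of v]] by (simp add: mult.assoc)
  finally show "norm (c *c gop a v) <= ep' * norm v" .
 qed
 note sm = meas_strong_scale[OF am, of c]
 have "norm w <= ep' * norm v" if "v : K" "(v, w) : strong_scale c a" for v w using m[OF that(1)] msv[OF sm that(2)] by blast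
 thus ?thesis unfolding nbhd_iff[OF pos(2)] using sm K(1,4) m(1) by blast
qed

lemma ex_unit_list: assumes a: "a : L" "a : nbhd r 1" and r: "r > 0"
 shows "[(of_real r, strong_scale (of_real (1 / r)) a)] : unit_lists" "combination [(of_real r, strong_scale (of_real (1 / r)) a)] a"
proof -
 note am = Lm[OF a(1)]
 let ?b = "strong_scale (of_real (1 / r)) a"
 show "[(of_real r, ?b)] : unit_lists"
  using scale[OF a(1)] nbhd_strong_scale[OF a(2) r zero_less_one, of "of_real (1 / r)"] r by (simp add: unit_lists_def norm_divide)
 show "combination [(of_real r, ?b)] a" unfolding combination_def
 proof (rule td_mono[OF measD(5)[OF am]], rule subsetI)
  fix x assume "x : Domain a"
  then obtain y where y: "(x, y) : a" by blast
  have b: "(x, of_real (1 / r) *c y) : ?b" by (rule strong_scale_mem[OF am y])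
  hence "of_real r *c gop ?b x = y" using measD(7)[OF meas_strong_scale[OF am] b] r by (simp add: scaleC_scaleC flip: of_real_mult)
  thus "x : {x. (ALL p : set [(of_real r, ?b)]. x : Domain (snd p)) & (x, \<Sum>p\<leftarrow>[(of_real r, ?b)]. fst p *c gop (snd p) x) : a}"
   using b y by auto
 qed
qed

lemma N_le_nbhd: assumes "a : L" "a : nbhd r 1" "r > 0" shows "N a <= r" using N_le[OF ex_unit_list[OF assms]] assms(3) by simp

lemma ex_nbhd: assumes a: "a : L" obtains r where "r > 0" "a : nbhd r 1"
proof -
 note am = Lm[OF a]
 obtain K where K: "reducing K" "K <= Domain a" "codim K <= ennreal 1" using tdD[OF measD(5)[OF am], of 1] by auto
 have "gop a o oproj K : A" by (rule bounded_on_reducing) (use measD[OF am] K in auto)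
 then obtain B where B: "B > 0" "!!v. norm ((gop a o oproj K) v) <= B * norm v" using bo_bound[OF bounded] by blast
 have "norm w <= B * norm v" if "v : K" "(v, w) : a" for v w
  using B(2)[of v] measD(7)[OF am that(2)] oproj_id[OF redD(1,3)[OF K(1)] that(1)] by simp
 hence "a : nbhd B 1" unfolding nbhd_iff[OF B(1)] using am K by blast
 with B(1) show thesis by (rule that)
qed

lemma N_nonempty: assumes "a : L" shows "EX l. l : unit_lists & combination l a"
 using ex_unit_list[OF assms] ex_nbhd[OF assms] by metis

lemma N_nonneg: assumes "a : L" shows "0 <= N a"
 unfolding N_def by (rule cInf_greatest) (use N_nonempty[OF assms] size_nonneg in auto)

lemma N_less: assumes "a : L" "N a < t" obtains l where "l : unit_lists" "combination l a" "size_list l < t"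
proof -
 have "{size_list l | l. l : unit_lists & combination l a} ~= {}" using N_nonempty[OF assms(1)] by blast
 from cInf_lessD[OF this assms(2)[unfolded N_def]] show thesis using that by blast
qed

text \<open>The bound of \<open>combination_nbhd\<close> depends on a representation through its
  size only, so it passes to the infimum.\<close>

lemma N_nbhd:
 obtains B where "B > 0" "!!a t. a : L ==> t > 0 ==> N a < t ==> a : nbhd (B * t) 1"
proof -
 define K where "K = q * R^2 / (q - 1) / (1 - R^2 / q)"
 define B where "B = 2 / (1 - 1 / R) * (1 + 8 * K)"
 have "K > 0" using q_gt R by (simp add: K_def)
 hence "B > 0" using R by (simp add: B_def)
 moreover have "a : nbhd (B * t) 1" if a: "a : L" and t: "t > 0" "N a < t" for a t
 proof -
  obtain l where l: "l : unit_lists" "combination l a" "size_list l < t" using N_less[OF a t(2)] by metis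
  have "snd p : nbhd ((R^2) ^ i) ((1 / q) ^ i)" if "p : set l" for p i
   using scaling_iterate[of "snd p" 1 1 i] l(1) that by (auto simp: unit_lists_def)
  from combination_nbhd[OF this R Lm[OF a] l(2) t(1) less_imp_le[OF l(3)] K_def] show ?thesis by (simp add: B_def)
 qed
 ultimately show thesis by (rule that)
qed

lemma N_zero: "N (op_graph (%v. 0)) = 0"
proof -
 have "N (op_graph (%v. 0)) <= size_list []" by (rule N_le) (auto simp: unit_lists_def combination_def td_UNIV)
 thus ?thesis using N_nonneg[OF zero] by simp
qed

lemma N_eq_0: assumes a: "a : L" "N a = 0" shows "a = op_graph (%v. 0)"
proof (rule nbhd_trivial[OF Lm[OF a(1)]])
 fix ep dl :: real assume "ep > 0" "dl > 0"
 then obtain r where r: "r > 0" "!!a. a : L ==> a : nbhd r 1 ==> a : nbhd ep dl" using scaling_base by metis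
 obtain B where B: "B > 0" "!!a t. a : L ==> t > 0 ==> N a < t ==> a : nbhd (B * t) 1" using N_nbhd by metis
 have "a : nbhd (B * (r / B)) 1" by (rule B(2)[OF a(1)]) (use r B a in auto)
 thus "a : nbhd ep dl" using r(2)[OF a(1)] B by simp
qed

lemma N_sum: assumes a: "a : L" and b: "b : L" shows "N (strong_sum a b) <= N a + N b"
proof (rule field_le_epsilon)
 fix e :: real assume e: "e > 0"
 obtain l where l: "l : unit_lists" "combination l a" "size_list l < N a + e / 2" using N_less[OF a, of "N a + e / 2"] e by auto
 obtain m where m: "m : unit_lists" "combination m b" "size_list m < N b + e / 2" using N_less[OF b, of "N b + e / 2"] e by auto
 have "combination (l @ m) (strong_sum a b)" unfolding combination_def
  by (rule td_mono[OF td_Int[OF l(2)[unfolded combination_def] m(2)[unfolded combination_def]]])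
   (auto intro!: strong_sum_mem[OF Lm[OF a] Lm[OF b]])
 moreover have "l @ m : unit_lists" using l m by (auto simp: unit_lists_def)
 ultimately have "N (strong_sum a b) <= size_list (l @ m)" by (intro N_le)
 thus "N (strong_sum a b) <= N a + N b + e" using l m by simp
qed

lemma scale_combination: assumes a: "a : L" and l: "l : unit_lists" "combination l a"
 shows "map (%p. (c * fst p, snd p)) l : unit_lists" "combination (map (%p. (c * fst p, snd p)) l) (strong_scale c a)"
  "size_list (map (%p. (c * fst p, snd p)) l) = cmod c * size_list l"
proof -
 let ?l = "map (%p. (c * fst p, snd p)) l"
 show "?l : unit_lists" using l by (auto simp: unit_lists_def)
 show "size_list ?l = cmod c * size_list l" by (induction l) (auto simp: norm_mult distrib_left)
 have "(\<Sum>p\<leftarrow>?l. fst p *c gop (snd p) x) = c *c (\<Sum>p\<leftarrow>l. fst p *c gop (snd p) x)" for x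
  by (induction l) (auto simp: scaleC_add_right scaleC_scaleC)
 thus "combination ?l (strong_scale c a)" unfolding combination_def
  by (intro td_mono[OF l(2)[unfolded combination_def]]) (auto intro!: strong_scale_mem[OF Lm[OF a]] simp del: map_map)
qed

lemma N_scale_le: assumes a: "a : L" shows "N (strong_scale c a) <= cmod c * N a"
proof (cases "c = 0")
 case True
 obtain l where "l : unit_lists" "combination l a" using N_nonempty[OF a] by blast
 from N_le[OF scale_combination(1,2)[OF a this, of c]] scale_combination(3)[OF a this, of c] True show ?thesis by simp
next
 case False
 show ?thesis
 proof (rule field_le_epsilon)
  fix e :: real assume e: "e > 0"
  have "N a < N a + e / cmod c" using e False by simp
  from N_less[OF a this] obtain l where l: "l : unit_lists" "combination l a" "size_list l < N a + e / cmod c" by metis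
  have "N (strong_scale c a) <= cmod c * size_list l"
   using N_le[OF scale_combination(1,2)[OF a l(1,2), of c]] scale_combination(3)[OF a l(1,2), of c] by simp
  also have "... <= cmod c * (N a + e / cmod c)" using l(3) by (intro mult_left_mono) auto
  also have "... = cmod c * N a + e" using False by (simp add: distrib_left)
  finally show "N (strong_scale c a) <= cmod c * N a + e" .
 qed
qed

lemma N_scale: assumes a: "a : L" shows "N (strong_scale c a) = cmod c * N a"
proof (cases "c = 0")
 case True
 thus ?thesis using N_scale_le[OF a, of c] N_nonneg[OF scale[OF a, of c]] by simp
next
 case False
 have "strong_scale (1 / c) (strong_scale c a) = a"
 proof (rule meas_eqI[OF _ Lm[OF a] measD(5)[OF Lm[OF a]]])
  show "strong_scale (1 / c) (strong_scale c a) : meas" by (intro Lm scale a)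
  show "Domain a <= Domain (strong_scale (1 / c) (strong_scale c a) Int a)"
  proof
   fix x assume "x : Domain a"
   then obtain y where y: "(x, y) : a" by blast
   have "(x, (1 / c) *c c *c y) : strong_scale (1 / c) (strong_scale c a)" by (intro strong_scale_mem Lm scale a y)
   thus "x : Domain (strong_scale (1 / c) (strong_scale c a) Int a)" using y False by (auto simp: scaleC_scaleC)
  qed
 qed
 hence "N a <= cmod (1 / c) * N (strong_scale c a)" using N_scale_le[OF scale[OF a, of c], of "1 / c"] by simp
 hence "cmod c * N a <= N (strong_scale c a)" using False by (simp add: norm_divide field_simps)
 thus ?thesis using N_scale_le[OF a, of c] by simp
qed

lemma strong_diff_self: assumes a: "a : meas" shows "strong_diff a a = op_graph (%v. 0)"
 by (rule meas_eqI[OF meas_strong_diff[OF a a] op_graph_meas[OF zero_mem] measD(5)[OF a]])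
  (use strong_diff_mem[OF a a] in fastforce)

lemma strong_diff_telescope: assumes a: "a : meas" and b: "b : meas" and c: "c : meas"
 shows "strong_sum (strong_diff a b) (strong_diff b c) = strong_diff a c"
proof (rule meas_eqI[OF meas_strong_sum[OF meas_strong_diff[OF a b] meas_strong_diff[OF b c]] meas_strong_diff[OF a c]
   td_Int[OF measD(5)[OF a] td_Int[OF measD(5)[OF b] measD(5)[OF c]]]], rule subsetI)
 fix x assume "x : Domain a Int (Domain b Int Domain c)"
 then obtain u v w where x: "(x, u) : a" "(x, v) : b" "(x, w) : c" by blast
 have "(x, (u - v) + (v - w)) : strong_sum (strong_diff a b) (strong_diff b c)"
  by (intro strong_sum_mem meas_strong_diff strong_diff_mem a b c x)
 moreover have "(x, u - w) : strong_diff a c" by (intro strong_diff_mem a c x)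
 ultimately show "x : Domain (strong_sum (strong_diff a b) (strong_diff b c) Int strong_diff a c)" by auto
qed

lemma openin_N:
 "openin (subtopology (measure_topology A \<tau>) L) U <->
  U <= L & (ALL a : U. EX r>0. ALL b : L. N (strong_diff b a) < r --> b : U)"
proof
 assume "openin (subtopology (measure_topology A \<tau>) L) U"
 then obtain S where S: "openin (measure_topology A \<tau>) S" "U = S Int L" by (auto simp: openin_subtopology)
 obtain B where B: "B > 0" "!!a t. a : L ==> t > 0 ==> N a < t ==> a : nbhd (B * t) 1" using N_nbhd by metis
 have "EX r>0. ALL b : L. N (strong_diff b a) < r --> b : U" if a: "a : U" for a
 proof -
  obtain ep dl where e: "ep > 0" "dl > 0" "!!b. b : meas ==> strong_diff b a : nbhd ep dl ==> b : S"
   using S a unfolding openin_measure_topology by blast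
  obtain r where r: "r > 0" "!!a. a : L ==> a : nbhd r 1 ==> a : nbhd ep dl" using scaling_base[OF e(1,2)] by metis
  have "b : U" if b: "b : L" "N (strong_diff b a) < r / B" for b
  proof -
   have d: "strong_diff b a : L" using diff b a S by blast
   have "strong_diff b a : nbhd (B * (r / B)) 1" by (rule B(2)[OF d _ b(2)]) (use r B in simp)
   hence "strong_diff b a : nbhd ep dl" using r(2)[OF d] B by simp
   thus ?thesis using e(3)[OF Lm[OF b(1)]] b(1) S by blast
  qed
  thus ?thesis using r B by (intro exI[of _ "r / B"]) auto
 qed
 thus "U <= L & (ALL a : U. EX r>0. ALL b : L. N (strong_diff b a) < r --> b : U)" using S by blast
next
 assume U: "U <= L & (ALL a : U. EX r>0. ALL b : L. N (strong_diff b a) < r --> b : U)"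
 \<comment> \<open>An open set of measurable operators that meets \<open>L\<close> in
   \<open>U\<close>: it collects the points \<open>b\<close>, inside or outside of \<open>L\<close>,
   with a neighbourhood whose part in \<open>L\<close> is contained in \<open>U\<close>. Halving
   both parameters shows that it is open.\<close>
 define S where "S = {b : meas. EX ep>0. EX dl>0. ALL c : L. strong_diff c b : nbhd ep dl --> c : U}"
 have "openin (measure_topology A \<tau>) S" unfolding openin_measure_topology
 proof (intro conjI ballI)
  show "S <= meas" by (auto simp: S_def)
  fix b assume "b : S"
  then obtain ep dl where b: "b : meas" "ep > 0" "dl > 0" "!!c. c : L ==> strong_diff c b : nbhd ep dl ==> c : U"
   by (auto simp: S_def)
  have "b' : S" if b': "b' : meas" "strong_diff b' b : nbhd (ep / 2) (dl / 2)" for b'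
  proof -
   have "c : U" if c: "c : L" "strong_diff c b' : nbhd (ep / 2) (dl / 2)" for c
   proof (rule b(4)[OF c(1)])
    show "strong_diff c b : nbhd ep dl"
     using nbhd_strong_sum[OF c(2) b'(2)] b(2,3) strong_diff_telescope[OF Lm[OF c(1)] b'(1) b(1)] by simp
   qed
   thus ?thesis using b b'(1) unfolding S_def by (intro CollectI conjI exI[of _ "ep / 2"] exI[of _ "dl / 2"]) auto
  qed
  thus "EX ep>0. EX dl>0. ALL b' : meas. strong_diff b' b : nbhd ep dl --> b' : S"
   using b(2,3) by (intro exI[of _ "ep / 2"] conjI exI[of _ "dl / 2"]) auto
 qed
 moreover have "U = S Int L"
 proof (intro equalityI subsetI IntI)
  fix a assume a: "a : U"
  thus aL: "a : L" using U by blast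
  obtain r where r: "r > 0" "!!b. b : L ==> N (strong_diff b a) < r ==> b : U" using U a by blast
  have "c : U" if c: "c : L" "strong_diff c a : nbhd (r / 2) 1" for c
   using N_le_nbhd[OF diff[OF c(1) aL] c(2)] r by (intro r(2)[OF c(1)]) auto
  thus "a : S" using Lm[OF aL] r(1) unfolding S_def by (intro CollectI conjI exI[of _ "r / 2"] exI[of _ 1]) auto
 next
  fix b assume "b : S Int L"
  then obtain ep dl where b: "b : L" "ep > 0" "dl > 0" "!!c. c : L ==> strong_diff c b : nbhd ep dl ==> c : U"
   by (auto simp: S_def)
  have "strong_diff b b : nbhd ep dl" unfolding strong_diff_self[OF Lm[OF b(1)]] nbhd_iff[OF b(2)]
   using op_graph_meas[OF zero_mem] b(2) by (intro conjI exI[of _ UNIV]) (auto simp: red_UNIV)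
  thus "b : U" by (rule b(4)[OF b(1)])
 qed
 ultimately show "openin (subtopology (measure_topology A \<tau>) L) U" unfolding openin_subtopology by blast
qed

theorem normable_measure_topology: "normable L (subtopology (measure_topology A \<tau>) L)" unfolding normable_def
 by (intro conjI ballI allI exI[of _ N] zero sum scale N_nonneg N_scale N_sum openin_N) (auto simp: N_zero dest: N_eq_0)

end

context crossed_growth
begin

theorem normable_L: "normable L (subtopology (measure_topology A \<tau>) L)"
proof -
 have "q / kap < q" using q(1,2) by (simp add: divide_less_eq)
 then obtain d where d: "1 <= d" "q / kap <= d" "d < q" using q(1) that[of "max 1 (q / kap)"] by auto
 \<comment> \<open>The midpoint of \<open>d\<close> and \<open>q\<close> is strictly above 1, even
   if \<open>d = 1\<close>, and strictly below \<open>q\<close>.\<close>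
 define r where "r = sqrt ((d + q) / 2)"
 have r2: "r^2 = (d + q) / 2" using d q(1) by (simp add: r_def)
 have dr: "1 < r^2" "d <= r^2" "r^2 < q" unfolding r2 using d(1,3) by simp_all
 have r: "1 < r^2" "q / kap <= r^2" "r^2 < q" by (rule dr(1), rule order_trans[OF d(2) dr(2)], rule dr(3))
 have "r > 1"
 proof (rule ccontr)
  assume "~ r > 1"
  moreover have "r >= 0" using d by (simp add: r_def)
  ultimately have "r^2 <= 1^2" by (intro power_mono) auto
  thus False using r(1) by simp
 qed
 interpret scaling_space A \<tau> L r q
 proof
  show "L <= meas" using L_meas by blast
  fix a ep dl assume a: "a : L" "a : nbhd ep dl" "ep > (0::real)"
  show "a : nbhd (r^2 * ep) (dl / q)"
   using L_scaling[OF a] measure_nbhd_mono[of "q / kap * ep" "r^2 * ep" "dl / q" "dl / q" A \<tau>] mult_right_mono[OF r(2), of ep] a(3) by auto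
 qed (use L_zero L_strong_sum L_strong_scale r `r > 1` in auto)
 show ?thesis by (rule normable_measure_topology)
qed

end

abbreviation (input) "oinv == orlicz_inv"

abbreviation (input) "oconj == orlicz_conj"

section \<open>Young functions and their fundamental functions\<close>

text \<open>The properties shared by an Orlicz function and its iterated conjugates. Convexity
  enters as \<open>Y(tht x) <= tht Y(x)\<close>, and everything is said through sublevels with real
  bounds, which avoids arithmetic with infinite values.\<close>

definition young :: "(real => ereal) => bool" where "young Y <-> (ALL x>=0. 0 <= Y x) &
  (ALL x>=0. ALL tht : {0..1}. ALL s. Y x <= ereal s --> Y (tht * x) <= ereal (tht * s)) &
  (EX x>0. EX s. Y x <= ereal s) & (EX x>0. EX s>0. ~ Y x <= ereal s)"

lemma youngD: assumes "young Y"
 shows "x >= 0 ==> 0 <= Y x" "x >= 0 ==> 0 <= tht ==> tht <= 1 ==> Y x <= ereal s ==> Y (tht * x) <= ereal (tht * s)"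
  "EX x>0. EX s. Y x <= ereal s" "EX x>0. EX s>0. ~ Y x <= ereal s" using assms by (auto simp: young_def)

lemma young_real: assumes "young Y" "x >= 0" "Y x ~= \<infinity>" obtains p where "Y x = ereal p" "p >= 0"
 using youngD(1)[OF assms(1,2)] assms(3) that by (cases "Y x") auto

lemma young_nonneg: "young Y ==> x >= 0 ==> Y x <= ereal s ==> s >= 0"
 using youngD(1)[of Y x] order_trans[of 0 "Y x" "ereal s"] by auto

lemma young_zero: assumes "young Y" shows "Y 0 = 0"
proof -
 obtain x s where "x > 0" "Y x <= ereal s" using youngD(3)[OF assms] by blast
 hence "Y (0 * x) <= ereal (0 * s)" by (intro youngD(2)[OF assms]) auto
 thus ?thesis using youngD(1)[OF assms, of 0] by (simp add: zero_ereal_def[symmetric])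
qed

lemma young_mono: assumes Y: "young Y" and xy: "0 <= x" "x <= y" shows "Y x <= Y y"
proof (cases "Y y = \<infinity>")
 case False
 obtain p where p: "Y y = ereal p" "p >= 0" using young_real[OF Y _ False] xy by auto
 show ?thesis
 proof (cases "y = 0")
  case F: False
  have "Y (x / y * y) <= ereal (x / y * p)" by (rule youngD(2)[OF Y]) (use xy F p in auto)
  also have "x / y * p <= p" using mult_right_mono[of "x / y" 1 p] p(2) xy F by simp
  finally show ?thesis using F p by simp
 qed (use xy in simp)
qed simp

lemma orlicz_function_young: assumes "orlicz_function \<psi>" shows "young \<psi>"
proof -
 have c: "\<psi> ((1 - t) * u + t * v) <= ereal (1 - t) * \<psi> u + ereal t * \<psi> v" if "u >= 0" "v >= 0" "t : {0..1}" for u v t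
  using assms that by (simp add: orlicz_function_def)
 have z: "\<psi> 0 = 0" and nn: "!!u. u >= 0 ==> 0 <= \<psi> u" using assms by (auto simp: orlicz_function_def)
 have "\<psi> (tht * x) <= ereal (tht * s)" if "x >= 0" "tht : {0..1}" "\<psi> x <= ereal s" for x tht s
 proof -
  have "\<psi> (tht * x) <= ereal tht * \<psi> x" using c[of 0 x tht] that z by simp
  also have "... <= ereal tht * ereal s" using that by (intro ereal_mult_left_mono) auto
  finally show ?thesis by simp
 qed
 moreover have "EX x>0. EX s. \<psi> x <= ereal s"
 proof -
  obtain u where "u > 0" "\<psi> u ~= \<infinity>" using assms by (auto simp: orlicz_function_def)
  moreover from this obtain r where "\<psi> u = ereal r" using nn[of u] by (cases "\<psi> u") auto
  ultimately show ?thesis by (intro exI[of _ u] exI[of _ r] conjI) auto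
 qed
 moreover have "EX x>0. EX s>0. ~ \<psi> x <= ereal s"
 proof -
  obtain u where u: "u > 0" "\<psi> u ~= 0" using assms by (auto simp: orlicz_function_def)
  hence "0 < \<psi> u" using nn[of u] by (simp add: order.strict_iff_order)
  then obtain s where "0 < ereal s" "ereal s < \<psi> u" using ereal_dense2 by blast
  thus ?thesis using u(1) by (intro exI[of _ u] conjI exI[of _ s]) auto
 qed
 ultimately show ?thesis using nn by (simp add: young_def)
qed

context
 fixes Y :: "real => ereal" assumes Y: "young Y"
begin

text \<open>Along a ray \<open>Y(x) / x\<close> increases, so a positive value at \<open>x1\<close>
  forces at least linear growth beyond.\<close>

lemma sublevel_bdd: "bdd_above {x. 0 <= x & Y x <= ereal s}"
proof -
 obtain x1 s1 where 1: "x1 > 0" "s1 > 0" "~ Y x1 <= ereal s1" using youngD(4)[OF Y] by blast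
 show ?thesis
 proof (rule bdd_aboveI[of _ "x1 * max 1 (s / s1)"], rule ccontr)
  fix x assume "x : {x. 0 <= x & Y x <= ereal s}" and n: "~ x <= x1 * max 1 (s / s1)"
  hence x: "0 <= x" "Y x <= ereal s" by auto
  have "x1 * 1 <= x1 * max 1 (s / s1)" "x1 * (s / s1) <= x1 * max 1 (s / s1)" using 1 by (intro mult_left_mono; simp)+
  hence le: "x1 <= x" "x1 * (s / s1) <= x" using n by auto
  have "Y (x1 / x * x) <= ereal (x1 / x * s)" by (rule youngD(2)[OF Y]) (use x le 1 in auto)
  also have "x1 / x * s <= s1" using le 1 by (simp add: field_simps)
  finally show False using 1 le by simp
 qed
qed

lemma le_inv: "x >= 0 ==> Y x <= ereal s ==> x <= oinv Y s" unfolding orlicz_inv_def by (intro cSup_upper sublevel_bdd) auto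

lemma less_inv: assumes "0 <= x" "x < oinv Y s" "s >= 0" shows "Y x <= ereal s"
proof -
 have "{x. 0 <= x & Y x <= ereal s} ~= {}" using young_zero[OF Y] assms(3) by (auto intro!: exI[of _ 0])
 from less_cSupE[OF assms(2)[unfolded orlicz_inv_def] this] obtain y where "x < y" "Y y <= ereal s" by blast
 thus ?thesis using young_mono[OF Y assms(1), of y] by (meson less_imp_le order_trans)
qed

lemma inv_pos: assumes s: "s > 0" shows "oinv Y s > 0"
proof -
 obtain x r where x: "x > 0" "Y x <= ereal r" using youngD(3)[OF Y] by blast
 have r: "r >= 0" by (rule young_nonneg[OF Y _ x(2)]) (use x in simp)
 define tht where "tht = min 1 (s / (r + 1))"
 have th: "0 < tht" "tht <= 1" "tht * r <= s"
 proof -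
  show "0 < tht" "tht <= 1" using s r by (auto simp: tht_def)
  have "tht * r <= s / (r + 1) * r" using r by (intro mult_right_mono) (auto simp: tht_def)
  also have "... <= s" using s r by (simp add: field_simps)
  finally show "tht * r <= s" .
 qed
 have "Y (tht * x) <= ereal (tht * r)" by (rule youngD(2)[OF Y]) (use x th in auto)
 also have "... <= ereal s" using th by simp
 finally have "tht * x <= oinv Y s" using x th by (intro le_inv) auto
 thus ?thesis using x th by (meson less_le_trans mult_pos_pos)
qed

lemma inv_le: assumes "0 <= s" "!!x. x >= 0 ==> Y x <= ereal s ==> x <= c" shows "oinv Y s <= c"
 unfolding orlicz_inv_def by (rule cSup_least) (use assms young_zero[OF Y] in "auto intro!: exI[of _ 0]")

lemma inv_mono: assumes "0 <= s" "s <= s'" shows "oinv Y s <= oinv Y s'"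
proof (rule inv_le[OF assms(1)])
 fix x :: real assume "x >= 0" "Y x <= ereal s"
 thus "x <= oinv Y s'" using assms(2) by (intro le_inv) (auto intro: order_trans)
qed

lemma inv_scale: assumes "0 < tht" "tht <= 1" "0 <= s" shows "tht * oinv Y s <= oinv Y (tht * s)"
proof -
 have "oinv Y s <= oinv Y (tht * s) / tht"
 proof (rule inv_le[OF assms(3)])
  fix x :: real assume x: "x >= 0" "Y x <= ereal s"
  have "tht * x <= oinv Y (tht * s)" by (intro le_inv youngD(2)[OF Y] x) (use x assms in auto)
  thus "x <= oinv Y (tht * s) / tht" using assms by (simp add: field_simps)
 qed
 thus ?thesis using assms by (simp add: field_simps)
qed

lemma conj_le_iff: "oconj Y u <= ereal c <-> (ALL v>0. ereal (u * v - c) <= Y v)"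
proof -
 have "ereal (u * v) - Y v <= ereal c <-> ereal (u * v - c) <= Y v" if "v > 0" for v
  using youngD(1)[OF Y, of v] that by (cases "Y v") auto
 thus ?thesis unfolding orlicz_conj_def by (auto simp: SUP_le_iff)
qed

lemma young_conj: "young (oconj Y)" unfolding young_def
proof (intro conjI allI impI ballI)
 fix x :: real assume x: "0 <= x"
 show "0 <= oconj Y x"
 proof (rule ccontr)
  assume "~ 0 <= oconj Y x"
  then obtain e where e: "oconj Y x < ereal e" "ereal e < 0" using ereal_dense2[of "oconj Y x" 0] by (auto simp: not_le)
  have *: "ereal (x * v - e) <= Y v" if "v > 0" for v using conj_le_iff[of x e] e(1) that by (auto simp: less_imp_le)
  \<comment> \<open>Near 0 the function \<open>Y\<close> drops to \<open>- e / 2\<close>, which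
    contradicts the affine minorant, whose value at 0 is \<open>- e > 0\<close>.\<close>
  have "0 < oinv Y (- e / 2)" using e(2) by (intro inv_pos) simp
  then obtain v where v: "0 < v" "v < oinv Y (- e / 2)" using dense by blast
  have "Y v <= ereal (- e / 2)" by (rule less_inv) (use v e in auto)
  hence "x * v - e <= - e / 2" using *[OF v(1)] by (meson ereal_less_eq(3) order_trans)
  moreover have "x * v >= 0" "e < 0" using x v e(2) by simp_all
  ultimately show False by linarith
 qed
next
 fix x tht s assume "(0::real) <= x" "tht : {0..1::real}" "oconj Y x <= ereal s"
 hence th: "0 <= tht" "tht <= 1" and *: "!!v. v > 0 ==> ereal (x * v - s) <= Y v" by (auto simp: conj_le_iff)
 show "oconj Y (tht * x) <= ereal (tht * s)" unfolding conj_le_iff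
 proof (intro allI impI)
  fix v :: real assume v: "v > 0"
  have "tht * x * v - tht * s = tht * (x * v - s)" by (simp add: algebra_simps)
  also have "... <= max 0 (x * v - s)" using th by (cases "x * v - s >= 0") (auto simp: mult_left_le_one_le mult_nonneg_nonpos max_def)
  finally have "ereal (tht * x * v - tht * s) <= max 0 (ereal (x * v - s))" by (simp add: max_def zero_ereal_def split: if_splits)
  also have "... <= Y v" using *[OF v] youngD(1)[OF Y, of v] v by simp
  finally show "ereal (tht * x * v - tht * s) <= Y v" .
 qed
next
 obtain x1 s where 1: "x1 > 0" "s > 0" "~ Y x1 <= ereal s" using youngD(4)[OF Y] by blast
 \<comment> \<open>Beyond \<open>x1\<close> the graph of \<open>Y\<close> stays above the line of
   slope \<open>s / x1\<close> through the origin.\<close>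
 have "oconj Y (s / x1) <= ereal s" unfolding conj_le_iff
 proof (intro allI impI)
  fix v :: real assume v: "v > 0"
  show "ereal (s / x1 * v - s) <= Y v"
  proof (cases "v <= x1")
   case True
   hence "s / x1 * v - s <= 0" using 1 by (simp add: field_simps)
   hence "ereal (s / x1 * v - s) <= 0" by (simp add: zero_ereal_def)
   thus ?thesis using youngD(1)[OF Y, of v] v by (meson less_imp_le order_trans)
  next
   case False
   have "~ Y v <= ereal (s / x1 * v)"
   proof
    assume "Y v <= ereal (s / x1 * v)"
    hence "Y (x1 / v * v) <= ereal (x1 / v * (s / x1 * v))" by (intro youngD(2)[OF Y]) (use v False 1 in auto)
    thus False using 1 v by simp
   qed
   moreover have "ereal (s / x1 * v - s) <= ereal (s / x1 * v)" using 1 by simp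
   ultimately show ?thesis by (meson linear order_trans)
  qed
 qed
 thus "EX x>0. EX s. oconj Y x <= ereal s" using 1 by (intro exI[of _ "s / x1"]) auto
next
 obtain x r where x: "x > 0" "Y x <= ereal r" using youngD(3)[OF Y] by blast
 have r: "r >= 0" by (rule young_nonneg[OF Y _ x(2)]) (use x in simp)
 \<comment> \<open>This slope makes the conjugate at least \<open>(r + 2) - r = 2\<close>.\<close>
 have "~ oconj Y ((r + 2) / x) <= ereal 1"
 proof
  assume "oconj Y ((r + 2) / x) <= ereal 1"
  hence "ereal ((r + 2) / x * x - 1) <= Y x" using x(1) unfolding conj_le_iff by blast
  hence "(r + 2) / x * x - 1 <= r" using x(2) by (meson ereal_less_eq(3) order_trans)
  thus False using x by simp
 qed
 thus "EX x>0. EX s>0. ~ oconj Y x <= ereal s" using x r by (intro exI[of _ "(r + 2) / x"] conjI exI[of _ 1]) auto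
qed

end

text \<open>The Fenchel--Moreau theorem at the level of generalized inverses, where the value at the right
  end of the interval of finiteness plays no role.\<close>

lemma orlicz_inv_biconj: assumes \<psi>: "orlicz_function \<psi>" and s: "s > 0"
 shows "oinv (oconj (oconj \<psi>)) s = oinv \<psi> s"
proof -
 have y: "young \<psi>" by (rule orlicz_function_young[OF \<psi>])
 note yc = young_conj[OF y] and ycc = young_conj[OF young_conj[OF y]]
 have conv: "\<psi> ((1 - t) * u + t * v) <= ereal (1 - t) * \<psi> u + ereal t * \<psi> v" if "u >= 0" "v >= 0" "t : {0..1}" for u v t
  using \<psi> that by (simp add: orlicz_function_def)
 show ?thesis
 proof (rule antisym)
  show "oinv \<psi> s <= oinv (oconj (oconj \<psi>)) s"
  proof (rule inv_le[OF y less_imp_le[OF s]])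
   fix x :: real assume x: "x >= 0" "\<psi> x <= ereal s"
   show "x <= oinv (oconj (oconj \<psi>)) s"
   proof (cases "x = 0")
    case True thus ?thesis using inv_pos[OF ycc s] by simp
   next
    case False
    have "oconj (oconj \<psi>) x <= ereal s" unfolding conj_le_iff[OF yc]
    proof (intro allI impI)
     fix u :: real assume u: "u > 0"
     have "ereal (x * u - s) <= ereal (u * x) - \<psi> x"
      using x youngD(1)[OF y x(1)] by (cases "\<psi> x") (auto simp: mult.commute)
     thus "ereal (x * u - s) <= oconj \<psi> u" unfolding orlicz_conj_def using False x by (intro SUP_upper2[of x]) auto
    qed
    thus ?thesis by (rule le_inv[OF ycc x(1)])
   qed
  qed
  show "oinv (oconj (oconj \<psi>)) s <= oinv \<psi> s"
  proof (rule inv_le[OF ycc less_imp_le[OF s]], rule ccontr)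
   fix x :: real assume x: "x >= 0" "oconj (oconj \<psi>) x <= ereal s" and n: "~ x <= oinv \<psi> s"
   have no: False if u: "u > 0" and c: "c < x * u - s" "!!v. v > 0 ==> ereal (u * v - c) <= \<psi> v" for u c
   proof -
    have "oconj \<psi> u <= ereal c" unfolding conj_le_iff[OF y] using c(2) by blast
    moreover have "ereal (x * u - s) <= oconj \<psi> u" using x(2) u unfolding conj_le_iff[OF yc] by blast
    ultimately show False using c(1) by (meson ereal_less_eq(3) not_le order_trans)
   qed
   \<comment> \<open>A point where \<open>\<psi>\<close> already exceeds \<open>s\<close>, strictly
     to the left of \<open>x\<close>.\<close>
   define x1 where "x1 = (x + oinv \<psi> s) / 2"
   have x1: "oinv \<psi> s < x1" "x1 < x" "x1 > 0" using n inv_pos[OF y s] by (auto simp: x1_def)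
   have gt: "~ \<psi> x1 <= ereal s" using le_inv[OF y, of x1 s] x1 by auto
   show False
   proof (cases "ALL v>x1. \<psi> v = \<infinity>")
    case True
    \<comment> \<open>With \<open>\<psi>\<close> infinite beyond \<open>x1\<close>, every increasing
      line vanishing at \<open>x1\<close> is a minorant; this slope makes it exceed \<open>s\<close>
      at \<open>x\<close>.\<close>
    define u where "u = (s + 1) / (x - x1)"
    have u: "u > 0" "u * (x - x1) = s + 1" using x1 s by (simp_all add: u_def)
    show False
    proof (rule no[OF u(1), of "u * x1"])
     show "u * x1 < x * u - s" using u(2) by (simp add: algebra_simps)
     fix v :: real assume v: "v > 0"
     show "ereal (u * v - u * x1) <= \<psi> v"
     proof (cases "v <= x1")
      case T: True
      hence "u * v - u * x1 <= 0" using u(1) by simp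
      hence "ereal (u * v - u * x1) <= 0" by (simp add: zero_ereal_def)
      thus ?thesis using youngD(1)[OF y, of v] v by (meson less_imp_le order_trans)
     qed (use True in auto)
    qed
   next
    case False
    then obtain x2 where x2: "x2 > x1" "\<psi> x2 ~= \<infinity>" by blast
    define p where "p v = real_of_ereal (\<psi> v)" for v
    define I where "I = {v. 0 <= v & \<psi> v ~= \<infinity>}"
    have p: "\<psi> v = ereal (p v)" if "v : I" for v
     using that youngD(1)[OF y, of v] by (cases "\<psi> v") (auto simp: p_def I_def)
    have c: "(1 - t) * u + t * v : I & p ((1 - t) * u + t * v) <= (1 - t) * p u + t * p v"
     if "0 <= t" "t <= 1" "u : I" "v : I" for t u v
    proof -
     have le: "\<psi> ((1 - t) * u + t * v) <= ereal ((1 - t) * p u + t * p v)"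
      using conv[of u v t] that p[of u] p[of v] by (simp add: I_def)
     hence "(1 - t) * u + t * v : I" using that by (auto simp: I_def)
     thus ?thesis using le p by simp
    qed
    have I: "convex_on I p" by (rule convex_onI) (use c in "auto simp: convex_alt")
    have "0 <= v ==> v <= x2 ==> v : I" for v using young_mono[OF y, of v x2] x2(2) by (auto simp: I_def)
    hence x1I: "0 : I" "x1 : I" "x1 : interior I" using x1(3) x2(1) by (auto intro!: interiorI[of "{0<..<x2}"])
    \<comment> \<open>Here \<open>x1\<close> is interior to the interval of finiteness, and an
      increasing supporting line at \<open>x1\<close> exceeds \<open>s\<close> at
      \<open>x\<close>.\<close>
    obtain u where mu: "!!v. v : I ==> p x1 + u * (v - x1) <= p v" using convex_le_Inf_differential[OF I x1I(3)] by blast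
    have px1: "p x1 > s" using gt p[OF x1I(2)] by simp
    have "p 0 = 0" using young_zero[OF y] by (simp add: p_def)
    hence "u * x1 > 0" using mu[OF x1I(1)] px1 s by simp
    hence u: "u > 0" using x1(3) by (simp add: zero_less_mult_iff)
    show False
    proof (rule no[OF u, of "u * x1 - p x1"])
     have "u * (x - x1) > 0" using u x1 by simp
     thus "u * x1 - p x1 < x * u - s" using px1 by (simp add: algebra_simps)
     fix v :: real assume v: "v > 0"
     show "ereal (u * v - (u * x1 - p x1)) <= \<psi> v"
     proof (cases "v : I")
      case True
      thus ?thesis using mu[OF True] p[OF True] by (simp add: algebra_simps)
     qed (use v in "simp add: I_def")
    qed
   qed
  qed
 qed
qed

abbreviation (input) "lux == luxemburg_norm"

abbreviation (input) "orn == orlicz_norm"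

abbreviation (input) "HM == borel_measurable half_line"

section \<open>Boyd indices\<close>

lemma measurable_mono_ennreal:
 fixes F :: "real => ennreal" assumes "mono F" shows "F : BM"
proof (rule borel_measurableI_greater)
 fix y
 have "is_interval {x. y < F x}" unfolding is_interval_1 using assms by (auto simp: mono_def intro: less_le_trans)
 thus "{x : space borel. y < F x} : sets borel" using real_interval_borel_measurable by simp
qed

section \<open>Modulars, characteristic functions and dilation norms\<close>

abbreviation modular :: "(real => ereal) => (real => complex) => real => ennreal"
 where "modular Y f l == (nni half_line (%t. e2ennreal (Y (cmod (f t) / l))))"

lemma modular_meas: assumes Y: "young Y" and f[measurable]: "f : HM" and l: "l > 0"
 shows "(%t. e2ennreal (Y (cmod (f t) / l))) : HM"
proof -
 define F where "F y = e2ennreal (Y (max 0 y))" for y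
 have "mono F" unfolding F_def mono_def by (auto intro!: e2ennreal_mono young_mono[OF Y])
 note [measurable] = measurable_mono_ennreal[OF this]
 have "(%t. F (cmod (f t) / l)) : HM" by measurable
 thus ?thesis using l by (simp add: F_def)
qed

lemma nn_integral_half_line: "(nni half_line (%x. F x)) = (nni lborel (%x. F x * ind {0<..} x))"
 unfolding half_line_def by (rule nn_integral_restrict_space) simp

lemma scale_half_line: assumes F: "F : HM" and c: "c > 0"
 shows "(nni half_line (%x. F (c * x))) = ennreal (1 / c) * (nni half_line (%x. F x))"
proof -
 define G where "G x = F x * ind {0<..} x" for x
 have G: "G : BM"
  using F borel_measurable_restrict_space_iff_ennreal[of "{0<..}" lborel F] by (simp add: half_line_def G_def[abs_def])
 have "(nni lborel (%x. G x)) = ennreal c * (nni lborel (%x. G (0 + c * x)))"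
  using nn_integral_real_affine[OF G, of c 0] c by simp
 moreover have "G (0 + c * x) = F (c * x) * ind {0<..} x" for x using c by (simp add: G_def indicator_def zero_less_mult_iff)
 moreover have "ennreal (1 / c) * ennreal c = 1" using c by (subst ennreal_mult'[symmetric]) auto
 ultimately show ?thesis unfolding nn_integral_half_line G_def[symmetric] by (simp add: mult.assoc[symmetric])
qed

lemma dilation_meas: assumes f: "f : HM" and c: "c > 0" shows "dilation c f : HM"
proof -
 have "(%x. c * x) : measurable half_line half_line" unfolding half_line_def
  by (intro measurable_restrict_space2 measurable_restrict_space1) (use c in "auto simp: space_restrict_space")
 from measurable_compose[OF this f] show ?thesis by (simp add: dilation_def[abs_def])
qed

lemma luxemburg_le: "l > 0 ==> modular Y f l <= 1 ==> lux Y f <= ennreal l" unfolding luxemburg_norm_def by (rule Inf_lower) auto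

text \<open>The infimum in the norm is approached from above, so the unit ball is described by all
  \<open>l > 1\<close> rather than by the modular at 1.\<close>

lemma luxemburg_le_one_iff: assumes Y: "young Y" shows "lux Y f <= 1 <-> (ALL l>1. modular Y f l <= 1)"
proof
 assume le: "lux Y f <= 1"
 show "ALL l>1. modular Y f l <= 1"
 proof (intro allI impI)
  fix l :: real assume l: "l > 1"
  have "1 < ennreal l" using l by simp
  hence "lux Y f < ennreal l" using le by (rule le_less_trans[rotated])
  then obtain l' where l': "0 < l'" "modular Y f l' <= 1" "ennreal l' < ennreal l"
   unfolding luxemburg_norm_def Inf_less_iff by blast
  have "l' < l" using l'(1,3) by (simp add: ennreal_less_iff)
  hence "modular Y f l <= modular Y f l'"
   using l l'(1) by (intro nn_integral_mono e2ennreal_mono young_mono[OF Y]) (auto simp: frac_le)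
  thus "modular Y f l <= 1" using l'(2) by (rule order_trans)
 qed
next
 assume *: "ALL l>1. modular Y f l <= 1"
 show "lux Y f <= 1"
 proof (rule ennreal_le_epsilon)
  fix e :: real assume "e > 0"
  hence "lux Y f <= ennreal (1 + e)" using * by (intro luxemburg_le) auto
  thus "lux Y f <= 1 + ennreal e" using `e > 0` by (simp add: ennreal_plus)
 qed
qed

text \<open>On the half line this is \<open>c\<close> times the characteristic function of
  \<open>(0, t)\<close>.\<close>

definition box :: "real => real => real => complex" where "box t c x = (if x < t then of_real c else 0)"

lemma box_meas [measurable]: "box t c : HM"
 unfolding box_def[abs_def] half_line_def by (intro measurable_restrict_space1) measurable

lemma dilation_box: "s > 0 ==> dilation (1 / s) (box t c) = box (s * t) c"
 by (auto simp: dilation_def box_def fun_eq_iff field_simps)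

lemma nn_integral_box: assumes "c >= 0" "t > 0" shows "(nni half_line (%x. a * ind {..<t} x)) = a * ennreal t"
proof -
 have "(nni half_line (%x. a * ind {..<t} x)) = (nni lborel (%x. a * ind {0<..<t} x))"
  unfolding nn_integral_half_line by (intro nn_integral_cong) (auto simp: indicator_def)
 thus ?thesis using assms by (simp add: nn_integral_cmult_indicator)
qed

lemma modular_box_le: assumes Y: "young Y" and c: "c >= 0" and t: "t > 0" and l: "l > 0"
 shows "modular Y (box t c) l <= 1 <-> Y (c / l) <= ereal (1 / t)"
proof -
 have "modular Y (box t c) l = (nni half_line (%x. e2ennreal (Y (c / l)) * ind {..<t} x))"
  using c young_zero[OF Y] by (intro nn_integral_cong) (auto simp: box_def indicator_def e2ennreal_neg)
 also have "... = e2ennreal (Y (c / l)) * ennreal t" by (rule nn_integral_box[OF c t])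
 finally have eq: "modular Y (box t c) l = e2ennreal (Y (c / l)) * ennreal t" .
 show ?thesis
 proof (cases "Y (c / l) = \<infinity>")
  case True
  thus ?thesis using t by (simp add: eq ennreal_top_mult top_unique)
 next
  case False
  obtain p where p: "Y (c / l) = ereal p" "p >= 0" using young_real[OF Y _ False] c l by auto
  have "modular Y (box t c) l = ennreal (p * t)" using p t by (simp add: eq ennreal_mult'')
  thus ?thesis using p t by (simp add: field_simps)
 qed
qed

lemma luxemburg_box_le_one: assumes Y: "young Y" and t: "t > 0" and c: "0 <= c" "c <= oinv Y (1 / t)"
 shows "lux Y (box t c) <= 1" unfolding luxemburg_le_one_iff[OF Y]
proof (intro allI impI)
 fix l :: real assume l: "l > 1"
 have "c / l < oinv Y (1 / t)"
 proof (cases "c = 0")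
  case True thus ?thesis using inv_pos[OF Y, of "1 / t"] t by simp
 next
  case False
  hence "c / l < c" using c l by (simp add: divide_less_eq)
  thus ?thesis using c by linarith
 qed
 hence "Y (c / l) <= ereal (1 / t)" by (intro less_inv[OF Y]) (use c l t in auto)
 thus "modular Y (box t c) l <= 1" using modular_box_le[OF Y c(1) t, of l] l by simp
qed

lemma luxemburg_box_ge: assumes Y: "young Y" and t: "t > 0" and c: "0 <= c"
 shows "ennreal (c / oinv Y (1 / t)) <= lux Y (box t c)" unfolding luxemburg_norm_def
proof (rule Inf_greatest, clarify)
 fix l :: real assume l: "0 < l" "modular Y (box t c) l <= 1"
 hence "Y (c / l) <= ereal (1 / t)" using modular_box_le[OF Y c t] by blast
 hence "c / l <= oinv Y (1 / t)" by (intro le_inv[OF Y]) (use c l in auto)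
 hence "c / oinv Y (1 / t) <= l" using l inv_pos[OF Y, of "1 / t"] t by (simp add: field_simps)
 thus "ennreal (c / oinv Y (1 / t)) <= ennreal l" by (rule ennreal_leI)
qed

text \<open>The substitution produces a factor \<open>s\<close>, which
  \<open>Y(y / s) <= Y(y) / s\<close> compensates.\<close>

lemma dilation_luxemburg_le: assumes Y: "young Y" and s: "s > 1" shows "dilation_norm (lux Y) s <= ennreal s"
 unfolding dilation_norm_def
proof (rule SUP_least, clarify)
 fix f :: "real => complex" assume f: "f : HM" "lux Y f <= 1"
 have sub: "e2ennreal (Y (y / s)) <= ennreal (1 / s) * e2ennreal (Y y)" if y: "y >= 0" for y
 proof (cases "Y y = \<infinity>")
  case True thus ?thesis using s by (simp add: ennreal_mult_top)
 next
  case False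
  obtain p where p: "Y y = ereal p" "p >= 0" using young_real[OF Y y False] by blast
  have "Y (1 / s * y) <= ereal (1 / s * p)" by (rule youngD(2)[OF Y y]) (use s p in auto)
  from e2ennreal_mono[OF this] show ?thesis using p s by (simp add: ennreal_mult'[symmetric])
 qed
 show "lux Y (dilation (1 / s) f) <= ennreal s"
 proof (rule ennreal_le_epsilon)
  fix e :: real assume e: "e > 0"
  define l where "l = 1 + e / s"
  have l: "l > 1" using e s by (simp add: l_def)
  have m: "modular Y f l <= 1" using f(2) l luxemburg_le_one_iff[OF Y] by blast
  have "modular Y (dilation (1 / s) f) (s * l) <= (nni half_line (%x. ennreal (1 / s) * e2ennreal (Y (cmod (f (1 / s * x)) / l))))"
   using sub[of "cmod (f (1 / s * x)) / l" for x] s l by (intro nn_integral_mono) (simp add: dilation_def mult.commute)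
  also have "... = ennreal (1 / s) * (nni half_line (%x. e2ennreal (Y (cmod (f (1 / s * x)) / l))))"
   using modular_meas[OF Y dilation_meas[OF f(1), of "1 / s"], of l] s l
   by (intro nn_integral_cmult) (simp add: dilation_def[abs_def])
  also have "(nni half_line (%x. e2ennreal (Y (cmod (f (1 / s * x)) / l)))) = ennreal (1 / (1 / s)) * modular Y f l"
   by (rule scale_half_line[OF modular_meas[OF Y f(1)]]) (use s l in auto)
  also have "ennreal (1 / s) * (ennreal (1 / (1 / s)) * modular Y f l) = modular Y f l"
   using s by (simp add: mult.assoc[symmetric] ennreal_mult'[symmetric])
  finally have "lux Y (dilation (1 / s) f) <= ennreal (s * l)" using m s l by (intro luxemburg_le) (auto intro: order_trans)
  also have "s * l = s + e" using s by (simp add: l_def distrib_left)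
  finally show "lux Y (dilation (1 / s) f) <= ennreal s + ennreal e" using s e by (simp add: ennreal_plus)
 qed
qed

text \<open>By duality the dilation is moved to \<open>g\<close>; compressing \<open>g\<close>
  lowers its modular, and the substitution contributes the factor \<open>s\<close>.\<close>

lemma dilation_orlicz_le: assumes Y: "young Y" and s: "s > 1" shows "dilation_norm (orn Y) s <= ennreal s"
 unfolding dilation_norm_def
proof (rule SUP_least, clarify)
 fix f :: "real => complex" assume f[measurable]: "f : HM" and N: "orn Y f <= 1"
 note yc = young_conj[OF Y]
 show "orn Y (dilation (1 / s) f) <= ennreal s" unfolding orlicz_norm_def
 proof (rule SUP_least, clarify)
  fix g assume g: "g : HM" "lux (oconj Y) g <= 1"
  have gm[measurable]: "dilation s g : HM" by (rule dilation_meas[OF g(1)]) (use s in simp)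
  have "lux (oconj Y) (dilation s g) <= 1" unfolding luxemburg_le_one_iff[OF yc]
  proof (intro allI impI)
   fix l :: real assume l: "l > 1"
   have "modular (oconj Y) (dilation s g) l = ennreal (1 / s) * modular (oconj Y) g l"
    unfolding dilation_def by (rule scale_half_line[OF modular_meas[OF yc g(1)]]) (use s l in auto)
   also have "... <= ennreal 1 * 1" using g(2) l luxemburg_le_one_iff[OF yc] s by (intro mult_mono ennreal_leI) auto
   finally show "modular (oconj Y) (dilation s g) l <= 1" by simp
  qed
  hence "(nni half_line (%x. ennreal (cmod (f x * dilation s g x)))) <= orn Y f"
   unfolding orlicz_norm_def using gm by (intro SUP_upper) auto
  also note N
  finally have le: "(nni half_line (%x. ennreal (cmod (f x * dilation s g x)))) <= 1" .
  have "(nni half_line (%x. ennreal (cmod (dilation (1 / s) f x * g x))))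
    = (nni half_line (%x. ennreal (cmod (f (1 / s * x) * dilation s g (1 / s * x)))))"
   using s by (intro nn_integral_cong) (simp add: dilation_def)
  also have "... = ennreal (1 / (1 / s)) * (nni half_line (%x. ennreal (cmod (f x * dilation s g x))))"
   by (rule scale_half_line) (use s in "measurable, simp")
  also have "... <= ennreal s * 1" using s le by (intro mult_mono) auto
  finally show "(nni half_line (%x. ennreal (cmod (dilation (1 / s) f x * g x)))) <= ennreal s" by simp
 qed
qed

text \<open>Tested with a box whose Luxemburg norm for the conjugate function is at most 1.\<close>

lemma orlicz_box_ge: assumes Y: "young Y" and t: "t > 0" and c: "c >= 0"
 shows "ennreal (c * t * oinv (oconj Y) (1 / t)) <= orn Y (box t c)"
proof -
 note yc = young_conj[OF Y]
 define d where "d = oinv (oconj Y) (1 / t)"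
 have d: "d > 0" unfolding d_def by (rule inv_pos[OF yc]) (use t in simp)
 have "(nni half_line (%x. ennreal (cmod (box t c x * box t d x)))) = (nni half_line (%x. ennreal (c * d) * ind {..<t} x))"
  using c d by (intro nn_integral_cong) (auto simp: box_def indicator_def simp flip: of_real_mult)
 also have "... = ennreal (c * d) * ennreal t" by (rule nn_integral_box[OF c t])
 also have "... = ennreal (c * t * d)" using c d t by (simp add: ennreal_mult'[symmetric] ac_simps)
 finally have "ennreal (c * t * d) = (nni half_line (%x. ennreal (cmod (box t c x * box t d x))))" ..
 also have "... <= orn Y (box t c)" unfolding orlicz_norm_def using luxemburg_box_le_one[OF yc t less_imp_le[OF d]]
  by (intro SUP_upper) (auto simp: d_def)
 finally show ?thesis by (simp add: d_def)
qed

lemma young_inequality: assumes Y: "young Y" and v: "v > 0" "Y v = ereal p" and y: "y >= 0"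
 shows "ennreal (y * v) <= e2ennreal (oconj Y y) + ennreal p"
proof (cases "oconj Y y = \<infinity>")
 case False
 obtain r where r: "oconj Y y = ereal r" "r >= 0" using young_real[OF young_conj[OF Y] y False] by blast
 have "ereal (y * v - r) <= Y v" using conj_le_iff[OF Y, of y r] r(1) v(1) by auto
 hence "y * v <= r + p" using v(2) by simp
 moreover have "p >= 0" using youngD(1)[OF Y, of v] v by simp
 ultimately show ?thesis using r by (simp add: ennreal_leI flip: ennreal_plus)
qed simp

text \<open>Jensen's inequality, applied to the supremum of affine functions that defines the conjugate.\<close>

lemma orlicz_box_le: assumes Y: "young Y" and t: "t > 0" and c: "c >= 0"
 shows "orn Y (box t c) <= ennreal (c * t * oinv (oconj Y) (1 / t))" unfolding orlicz_norm_def
proof (rule SUP_least, clarify)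
 note yc = young_conj[OF Y]
 let ?\<chi> = "oconj Y"
 fix g assume g[measurable]: "g : HM" and gn: "lux ?\<chi> g <= 1"
 define d where "d = oinv ?\<chi> (1 / t)"
 have ind[measurable]: "(ind {..<t} :: real => ennreal) : HM" unfolding half_line_def by (intro measurable_restrict_space1) simp
 define J where "J = (nni half_line (%x. ennreal (cmod (g x)) * ind {..<t} x))"
 have key: "ennreal (v / l) * J <= ennreal (1 + p * t)" if v: "v > 0" "Y v = ereal p" and l: "l > 1" for v p l
 proof -
  have p: "p >= 0" using youngD(1)[OF Y, of v] v by simp
  have m: "modular ?\<chi> g l <= 1" using gn l luxemburg_le_one_iff[OF yc] by blast
  have "ennreal (v / l) * J = (nni half_line (%x. ennreal (v / l) * (ennreal (cmod (g x)) * ind {..<t} x)))"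
   unfolding J_def by (rule nn_integral_cmult[symmetric]) measurable
  also have "... <= (nni half_line (%x. e2ennreal (?\<chi> (cmod (g x) / l)) + ennreal p * ind {..<t} x))"
  proof (rule nn_integral_mono)
   fix x
   have "ennreal (v / l) * ennreal (cmod (g x)) = ennreal (cmod (g x) / l * v)" using v l by (simp add: ennreal_mult'[symmetric] ac_simps)
   also have "... <= e2ennreal (?\<chi> (cmod (g x) / l)) + ennreal p" by (rule young_inequality[OF Y v]) (use l in simp)
   finally show "ennreal (v / l) * (ennreal (cmod (g x)) * ind {..<t} x) <= e2ennreal (?\<chi> (cmod (g x) / l)) + ennreal p * ind {..<t} x"
    by (auto simp: indicator_def)
  qed
  also have "... = modular ?\<chi> g l + (nni half_line (%x. ennreal p * ind {..<t} x))"
   using l by (intro nn_integral_add modular_meas[OF yc g]) (simp_all add: ind)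
  also have "(nni half_line (%x. ennreal p * ind {..<t} x)) = ennreal p * ennreal t" by (rule nn_integral_box[OF c t])
  also have "modular ?\<chi> g l + ennreal p * ennreal t <= 1 + ennreal p * ennreal t" by (rule add_right_mono[OF m])
  also have "... = ennreal (1 + p * t)" using p t by (simp add: ennreal_mult'' ennreal_plus)
  finally show ?thesis .
 qed
 have "J ~= \<infinity>"
 proof -
  obtain v r where v: "v > 0" "Y v <= ereal r" using youngD(3)[OF Y] by blast
  hence "Y v ~= \<infinity>" by auto
  then obtain p where "Y v = ereal p" using young_real[OF Y, of v] v(1) by (metis less_imp_le)
  from key[OF v(1) this, of 2] show ?thesis using v(1) by (auto simp: ennreal_mult_top top_unique)
 qed
 then obtain j where j: "J = ennreal j" "j >= 0" by (cases J) auto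
 have "j <= t * d"
 proof (rule field_le_mult_one_interval)
  \<comment> \<open>The estimate \<open>key\<close> holds for \<open>l > 1\<close> only;
    \<open>z = 1 / l\<close> approaches 1.\<close>
  fix z :: real assume z: "0 < z" "z < 1"
  have l: "1 / z > 1" using z by simp
  have "?\<chi> (j * z / t) <= ereal (1 / t)" unfolding conj_le_iff[OF Y]
  proof (intro allI impI)
   fix v :: real assume v: "v > 0"
   show "ereal (j * z / t * v - 1 / t) <= Y v"
   proof (cases "Y v = \<infinity>")
    case False
    then obtain p where p: "Y v = ereal p" "p >= 0" using young_real[OF Y, of v] v by (metis less_imp_le)
    have "ennreal (v / (1 / z) * j) <= ennreal (1 + p * t)" using key[OF v p(1) l] v z j by (simp add: ennreal_mult'')
    hence "v / (1 / z) * j <= 1 + p * t" using p t by (subst (asm) ennreal_le_iff) auto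
    hence "v * z * j <= 1 + p * t" by simp
    hence "j * z / t * v - 1 / t <= p" using t by (simp add: field_simps)
    thus ?thesis by (simp add: p)
   qed simp
  qed
  hence "j * z / t <= d" unfolding d_def by (intro le_inv[OF yc]) (use j z t in auto)
  thus "z * j <= t * d" using t by (simp add: field_simps)
 qed
 have "(nni half_line (%x. ennreal (cmod (box t c x * g x)))) = (nni half_line (%x. ennreal c * (ennreal (cmod (g x)) * ind {..<t} x)))"
  using c by (intro nn_integral_cong) (auto simp: box_def indicator_def norm_mult ennreal_mult')
 also have "... = ennreal c * J" unfolding J_def by (rule nn_integral_cmult) measurable
 also have "... = ennreal (c * j)" using c j by (simp add: ennreal_mult')
 also have "... <= ennreal (c * (t * d))" using `j <= t * d` c by (intro ennreal_leI mult_left_mono)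
 finally show "(nni half_line (%x. ennreal (cmod (box t c x * g x)))) <= ennreal (c * t * oinv ?\<chi> (1 / t))"
  by (simp add: d_def mult.assoc)
qed

text \<open>Finiteness of the dilation norms matters here, since \<open>enn2real \<infinity> = 0\<close> and \<open>ln 0 = 0\<close>.\<close>

lemma upper_boyd_index_less_one: assumes N: "upper_boyd_index N < 1" and le: "!!s. s > 1 ==> dilation_norm N s <= ennreal s"
 obtains s H where "s > 1" "0 <= H" "H < s" "dilation_norm N s = ennreal H"
proof -
 have "(%s. ln (enn2real (dilation_norm N s)) / ln s) ` {1<..} ~= {}" by simp
 from cInf_lessD[OF this N[unfolded upper_boyd_index_def]]
 obtain s where s: "s > 1" "ln (enn2real (dilation_norm N s)) / ln s < 1" by blast
 define H where "H = enn2real (dilation_norm N s)"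
 have "dilation_norm N s < top" using le[OF s(1)] by (rule le_less_trans) simp
 hence eq: "dilation_norm N s = ennreal H" by (simp add: H_def ennreal_enn2real)
 have "ln H < ln s" using s by (simp add: H_def divide_less_eq)
 hence "H < s" using s(1) by (cases "H > 0") auto
 show thesis by (rule that[OF s(1) _ `H < s` eq]) (simp add: H_def)
qed

lemma dilation_norm_ge: "f : HM ==> N f <= 1 ==> N (dilation (1 / s) f) <= dilation_norm N s"
 unfolding dilation_norm_def by (rule SUP_upper) auto

lemma boyd_growth: assumes N: "upper_boyd_index N < 1" "!!s. s > 1 ==> dilation_norm N s <= ennreal s"
  and w: "!!t. t > 0 ==> 0 < (w t :: real)" "!!s t. s > 1 ==> t > 0 ==> ennreal (s * w t / w (s * t)) <= dilation_norm N s"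
 obtains q kap where "1 < q" "1 < kap" "!!t. t > 0 ==> kap * w t <= w (q * t)"
proof -
 obtain s H where s: "s > 1" "0 <= H" "H < s" "dilation_norm N s = ennreal H" using upper_boyd_index_less_one[OF N] by metis
 have le: "s * w t <= H * w (s * t)" if "t > 0" for t using w(2)[OF s(1) that] w(1)[of "s * t"] s that by (simp add: divide_le_eq)
 have "s * w 1 > 0" using w(1)[of 1] s by simp
 \<comment> \<open>Positivity of \<open>w\<close> excludes \<open>H = 0\<close>, so that
   \<open>kap = s / H\<close> makes sense.\<close>
 hence H: "H > 0" using le[of 1] w(1)[of "s * 1"] s by (cases "H = 0") auto
 show thesis by (rule that[of s "s / H"]) (use s H le in "auto simp: field_simps")
qed

text \<open>The test function is the characteristic function of \<open>(0, t)\<close> scaled to norm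
  at most 1; the norm of its dilation is at least a quotient of two values of the fundamental
  function.\<close>

lemma luxemburg_growth: assumes Y: "young Y" and N: "upper_boyd_index (lux Y) < 1"
 obtains q kap where "1 < q" "1 < kap" "!!t. t > 0 ==> kap * (t * oinv Y (1 / t)) <= q * t * oinv Y (1 / (q * t))"
proof (rule boyd_growth[OF N dilation_luxemburg_le[OF Y], of "%t. t * oinv Y (1 / t)"])
 let ?I = "%t. oinv Y (1 / t)"
 have I: "?I t > 0" if "t > 0" for t by (rule inv_pos[OF Y]) (use that in simp)
 thus "t * ?I t > 0" if "t > 0" for t using that by simp
 fix s t :: real assume s: "s > 1" and t: "t > 0"
 have "ennreal (?I t / ?I (s * t)) <= lux Y (box (s * t) (?I t))" by (rule luxemburg_box_ge[OF Y]) (use I[OF t] s t in auto)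
 also have "... = lux Y (dilation (1 / s) (box t (?I t)))" using s by (simp add: dilation_box)
 also have "... <= dilation_norm (lux Y) s" using luxemburg_box_le_one[OF Y t, of "?I t"] I[OF t] by (intro dilation_norm_ge) auto
 finally show "ennreal (s * (t * ?I t) / (s * t * ?I (s * t))) <= dilation_norm (lux Y) s" using s t by simp
qed auto

lemma orlicz_growth: assumes Y: "young Y" and N: "upper_boyd_index (orn Y) < 1"
 obtains q kap where "1 < q" "1 < kap"
  "!!t. t > 0 ==> kap * (1 / oinv (oconj Y) (1 / t)) <= 1 / oinv (oconj Y) (1 / (q * t))"
proof (rule boyd_growth[OF N dilation_orlicz_le[OF Y], of "%t. 1 / oinv (oconj Y) (1 / t)"])
 let ?I = "%t. oinv (oconj Y) (1 / t)"
 have I: "?I t > 0" if "t > 0" for t by (rule inv_pos[OF young_conj[OF Y]]) (use that in simp)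
 thus "1 / ?I t > 0" if "t > 0" for t using that by simp
 fix s t :: real assume s: "s > 1" and t: "t > 0"
 define c where "c = 1 / (t * ?I t)"
 have c: "c >= 0" "c * t * ?I t = 1" using I[OF t] t by (simp_all add: c_def)
 have "s * (1 / ?I t) / (1 / ?I (s * t)) = c * (s * t) * ?I (s * t)" using t by (simp add: c_def)
 also have "ennreal ... <= orn Y (box (s * t) c)" by (rule orlicz_box_ge[OF Y _ c(1)]) (use s t in simp)
 also have "... = orn Y (dilation (1 / s) (box t c))" using s by (simp add: dilation_box)
 also have "... <= dilation_norm (orn Y) s" using orlicz_box_le[OF Y t c(1)] c(2) by (intro dilation_norm_ge) auto
 finally show "ennreal (s * (1 / ?I t) / (1 / ?I (s * t))) <= dilation_norm (orn Y) s" .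
qed auto

lemma inv_bounds: assumes y: "young p" and u: "0 < u" "u <= v"
 shows "oinv p (1 / u) > 0" "oinv p (1 / v) <= oinv p (1 / u)" "u * oinv p (1 / u) <= v * oinv p (1 / v)"
proof -
 show "oinv p (1 / u) > 0" by (rule inv_pos[OF y]) (use u in simp)
 show "oinv p (1 / v) <= oinv p (1 / u)" by (rule inv_mono[OF y]) (use u in "auto simp: frac_le")
 have "u / v * oinv p (1 / u) <= oinv p (u / v * (1 / u))" by (rule inv_scale[OF y]) (use u in auto)
 thus "u * oinv p (1 / u) <= v * oinv p (1 / v)" using u by (simp add: field_simps)
qed

theorem theorem3p13:
  fixes M :: "('h::complex_hilbert \<Rightarrow> 'h) set"
    and \<nu> :: "('h \<Rightarrow> 'h) \<Rightarrow> ennreal"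
    and \<sigma> :: "real \<Rightarrow> ('h \<Rightarrow> 'h) \<Rightarrow> ('h \<Rightarrow> 'h)"
    and \<tau> :: "('h L2 \<Rightarrow> 'h L2) \<Rightarrow> ennreal"
    and h :: "('h L2 \<times> 'h L2) set"
    and \<psi> :: "real \<Rightarrow> ereal"
  assumes "von_neumann_algebra M"
    and "fns_weight M \<nu>"
    and "modular_group M \<nu> \<sigma>"
    and "canonical_trace M \<nu> \<sigma> \<tau> h"
    and "orlicz_function \<psi>"
  shows "(upper_boyd_index (luxemburg_norm \<psi>) < 1 \<longrightarrow>
           normable (luxemburg_space \<psi> M \<nu> \<sigma> \<tau> h)
             (subtopology (measure_topology (crossed_product M \<sigma>) \<tau>)
               (luxemburg_space \<psi> M \<nu> \<sigma> \<tau> h))) \<and>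
         (upper_boyd_index (orlicz_norm \<psi>) < 1 \<longrightarrow>
           normable (orlicz_space \<psi> M \<nu> \<sigma> \<tau> h)
             (subtopology (measure_topology (crossed_product M \<sigma>) \<tau>)
               (orlicz_space \<psi> M \<nu> \<sigma> \<tau> h)))"
proof (intro conjI impI, goal_cases)
 interpret crossed M \<nu> \<sigma> \<tau> h by standard (rule assms)+
 have y: "young \<psi>" by (rule orlicz_function_young[OF assms(5)])
 {
  case 1
  then obtain q kap where q: "1 < q" "1 < kap"
   "!!t. t > 0 ==> kap * (t * oinv \<psi> (1 / t)) <= q * t * oinv \<psi> (1 / (q * t))" using luxemburg_growth[OF y] by metis
  \<comment> \<open>By definition this is \<open>t\<close> times the inverse of the double conjugate
    at \<open>1 / t\<close>; \<open>orlicz_inv_biconj\<close> returns to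
    \<open>\<psi>\<close>.\<close>
  have eq: "fund_orlicz (oconj \<psi>) t = t * oinv \<psi> (1 / t)" if "t > 0" for t
   using orlicz_inv_biconj[OF assms(5), of "1 / t"] that by (simp add: fund_orlicz_def fund_luxemburg_def)
  note I = inv_bounds[OF y]
  interpret G: crossed_growth M \<nu> \<sigma> \<tau> h "fund_orlicz (oconj \<psi>)" q kap
   by standard (use q I(1)[OF _ order_refl] I(2,3) in "auto simp: eq")
  show ?case using G.normable_L by (simp add: luxemburg_space_def)
 next
  case 2
  then obtain q kap where q: "1 < q" "1 < kap"
   "!!t. t > 0 ==> kap * (1 / oinv (oconj \<psi>) (1 / t)) <= 1 / oinv (oconj \<psi>) (1 / (q * t))"
   using orlicz_growth[OF y] by metis
  note I = inv_bounds[OF young_conj[OF y]]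
  have I': "oinv (oconj \<psi>) (1 / t) > 0" if "t > 0" for t using I(1)[OF that order_refl] .
  interpret G: crossed_growth M \<nu> \<sigma> \<tau> h "fund_luxemburg (oconj \<psi>)" q kap
  proof
   fix u v :: real assume u: "0 < u" "u <= v"
   show "fund_luxemburg (oconj \<psi>) u <= fund_luxemburg (oconj \<psi>) v"
    using I(2)[OF u] I'[of u] I'[of v] u by (simp add: fund_luxemburg_def frac_le)
   show "fund_luxemburg (oconj \<psi>) v * u <= fund_luxemburg (oconj \<psi>) u * v"
    using I(3)[OF u] I'[of u] I'[of v] u by (simp add: fund_luxemburg_def field_simps)
  qed (use q I' in "auto simp: fund_luxemburg_def")
  show ?case using G.normable_L by (simp add: orlicz_space_def)
 }
qed

end
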